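(* Let $\mathcal{B}$ be a finite alphabet and let $P$ be a nontrivial property of nonempty, $\Pi_2$-computable, compact, connected subsets of $\mathcal{M}_\sigma(\mathcal{B}^{\mathbb{Z}})$ (i.e. at least one such set satisfies $P$ and at least one such set does not). For each finite alphabet $\mathcal{A}\supset\mathcal{B}$ let a measure $\mu_{\mathcal{A}}\in\mathcal{M}_{\sigma\text{-mix}}^{\mathrm{full}}(\mathcal{A}^{\mathbb{Z}})$ be fixed. Then there is no algorithm that can decide, given a finite alphabet $\mathcal{A}\supset\mathcal{B}$ and a cellular automaton $F:\mathcal{A}^{\mathbb{Z}}\to\mathcal{A}^{\mathbb{Z}}$, whether $\mathcal{V}(F,\mu_{\mathcal{A}})$ satisfies $P$.
   Context: For a finite alphabet $\mathcal{A}$: $\mathcal{A}^{\mathbb{Z}}$ carries the product topology, $\mathcal{A}^{*}$ is the set of finite words, $\sigma(x)_i=x_{i+1}$ is the shift, and for a word $u$, $[u]=\{x: x_0\cdots x_{|u|-1}=u\}$. $\mathcal{M}_\sigma(\mathcal{A}^{\mathbb{Z}})$ is the set of $\sigma$-invariant Borel probability measures with the weak$^*$ topology, metrised by $d_{\mathcal{M}}(\mu,\nu)=\sum_{n\in\mathbb{N}}2^{-n}\max_{u\in\mathcal{A}^n}|\mu([u])-\nu([u])|$. If $\mathcal{B}\subset\mathcal{A}$, $\mathcal{M}_\sigma(\mathcal{B}^{\mathbb{Z}})$ is regarded as the subset of $\mathcal{M}_\sigma(\mathcal{A}^{\mathbb{Z}})$ of measures supported on $\mathcal{B}^{\mathbb{Z}}$.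 A cellular automaton is a continuous map $F:\mathcal{A}^{\mathbb{Z}}\to\mathcal{A}^{\mathbb{Z}}$ commuting with $\sigma$; equivalently it is given by a finite neighbourhood and a local rule, and this is how it is given as input to an algorithm. $F_*\mu(E)=\mu(F^{-1}(E))$. $\mathcal{V}(F,\mu)$ is the set of weak$^*$ limit points of $(F_*^t\mu)_{t\in\mathbb{N}}$. A property $P$ is identified with the collection of nonempty, $\Pi_2$-computable, compact, connected sets satisfying it, and "$\mathcal{V}(F,\mu)$ satisfies $P$" means that $\mathcal{V}(F,\mu)$ belongs to this collection. For $U\subset\mathbb{Z}$ let $\mathfrak{B}_U$ be the $\sigma$-algebra generated by cylinders on finite subsets of $U$, and let $$\psi_\mu(n)=\sup\left\{\left|\frac{\mu(A\cap B)}{\mu(A)\mu(B)}-1\right| : A\in\mathfrak{B}_{]-\infty,0]},\ B\in\mathfrak{B}_{[n,\infty[},\ \mu(A)>0,\ \mu(B)>0\right\}.$$ $\mu\in\mathcal{M}_\sigma(\mathcal{A}^{\mathbb{Z}})$ is $\psi$-mixing if $\psi_\mu(n)\to0$, and has full support if $\mu([u])>0$ for all $u\in\mathcal{A}^*$; $\mathcal{M}_{\sigma\text{-mix}}^{\mathrm{full}}(\mathcal{A}^{\mathbb{Z}})$ is the set of $\psi$-mixing measures with full support. For a nonempty word $w$, $\widehat{\delta_w}=\frac1{|w|}\sum_{i=0}^{|w|-1}\delta_{\sigma^i({}^\infty w^\infty)}$ is the measure supported by the orbit of the periodic configuration ${}^\infty w^\infty$. $\overline{\mathbf{B}(\mu,r)}$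 denotes the closed $d_{\mathcal{M}}$-ball. A closed set $\mathcal{K}\subset\mathcal{M}_\sigma(\mathcal{B}^{\mathbb{Z}})$ is $\Pi_2$-computable if the characteristic function of $\{(w,r)\in\mathcal{B}^*\times\mathbb{Q}:\overline{\mathbf{B}(\widehat{\delta_w},r)}\cap\mathcal{K}\neq\emptyset\}$ can be written as $\inf_{i}\sup_{j}f_{i,j}$ where $(i,j,w,r)\mapsto f_{i,j}(w,r)$ is computable. *)

theory Defs
  imports "HOL-Probability.Probability" "HOL-Library.Nat_Bijection"
begin

datatype recf =
    Zero
  | Succ
  | Proj nat
  | Comp recf "recf list"
  | PrimRec recf recf
  | Mu recf

text \<open>
  \<open>evaluates p xs y\<close>: the program \<open>p\<close> halts on the argument list \<open>xs\<close> with result \<open>y\<close>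
  (and it diverges on \<open>xs\<close> if there is no such \<open>y\<close>).
\<close>

inductive evaluates :: "recf \<Rightarrow> nat list \<Rightarrow> nat \<Rightarrow> bool" where
  zero: "evaluates Zero xs 0"
| succ: "evaluates Succ [x] (Suc x)"
| proj: "i < length xs \<Longrightarrow> evaluates (Proj i) xs (xs ! i)"
| comp: "list_all2 (\<lambda>g y. evaluates g xs y) gs ys \<Longrightarrow> evaluates f ys z
          \<Longrightarrow> evaluates (Comp f gs) xs z"
| prim_0: "evaluates f xs y \<Longrightarrow> evaluates (PrimRec f g) (0 # xs) y"
| prim_Suc: "evaluates (PrimRec f g) (n # xs) z \<Longrightarrow> evaluates g (n # z # xs) y
          \<Longrightarrow> evaluates (PrimRec f g) (Suc n # xs) y"
| mu: "evaluates f (n # xs) 0 \<Longrightarrow> (\<forall>m<n. \<exists>k>0. evaluates f (m # xs) k)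
          \<Longrightarrow> evaluates (Mu f) xs n"

inductive_cases evaluates_ZeroE: "evaluates Zero xs y"
inductive_cases evaluates_SuccE: "evaluates Succ xs y"
inductive_cases evaluates_ProjE: "evaluates (Proj i) xs y"
inductive_cases evaluates_CompE: "evaluates (Comp f gs) xs y"
inductive_cases evaluates_PrimRec_0E: "evaluates (PrimRec f g) (0 # xs) y"
inductive_cases evaluates_PrimRec_SucE: "evaluates (PrimRec f g) (Suc n # xs) y"
inductive_cases evaluates_MuE: "evaluates (Mu f) xs y"

lemma evaluates_unique: "evaluates p xs y \<Longrightarrow> evaluates p xs y' \<Longrightarrow> y = y'"
proof (induction arbitrary: y' rule: evaluates.induct)
  case (zero xs)
  then show ?case by (rule evaluates_ZeroE) simp
next
  case (succ x)
  then show ?case by (rule evaluates_SuccE) simp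
next
  case (proj i xs)
  from proj.prems show ?case by (rule evaluates_ProjE) simp
next
  case (comp xs gs ys f z)
  from comp.prems obtain ys' where *: "list_all2 (\<lambda>g y. evaluates g xs y) gs ys'"
    "evaluates f ys' y'"
    by (rule evaluates_CompE)
  have "ys = ys'"
    using comp.IH(1) *(1) by (intro nth_equalityI) (auto simp: list_all2_conv_all_nth)
  with *(2) comp.IH(2) show ?case by simp
next
  case (prim_0 f xs y g)
  from prim_0.prems show ?case by (rule evaluates_PrimRec_0E) (rule prim_0.IH)
next
  case (prim_Suc f g n xs z y)
  from prim_Suc.prems obtain z' where *: "evaluates (PrimRec f g) (n # xs) z'"
    "evaluates g (n # z' # xs) y'"
    by (rule evaluates_PrimRec_SucE)
  from prim_Suc.IH(1)[OF *(1)] *(2) prim_Suc.IH(2) show ?case by simp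
next
  case (mu f n xs)
  from mu.prems have *: "evaluates f (y' # xs) 0" "\<forall>m<y'. \<exists>k>0. evaluates f (m # xs) k"
    by (auto elim!: evaluates_MuE)
  have "\<not> n < y'"
    using *(2) mu.IH(1) by (metis less_irrefl)
  moreover have "\<not> y' < n"
    using *(1) mu.IH(2) by (metis less_irrefl)
  ultimately show ?case by simp
qed

text \<open>Integers are coded by \<^const>\<open>int_encode\<close>; a rational is coded by its normalised fraction.\<close>

definition rat_code :: "rat \<Rightarrow> nat" where
  "rat_code r = (let (p, q) = quotient_of r in prod_encode (int_encode p, int_encode q))"

text \<open>
  Letters are natural numbers and an alphabet is a finite set \<open>A\<close> of letters. All configurations
  live in \<^typ>\<open>int \<Rightarrow> nat\<close> with the product topology (\<^typ>\<open>nat\<close> being discrete), and a measure on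
  \<open>A\<^sup>\<int>\<close> is a Borel measure on \<^typ>\<open>int \<Rightarrow> nat\<close> carried by \<open>configs A\<close>. For \<open>B \<subseteq> A\<close> this makes
  \<open>inv_measures B\<close> an actual subset of \<open>inv_measures A\<close>.
\<close>

type_synonym config = "int \<Rightarrow> nat"

definition configs :: "nat set \<Rightarrow> config set" where
  "configs A = {x. \<forall>i. x i \<in> A}"

definition shift :: "config \<Rightarrow> config" where
  "shift x = (\<lambda>i. x (i + 1))"

definition cyl :: "nat list \<Rightarrow> config set" where
  "cyl u = {x. \<forall>i<length u. x (int i) = u ! i}"

definition inv_measures :: "nat set \<Rightarrow> config measure set" where
  "inv_measures A = {\<mu>. prob_space \<mu> \<and> sets \<mu> = sets borel \<and> (AE x in \<mu>. x \<in> configs A) \<and>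
     distr \<mu> borel shift = \<mu>}"

text \<open>The weak* topology: the coarsest one making \<open>\<mu> \<mapsto> \<integral> f d\<mu>\<close> continuous
  for each continuous \<open>f\<close> on \<open>A\<^sup>\<int>\<close>.\<close>

definition weak_star :: "nat set \<Rightarrow> config measure topology" where
  "weak_star A = topology_generated_by
     {{\<mu> \<in> inv_measures A. set_lebesgue_integral \<mu> (configs A) f \<in> U} | (f :: config \<Rightarrow> real) U.
        continuous_on (configs A) f \<and> open U}"

definition dist_M :: "nat set \<Rightarrow> config measure \<Rightarrow> config measure \<Rightarrow> real" where
  "dist_M A \<mu> \<nu> = (\<Sum>n. (1 / 2) ^ n *
     Max ((\<lambda>u. \<bar>measure \<mu> (cyl u) - measure \<nu> (cyl u)\<bar>) ` {u \<in> lists A. length u = n}))"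

definition cball_M :: "nat set \<Rightarrow> config measure \<Rightarrow> real \<Rightarrow> config measure set" where
  "cball_M A \<mu> r = {\<nu> \<in> inv_measures A. dist_M A \<mu> \<nu> \<le> r}"

definition periodic_config :: "nat list \<Rightarrow> config" where
  "periodic_config w = (\<lambda>i. w ! nat (i mod int (length w)))"

definition periodic_measure :: "nat list \<Rightarrow> config measure" where
  "periodic_measure w =
     distr (uniform_count_measure {..<length w}) borel (\<lambda>i. (shift ^^ i) (periodic_config w))"

definition sigma_on :: "int set \<Rightarrow> config set set" where
  "sigma_on U = sigma_sets UNIV {{x. \<forall>i\<in>S. x i = w i} | S (w :: config). finite S \<and> S \<subseteq> U}"

text \<open>The supremum is taken in \<^typ>\<open>ereal\<close> because it may be infinite.\<close>

definition psi :: "config measure \<Rightarrow> nat \<Rightarrow> ereal" where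
  "psi \<mu> n = Sup {ereal \<bar>measure \<mu> (X \<inter> Y) / (measure \<mu> X * measure \<mu> Y) - 1\<bar> | X Y.
     X \<in> sigma_on {..0} \<and> Y \<in> sigma_on {int n..} \<and> measure \<mu> X > 0 \<and> measure \<mu> Y > 0}"

definition psi_mixing :: "config measure \<Rightarrow> bool" where
  "psi_mixing \<mu> \<longleftrightarrow> psi \<mu> \<longlonglongrightarrow> 0"

definition full_support :: "nat set \<Rightarrow> config measure \<Rightarrow> bool" where
  "full_support A \<mu> \<longleftrightarrow> (\<forall>u\<in>lists A. measure \<mu> (cyl u) > 0)"

definition mixing_full_measures :: "nat set \<Rightarrow> config measure set" where
  "mixing_full_measures A = {\<mu> \<in> inv_measures A. psi_mixing \<mu> \<and> full_support A \<mu>}"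

text \<open>The infimum and supremum are taken in \<^typ>\<open>ereal\<close>, so no boundedness of \<open>f\<close> is presupposed.
  The empty word is excluded since it has no associated periodic measure.\<close>

definition Pi2_computable :: "nat set \<Rightarrow> config measure set \<Rightarrow> bool" where
  "Pi2_computable B K \<longleftrightarrow> (\<exists>p (f :: nat \<Rightarrow> nat \<Rightarrow> nat list \<Rightarrow> rat \<Rightarrow> rat).
     (\<forall>i j r. \<forall>w\<in>lists B - {[]}.
        evaluates p [i, j, list_encode w, rat_code r] (rat_code (f i j w r))) \<and>
     (\<forall>r. \<forall>w\<in>lists B - {[]}.
        (if cball_M B (periodic_measure w) (of_rat r) \<inter> K \<noteq> {} then 1 else 0)
          = (INF i. SUP j. ereal (of_rat (f i j w r)))))"

definition admissible_sets :: "nat set \<Rightarrow> config measure set set" where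
  "admissible_sets B = {K. K \<noteq> {} \<and> K \<subseteq> inv_measures B \<and> Pi2_computable B K \<and>
     compactin (weak_star B) K \<and> connectedin (weak_star B) K}"

text \<open>Only the values of \<open>F\<close> on \<open>configs A\<close> matter.\<close>

definition cellular_automaton :: "nat set \<Rightarrow> (config \<Rightarrow> config) \<Rightarrow> bool" where
  "cellular_automaton A F \<longleftrightarrow> F \<in> configs A \<rightarrow> configs A \<and> continuous_on (configs A) F \<and>
     (\<forall>x\<in>configs A. F (shift x) = shift (F x))"

text \<open>A pattern on a finite neighbourhood \<open>N\<close> is the word of its letters in increasing order of
  the positions.\<close>

definition given_by_local_rule ::
    "nat set \<Rightarrow> (config \<Rightarrow> config) \<Rightarrow> int set \<Rightarrow> (nat list \<Rightarrow> nat) \<Rightarrow> bool" where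
  "given_by_local_rule A F N f \<longleftrightarrow> finite N \<and>
     (\<forall>x\<in>configs A. \<forall>i. F x i = f (map (\<lambda>k. x (i + k)) (sorted_list_of_set N)))"

text \<open>The input given to an algorithm: the alphabet, the neighbourhood, and the table of values of
  the local rule on the words of length \<open>card N\<close> over \<open>A\<close>, in a fixed order.\<close>

definition ca_code :: "nat set \<Rightarrow> int set \<Rightarrow> (nat list \<Rightarrow> nat) \<Rightarrow> nat" where
  "ca_code A N f = prod_encode (list_encode (sorted_list_of_set A),
     prod_encode (list_encode (map int_encode (sorted_list_of_set N)),
       list_encode (map f (List.n_lists (card N) (sorted_list_of_set A)))))"

text \<open>The restriction makes this the push-forward by a map that is only specified on \<open>configs A\<close>;
  it loses no mass for measures carried by \<open>configs A\<close>.\<close>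

definition push_forward ::
    "nat set \<Rightarrow> (config \<Rightarrow> config) \<Rightarrow> config measure \<Rightarrow> config measure" where
  "push_forward A F \<mu> = distr (restrict_space \<mu> (configs A)) borel F"

definition limit_measures ::
    "nat set \<Rightarrow> (config \<Rightarrow> config) \<Rightarrow> config measure \<Rightarrow> config measure set" where
  "limit_measures A F \<mu> = {\<nu> \<in> inv_measures A. \<forall>U. openin (weak_star A) U \<and> \<nu> \<in> U \<longrightarrow>
     (\<exists>\<^sub>F t in sequentially. (push_forward A F ^^ t) \<mu> \<in> U)}"

end

theory Submission
 imports Defs "HOL-Real_Asymp.Real_Asymp"
begin

text \<open>
  The neighbourhood of a cellular automaton is part of its code, while its alphabet and its table need
  not know it. We build an automaton, with neighbourhood \<open>{- e n, - n, - 1, 0, n}\<close>, whose walls each run a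
  register machine in a few cells of the lattice \<open>n \<int>\<close>; a signal that comes back from distance
  \<open>e\<close> on the lattice hands the machine the number \<open>e\<close>. Choosing \<open>e\<close> as a code of \<open>n\<close>, the alphabet, and
  the table lets the machine reconstruct the code of its own automaton, run the alleged decision
  procedure on it, and do the opposite: it emits periodic words whose measures accumulate on a set
  without the property if the answer is yes, and on a set with the property if the answer is no. Walls
  die at sparse times, so that the words, which travel to the right, eventually fill almost everything
  with respect to a \<open>\<psi>\<close>-mixing measure of full support.
\<close>

section \<open>Computable functions\<close>

text \<open>The obstacle is that the measures are arbitrary and come too late. The alphabet contains
  the states of the program, and \<open>\<mu> A\<close> is given only once the alphabet is. So the
  program is fixed before the mixing distance n and the colour of the cells are known, and it cannot
  contain its own code. The leftmost position - e n of the neighbourhood enters neither the alphabet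
  nor the table; it can be chosen last and can carry everything else.

  The constants obey 4 < 16 < 64. A waiting wall followed by g inert cells has probability at least
  of order 4^-g and then lives for 64^g steps. At times around 64^r one inspects about 16^r sites:
  enough to contain a survivor, yet so few that none of them is followed by r occupied cells, which
  could feign a machine. The latter have probability (3/128)^r at most, and 16 * 3/128 < 1. This is
  why the states come in 64 colours, one of which has mass at most 1/64 under any measure.\<close>

lemma evaluates_Comp1: "evaluates g xs y ==> evaluates f [y] z ==> evaluates (Comp f [g]) xs z"
 by (rule evaluates.comp[of _ _ "[y]"]) auto

lemma evaluates_Comp2:
 "evaluates g xs y ==> evaluates h xs y' ==> evaluates f [y, y'] z ==> evaluates (Comp f [g, h]) xs z"
 by (rule evaluates.comp[of _ _ "[y, y']"]) auto

lemma evaluates_Comp4: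
 "evaluates g xs y ==> evaluates h xs y' ==> evaluates k xs y'' ==> evaluates l xs y'''
  ==> evaluates f [y, y', y'', y'''] z ==> evaluates (Comp f [g, h, k, l]) xs z"
 by (rule evaluates.comp[of _ _ "[y, y', y'', y''']"]) auto

lemma evaluates_Proj0: "evaluates (Proj 0) (x # xs) x"
 using evaluates.proj[of 0 "x # xs"] by simp

lemma evaluates_Proj1: "evaluates (Proj 1) (x # y # xs) y"
 using evaluates.proj[of 1 "x # y # xs"] by simp

lemma evaluates_Proj2: "evaluates (Proj 2) (x # y # z # xs) z"
 using evaluates.proj[of 2 "x # y # z # xs"] by simp

lemma evaluates_PrimRec:
 assumes "evaluates f xs z" and "\<And>n y. evaluates g (n # y # xs) (h n y)"
 shows "evaluates (PrimRec f g) (n # xs) (rec_nat z h n)"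
 by (induction n) (auto intro: evaluates.prim_0 evaluates.prim_Suc assms)

text \<open>Several arguments are packed into one with \<open>pair\<close>, so closure under
  composition, recursion and search is needed for unary functions only; the binary notion below
  serves the arithmetic on which this rests.\<close>

definition computable :: "(nat => nat) => bool" where
 "computable f \<longleftrightarrow> (\<exists>p. \<forall>x. evaluates p [x] (f x))"

definition computable2 :: "(nat => nat => nat) => bool" where
 "computable2 f \<longleftrightarrow> (\<exists>p. \<forall>x y. evaluates p [x, y] (f x y))"

definition decidable :: "(nat => bool) => bool" where
 "decidable P \<longleftrightarrow> computable (\<lambda>x. of_bool (P x))"

lemma computable2_add: "computable2 (+)"
proof -
 have "evaluates (PrimRec (Proj 0) (Comp Succ [Proj 1])) [a, b] (rec_nat b (\<lambda>n z. Suc z) a)" for a b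
  by (intro evaluates_PrimRec evaluates_Proj0 evaluates_Comp1[OF evaluates_Proj1] evaluates.succ)
 moreover have "rec_nat b (\<lambda>n z. Suc z) a = a + b" for a b
  by (induction a) auto
 ultimately show ?thesis
  unfolding computable2_def by metis
qed

lemma computable2_mult: "computable2 (*)"
proof -
 obtain p where p: "\<And>a b. evaluates p [a, b] (a + b)"
  using computable2_add unfolding computable2_def by blast
 have "evaluates (PrimRec Zero (Comp p [Proj 1, Proj 2])) [a, b] (rec_nat 0 (\<lambda>n z. z + b) a)" for a b
  by (intro evaluates_PrimRec evaluates.zero evaluates_Comp2[OF evaluates_Proj1 evaluates_Proj2] p)
 moreover have "rec_nat 0 (\<lambda>n z. z + b) a = a * b" for a b
  by (induction a) auto
 ultimately show ?thesis
  unfolding computable2_def by metis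
qed

lemma computable2_diff: "computable2 (-)"
proof -
 have "evaluates (PrimRec Zero (Proj 0)) [n] (rec_nat 0 (\<lambda>n z. n) n)" for n
  by (intro evaluates_PrimRec evaluates.zero evaluates_Proj0)
 moreover have "rec_nat 0 (\<lambda>n z. n) n = n - 1" for n :: nat
  by (cases n) auto
 ultimately have p: "evaluates (PrimRec Zero (Proj 0)) [n] (n - 1)" for n
  by metis
 have "evaluates (PrimRec (Proj 0) (Comp (PrimRec Zero (Proj 0)) [Proj 1])) [a, b] (rec_nat b (\<lambda>n z. z - 1) a)" for a b
  by (intro evaluates_PrimRec evaluates_Proj0 evaluates_Comp1[OF evaluates_Proj1] p)
 moreover have "rec_nat b (\<lambda>n z. z - 1) a = b - a" for a b :: nat
  by (induction a) auto
 \<comment> \<open>Recursion on the first argument yields b - a; the two projections exchange the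
   arguments.\<close>
 ultimately have "evaluates (Comp (PrimRec (Proj 0) (Comp (PrimRec Zero (Proj 0)) [Proj 1])) [Proj 1, Proj 0]) [a, b] (a - b)" for a b
  by (metis evaluates_Comp2[OF evaluates_Proj1 evaluates_Proj0])
 then show ?thesis
  unfolding computable2_def by metis
qed

lemma computable_const: "computable (\<lambda>x. c)"
proof (induction c)
 case 0
 show ?case unfolding computable_def by (metis evaluates.zero)
next
 case (Suc c)
 then show ?case unfolding computable_def by (blast intro: evaluates_Comp1 evaluates.succ)
qed

lemma computable_id: "computable (\<lambda>x. x)"
 unfolding computable_def by (metis evaluates_Proj0)

lemma computable_compose:
 assumes "computable f" "computable g"
 shows "computable (\<lambda>x. f (g x))"
proof -
 obtain p q where "\<And>x. evaluates p [x] (f x)" "\<And>x. evaluates q [x] (g x)"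
  using assms unfolding computable_def by blast
 then show ?thesis
  unfolding computable_def by (blast intro: evaluates_Comp1)
qed

lemma computable2_compose:
 assumes "computable2 f" "computable g" "computable h"
 shows "computable (\<lambda>x. f (g x) (h x))"
proof -
 obtain p q r where "\<And>x y. evaluates p [x, y] (f x y)" "\<And>x. evaluates q [x] (g x)" "\<And>x. evaluates r [x] (h x)"
  using assms unfolding computable_def computable2_def by blast
 then show ?thesis
  unfolding computable_def by (blast intro: evaluates_Comp2)
qed

lemma computable_Suc: "computable f ==> computable (\<lambda>x. Suc (f x))"
 unfolding computable_def by (blast intro: evaluates_Comp1 evaluates.succ)

lemmas computable_add = computable2_compose[OF computable2_add]
 and computable_mult = computable2_compose[OF computable2_mult]
 and computable_diff = computable2_compose[OF computable2_diff]

lemma computable_LEAST_raw: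
 assumes "computable2 (\<lambda>n x. of_bool (~ P n x))" and "\<And>x. \<exists>n. P n x"
 shows "computable (\<lambda>x. LEAST n. P n x)"
proof -
 obtain p where p: "\<And>n x. evaluates p [n, x] (of_bool (~ P n x))"
  using assms(1) unfolding computable2_def by blast
 have "evaluates (Mu p) [x] (LEAST n. P n x)" for x
 proof (rule evaluates.mu)
  show "evaluates p ((LEAST n. P n x) # [x]) 0"
   using p[of "LEAST n. P n x" x] LeastI_ex[OF assms(2)[of x]] by simp
  show "\<forall>m<LEAST n. P n x. \<exists>k>0. evaluates p (m # [x]) k"
  proof (intro allI impI)
   fix m assume "m < (LEAST n. P n x)"
   then have "~ P m x" by (rule not_less_Least)
   then show "\<exists>k>0. evaluates p (m # [x]) k"
    using p[of m x] by (intro exI[of _ 1]) simp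
  qed
 qed
 then show ?thesis unfolding computable_def by blast
qed

lemma computable2_triangle: "computable2 (\<lambda>a b. triangle (a + b))"
proof -
 have t: "computable triangle"
 proof -
  obtain p where p: "\<And>a b. evaluates p [a, b] (a + b)"
   using computable2_add unfolding computable2_def by blast
  have "evaluates (PrimRec Zero (Comp p [Proj 1, Comp Succ [Proj 0]])) [n] (rec_nat 0 (\<lambda>n z. z + Suc n) n)" for n
   by (intro evaluates_PrimRec evaluates.zero evaluates_Comp2[OF evaluates_Proj1 evaluates_Comp1[OF evaluates_Proj0 evaluates.succ]] p)
  moreover have "rec_nat 0 (\<lambda>n z. z + Suc n) n = triangle n" for n
   by (induction n) auto
  ultimately show ?thesis
   unfolding computable_def by metis
 qed
 show ?thesis
  using t computable2_add unfolding computable_def computable2_def by (blast intro: evaluates_Comp1)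
qed

section \<open>Cantor pairing and its inverse\<close>

definition pfst :: "nat => nat" where "pfst x = fst (prod_decode x)"
definition psnd :: "nat => nat" where "psnd x = snd (prod_decode x)"
definition pair :: "nat => nat => nat" where "pair a b = prod_encode (a, b)"

lemma pfst_pair [simp]: "pfst (pair a b) = a" and psnd_pair [simp]: "psnd (pair a b) = b"
 by (auto simp: pfst_def psnd_def pair_def)

lemma pair_collapse [simp]: "pair (pfst x) (psnd x) = x"
 by (simp add: pfst_def psnd_def pair_def)

lemma pfst_le: "pfst x <= x" and psnd_le: "psnd x <= x"
 using le_prod_encode_1[of "pfst x" "psnd x"] le_prod_encode_2[of "psnd x" "pfst x"]
 by (simp_all add: pfst_def psnd_def)

lemma computable2_pair: "computable2 pair"
proof -
 obtain p where p: "\<And>a b. evaluates p [a, b] (a + b)"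
  using computable2_add unfolding computable2_def by blast
 obtain q where q: "\<And>a b. evaluates q [a, b] (triangle (a + b))"
  using computable2_triangle unfolding computable2_def by blast
 have "evaluates (Comp p [q, Proj 0]) [a, b] (pair a b)" for a b
  unfolding pair_def prod_encode_def prod.case
  by (intro evaluates_Comp2[OF q evaluates_Proj0] p)
 then show ?thesis unfolding computable2_def by blast
qed

lemmas computable_pair = computable2_compose[OF computable2_pair]

lemma triangle_mono: "a <= b ==> triangle a <= triangle b"
 by (induction b) (auto simp: le_Suc_eq)

text \<open>The search finds the antidiagonal of the Cantor pairing that contains x; the components
  are then differences. This description makes the inverse computable.\<close>

lemma pfst_psnd_triangle:
 defines "s \<equiv> \<lambda>x. LEAST n. x < triangle (Suc n)"
 shows "pfst x = x - triangle (s x)" "psnd x = s x - pfst x"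
proof -
 have x: "x = triangle (pfst x + psnd x) + pfst x"
  using pair_collapse[of x] unfolding pair_def prod_encode_def prod.case by simp
 have sx: "s x = pfst x + psnd x"
  unfolding s_def
 proof (rule Least_equality)
  show "x < triangle (Suc (pfst x + psnd x))"
   using x by simp
  fix n assume n: "x < triangle (Suc n)"
  show "pfst x + psnd x <= n"
  proof (rule ccontr)
   assume "~ pfst x + psnd x <= n"
   then have "triangle (Suc n) <= triangle (pfst x + psnd x)"
    by (intro triangle_mono) simp
   then show False using n x by linarith
  qed
 qed
 have "pfst x = x - triangle (pfst x + psnd x)"
  using x by linarith
 then show "pfst x = x - triangle (s x)"
  by (subst sx)
 show "psnd x = s x - pfst x"
  by (subst sx) (rule diff_add_inverse[symmetric])
qed

lemma computable_triangle: "computable f ==> computable (\<lambda>x. triangle (f x))"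
 using computable2_compose[OF computable2_triangle, of f "\<lambda>_. 0"] computable_const by simp

lemma computable_pfst_raw: "computable pfst" and computable_psnd_raw: "computable psnd"
proof -
 have ex: "\<exists>n. x < triangle (Suc n)" for x
  by (intro exI[of _ x]) simp
 have b: "of_bool (~ x < triangle (Suc n)) = 1 - (triangle (Suc n) - x)" for x n
  by simp
 have "computable2 (\<lambda>n x. of_bool (~ x < triangle (Suc n)))"
 proof -
  obtain t where t: "\<And>x. evaluates t [x] (triangle (Suc x))"
   using computable_triangle[OF computable_Suc[OF computable_id]] unfolding computable_def by blast
  obtain m where m: "\<And>x y. evaluates m [x, y] (x - y)"
   using computable2_diff unfolding computable2_def by blast
  have "evaluates (Comp m [Comp Succ [Zero], Comp m [Comp t [Proj 0], Proj 1]]) [n, x]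
      (of_bool (~ x < triangle (Suc n)))" for n x
   unfolding b
   by (metis One_nat_def evaluates_Comp2[OF evaluates_Comp1[OF evaluates.zero evaluates.succ]
      evaluates_Comp2[OF evaluates_Comp1[OF evaluates_Proj0 t] evaluates_Proj1 m] m])
  then show ?thesis unfolding computable2_def by blast
 qed
 from computable_LEAST_raw[OF this ex] have s: "computable (\<lambda>x. LEAST n. x < triangle (Suc n))" .
 show 1: "computable pfst"
  using computable_diff[OF computable_id computable_triangle[OF s]] pfst_psnd_triangle(1)
  by (simp add: computable_def)
 show "computable psnd"
  using computable_diff[OF s 1] pfst_psnd_triangle(2)
  by (simp add: computable_def)
qed

lemmas computable_pfst = computable_compose[OF computable_pfst_raw]
 and computable_psnd = computable_compose[OF computable_psnd_raw]

lemma computable_rec_nat: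
 assumes Z: "computable Z" and S: "computable (\<lambda>p. S (pfst p) (pfst (psnd p)) (psnd (psnd p)))"
  and N: "computable N"
 shows "computable (\<lambda>x. rec_nat (Z x) (\<lambda>n z. S n z x) (N x))"
proof -
 obtain z s k where z: "\<And>x. evaluates z [x] (Z x)"
  and s: "\<And>x. evaluates s [x] (S (pfst x) (pfst (psnd x)) (psnd (psnd x)))"
  and k: "\<And>x. evaluates k [x] (N x)"
  using assms unfolding computable_def by blast
 obtain p where p: "\<And>a b. evaluates p [a, b] (pair a b)"
  using computable2_pair unfolding computable2_def by blast
 let ?q = "Comp s [Comp p [Proj 0, Comp p [Proj 1, Proj 2]]]"
 have "evaluates ?q (n # y # [x]) (S n y x)" for n x y
  using evaluates_Comp1[OF evaluates_Comp2[OF evaluates_Proj0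
    evaluates_Comp2[OF evaluates_Proj1 evaluates_Proj2 p] p] s, of n y x "[]"]
  by (simp only: pfst_pair psnd_pair)
 then have "evaluates (PrimRec z ?q) [n, x] (rec_nat (Z x) (\<lambda>n z. S n z x) n)" for n x
  by (intro evaluates_PrimRec z)
 then have "evaluates (Comp (PrimRec z ?q) [k, Proj 0]) [x]
   (rec_nat (Z x) (\<lambda>n z. S n z x) (N x))" for x
  by (rule evaluates_Comp2[OF k evaluates_Proj0])
 then show ?thesis
  unfolding computable_def by blast
qed

lemma computable_of_bool: "decidable P ==> computable (\<lambda>x. of_bool (P x))"
 unfolding decidable_def .

lemma decidable_less: "computable f ==> computable g ==> decidable (\<lambda>x. f x < g x)"
proof -
 assume *: "computable f" "computable g"
 have "of_bool (f x < g x) = 1 - (1 - (g x - f x))" for x by simp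
 then show ?thesis
  unfolding decidable_def by (simp only:) (intro computable_diff computable_const *)
qed

lemma decidable_not: "decidable P ==> decidable (\<lambda>x. ~ P x)"
proof -
 assume *: "decidable P"
 have "of_bool (~ P x) = 1 - (of_bool (P x) :: nat)" for x by simp
 then show ?thesis
  using * unfolding decidable_def by (simp only:) (intro computable_diff computable_const)
qed

lemma decidable_conj: "decidable P ==> decidable Q ==> decidable (\<lambda>x. P x & Q x)"
 unfolding decidable_def of_bool_conj by (rule computable_mult)

lemma decidable_disj: "decidable P ==> decidable Q ==> decidable (\<lambda>x. P x \<or> Q x)"
 using decidable_not[OF decidable_conj[OF decidable_not decidable_not], of P Q] by simp

lemma decidable_imp: "decidable P ==> decidable Q ==> decidable (\<lambda>x. P x --> Q x)"
 unfolding imp_conv_disj by (intro decidable_disj decidable_not)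

lemma decidable_le: "computable f ==> computable g ==> decidable (\<lambda>x. f x <= g x)"
 using decidable_not[OF decidable_less, of g f] by (simp add: not_less)

lemma decidable_eq: "computable f ==> computable g ==> decidable (\<lambda>x. f x = g x)"
 using decidable_conj[OF decidable_le decidable_le, of f g g f] by (simp add: eq_iff)

lemma decidable_True: "decidable (\<lambda>x. b)"
 unfolding decidable_def by (rule computable_const)

lemma decidable_compose: "decidable P ==> computable f ==> decidable (\<lambda>x. P (f x))"
 unfolding decidable_def by (rule computable_compose)

lemma computable_If:
 assumes "decidable P" "computable f" "computable g"
 shows "computable (\<lambda>x. if P x then f x else g x)"
proof -
 have *: "(if P x then f x else g x) = of_bool (P x) * f x + (1 - of_bool (P x)) * g x" for x
  by (cases "P x") simp_all
 show ?thesis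
  unfolding * by (intro computable_add computable_mult computable_diff computable_const computable_of_bool assms)
qed

lemma computable_sum:
 assumes H: "computable (\<lambda>p. H (pfst p) (psnd p))" and N: "computable N"
 shows "computable (\<lambda>x. \<Sum>i<N x. H i x)"
proof -
 have "rec_nat 0 (\<lambda>n z. z + H n x) m = (\<Sum>i<m. H i x)" for m x
  by (induction m) auto
 moreover have "computable (\<lambda>p. H (pfst p) (psnd (psnd p)))"
  using computable_compose[OF H, of "\<lambda>p. pair (pfst p) (psnd (psnd p))"]
  by (simp add: computable_pair computable_pfst computable_psnd computable_id)
 then have "computable (\<lambda>x. rec_nat 0 (\<lambda>n z. z + H n x) (N x))"
  by (intro computable_rec_nat computable_const computable_add computable_pfst computable_psnd computable_id N)
 ultimately show ?thesis
  by simp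
qed

lemma decidable_ex_less:
 assumes "decidable (\<lambda>p. P (pfst p) (psnd p))" "computable N"
 shows "decidable (\<lambda>x. \<exists>i<N x. P i x)"
proof -
 have "(\<exists>i<N x. P i x) \<longleftrightarrow> 0 < (\<Sum>i<N x. of_bool (P i x) :: nat)" for x
  unfolding neq0_conv[symmetric] sum_eq_0_iff[OF finite_lessThan] by simp blast
 moreover have "decidable (\<lambda>x. 0 < (\<Sum>i<N x. of_bool (P i x) :: nat))"
  using assms(1) unfolding decidable_def[of "\<lambda>p. P (pfst p) (psnd p)"]
  by (intro decidable_less computable_const computable_sum assms(2))
 ultimately show ?thesis
  by simp
qed

lemma decidable_all_less:
 assumes "decidable (\<lambda>p. P (pfst p) (psnd p))" "computable N"
 shows "decidable (\<lambda>x. \<forall>i<N x. P i x)"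
 using decidable_not[OF decidable_ex_less[OF decidable_not[OF assms(1)] assms(2)]] by simp

lemma decidable_ex_le:
 assumes "decidable (\<lambda>p. P (pfst p) (psnd p))" "computable N"
 shows "decidable (\<lambda>x. \<exists>i\<le>N x. P i x)"
 using decidable_ex_less[OF assms(1) computable_Suc[OF assms(2)]] by (simp add: less_Suc_eq_le)

lemma decidable_all_le:
 assumes "decidable (\<lambda>p. P (pfst p) (psnd p))" "computable N"
 shows "decidable (\<lambda>x. \<forall>i\<le>N x. P i x)"
 using decidable_all_less[OF assms(1) computable_Suc[OF assms(2)]] by (simp add: less_Suc_eq_le)

lemma computable_LEAST:
 assumes "decidable (\<lambda>p. P (pfst p) (psnd p))" "\<And>x. \<exists>n. P n x"
 shows "computable (\<lambda>x. LEAST n. P n x)"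
proof (rule computable_LEAST_raw)
 obtain p where p: "\<And>x. evaluates p [x] (of_bool (~ P (pfst x) (psnd x)))"
  using decidable_not[OF assms(1)] unfolding decidable_def computable_def by blast
 obtain q where q: "\<And>a b. evaluates q [a, b] (pair a b)"
  using computable2_pair unfolding computable2_def by blast
 show "computable2 (\<lambda>n x. of_bool (~ P n x))"
  unfolding computable2_def using evaluates_Comp1[OF q p, unfolded pfst_pair psnd_pair] by blast
qed (rule assms(2))

lemma computable_power: "computable f ==> computable g ==> computable (\<lambda>x. f x ^ g x)"
proof -
 assume *: "computable f" "computable g"
 have "rec_nat 1 (\<lambda>n z. z * f x) m = f x ^ m" for x m
  by (induction m) auto
 moreover have "computable (\<lambda>x. rec_nat 1 (\<lambda>n z. z * f x) (g x))"
  by (intro computable_rec_nat computable_const computable_mult computable_compose[OF *(1)]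
    computable_pfst computable_psnd computable_id *(2))
 ultimately show ?thesis
  by simp
qed

lemma computable_div:
 assumes f: "computable f" and g: "computable g"
 shows "computable (\<lambda>x. f x div g x)"
proof -
 \<comment> \<open>The disjunct b = 0 makes the search succeed for every argument, as a total
   function requires.\<close>
 have eq: "a div b = (if b = 0 then 0 else LEAST n. b = 0 \<or> a < Suc n * b)" for a b :: nat
 proof (cases "b = 0")
  case False
  then have "(LEAST n. b = 0 \<or> a < Suc n * b) = a div b"
  proof (intro Least_equality disjI2)
   show "a < Suc (a div b) * b"
    using dividend_less_div_times[of b a] False by simp
   fix n assume "b = 0 \<or> a < Suc n * b"
   then have "a div b < Suc n" using False by (simp add: div_less_iff_less_mult)
   then show "a div b <= n" by simp
  qed
  then show ?thesis using False by simp
 qed simp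
 have "computable (\<lambda>x. LEAST n. g x = 0 \<or> f x < Suc n * g x)"
 proof (rule computable_LEAST)
  show "\<exists>n. g x = 0 \<or> f x < Suc n * g x" for x
  proof (cases "g x")
   case (Suc m)
   then have "f x < Suc (f x) * g x" by simp
   then show ?thesis by blast
  qed simp
 qed (intro decidable_disj decidable_eq decidable_less computable_const computable_mult computable_Suc
   computable_pfst computable_psnd computable_id computable_compose[OF f] computable_compose[OF g])
 then show ?thesis
  unfolding eq by (intro computable_If decidable_eq computable_const g)
qed

lemma computable_mod:
 assumes f: "computable f" and g: "computable g"
 shows "computable (\<lambda>x. f x mod g x)"
 unfolding modulo_nat_def by (intro computable_diff computable_mult computable_div assms)

lemma computable_list_encode_map:
 assumes H: "computable (\<lambda>p. H (pfst p) (psnd p))" and N: "computable N"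
 shows "computable (\<lambda>x. list_encode (map (\<lambda>i. H i x) [0..<N x]))"
proof -
 \<comment> \<open>A list is coded by consing, so stage m of the recursion holds the code of the
   last m entries.\<close>
 have "rec_nat 0 (\<lambda>n z. Suc (pair (H (k - Suc n) x) z)) m = list_encode (map (\<lambda>i. H i x) [k - m..<k])"
  if "m <= k" for m k x
  using that
 proof (induction m)
  case (Suc m)
  then have "[k - Suc m..<k] = (k - Suc m) # [k - m..<k]"
   using upt_conv_Cons[of "k - Suc m" k] by (simp add: Suc_diff_Suc)
  then show ?case using Suc by (simp add: pair_def)
 qed simp
 from this[of "N x" "N x" for x]
 have eq: "rec_nat 0 (\<lambda>n z. Suc (pair (H (N x - Suc n) x) z)) (N x) = list_encode (map (\<lambda>i. H i x) [0..<N x])" for x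
  by simp
 have "computable (\<lambda>p. pair (N (psnd (psnd p)) - Suc (pfst p)) (psnd (psnd p)))"
  by (intro computable_pair computable_diff computable_compose[OF N] computable_Suc computable_pfst
    computable_psnd computable_id)
 from computable_compose[OF H this]
 have "computable (\<lambda>p. H (N (psnd (psnd p)) - Suc (pfst p)) (psnd (psnd p)))"
  by simp
 then have "computable (\<lambda>x. rec_nat 0 (\<lambda>n z. Suc (pair (H (N x - Suc n) x) z)) (N x))"
  by (intro computable_rec_nat computable_const computable_Suc computable_pair computable_pfst
    computable_psnd computable_id N)
 then show ?thesis
  by (simp only: eq)
qed

lemmas computable_intros = computable_const computable_id computable_Suc computable_add computable_mult
 computable_diff computable_pair computable_pfst computable_psnd computable_of_bool computable_If computable_sum
 computable_power computable_div computable_mod computable_list_encode_map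
 decidable_less decidable_le decidable_eq decidable_not decidable_conj decidable_disj decidable_imp
 decidable_ex_less decidable_all_less decidable_ex_le decidable_all_le decidable_True

section \<open>Register programs\<close>

text \<open>
  A cell of the output track holds two letters and a flag marking the last cell of the word.
  Register 0 holds the input: it can be decremented and tested but not incremented, so that it is
  bounded by the input. \<open>Put\<close> writes to the staging track at the position held in a register,
  \<open>Com\<close> copies the staging track to the active track.
\<close>

type_synonym trip = "nat \<times> nat \<times> bool"

datatype cmd = Inc nat | Dec nat | Put nat trip | Com | Seq cmd cmd | While nat cmd

text \<open>Stack of commands still to be run, registers, staging track, active track. With an
  explicit stack a step is a local operation, and a fixed program produces only finitely many
  stacks, so that a single cell can hold it.\<close>

type_synonym mstate = "cmd list \<times> (nat => nat) \<times> (nat => trip) \<times> (nat => trip)"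

fun astep :: "mstate => mstate" where
 "astep ([], s, g, a) = ([], s, g, a)"
| "astep (Inc r # K, s, g, a) = (K, if r = 0 then s else s(r := Suc (s r)), g, a)"
| "astep (Dec r # K, s, g, a) = (K, s(r := s r - 1), g, a)"
| "astep (Put r t # K, s, g, a) = (K, s, if r = 0 then g else g(s r := t), a)"
| "astep (Com # K, s, g, a) = (K, s, g, g)"
| "astep (Seq c d # K, s, g, a) = (c # d # K, s, g, a)"
| "astep (While r c # K, s, g, a) = (if s r = 0 then K else c # While r c # K, s, g, a)"

definition actv :: "mstate => nat => trip" where
 "actv x = snd (snd (snd x))"

lemma actv_simp [simp]: "actv (K, s, g, a) = a"
 by (simp add: actv_def)

text \<open>The emitted letters depend on the active track at every moment of a run, not only at its
  end. Hence runs are composed of steps that leave this track alone, and \<open>Com\<close> is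
  treated separately.\<close>

definition quiet :: "mstate => mstate => bool" where
 "quiet x y \<longleftrightarrow> y = astep x & actv y = actv x"

text \<open>The quantifiers over the rest of the stack and over the active track build a frame rule
  into the notion, so that runs compose under \<open>Seq\<close> and \<open>While\<close>.\<close>

definition exec :: "cmd => (nat => nat) \<times> (nat => trip) => (nat => nat) \<times> (nat => trip) => bool" where
 "exec c x y \<longleftrightarrow> (\<forall>K a. quiet\<^sup>*\<^sup>* (c # K, fst x, snd x, a) (K, fst y, snd y, a))"

lemma execD: "exec c (s, g) (s', g') ==> quiet\<^sup>*\<^sup>* (c # K, s, g, a) (K, s', g', a)"
 by (simp add: exec_def)

lemma exec_Inc: "r ~= 0 ==> exec (Inc r) (s, g) (s(r := Suc (s r)), g)"
 by (auto simp: exec_def quiet_def intro!: r_into_rtranclp)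

lemma exec_Dec: "exec (Dec r) (s, g) (s(r := s r - 1), g)"
 by (auto simp: exec_def quiet_def intro!: r_into_rtranclp)

lemma exec_Put: "r ~= 0 ==> exec (Put r t) (s, g) (s, g(s r := t))"
 by (auto simp: exec_def quiet_def intro!: r_into_rtranclp)

lemma quiet_Seq: "quiet (Seq c d # K, s, g, a) (c # d # K, s, g, a)"
 by (simp add: quiet_def)

lemma quiet_While: "s r ~= 0 ==> quiet (While r c # K, s, g, a) (c # While r c # K, s, g, a)"
 by (simp add: quiet_def)

lemma exec_Seq:
 assumes "exec c x y" "exec d y z"
 shows "exec (Seq c d) x z"
 unfolding exec_def
proof (intro allI)
 fix K a
 have "quiet\<^sup>*\<^sup>* (c # d # K, fst x, snd x, a) (d # K, fst y, snd y, a)"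
  "quiet\<^sup>*\<^sup>* (d # K, fst y, snd y, a) (K, fst z, snd z, a)"
  using assms unfolding exec_def by simp_all
 from converse_rtranclp_into_rtranclp[of quiet, OF quiet_Seq rtranclp_trans[OF this]]
 show "quiet\<^sup>*\<^sup>* (Seq c d # K, fst x, snd x, a) (K, fst z, snd z, a)" .
qed

lemma exec_While_0: "s r = 0 ==> exec (While r c) (s, g) (s, g)"
 by (auto simp: exec_def quiet_def intro!: r_into_rtranclp)

lemma exec_While:
 assumes "s r ~= 0" "exec c (s, g) y" "exec (While r c) y z"
 shows "exec (While r c) (s, g) z"
 unfolding exec_def fst_conv snd_conv
proof (intro allI)
 fix K a
 have "quiet\<^sup>*\<^sup>* (c # While r c # K, s, g, a) (While r c # K, fst y, snd y, a)"
  "quiet\<^sup>*\<^sup>* (While r c # K, fst y, snd y, a) (K, fst z, snd z, a)"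
  using assms(2,3) unfolding exec_def by simp_all
 from converse_rtranclp_into_rtranclp[of quiet, OF quiet_While[of s r, OF assms(1)] rtranclp_trans[OF this]]
 show "quiet\<^sup>*\<^sup>* (While r c # K, s, g, a) (K, fst z, snd z, a)" .
qed

lemma exec_While_once: "s r ~= 0 ==> exec c (s, g) (s', g') ==> s' r = 0 ==> exec (While r c) (s, g) (s', g')"
 by (rule exec_While[OF _ _ exec_While_0])

definition clear :: "nat => cmd" where
 "clear r = While r (Dec r)"

lemma exec_clear: "exec (clear r) (s, g) (s(r := 0), g)"
proof (induction "s r" arbitrary: s)
 case 0
 then have "s(r := 0) = s" by auto
 then show ?case using 0 exec_While_0[of s r] by (simp add: clear_def)
next
 case (Suc n)
 then have n: "s r = Suc n" by simp
 have "exec (clear r) (s(r := n), g) (s(r := 0), g)"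
  using Suc(1)[of "s(r := n)"] by simp
 then show ?case
  unfolding clear_def using exec_While[of s r "Dec r" g] exec_Dec[of r s g] n by simp
qed

definition copy :: "nat => nat => nat => cmd" where
 "copy x y t = Seq (clear y) (Seq (clear t) (Seq (While x (Seq (Dec x) (Seq (Inc y) (Inc t))))
   (While t (Seq (Dec t) (Inc x)))))"

lemma exec_copy:
 assumes "x ~= 0" "y ~= 0" "t ~= 0" "x ~= y" "x ~= t" "y ~= t"
 shows "exec (copy x y t) (s, g) (s(y := s x, t := 0), g)"
proof -
 have 1: "exec (While x (Seq (Dec x) (Seq (Inc y) (Inc t)))) (u, g)
   (u(x := 0, y := u y + u x, t := u t + u x), g)" for u
 proof (induction "u x" arbitrary: u)
  case 0
  then have eq: "u(x := 0, y := u y + u x, t := u t + u x) = u" by auto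
  show ?case unfolding eq using 0 by (intro exec_While_0) simp
 next
  case (Suc n)
  let ?u = "u(x := n, y := Suc (u y), t := Suc (u t))"
  have "exec (Seq (Dec x) (Seq (Inc y) (Inc t))) (u, g) (?u, g)"
   using exec_Seq[OF exec_Dec[of x u g] exec_Seq[OF exec_Inc[of y] exec_Inc[of t]]] assms Suc(2)[symmetric]
   by simp
  moreover have "?u(x := 0, y := ?u y + ?u x, t := ?u t + ?u x) = u(x := 0, y := u y + u x, t := u t + u x)"
   using assms Suc(2)[symmetric] by (auto simp: fun_eq_iff)
  ultimately show ?case
   using Suc(1)[of ?u] exec_While[of u x _ g "(?u, g)"] Suc(2)[symmetric] assms by simp
 qed
 have 2: "exec (While t (Seq (Dec t) (Inc x))) (u, g) (u(t := 0, x := u x + u t), g)" for u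
 proof (induction "u t" arbitrary: u)
  case 0
  then have eq: "u(t := 0, x := u x + u t) = u" by auto
  show ?case unfolding eq using 0 by (intro exec_While_0) simp
 next
  case (Suc n)
  let ?u = "u(t := n, x := Suc (u x))"
  have "exec (Seq (Dec t) (Inc x)) (u, g) (?u, g)"
   using exec_Seq[OF exec_Dec[of t u g] exec_Inc[of x]] assms Suc(2)[symmetric] by simp
  moreover have "?u(t := 0, x := ?u x + ?u t) = u(t := 0, x := u x + u t)"
   using assms Suc(2)[symmetric] by (auto simp: fun_eq_iff)
  ultimately show ?case
   using Suc(1)[of ?u] exec_While[of u t _ g "(?u, g)"] Suc(2)[symmetric] assms by simp
 qed
 have e: "exec (copy x y t) (s, g) (((s(y := 0, t := 0))(x := 0, y := 0 + s x, t := 0 + s x))(t := 0, x := 0 + s x), g)"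
  unfolding copy_def
  using exec_Seq[OF exec_clear[of y s g] exec_Seq[OF exec_clear[of t] exec_Seq[OF 1 2]]] assms
  by simp
 have "((s(y := 0, t := 0))(x := 0, y := 0 + s x, t := 0 + s x))(t := 0, x := 0 + s x) = s(y := s x, t := 0)"
  using assms by (auto simp: fun_eq_iff)
 with e show ?thesis by simp
qed

subsection \<open>Compiling recursive functions\<close>

primrec seqi :: "nat => (nat => cmd) list => cmd" where
 "seqi k [] = clear k"
| "seqi k (c # cs) = Seq (c k) (seqi (Suc k) cs)"

text \<open>\<open>xs\<close> lists the registers of the arguments, \<open>out\<close> is the
  register of the result, and the registers from \<open>b\<close> on are scratch. Register 0 cannot
  be incremented; \<open>compiled\<close> below keeps it out of all of these.\<close>

primrec compile :: "recf => nat list => nat => nat => cmd" where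
 "compile Zero = (\<lambda>xs out b. clear out)"
| "compile Succ = (\<lambda>xs out b. Seq (copy (xs ! 0) out b) (Inc out))"
| "compile (Proj i) = (\<lambda>xs out b. copy (xs ! i) out b)"
| "compile (Comp f gs) = (\<lambda>xs out b. let b' = b + length gs in
   Seq (seqi b (map (\<lambda>c k. c xs k b') (map compile gs))) (compile f [b..<b'] out b'))"
| "compile (PrimRec f g) = (\<lambda>xs out b.
   Seq (compile f (tl xs) (b + 1) (b + 4)) (Seq (copy (hd xs) (b + 2) (b + 4)) (Seq (clear b)
   (Seq (While (b + 2) (Seq (compile g (b # (b + 1) # tl xs) (b + 3) (b + 4))
      (Seq (copy (b + 3) (b + 1) (b + 4)) (Seq (Inc b) (Dec (b + 2))))))
    (copy (b + 1) out (b + 4))))))"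
| "compile (Mu f) = (\<lambda>xs out b.
   Seq (clear b) (Seq (compile f (b # xs) (b + 1) (b + 2))
   (Seq (While (b + 1) (Seq (Inc b) (compile f (b # xs) (b + 1) (b + 2))))
    (copy b out (b + 2)))))"

definition computes :: "cmd => nat => nat => (nat => nat) => nat => bool" where
 "computes c out b s y \<longleftrightarrow>
   (\<exists>s'. (\<forall>g. exec c (s, g) (s', g)) & s' out = y & (\<forall>r<b. r ~= out --> s' r = s r))"

lemma computesI: "(\<And>g. exec c (s, g) (s', g)) ==> s' out = y ==> (\<And>r. r < b ==> r ~= out ==> s' r = s r)
  ==> computes c out b s y"
 unfolding computes_def by blast

definition compiled :: "recf => bool" where
 "compiled p \<longleftrightarrow> (\<forall>xs s out b y. evaluates p (map s xs) y --> set xs \<subseteq> {0<..<b} --> 0 < out --> out < b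
   --> out \<notin> set xs --> computes (compile p xs out b) out b s y)"

lemma compiledD:
 assumes "compiled p" "evaluates p vs y" "map s xs = vs" "set xs \<subseteq> {0<..<b}" "0 < out" "out < b" "out \<notin> set xs"
 obtains s' where "\<And>g. exec (compile p xs out b) (s, g) (s', g)" "s' out = y"
  "\<And>r. r < b ==> r ~= out ==> s' r = s r"
proof -
 have "computes (compile p xs out b) out b s y"
  using assms(1)[unfolded compiled_def, rule_format, of s xs y b out] assms(2-7) by simp
 then show ?thesis
  unfolding computes_def using that by blast
qed

lemma map_eq_agree: "map s xs = vs ==> (\<And>r. r \<in> set xs ==> s' r = s r) ==> map s' xs = vs"
 using map_cong[OF refl, of xs s' s] by simp

lemma compiledI:
 assumes "\<And>xs s out b y. evaluates p (map s xs) y ==> set xs \<subseteq> {0<..<b} ==> 0 < out ==> out < b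
   ==> out \<notin> set xs ==> computes (compile p xs out b) out b s y"
 shows "compiled p"
 unfolding compiled_def by (intro allI impI assms)

lemma compile_Comp_args:
 fixes s :: "nat => nat" and xs :: "nat list"
 assumes "list_all2 (\<lambda>g y. evaluates g vs y) gs ys" "\<And>g. g \<in> set gs ==> compiled g"
  and "map s xs = vs" "set xs \<subseteq> {0<..<b}" "0 < b" "b <= k"
 shows "\<exists>s'. (\<forall>h. exec (seqi k (map (\<lambda>c k'. c xs k' (k + length gs)) (map compile gs))) (s, h) (s', h)) &
   map s' [k..<k + length gs] = ys & (\<forall>r<k. s' r = s r)"
 using assms
proof (induction gs ys arbitrary: k s rule: list_all2_induct)
 case Nil
 show ?case
  by (intro exI[of _ "s(k := 0)"] conjI allI impI) (simp_all only: seqi.simps list.map exec_clear, simp_all)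
next
 case (Cons g gs y ys)
 obtain s1 where s1: "\<And>h. exec (compile g xs k (k + length (g # gs))) (s, h) (s1, h)" "s1 k = y"
  "\<And>r. r < k + length (g # gs) ==> r ~= k ==> s1 r = s r"
  by (rule compiledD[OF Cons.prems(1)[of g] Cons.hyps(1) Cons.prems(2), of "k + length (g # gs)" k])
   (use Cons.prems in force)+
 have "map s1 xs = vs"
  using Cons.prems s1(3) by (intro map_eq_agree[OF Cons.prems(2)]) (auto simp: subset_iff)
 from Cons.IH[of s1 "Suc k"] this Cons.prems obtain s2 where
  s2: "\<And>h. exec (seqi (Suc k) (map (\<lambda>c k'. c xs k' (Suc k + length gs)) (map compile gs))) (s1, h) (s2, h)"
   "map s2 [Suc k..<Suc k + length gs] = ys" "\<And>r. r < Suc k ==> s2 r = s1 r"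
  by (auto simp del: upt_Suc)
 show ?case
 proof (intro exI[of _ s2] conjI allI impI)
  show "exec (seqi k (map (\<lambda>c k'. c xs k' (k + length (g # gs))) (map compile (g # gs)))) (s, h) (s2, h)" for h
   using exec_Seq[OF s1(1) s2(1)] by simp
  show "map s2 [k..<k + length (g # gs)] = y # ys"
   using s2(2) s2(3)[of k] s1(2) upt_conv_Cons[of k "k + length (g # gs)"] by simp
  show "s2 r = s r" if "r < k" for r
   using s2(3)[of r] s1(3)[of r] that by simp
 qed
qed

lemma evaluates_PrimRecD:
 "evaluates (PrimRec f g) (n # xs) y ==>
   \<exists>h. evaluates f xs (h 0) & (\<forall>i<n. evaluates g (i # h i # xs) (h (Suc i))) & h n = y"
proof (induction n arbitrary: y)
 case 0
 then show ?case by (auto elim!: evaluates_PrimRec_0E intro!: exI[of _ "\<lambda>_. y"])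
next
 case (Suc n)
 then obtain z where z: "evaluates (PrimRec f g) (n # xs) z" "evaluates g (n # z # xs) y"
  by (auto elim: evaluates_PrimRec_SucE)
 from Suc.IH[OF z(1)] obtain h where h: "evaluates f xs (h 0)" "\<forall>i<n. evaluates g (i # h i # xs) (h (Suc i))" "h n = z"
  by blast
 show ?case
  using h z(2) by (intro exI[of _ "h(Suc n := y)"]) (auto simp: less_Suc_eq)
qed

lemma evaluates_PrimRec_nonempty: "evaluates (PrimRec f g) xs y ==> xs ~= []"
 by (cases rule: evaluates.cases) auto

lemma compiled_PrimRec:
 assumes "compiled f" "compiled g"
 shows "compiled (PrimRec f g)"
proof (rule compiledI)
 fix xs :: "nat list" and s :: "nat => nat" and out b y
 assume ev: "evaluates (PrimRec f g) (map s xs) y" and xs: "set xs \<subseteq> {0<..<b}"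
  and out: "0 < out" "out < b" "out \<notin> set xs"
 from evaluates_PrimRec_nonempty[OF ev] obtain x ys where xys: "xs = x # ys"
  by (cases xs) auto
 from evaluates_PrimRecD[of f g "s x" "map s ys" y] ev xys obtain h where
  h: "evaluates f (map s ys) (h 0)" "\<And>i. i < s x ==> evaluates g (i # h i # map s ys) (h (Suc i))" "h (s x) = y"
  by auto
 have b: "0 < b" using out by simp
 have x: "0 < x" "x < b" and ys: "\<And>r. r \<in> set ys ==> 0 < r & r < b"
  using xs xys by auto
 obtain s1 where s1: "\<And>k. exec (compile f ys (b + 1) (b + 4)) (s, k) (s1, k)" "s1 (b + 1) = h 0"
  "\<And>r. r < b + 4 ==> r ~= b + 1 ==> s1 r = s r"
  by (rule compiledD[OF assms(1) h(1) refl, of "b + 4" "b + 1"]) (use ys in \<open>force+\<close>)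
 define s2 where "s2 = s1(b + 2 := s x, b + 4 := 0, b := 0)"
 have e2: "exec (Seq (copy x (b + 2) (b + 4)) (clear b)) (s1, k) (s2, k)" for k
  using exec_Seq[OF exec_copy[of x "b + 2" "b + 4" s1 k] exec_clear[of b]] x s1(3)[of x]
  by (simp add: s2_def)
 let ?body = "Seq (compile g (b # (b + 1) # ys) (b + 3) (b + 4))
      (Seq (copy (b + 3) (b + 1) (b + 4)) (Seq (Inc b) (Dec (b + 2))))"
 \<comment> \<open>Invariant with m rounds left: b + 2 counts these rounds, b holds the index s x -
   m, and b + 1 the value of the recursion there.\<close>
 have loop: "\<exists>s'. (\<forall>k. exec (While (b + 2) ?body) (u, k) (s', k)) & s' (b + 1) = y & (\<forall>r<b. s' r = s r)"
  if "u (b + 2) = m" "m <= s x" "u b = s x - m" "u (b + 1) = h (s x - m)" "\<And>r. r < b ==> u r = s r" for u m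
  using that
 proof (induction m arbitrary: u)
  case 0
  then show ?case using h(3) exec_While_0[of u "b + 2"] by (intro exI[of _ u]) auto
 next
  case (Suc m)
  have vs: "map u (b # (b + 1) # ys) = (s x - Suc m) # h (s x - Suc m) # map s ys"
   using Suc.prems ys by auto
  obtain u1 where u1: "\<And>k. exec (compile g (b # (b + 1) # ys) (b + 3) (b + 4)) (u, k) (u1, k)"
   "u1 (b + 3) = h (Suc (s x - Suc m))" "\<And>r. r < b + 4 ==> r ~= b + 3 ==> u1 r = u r"
   by (rule compiledD[OF assms(2) h(2)[of "s x - Suc m"] vs, of "b + 4" "b + 3"])
    (use Suc.prems(2) ys b in \<open>force+\<close>)
  define u2 where "u2 = u1(b + 1 := u1 (b + 3), b + 4 := 0, b := Suc (u1 b), b + 2 := u1 (b + 2) - 1)"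
  have "exec (Seq (copy (b + 3) (b + 1) (b + 4)) (Seq (Inc b) (Dec (b + 2)))) (u1, k) (u2, k)" for k
   using exec_Seq[OF exec_copy[of "b + 3" "b + 1" "b + 4" u1 k] exec_Seq[OF exec_Inc[of b] exec_Dec[of "b + 2"]]] b
   by (simp add: u2_def)
  then have e: "exec ?body (u, k) (u2, k)" for k
   by (rule exec_Seq[OF u1(1)])
  have "u2 (b + 2) = m" "u2 b = s x - m" "u2 (b + 1) = h (s x - m)" "\<And>r. r < b ==> u2 r = s r"
   using u1(2) u1(3)[of "b + 2"] u1(3)[of b] Suc.prems u1(3) by (auto simp: u2_def Suc_diff_Suc)
  from Suc.IH[OF this(1) _ this(2-4)] Suc.prems(2) obtain s' where
   s': "\<And>k. exec (While (b + 2) ?body) (u2, k) (s', k)" "s' (b + 1) = y" "\<forall>r<b. s' r = s r"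
   by auto
  have "exec (While (b + 2) ?body) (u, k) (s', k)" for k
   using exec_While[OF _ e s'(1)] Suc.prems(1) by simp
  then show ?case using s' by blast
 qed
 have "\<exists>s'. (\<forall>k. exec (While (b + 2) ?body) (s2, k) (s', k)) & s' (b + 1) = y & (\<forall>r<b. s' r = s r)"
  by (rule loop[of s2 "s x"]) (use s1 in \<open>auto simp: s2_def\<close>)
 then obtain s3 where s3: "\<And>k. exec (While (b + 2) ?body) (s2, k) (s3, k)" "s3 (b + 1) = y" "\<And>r. r < b ==> s3 r = s r"
  by blast
 have e4: "exec (copy (b + 1) out (b + 4)) (s3, k) (s3(out := y, b + 4 := 0), k)" for k
  using exec_copy[of "b + 1" out "b + 4" s3 k] out s3(2) by simp
 have reassoc: "exec (Seq (copy x (b + 2) (b + 4)) (Seq (clear b) c)) (s1, k) z" if "exec c (s2, k) z" for c k z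
 proof -
  have "exec (clear b) (s1(b + 2 := s x, b + 4 := 0), k) (s2, k)"
   using exec_clear[of b "s1(b + 2 := s x, b + 4 := 0)" k] by (simp add: s2_def)
  then show ?thesis
   using exec_Seq[OF exec_copy[of x "b + 2" "b + 4" s1 k] exec_Seq[OF _ that]] x s1(3)[of x] by simp
 qed
 show "computes (compile (PrimRec f g) xs out b) out b s y"
  unfolding compile.simps xys list.sel
  by (rule computesI[of _ _ "s3(out := y, b + 4 := 0)"], rule exec_Seq[OF s1(1)], rule reassoc,
    rule exec_Seq[OF s3(1) e4]) (use out s3 in auto)
qed

lemma compiled_Mu:
 assumes "compiled f"
 shows "compiled (Mu f)"
proof (rule compiledI)
 fix xs :: "nat list" and s :: "nat => nat" and out b n
 assume ev: "evaluates (Mu f) (map s xs) n" and xs: "set xs \<subseteq> {0<..<b}"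
  and out: "0 < out" "out < b" "out \<notin> set xs"
 then have b: "0 < b" by simp
 from ev have f: "evaluates f (n # map s xs) 0" "\<forall>m<n. \<exists>k>0. evaluates f (m # map s xs) k"
  by (auto elim!: evaluates_MuE)
 then obtain v where v: "\<And>m. m <= n ==> evaluates f (m # map s xs) (v m)" "v n = 0" "\<And>m. m < n ==> 0 < v m"
 proof -
  from f(2) obtain w where "\<And>m. m < n ==> 0 < w m & evaluates f (m # map s xs) (w m)" by metis
  then show ?thesis using f(1) by (intro that[of "\<lambda>m. if m < n then w m else 0"]) (auto simp: le_less)
 qed
 have call: "\<exists>s'. (\<forall>k. exec (compile f (b # xs) (b + 1) (b + 2)) (u, k) (s', k)) & s' (b + 1) = v m & s' b = m
   & (\<forall>r<b. s' r = s r)"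
  if c: "u b = m" "m <= n" "\<And>r. r < b ==> u r = s r" for u m
 proof -
  have vs: "map u (b # xs) = m # map s xs" using c xs by auto
  obtain s' where
   "\<And>k. exec (compile f (b # xs) (b + 1) (b + 2)) (u, k) (s', k)" "s' (b + 1) = v m"
   "\<And>r. r < b + 2 ==> r ~= b + 1 ==> s' r = u r"
   by (rule compiledD[OF assms v(1)[OF c(2)] vs, of "b + 2" "b + 1"]) (use xs b in \<open>force+\<close>)
  then show ?thesis using c by (intro exI[of _ s']) auto
 qed
 let ?body = "Seq (Inc b) (compile f (b # xs) (b + 1) (b + 2))"
 \<comment> \<open>Invariant with m values left to try: b holds the candidate n - m and b + 1 the
   value of f there, which is positive before n and 0 at n.\<close>
 have loop: "\<exists>s'. (\<forall>k. exec (While (b + 1) ?body) (u, k) (s', k)) & s' b = n & (\<forall>r<b. s' r = s r)"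
  if "u b = n - m" "m <= n" "u (b + 1) = v (n - m)" "\<And>r. r < b ==> u r = s r" for u m
  using that
 proof (induction m arbitrary: u)
  case 0
  then show ?case using v(2) exec_While_0[of u "b + 1"] by (intro exI[of _ u]) auto
 next
  case (Suc m)
  have "\<exists>u1. (\<forall>k. exec (compile f (b # xs) (b + 1) (b + 2)) (u(b := Suc (u b)), k) (u1, k)) & u1 (b + 1) = v (n - m)
    & u1 b = n - m & (\<forall>r<b. u1 r = s r)"
   by (rule call) (use Suc.prems in auto)
  then obtain u1 where u1: "\<And>k. exec (compile f (b # xs) (b + 1) (b + 2)) (u(b := Suc (u b)), k) (u1, k)"
   "u1 (b + 1) = v (n - m)" "u1 b = n - m" "\<And>r. r < b ==> u1 r = s r" by blast
  have e: "exec ?body (u, k) (u1, k)" for k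
   by (rule exec_Seq[OF exec_Inc u1(1)]) (use b in auto)
  from Suc.IH[OF u1(3) _ u1(2,4)] Suc.prems(2) obtain s' where
   s': "\<And>k. exec (While (b + 1) ?body) (u1, k) (s', k)" "s' b = n" "\<forall>r<b. s' r = s r" by auto
  have "u (b + 1) ~= 0" using Suc.prems(2,3) v(3)[of "n - Suc m"] by simp
  then have "exec (While (b + 1) ?body) (u, k) (s', k)" for k
   by (rule exec_While[OF _ e s'(1)])
  then show ?case using s' by blast
 qed
 have "\<exists>s1. (\<forall>k. exec (compile f (b # xs) (b + 1) (b + 2)) (s(b := 0), k) (s1, k)) & s1 (b + 1) = v 0
    & s1 b = 0 & (\<forall>r<b. s1 r = s r)"
  by (rule call) auto
 then obtain s1 where s1: "\<And>k. exec (compile f (b # xs) (b + 1) (b + 2)) (s(b := 0), k) (s1, k)" "s1 (b + 1) = v 0"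
  "s1 b = 0" "\<And>r. r < b ==> s1 r = s r" by blast
 have "\<exists>s'. (\<forall>k. exec (While (b + 1) ?body) (s1, k) (s', k)) & s' b = n & (\<forall>r<b. s' r = s r)"
  by (rule loop[of _ n]) (use s1 in auto)
 then obtain s2 where s2: "\<And>k. exec (While (b + 1) ?body) (s1, k) (s2, k)" "s2 b = n" "\<And>r. r < b ==> s2 r = s r"
  by blast
 have e: "exec (copy b out (b + 2)) (s2, k) (s2(out := n, b + 2 := 0), k)" for k
  using exec_copy[of b out "b + 2" s2 k] out b s2(2) by simp
 show "computes (compile (Mu f) xs out b) out b s n"
  unfolding compile.simps
  by (rule computesI[of _ _ "s2(out := n, b + 2 := 0)"], rule exec_Seq[OF exec_clear], rule exec_Seq[OF s1(1)],
    rule exec_Seq[OF s2(1) e]) (use out s2 in auto)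
qed

theorem compiled: "compiled p"
proof (induction p)
 case Zero
 show ?case
 proof (rule compiledI)
  fix xs :: "nat list" and s :: "nat => nat" and out b y assume "evaluates Zero (map s xs) y"
  then have "y = 0" by (rule evaluates_ZeroE)
  then show "computes (compile Zero xs out b) out b s y"
   by (intro computesI[of _ _ "s(out := 0)"]) (auto simp: exec_clear)
 qed
next
 case Succ
 show ?case
 proof (rule compiledI)
  fix xs :: "nat list" and s :: "nat => nat" and out b y assume ev: "evaluates Succ (map s xs) y" and xs: "set xs \<subseteq> {0<..<b}"
   and out: "0 < out" "out < b" "out \<notin> set xs"
  from ev obtain x where x: "xs = [x]" "y = Suc (s x)" by (auto elim!: evaluates_SuccE)
  show "computes (compile Succ xs out b) out b s y"
   using exec_Seq[OF exec_copy[of x out b s] exec_Inc[of out]] xs out x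
   by (intro computesI[of _ _ "s(out := Suc (s x), b := 0)"]) (auto simp: fun_upd_twist)
 qed
next
 case (Proj i)
 show ?case
 proof (rule compiledI)
  fix xs :: "nat list" and s :: "nat => nat" and out b y assume ev: "evaluates (Proj i) (map s xs) y" and xs: "set xs \<subseteq> {0<..<b}"
   and out: "0 < out" "out < b" "out \<notin> set xs"
  from ev have i: "i < length xs" "y = s (xs ! i)" by (auto elim!: evaluates_ProjE)
  then have "0 < xs ! i" "xs ! i < b" "xs ! i ~= out" using xs out nth_mem[OF i(1)] by force+
  then show "computes (compile (Proj i) xs out b) out b s y"
   using exec_copy[of "xs ! i" out b s] i out
   by (intro computesI[of _ _ "s(out := s (xs ! i), b := 0)"]) auto
 qed
next
 case (Comp f gs)
 show ?case
 proof (rule compiledI)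
  fix xs :: "nat list" and s :: "nat => nat" and out b y assume ev: "evaluates (Comp f gs) (map s xs) y" and xs: "set xs \<subseteq> {0<..<b}"
   and out: "0 < out" "out < b" "out \<notin> set xs"
  from ev obtain ys where ys: "list_all2 (\<lambda>g y. evaluates g (map s xs) y) gs ys" "evaluates f ys y"
   by (rule evaluates_CompE)
  from compile_Comp_args[OF ys(1) Comp(2) refl xs, of b] out obtain s1 where
   s1: "\<And>g. exec (seqi b (map (\<lambda>c k'. c xs k' (b + length gs)) (map compile gs))) (s, g) (s1, g)"
    "map s1 [b..<b + length gs] = ys" "\<And>r. r < b ==> s1 r = s r" by auto
  obtain s2 where s2: "\<And>g. exec (compile f [b..<b + length gs] out (b + length gs)) (s1, g) (s2, g)" "s2 out = y"
    "\<And>r. r < b + length gs ==> r ~= out ==> s2 r = s1 r"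
   by (rule compiledD[OF Comp(1) ys(2) s1(2), of "b + length gs" out]) (use out in auto)
  show "computes (compile (Comp f gs) xs out b) out b s y"
   unfolding compile.simps Let_def
   by (rule computesI[of _ _ s2], rule exec_Seq[OF s1(1) s2(1)]) (use s2 s1 in auto)
 qed
qed (auto intro: compiled_PrimRec compiled_Mu)


subsection \<open>The main loop\<close>

text \<open>A \<open>case\<close> distinction on the value of register \<open>v\<close>; the registers from \<open>h\<close> on are flags, one per
  branch, which are set iff the branch is to be taken.\<close>

primrec dispatch :: "nat => nat => cmd list => cmd" where
 "dispatch v h [] = clear v"
| "dispatch v h (c # cs) = Seq (clear h) (Seq (Inc h)
   (Seq (While v (Seq (clear h) (Seq (Dec v) (Seq (dispatch v (Suc h) cs) (clear v)))))
    (While h (Seq c (clear h)))))"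

text \<open>Every branch used below increments one register r and changes the staging track by a
  function of its old value. Stated abstractly, this treats the end of a word and the writing of a
  letter alike.\<close>

lemma exec_dispatch:
 assumes "i < length cs" "s v = i" "v < h" "r < h" "r ~= v" "0 < h"
  and "\<And>s. exec (cs ! i) (s, g) (s(r := Suc (s r)), G (s r))"
 shows "\<exists>s'. exec (dispatch v h cs) (s, g) (s', G (s r)) & s' r = Suc (s r) &
   (\<forall>k<h. k ~= r --> k ~= v --> s' k = s k)"
 using assms
proof (induction cs arbitrary: i s h)
 case Nil
 then show ?case by simp
next
 case (Cons c cs)
 define s1 where "s1 = s(h := Suc 0)"
 have e1: "exec (Seq (clear h) (Seq (Inc h) d)) (s, g) z" if "exec d (s1, g) z" for d z
  using exec_Seq[OF exec_clear[of h s g] exec_Seq[OF exec_Inc[of h] ]] that Cons.prems(6) by (simp add: s1_def)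
 show ?case
 proof (cases i)
  case 0
  have w: "exec (While v d) (s1, g) (s1, g)" for d
   by (rule exec_While_0) (use Cons.prems 0 in \<open>auto simp: s1_def\<close>)
  have c: "exec c (s1, g) (s1(r := Suc (s r)), G (s r))"
  proof -
   have r: "s1 r = s r" using Cons.prems(4) by (simp add: s1_def)
   show ?thesis using Cons.prems(7)[of s1] unfolding 0 nth_Cons_0 r .
  qed
  have "exec (While h (Seq c (clear h))) (s1, g) (s1(r := Suc (s r), h := 0), G (s r))"
   by (rule exec_While_once[OF _ exec_Seq[OF c exec_clear]]) (auto simp: s1_def)
  note e = e1[OF exec_Seq[OF w this]]
  show ?thesis
   unfolding dispatch.simps
   by (rule exI[of _ "s1(r := Suc (s r), h := 0)"], intro conjI, rule e)
    (use Cons.prems in \<open>auto simp: s1_def\<close>)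
 next
  case (Suc j)
  define s2 where "s2 = s1(h := 0, v := j)"
  have e2: "exec (Seq (clear h) (Seq (Dec v) d)) (s1, g) z" if "exec d (s2, g) z" for d z
  proof -
   have "(s1(h := 0)) v - 1 = j" using Cons.prems Suc by (simp add: s1_def)
   then have "exec (Dec v) (s1(h := 0), g) (s2, g)"
    using exec_Dec[of v "s1(h := 0)" g] unfolding s2_def by (simp only:)
   from exec_Seq[OF exec_clear exec_Seq[OF this that]] show ?thesis .
  qed
  have "\<exists>s'. exec (dispatch v (Suc h) cs) (s2, g) (s', G (s2 r)) & s' r = Suc (s2 r) &
   (\<forall>k<Suc h. k ~= r --> k ~= v --> s' k = s2 k)"
   by (rule Cons.IH[of j]) (use Cons.prems Suc in \<open>auto simp: s2_def\<close>)
  moreover have r: "s2 r = s r" using Cons.prems by (simp add: s2_def s1_def)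
  ultimately obtain s3 where s3: "exec (dispatch v (Suc h) cs) (s2, g) (s3, G (s r))" "s3 r = Suc (s r)"
   "\<And>k. k < Suc h ==> k ~= r ==> k ~= v ==> s3 k = s2 k" by auto
  have w: "exec (While v (Seq (clear h) (Seq (Dec v) (Seq (dispatch v (Suc h) cs) (clear v))))) (s1, g)
    (s3(v := 0), G (s r))"
   by (rule exec_While_once[OF _ e2[OF exec_Seq[OF s3(1) exec_clear]]])
    (use Cons.prems Suc in \<open>auto simp: s1_def\<close>)
  have "exec (While h (Seq c (clear h))) (s3(v := 0), G (s r)) (s3(v := 0), G (s r))"
   by (rule exec_While_0) (use Cons.prems s3(3)[of h] in \<open>auto simp: s2_def\<close>)
  note e = e1[OF exec_Seq[OF w this]]
  show ?thesis
   unfolding dispatch.simps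
   by (rule exI[of _ "s3(v := 0)"], intro conjI, rule e) (use Cons.prems s3 in \<open>auto simp: s2_def s1_def\<close>)
 qed
qed

text \<open>Register 1 holds the input e, 2 the number of the word, 3 the position in it, 4 the
  answer of \<open>R\<close>; 5 signals the end of the word, and 6 stays positive to keep the loop
  running. Answer 0 ends the word, answer i + 1 writes \<open>ts ! i\<close>.\<close>

definition loop_body :: "recf => trip list => cmd" where
 "loop_body R ts = Seq (compile R [2, 3, 1] 4 7)
   (Seq (dispatch 4 7 (Inc 5 # map (\<lambda>t. Seq (Put 3 t) (Inc 3)) ts))
    (While 5 (Seq Com (Seq (clear 3) (Seq (Inc 2) (clear 5))))))"

text \<open>Register 0 can only be emptied, so its content is moved once to register 1, from which
  it can be copied.\<close>

definition main_prog :: "recf => trip list => cmd" where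
 "main_prog R ts = Seq (While 0 (Seq (Dec 0) (Inc 1))) (Seq (Inc 6) (While 6 (loop_body R ts)))"

definition start_state :: "cmd => nat => trip => mstate" where
 "start_state C e d = ([C], (\<lambda>r. if r = 0 then e else 0), (\<lambda>_. d), (\<lambda>_. d))"

lemma quiet_steps:
 assumes "quiet\<^sup>*\<^sup>* x y"
 shows "\<exists>k. y = (astep ^^ k) x & (\<forall>i\<le>k. actv ((astep ^^ i) x) = actv x)"
 using assms
proof (induction rule: rtranclp_induct)
 case base
 show ?case by (rule exI[of _ 0]) simp
next
 case (step y z)
 then obtain k where k: "y = (astep ^^ k) x" "\<forall>i\<le>k. actv ((astep ^^ i) x) = actv x" by blast
 show ?case
  using k step(2) by (intro exI[of _ "Suc k"]) (auto simp: quiet_def le_Suc_eq)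
qed

locale main_program =
 fixes R :: recf and ts :: "trip list" and e :: nat and d :: trip
  and V :: "nat => nat => nat" and L :: "nat => nat"
 assumes R: "\<And>n j. evaluates R [n, j, e] (V n j)"
  and V_pos: "\<And>n j. j < L n ==> 0 < V n j & V n j <= length ts"
  and V_end: "\<And>n. V n (L n) = 0"
begin

definition "symb n j = ts ! (V n j - 1)"
definition "conf N = (astep ^^ N) (start_state (main_prog R ts) e d)"
definition "ready n N \<longleftrightarrow> (\<exists>s g a. conf N = ([While 6 (loop_body R ts)], s, g, a) &
  s 6 = Suc 0 & s 1 = e & s 2 = n & s 3 = 0 & s 5 = 0)"

lemma body:
 assumes "s 6 = Suc 0" "s 1 = e" "s 2 = n" "s 3 = j" "s 5 = 0" "j <= L n"
 obtains s' g' where "quiet\<^sup>*\<^sup>* (While 6 (loop_body R ts) # K, s, g, a)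
   (While 5 (Seq Com (Seq (clear 3) (Seq (Inc 2) (clear 5)))) # While 6 (loop_body R ts) # K, s', g', a)"
  "s' 6 = Suc 0" "s' 1 = e" "s' 2 = n" "s' 3 = (if j < L n then Suc j else j)" "s' 5 = of_bool (j = L n)"
  "g' = (if j < L n then g(j := symb n j) else g)"
proof -
 have vs: "map s [2, 3, 1] = [n, j, e]" using assms by simp
 obtain s1 where s1: "\<And>g. exec (compile R [2, 3, 1] 4 7) (s, g) (s1, g)" "s1 4 = V n j"
  "\<And>r. r < 7 ==> r ~= 4 ==> s1 r = s r"
  by (rule compiledD[OF compiled R vs, of 7 4]) auto
 let ?cs = "Inc 5 # map (\<lambda>t. Seq (Put 3 t) (Inc 3)) ts"
 define r :: nat where "r = (if j < L n then 3 else 5)"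
 define G where "G = (\<lambda>p. if j < L n then g(p := symb n j) else g)"
 have "exec (?cs ! V n j) (s, g) (s(r := Suc (s r)), G (s r))" for s
 proof (cases "j < L n")
  case True
  then show ?thesis
   using exec_Seq[OF exec_Put[of 3 "symb n j" s g] exec_Inc[of 3 s]] V_pos[OF True]
   by (cases "V n j") (auto simp: r_def G_def symb_def)
 next
  case False
  then have "j = L n" using assms by simp
  then show ?thesis using V_end[of n] exec_Inc[of 5 s g] by (simp add: r_def G_def)
 qed
 moreover have "V n j < length ?cs"
  using V_pos[of j n] V_end[of n] assms(6) by (cases "j = L n") auto
 ultimately have "\<exists>s'. exec (dispatch 4 7 ?cs) (s1, g) (s', G (s1 r)) & s' r = Suc (s1 r) &
   (\<forall>k<7. k ~= r --> k ~= 4 --> s' k = s1 k)"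
  by (intro exec_dispatch[where i = "V n j"]) (auto simp: s1 r_def)
 then obtain s2 where s2: "exec (dispatch 4 7 ?cs) (s1, g) (s2, G (s1 r))" "s2 r = Suc (s1 r)"
   "\<And>k. k < 7 ==> k ~= r ==> k ~= 4 ==> s2 k = s1 k" by blast
 show ?thesis
 proof (rule that)
  let ?w = "While 5 (Seq Com (Seq (clear 3) (Seq (Inc 2) (clear 5))))"
  let ?K = "While 6 (loop_body R ts) # K"
  have "quiet (While 6 (loop_body R ts) # K, s, g, a) (loop_body R ts # ?K, s, g, a)"
   by (rule quiet_While) (simp add: assms)
  moreover have "quiet (loop_body R ts # ?K, s, g, a) (compile R [2, 3, 1] 4 7 # Seq (dispatch 4 7 ?cs) ?w # ?K, s, g, a)"
   unfolding loop_body_def by (rule quiet_Seq)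
  moreover note execD[OF s1(1)[of g], of "Seq (dispatch 4 7 ?cs) ?w # ?K" a]
  moreover have "quiet (Seq (dispatch 4 7 ?cs) ?w # ?K, s1, g, a) (dispatch 4 7 ?cs # ?w # ?K, s1, g, a)"
   by (rule quiet_Seq)
  moreover note execD[OF s2(1), of "?w # ?K" a]
  ultimately show "quiet\<^sup>*\<^sup>* (While 6 (loop_body R ts) # K, s, g, a) (?w # ?K, s2, G (s1 r), a)"
   by (meson converse_rtranclp_into_rtranclp rtranclp_trans)
  show "s2 6 = Suc 0" "s2 1 = e" "s2 2 = n" "s2 3 = (if j < L n then Suc j else j)" "s2 5 = of_bool (j = L n)"
   "G (s1 r) = (if j < L n then g(j := symb n j) else g)"
   using s2(2) s2(3) s1(3) assms by (auto simp: r_def G_def)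
 qed
qed

text \<open>The run is followed only up to \<open>Com\<close>, the one command of the loop that
  alters the active track; induction is on the number of letters still to be written.\<close>

lemma word_loop:
 assumes "s 6 = Suc 0" "s 1 = e" "s 2 = n" "s 3 = j" "s 5 = 0" "j <= L n" "\<forall>i<j. g i = symb n i"
 obtains s' g' where "quiet\<^sup>*\<^sup>* (While 6 (loop_body R ts) # K, s, g, a)
   (Com # Seq (clear 3) (Seq (Inc 2) (clear 5)) # While 5 (Seq Com (Seq (clear 3) (Seq (Inc 2) (clear 5)))) # While 6 (loop_body R ts) # K, s', g', a)"
  "s' 6 = Suc 0" "s' 1 = e" "s' 2 = n" "\<forall>i<L n. g' i = symb n i"
proof -
 have "\<exists>s' g'. quiet\<^sup>*\<^sup>* (While 6 (loop_body R ts) # K, s, g, a)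
   (Com # Seq (clear 3) (Seq (Inc 2) (clear 5)) # While 5 (Seq Com (Seq (clear 3) (Seq (Inc 2) (clear 5)))) # While 6 (loop_body R ts) # K, s', g', a) &
  s' 6 = Suc 0 & s' 1 = e & s' 2 = n & (\<forall>i<L n. g' i = symb n i)"
  using assms
 proof (induction "L n - j" arbitrary: j s g)
  case 0
  let ?c = "Seq Com (Seq (clear 3) (Seq (Inc 2) (clear 5)))"
  let ?K = "While 6 (loop_body R ts) # K"
  obtain s1 g1 where s1: "quiet\<^sup>*\<^sup>* (While 6 (loop_body R ts) # K, s, g, a) (While 5 ?c # ?K, s1, g1, a)"
   "s1 6 = Suc 0" "s1 1 = e" "s1 2 = n" "s1 5 = of_bool (j = L n)" "g1 = (if j < L n then g(j := symb n j) else g)"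
   by (rule body[OF 0(2-7), of K g a])
  have "quiet (While 5 ?c # ?K, s1, g1, a) (?c # While 5 ?c # ?K, s1, g1, a)"
   by (rule quiet_While) (use s1 0 in simp)
  moreover have "quiet (?c # While 5 ?c # ?K, s1, g1, a) (Com # Seq (clear 3) (Seq (Inc 2) (clear 5)) # While 5 ?c # ?K, s1, g1, a)"
   by (rule quiet_Seq)
  ultimately have "quiet\<^sup>*\<^sup>* (While 6 (loop_body R ts) # K, s, g, a) (Com # Seq (clear 3) (Seq (Inc 2) (clear 5)) # While 5 ?c # ?K, s1, g1, a)"
   using s1(1) by (meson rtranclp.rtrancl_into_rtrancl)
  then show ?case using s1 0 by (intro exI[of _ s1] exI[of _ g1]) auto
 next
  case (Suc m)
  let ?c = "Seq Com (Seq (clear 3) (Seq (Inc 2) (clear 5)))"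
  let ?K = "While 6 (loop_body R ts) # K"
  obtain s1 g1 where s1: "quiet\<^sup>*\<^sup>* (While 6 (loop_body R ts) # K, s, g, a) (While 5 ?c # ?K, s1, g1, a)"
   "s1 6 = Suc 0" "s1 1 = e" "s1 2 = n" "s1 3 = (if j < L n then Suc j else j)" "s1 5 = of_bool (j = L n)"
   "g1 = (if j < L n then g(j := symb n j) else g)"
   by (rule body[OF Suc(3-8), of K g a])
  have j: "j < L n" using Suc(2) by simp
  have w: "quiet\<^sup>*\<^sup>* (While 5 ?c # ?K, s1, g1, a) (?K, s1, g1, a)"
   by (intro execD exec_While_0) (use s1 j in simp)
  have "\<exists>s' g'. quiet\<^sup>*\<^sup>* (While 6 (loop_body R ts) # K, s1, g1, a)
   (Com # Seq (clear 3) (Seq (Inc 2) (clear 5)) # While 5 (Seq Com (Seq (clear 3) (Seq (Inc 2) (clear 5)))) # While 6 (loop_body R ts) # K, s', g', a) &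
   s' 6 = Suc 0 & s' 1 = e & s' 2 = n & (\<forall>i<L n. g' i = symb n i)"
   by (rule Suc(1)[of "Suc j"]) (use Suc s1 j in \<open>auto simp: less_Suc_eq\<close>)
  then show ?case using rtranclp_trans[OF rtranclp_trans[OF s1(1) w]] by blast
 qed
 then show ?thesis using that by blast
qed

lemma conf_add: "conf (N + k) = (astep ^^ k) (conf N)"
 by (simp add: conf_def funpow_add[of k N] add.commute[of N k])

text \<open>The commit is the step from M to M + 1. Between two visits to the head of the loop the
  active track shows first what it inherited and then word n.\<close>

definition "phase n a b M \<longleftrightarrow> a <= M & M < b & (\<forall>i. a <= i --> i <= M --> actv (conf i) = actv (conf a)) &
    (\<forall>i j. M < i --> i <= b --> j < L n --> actv (conf i) j = symb n j)"

lemma ready_next: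
 assumes "ready n N"
 shows "\<exists>N'. ready (Suc n) N' & (\<exists>M. phase n N N' M)"
proof -
 let ?W = "While 6 (loop_body R ts)" and ?w = "While 5 (Seq Com (Seq (clear 3) (Seq (Inc 2) (clear 5))))"
 let ?c = "Seq (clear 3) (Seq (Inc 2) (clear 5))"
 from assms obtain s g a where c: "conf N = ([?W], s, g, a)" and s: "s 6 = Suc 0" "s 1 = e" "s 2 = n" "s 3 = 0" "s 5 = 0"
  unfolding ready_def by blast
 obtain s1 g1 where s1: "quiet\<^sup>*\<^sup>* ([?W], s, g, a) ([Com, ?c, ?w, ?W], s1, g1, a)"
  "s1 6 = Suc 0" "s1 1 = e" "s1 2 = n" "\<forall>i<L n. g1 i = symb n i"
  by (rule word_loop[OF s, of g "[]" a]) auto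
 obtain k where k: "([Com, ?c, ?w, ?W], s1, g1, a) = (astep ^^ k) (conf N)"
  "\<And>i. i <= k ==> actv ((astep ^^ i) (conf N)) = actv (conf N)"
  using quiet_steps[OF s1(1)] unfolding c by blast
 have com: "conf (Suc (N + k)) = ([?c, ?w, ?W], s1, g1, g1)"
  using conf_add[of "N + k" 1] conf_add[of N k] k(1)[symmetric] by simp
 have "exec ?c (s1, g1) (s1(3 := 0, 2 := Suc n, 5 := 0), g1)"
  using exec_Seq[OF exec_clear[of 3 s1 g1] exec_Seq[OF exec_Inc[of 2] exec_clear[of 5]]] s1 by simp
 from execD[OF this] have "quiet\<^sup>*\<^sup>* ([?c, ?w, ?W], s1, g1, g1) ([?w, ?W], s1(3 := 0, 2 := Suc n, 5 := 0), g1, g1)" .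
 moreover have "quiet\<^sup>*\<^sup>* ([?w, ?W], s1(3 := 0, 2 := Suc n, 5 := 0), g1, g1) ([?W], s1(3 := 0, 2 := Suc n, 5 := 0), g1, g1)"
  by (intro execD exec_While_0) simp
 ultimately have q: "quiet\<^sup>*\<^sup>* (conf (Suc (N + k))) ([?W], s1(3 := 0, 2 := Suc n, 5 := 0), g1, g1)"
  unfolding com by (rule rtranclp_trans)
 obtain l where l: "([?W], s1(3 := 0, 2 := Suc n, 5 := 0), g1, g1) = (astep ^^ l) (conf (Suc (N + k)))"
  "\<And>i. i <= l ==> actv ((astep ^^ i) (conf (Suc (N + k)))) = actv (conf (Suc (N + k)))"
  using quiet_steps[OF q] by blast
 have r: "ready (Suc n) (Suc (N + k) + l)"
  unfolding ready_def conf_add l(1)[symmetric] using s1 by auto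
 have a: "actv (conf i) = actv (conf N)" if "N <= i" "i <= N + k" for i
  using k(2)[of "i - N"] conf_add[of N "i - N"] that by simp
 have b: "actv (conf i) j = symb n j" if "N + k < i" "i <= Suc (N + k) + l" "j < L n" for i j
 proof -
  have i: "conf i = (astep ^^ (i - Suc (N + k))) (conf (Suc (N + k)))"
   using conf_add[of "Suc (N + k)" "i - Suc (N + k)"] that by simp
  have "actv (conf i) = actv (conf (Suc (N + k)))"
   unfolding i by (rule l(2)) (use that in simp)
  then show ?thesis unfolding com actv_simp using s1(5) that by simp
 qed
 have "phase n N (Suc (N + k) + l) (N + k)"
  unfolding phase_def by (intro conjI allI impI a b) simp_all
 with r show ?thesis by blast
qed

lemma ready_start: "\<exists>N. ready 0 N"
proof -
 let ?s = "\<lambda>r::nat. if r = 0 then e else 0" and ?g = "\<lambda>_::nat. d"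
 have move: "exec (While 0 (Seq (Dec 0) (Inc 1))) (u, ?g) (u(0 := 0, 1 := u 1 + u 0), ?g)" for u
 proof (induction "u 0" arbitrary: u)
  case 0
  then have eq: "u(0 := 0, 1 := u 1 + u 0) = u" by auto
  show ?case unfolding eq using 0 by (intro exec_While_0) simp
 next
  case (Suc n)
  let ?u = "u(0 := n, 1 := Suc (u 1))"
  have "exec (Seq (Dec 0) (Inc 1)) (u, ?g) (?u, ?g)"
   using exec_Seq[OF exec_Dec[of 0 u ?g] exec_Inc[of 1]] Suc(2)[symmetric] by simp
  moreover have "?u(0 := 0, 1 := ?u 1 + ?u 0) = u(0 := 0, 1 := u 1 + u 0)"
   using Suc(2)[symmetric] by (auto simp: fun_eq_iff)
  ultimately show ?case
   using Suc(1)[of ?u] exec_While[of u 0 _ ?g "(?u, ?g)"] Suc(2)[symmetric] by simp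
 qed
 let ?s1 = "?s(0 := 0, 1 := e)" and ?W = "While 6 (loop_body R ts)"
 have m: "exec (While 0 (Seq (Dec 0) (Inc 1))) (?s, ?g) (?s1, ?g)"
  using move[of ?s] by simp
 have q1: "quiet\<^sup>*\<^sup>* (start_state (main_prog R ts) e d) ([Seq (Inc 6) ?W], ?s1, ?g, ?g)"
  unfolding start_state_def main_prog_def
  by (rule converse_rtranclp_into_rtranclp[of quiet, OF quiet_Seq execD[OF m]])
 have "exec (Inc 6) (?s1, ?g) (?s1(6 := Suc (?s1 6)), ?g)"
  by (rule exec_Inc) simp
 then have q2: "quiet\<^sup>*\<^sup>* ([Seq (Inc 6) ?W], ?s1, ?g, ?g) ([?W], ?s1(6 := Suc (?s1 6)), ?g, ?g)"
  by (rule converse_rtranclp_into_rtranclp[of quiet, OF quiet_Seq execD])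
 from quiet_steps[OF rtranclp_trans[OF q1 q2]] obtain k where
  "conf k = ([?W], ?s1(6 := Suc (?s1 6)), ?g, ?g)"
  unfolding conf_def by metis
 then show ?thesis
  unfolding ready_def by (intro exI[of _ k]) auto
qed

theorem main_loop:
 obtains \<tau> :: "nat => nat" where "strict_mono \<tau>"
  "\<And>n N j. \<tau> n <= N ==> N < \<tau> (Suc n) ==> j < L n ==> actv (conf N) j = symb n j"
proof -
 have "\<exists>f. \<forall>n. ready n (f n) & (\<exists>M. phase n (f n) (f (Suc n)) M)"
  by (rule dependent_nat_choice[OF ready_start ready_next])
 then obtain f where "\<forall>n. \<exists>M. phase n (f n) (f (Suc n)) M" by blast
 from choice[OF this] obtain M where "\<forall>n. phase n (f n) (f (Suc n)) (M n)" by blast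
 then have M: "\<And>n. f n <= M n" "\<And>n. M n < f (Suc n)"
  "\<And>n i. f n <= i ==> i <= M n ==> actv (conf i) = actv (conf (f n))"
  "\<And>n i j. M n < i ==> i <= f (Suc n) ==> j < L n ==> actv (conf i) j = symb n j"
  unfolding phase_def by simp_all
 show ?thesis
 \<comment> \<open>Words are dated from the commits, not from the head of the loop; the reign of a
   word covers the end of one phase and the beginning of the next.\<close>
 proof (rule that[of "\<lambda>n. Suc (M n)"])
  show "strict_mono (\<lambda>n. Suc (M n))"
   by (intro strict_monoI_Suc) (simp add: less_le_trans[OF M(2) M(1)])
  show "actv (conf N) j = symb n j" if N: "Suc (M n) <= N" "N < Suc (M (Suc n))" "j < L n" for n N j
  proof (cases "N <= f (Suc n)")
   case False
   then have "actv (conf N) = actv (conf (f (Suc n)))"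
    using N by (intro M(3)[of "Suc n"]) auto
   then show ?thesis using M(4)[of n "f (Suc n)" j] M(2)[of n] N by simp
  qed (use N M(4)[of n N j] in auto)
 qed
qed

end

section \<open>A machine made of finitely many cells\<close>

text \<open>
  The machine is driven by a wall cell at its left end. Instruction waves, launch waves and carries
  travel to the right at speed one; packets and tokens travel to the left. A counter in base 64
  whose digits are the cells grows by one digit at exponentially long intervals; each new digit sends
  the token \<open>b_xt\<close> to the wall, which then issues one instruction of the program. When the counter
  leaves the body the token \<open>b_dt\<close> kills the wall. A launch wave makes the cells of the active word
  send their letters to the wall, which emits two letters per packet.
\<close>

record wst =
 w_stk :: "cmd list"
 w_iw :: "cmd option"
 w_lw :: bool
 w_out :: nat
 w_buf :: nat

text \<open>Registers are in unary: cell j carries bar q iff j is less than the value of register q.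
  Besides the staging and active letters a cell holds the passing instruction wave, launch wave and
  packet, its digit and carry, the mark \<open>b_fr\<close> of a digit that no carry has reached
  yet, and the two tokens.\<close>

record bst =
 b_bars :: "nat set"
 b_stg :: trip
 b_act :: trip
 b_iw :: "cmd option"
 b_lw :: bool
 b_pk :: "trip option"
 b_dg :: nat
 b_cy :: bool
 b_fr :: bool
 b_xt :: bool
 b_dt :: bool

text \<open>S is the set of nonzero registers. The wall reads it off the bars of its right
  neighbour: in unary a register is nonzero iff its first bar is set.\<close>

fun nextk :: "nat set => cmd list => cmd list" where
 "nextk S [] = []"
| "nextk S (Seq c d # K) = c # d # K"
| "nextk S (While r c # K) = (if r \<in> S then c # While r c # K else K)"
| "nextk S (_ # K) = K"

fun wave :: "cmd list => cmd option" where
 "wave (Inc r # K) = (if r = 0 then None else Some (Inc r))"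
| "wave (Dec r # K) = Some (Dec r)"
| "wave (Put r t # K) = (if r = 0 then None else Some (Put r t))"
| "wave (Com # K) = Some Com"
| "wave _ = None"

abbreviation last_of :: "trip => bool" where "last_of t \<equiv> snd (snd t)"

definition packet :: "bst => trip option" where
 "packet b = (if b_lw b then Some (b_act b) else b_pk b)"

definition wstep :: "wst => bst => wst option" where
 "wstep w b = (if b_dt b then None else Some
   \<lparr> w_stk = (if b_xt b then nextk (b_bars b) (w_stk w) else w_stk w),
    w_iw = (if b_xt b then wave (w_stk w) else None),
    w_lw = (case packet b of None => False | Some t => last_of t),
    w_out = (case packet b of None => w_buf w | Some t => fst t),
    w_buf = (case packet b of None => w_buf w | Some t => fst (snd t)) \<rparr>)"

text \<open>An increment or a \<open>Put\<close> dies at the first cell without bar r, whose index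
  is the value of r, and acts there; a decrement runs through and removes the bar that has no bar to
  its right.\<close>

definition passes :: "bst => cmd option => cmd option" where
 "passes b c = (case c of Some (Inc r) => if r \<in> b_bars b then c else None
   | Some (Put r t) => if r \<in> b_bars b then c else None | _ => c)"

definition carry_in :: "wst + bst => bool" where
 "carry_in l = (case l of Inl w => True | Inr b => b_cy b)"

definition bstep :: "wst + bst => bst => bst option => bst" where
 "bstep l b rb =
   \<lparr> b_bars = (case b_iw b of Some (Inc r) => insert r (b_bars b)
     | Some (Dec r) => (if \<exists>b'. rb = Some b' & r \<in> b_bars b' then b_bars b else b_bars b - {r})
     | _ => b_bars b),
    b_stg = (case b_iw b of Some (Put r t) => if r \<in> b_bars b then b_stg b else t | _ => b_stg b),
    b_act = (if b_iw b = Some Com then b_stg b else b_act b),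
    b_iw = (case l of Inl w => w_iw w | Inr b' => passes b' (b_iw b')),
    b_lw = (case l of Inl w => w_lw w | Inr b' => b_lw b' & ~ last_of (b_act b')),
    b_pk = (case rb of None => None | Some b' => packet b'),
    b_dg = (if carry_in l then (if b_dg b = 63 then 0 else Suc (b_dg b)) else b_dg b),
    b_cy = (carry_in l & b_dg b = 63),
    b_fr = (b_fr b & ~ carry_in l),
    b_xt = (b_fr b & carry_in l \<or> (\<exists>b'. rb = Some b' & b_xt b')),
    b_dt = (rb = None & carry_in l & b_dg b = 63 \<or> (\<exists>b'. rb = Some b' & b_dt b')) \<rparr>"

definition fresh :: "trip => bool => bst" where
 "fresh d f = \<lparr> b_bars = (if f then {0} else {}), b_stg = d, b_act = d, b_iw = None, b_lw = False,
   b_pk = None, b_dg = 0, b_cy = False, b_fr = True, b_xt = False, b_dt = False \<rparr>"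

definition start_wall :: "cmd => trip => wst" where
 "start_wall C d = \<lparr> w_stk = [C], w_iw = None, w_lw = True, w_out = fst d, w_buf = fst (snd d) \<rparr>"

text \<open>The first carry into cell n arrives at time 64^n + n, and the token it releases needs n
  steps back to the wall. The exponential spacing lets the wall repeat a word many times between two
  instructions.\<close>

definition issue :: "nat => nat" where "issue n = 64 ^ n + 2 * n"

definition issued :: "nat => nat" where "issued t = (LEAST n. t <= issue n)"

lemma issue_less_Suc: "issue n + 2 < issue (Suc n)"
 using one_le_power[of "64::nat" n] by (simp add: issue_def)

lemma issue_strict_mono: "strict_mono issue"
proof (rule strict_monoI_Suc)
 show "issue n < issue (Suc n)" for n using issue_less_Suc[of n] by linarith
qed

lemma le_issue: "n < issue n"
 by (simp add: issue_def trans_less_add1)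

lemma issued_le_iff: "issued t <= n \<longleftrightarrow> t <= issue n"
proof
 assume "issued t <= n"
 then have "issue (issued t) <= issue n"
  using issue_strict_mono by (simp add: strict_mono_less_eq)
 moreover have "t <= issue (issued t)"
  unfolding issued_def by (rule LeastI[of _ t]) (use le_issue[of t] in simp)
 ultimately show "t <= issue n" by (rule order_trans[rotated])
qed (simp add: issued_def Least_le)

lemma issued_eqI: "t <= issue n ==> (n = 0 \<or> issue (n - 1) < t) ==> issued t = n"
proof -
 assume t: "t <= issue n" "n = 0 \<or> issue (n - 1) < t"
 have "issued t <= n" using t by (simp add: issued_le_iff)
 moreover have "~ issued t <= n - 1" if "n ~= 0"
  using t that by (simp add: issued_le_iff)
 ultimately show ?thesis by (cases "n = 0") auto
qed

lemma issued_0 [simp]: "issued 0 = 0"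
 by (rule issued_eqI) auto

lemma issue_pred_less: "n ~= 0 ==> issue (n - 1) + 2 < issue n"
 using issue_less_Suc[of "n - 1"] by simp

lemma issued_issue [simp]: "issued (issue n) = n" "issued (issue n - 1) = n" "issued (issue n - 2) = n"
proof -
 have "n = 0 \<or> issue (n - 1) + 2 < issue n" using issue_pred_less by blast
 then have "n = 0 \<or> issue (n - 1) < issue n" "n = 0 \<or> issue (n - 1) < issue n - 1" "n = 0 \<or> issue (n - 1) < issue n - 2"
  by auto
 then show "issued (issue n) = n" "issued (issue n - 1) = n" "issued (issue n - 2) = n"
  by (simp_all only: issued_eqI diff_le_self order_refl)
qed

lemma issued_issue_Suc_0 [simp]: "issued (issue n - Suc 0) = n"
 using issued_issue(2)[of n] by simp

lemma issued_Suc: "issued (Suc t) = (if issue (issued t) = t then Suc (issued t) else issued t)"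
proof -
 have "t <= issue (issued t)" using issued_le_iff by blast
 moreover have "issued t = 0 \<or> issue (issued t - 1) < t"
  using issued_le_iff[of t "issued t - 1"] by auto
 ultimately show ?thesis
  using issue_less_Suc[of "issued t"] by (auto intro!: issued_eqI)
qed

lemma issued_mono: "t <= t' ==> issued t <= issued t'"
 by (meson issued_le_iff order_refl order_trans)

text \<open>As the program starts with a sequence, its first step emits no wave. So after n steps
  every register but 0 is at most n - 1, and the cells from n - 1 on are untouched. They hold d,
  whose end mark terminates every word in time.\<close>

locale machine =
 fixes C :: cmd and d :: trip and e :: nat
 assumes C: "\<exists>c1 c2. C = Seq c1 c2" and d: "last_of d"
begin

definition "conf N = (astep ^^ N) (start_state C e d)"
definition "stk n = fst (conf n)"
definition "reg n = fst (snd (conf n))"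
definition "stg n = fst (snd (snd (conf n)))"
definition "acv n = actv (conf n)"

lemma conf_eq: "conf n = (stk n, reg n, stg n, acv n)"
 by (simp add: stk_def reg_def stg_def acv_def actv_def)

lemma conf_0: "stk 0 = [C]" "reg 0 = (\<lambda>r. if r = 0 then e else 0)" "stg 0 = (\<lambda>_. d)" "acv 0 = (\<lambda>_. d)"
 by (simp_all add: stk_def reg_def stg_def acv_def conf_def start_state_def)

lemma conf_Suc:
 "stk (Suc n) = nextk {r. 0 < reg n r} (stk n)"
 "reg (Suc n) = (case wave (stk n) of Some (Inc r) => (reg n)(r := Suc (reg n r))
   | Some (Dec r) => (reg n)(r := reg n r - 1) | _ => reg n)"
 "stg (Suc n) = (case wave (stk n) of Some (Put r t) => (stg n)(reg n r := t) | _ => stg n)"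
 "acv (Suc n) = (if wave (stk n) = Some Com then stg n else acv n)"
proof -
 have *: "conf (Suc n) = astep (stk n, reg n, stg n, acv n)"
  by (simp add: conf_eq[symmetric] conf_def)
 have "stk (Suc n) = nextk {r. 0 < reg n r} (stk n) &
 reg (Suc n) = (case wave (stk n) of Some (Inc r) => (reg n)(r := Suc (reg n r))
   | Some (Dec r) => (reg n)(r := reg n r - 1) | _ => reg n) &
 stg (Suc n) = (case wave (stk n) of Some (Put r t) => (stg n)(reg n r := t) | _ => stg n) &
 acv (Suc n) = (if wave (stk n) = Some Com then stg n else acv n)"
 proof (cases "stk n")
  case Nil
  then show ?thesis
   using * unfolding stk_def[of "Suc n"] reg_def[of "Suc n"] stg_def[of "Suc n"] acv_def[of "Suc n"] by simp
 next
  case (Cons c K)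
  then show ?thesis
   using * unfolding stk_def[of "Suc n"] reg_def[of "Suc n"] stg_def[of "Suc n"] acv_def[of "Suc n"]
   by (cases c) simp_all
 qed
 then show "stk (Suc n) = nextk {r. 0 < reg n r} (stk n)"
 "reg (Suc n) = (case wave (stk n) of Some (Inc r) => (reg n)(r := Suc (reg n r))
   | Some (Dec r) => (reg n)(r := reg n r - 1) | _ => reg n)"
 "stg (Suc n) = (case wave (stk n) of Some (Put r t) => (stg n)(reg n r := t) | _ => stg n)"
 "acv (Suc n) = (if wave (stk n) = Some Com then stg n else acv n)" by blast+
qed

lemma wave_nonzero: "wave K ~= Some (Inc 0)" "wave K ~= Some (Put 0 t)"
 by (cases K rule: wave.cases; simp)+

lemma wave_stk_0: "wave (stk 0) = None"
 using C by (auto simp: conf_0)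

lemma reg_Suc_0: "reg (Suc n) 0 <= reg n 0"
proof (cases "wave (stk n)")
 case (Some c)
 then show ?thesis using wave_nonzero(1)[of "stk n"] by (cases c) (simp_all add: conf_Suc(2))
qed (simp add: conf_Suc(2))

lemma reg_Suc_le: "reg (Suc n) r <= Suc (reg n r)"
proof (cases "wave (stk n)")
 case (Some c)
 then show ?thesis by (cases c) (auto simp add: conf_Suc(2))
qed (simp add: conf_Suc(2))

lemma reg_0_bound: "reg n 0 <= e"
proof (induction n)
 case (Suc n)
 then show ?case using reg_Suc_0[of n] by linarith
qed (simp add: conf_0)

lemma reg_bound:
 assumes "r ~= 0"
 shows "reg n r <= n - 1"
proof (induction n)
 case (Suc n)
 show ?case
 proof (cases "n = 0")
  case True
  then show ?thesis using wave_stk_0 assms by (simp add: conf_Suc(2) conf_0)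
 next
  case False
  then show ?thesis using reg_Suc_le[of n r] Suc by linarith
 qed
qed (use assms in \<open>simp add: conf_0\<close>)

lemma stg_untouched: "n - 1 <= p ==> stg n p = d"
proof (induction n)
 case (Suc n)
 have IH: "stg n p = d" using Suc by simp
 show ?case
 proof (cases "\<exists>r t. wave (stk n) = Some (Put r t)")
  case True
  then obtain r t where w: "wave (stk n) = Some (Put r t)" by blast
  then have r: "r ~= 0" using wave_nonzero(2)[of "stk n" t] by auto
  have "n ~= 0" using w wave_stk_0 by (cases n) auto
  then have "reg n r ~= p" using reg_bound[OF r, of n] Suc.prems by simp
  then show ?thesis using IH w by (simp add: conf_Suc(3))
 next
  case False
  then have "stg (Suc n) = stg n"
   unfolding conf_Suc(3) by (simp split: option.split cmd.split)
  then show ?thesis using IH by simp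
 qed
qed (simp add: conf_0)

lemma acv_untouched: "n - 1 <= p ==> acv n p = d"
 by (induction n) (auto simp: conf_0 conf_Suc(4) stg_untouched)

subsection \<open>The emitted sequence\<close>

text \<open>In half-step \<open>h\<close> the packet of position \<open>pos h\<close> of the word \<open>wrd h\<close> is emitted.\<close>

primrec posw :: "nat => nat \<times> (nat => trip)" where
 "posw 0 = (0, acv 0)"
| "posw (Suc h) = (if last_of (snd (posw h) (fst (posw h))) then (0, acv (issued (2 * h + 1)))
   else (Suc (fst (posw h)), snd (posw h)))"

definition "pos h = fst (posw h)"
definition "wrd h = snd (posw h)"
definition "symw h = wrd h (pos h)"

lemma pos_Suc: "pos (Suc h) = (if last_of (symw h) then 0 else Suc (pos h))"
 and wrd_Suc: "wrd (Suc h) = (if last_of (symw h) then acv (issued (2 * h + 1)) else wrd h)"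
 by (simp_all add: pos_def wrd_def symw_def)

lemma pos_le: "pos h <= h"
 by (induction h) (auto simp: pos_Suc, simp add: pos_def)

text \<open>The launch wave travels at the speed of the instruction waves, so all cells show it the
  active track as of the moment of launch, and a word is never composed of two versions. The letter
  at position p reaches the wall 2 p steps after the first one; subtracting this dates the
  launch.\<close>

lemma wrd_eq: "wrd h = acv (issued (2 * h - 2 * pos h - 1))"
proof (induction h)
 case (Suc h)
 have "2 * Suc h - 2 * Suc (pos h) - 1 = 2 * h - 2 * pos h - 1" by simp
 then show ?case using Suc by (auto simp: pos_Suc wrd_Suc)
qed (simp add: wrd_def pos_def)

lemma not_last_below_pos: "p < pos h ==> ~ last_of (wrd h p)"
proof (induction h arbitrary: p)
 case (Suc h)
 then show ?case
  by (cases "last_of (symw h)") (auto simp: pos_Suc wrd_Suc symw_def less_Suc_eq)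
qed (simp add: pos_def)

text \<open>A word that has reached position r was launched at least 2 r steps earlier, when at most
  r instructions had been issued; an untouched cell with its end mark then stood before position
  r.\<close>

lemma pos_less:
 assumes "issued (2 * h - 2 * r) <= r" "0 < r"
 shows "pos h < r"
proof (rule ccontr)
 assume "~ pos h < r"
 define n where "n = issued (2 * h - 2 * pos h - 1)"
 have "2 * h - 2 * pos h - 1 <= 2 * h - 2 * r" using \<open>~ pos h < r\<close> by linarith
 from issued_mono[OF this] assms(1) have "n <= r" unfolding n_def by linarith
 then have "n - 1 < pos h" using assms(2) \<open>~ pos h < r\<close> by linarith
 then have "~ last_of (acv n (n - 1))"
  using not_last_below_pos[of "n - 1" h] by (simp add: wrd_eq n_def)
 then show False using acv_untouched[of n "n - 1"] d by simp
qed

text \<open>At times 0 and 1 the wall shows the letters of d with which it was started; the first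
  packet appears at time 2, and each packet provides the letters of two successive steps.\<close>

definition emit :: "nat => nat" where
 "emit t = (if t = 0 then fst d else if t = 1 then fst (snd d)
   else if even t then fst (symw ((t - 2) div 2)) else fst (snd (symw ((t - 2) div 2))))"

subsection \<open>Closed form of the evolution\<close>

definition issue_at :: "nat => cmd option" where
 "issue_at u = (if issue (issued u) = u then wave (stk (issued u)) else None)"

definition reaches :: "nat => nat => cmd option => cmd option" where
 "reaches j n c = (case c of Some (Inc r) => if j <= reg n r then c else None
   | Some (Put r t) => if j <= reg n r then c else None | _ => c)"

definition wall :: "nat => wst" where
 "wall t = \<lparr> w_stk = stk (issued t), w_iw = (if t = 0 then None else issue_at (t - 1)),
   w_lw = (even t & pos (t div 2) = 0), w_out = emit t,
   w_buf = (if t < 2 then fst (snd d) else fst (snd (symw ((t - 2) div 2)))) \<rparr>"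

text \<open>r is the number of cells and t the age of the wall. A wave issued at time u stands in
  the wall at u + 1 and in cell j at u + 2 + j, and takes effect in the next step; so cell j follows
  the abstract run with a delay of 2 + j. The death token appears in cell r - 1 at time 64^r + r -
  1, when the counter overflows.\<close>

definition body :: "nat => nat => nat => bst" where
 "body r j t = \<lparr> b_bars = {q. j < reg (issued (t - 2 - j)) q}, b_stg = stg (issued (t - 2 - j)) j,
   b_act = acv (issued (t - 2 - j)) j,
   b_iw = (if t < 2 + j then None else reaches j (issued (t - 2 - j)) (issue_at (t - 2 - j))),
   b_lw = (odd (t + j) & pos ((t + j) div 2) = j),
   b_pk = (if odd (t + j) & j < pos ((t + j) div 2) then Some (symw ((t + j) div 2)) else None),
   b_dg = ((t - j) div 64 ^ j) mod 64,
   b_cy = (j < t & 64 ^ Suc j dvd (t - j)),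
   b_fr = (t < 64 ^ j + j),
   b_xt = (\<exists>i. j <= i & i < r & t + j = issue i),
   b_dt = (t + j = 64 ^ r + 2 * r - 2) \<rparr>"

lemma wall_0: "wall 0 = start_wall C d"
 by (simp add: wall_def start_wall_def conf_0 pos_def emit_def)

lemma body_0:
 assumes "j < r"
 shows "body r j 0 = fresh d (j < e)"
proof -
 have p: "pos (j div 2) <= j div 2" by (rule pos_le)
 have 1: "~ (odd j & pos (j div 2) = j)" "~ (odd j & j < pos (j div 2))"
  using p by (auto elim: oddE)
 have 2: "~ (\<exists>i\<ge>j. i < r & j = issue i)"
  using le_issue by (metis not_less)
 have 3: "j ~= 64 ^ r + 2 * r - 2"
  using assms one_le_power[of "64::nat" r] by linarith
 have 4: "0 < 64 ^ j + j" by simp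
 show ?thesis
  using 1 2 3 4 unfolding body_def fresh_def by (simp add: conf_0)
qed

lemma packet_body:
 "packet (body r j t) = (if odd (t + j) & j <= pos ((t + j) div 2) then Some (symw ((t + j) div 2)) else None)"
proof -
 have "acv (issued (t - 2 - j)) j = symw ((t + j) div 2)" if "odd (t + j)" "pos ((t + j) div 2) = j"
 proof -
  have "2 * ((t + j) div 2) = t + j - 1"
   using that(1) by (auto elim!: oddE)
  then have "2 * ((t + j) div 2) - 2 * j - 1 = t - 2 - j" by simp
  then show ?thesis unfolding symw_def wrd_eq that(2) by simp
 qed
 then show ?thesis unfolding packet_def by (auto simp: body_def)
qed

lemma bars_issue: "b_bars (body r 0 (issue i)) = {q. 0 < reg i q}"
 by (simp add: body_def)

lemma wstep_wall:
 assumes "t < 64 ^ r + 2 * r - 2" "0 < r"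
 shows "wstep (wall t) (body r 0 t) = Some (wall (Suc t))"
proof -
 have dt: "~ b_dt (body r 0 t)" using assms by (simp add: body_def)
 have xt: "b_xt (body r 0 t) \<longleftrightarrow> issue (issued t) = t"
 proof
  assume "issue (issued t) = t"
  moreover have "issued t < r"
  proof (rule ccontr)
   assume "~ issued t < r"
   then have "issue r <= issue (issued t)"
    using issue_strict_mono by (simp add: strict_mono_less_eq)
   then show False using calculation assms(1) by (simp add: issue_def)
  qed
  ultimately show "b_xt (body r 0 t)" by (auto simp: body_def intro!: exI[of _ "issued t"])
 qed (auto simp: body_def)
 have stk: "(if issue (issued t) = t then nextk (b_bars (body r 0 t)) (stk (issued t)) else stk (issued t)) = stk (issued (Suc t))"
  using bars_issue[of r "issued t"] by (auto simp: issued_Suc conf_Suc(1))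
 have lw: "(case packet (body r 0 t) of None => False | Some t => last_of t) = (even (Suc t) & pos (Suc t div 2) = 0)"
 by (auto simp: packet_body pos_Suc)
 have out: "(case packet (body r 0 t) of None => w_buf (wall t) | Some t => fst t) = emit (Suc t)"
  and buf: "(case packet (body r 0 t) of None => w_buf (wall t) | Some t => fst (snd t)) = w_buf (wall (Suc t))"
 proof -
  have 1: "odd t ==> Suc t ~= 1 & ~ Suc t < 2 & (Suc t - 2) div 2 = t div 2" by presburger
  have 2: "even t ==> t ~= 0 ==> 2 <= t & (Suc t - 2) div 2 = (t - 2) div 2" by presburger
  have cs: "t = 0 \<or> odd t & Suc t ~= 1 & ~ Suc t < 2 & (Suc t - 2) div 2 = t div 2
   \<or> even t & 2 <= t & (Suc t - 2) div 2 = (t - 2) div 2" using 1 2 by blast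
  from cs show "(case packet (body r 0 t) of None => w_buf (wall t) | Some t => fst t) = emit (Suc t)"
   by (elim disjE conjE) (simp_all only: packet_body emit_def wall_def, simp_all)
  from cs show "(case packet (body r 0 t) of None => w_buf (wall t) | Some t => fst (snd t)) = w_buf (wall (Suc t))"
   by (elim disjE conjE) (simp_all only: packet_body wall_def, simp_all)
 qed
 have "wall (Suc t) = the (wstep (wall t) (body r 0 t))"
 proof (rule wst.equality)
  show "w_stk (wall (Suc t)) = w_stk (the (wstep (wall t) (body r 0 t)))"
   by (simp add: wstep_def wall_def stk[symmetric] xt dt)
  show "w_iw (wall (Suc t)) = w_iw (the (wstep (wall t) (body r 0 t)))"
   by (simp add: wstep_def wall_def issue_at_def xt dt)
  show "w_lw (wall (Suc t)) = w_lw (the (wstep (wall t) (body r 0 t)))"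
   using lw dt by (simp add: wstep_def wall_def[of "Suc t"])
  show "w_out (wall (Suc t)) = w_out (the (wstep (wall t) (body r 0 t)))"
   using out dt by (simp add: wstep_def wall_def[of "Suc t"])
  show "w_buf (wall (Suc t)) = w_buf (the (wstep (wall t) (body r 0 t)))"
   using buf dt by (simp add: wstep_def)
 qed simp
 then show ?thesis
  using dt by (simp add: wstep_def)
qed

lemma wstep_dies: "0 < r ==> wstep w (body r 0 (64 ^ r + 2 * r - 2)) = None"
 by (simp add: wstep_def body_def)


section \<open>The closed form satisfies the transition rule, field by field\<close>

definition left :: "nat => nat => nat => wst + bst" where
 "left r j t = (if j = 0 then Inl (wall t) else Inr (body r (j - 1) t))"

definition right :: "nat => nat => nat => bst option" where
 "right r j t = (if Suc j < r then Some (body r (Suc j) t) else None)"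

lemma issue_at_issue [simp]: "issue_at (issue n) = wave (stk n)"
 by (simp add: issue_at_def)

lemma issue_at_cases:
 obtains n where "u = issue n" "issued u = n" "issued (Suc u) = Suc n"
 | "issue_at u = None" "issued (Suc u) = issued u"
by (metis issued_Suc issue_at_def)

lemma b_iw_body:
 assumes "2 + j <= t"
 shows "b_iw (body r j t) = reaches j (issued (t - 2 - j)) (issue_at (t - 2 - j))"
 using assms by (simp add: body_def)

lemma body_bars:
 assumes j: "j < r" and t: "t < 64 ^ r + 2 * r - 2" and e: "e <= r"
 shows "b_bars (bstep l (body r j t) (right r j t)) = b_bars (body r j (Suc t))"
  and "b_stg (bstep l (body r j t) (right r j t)) = b_stg (body r j (Suc t))"
  and "b_act (bstep l (body r j t) (right r j t)) = b_act (body r j (Suc t))"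
proof -
 let ?b = "body r j t" and ?rb = "right r j t"
 define u where "u = t - 2 - j"
 have "b_bars (bstep l ?b ?rb) = b_bars (body r j (Suc t)) & b_stg (bstep l ?b ?rb) = b_stg (body r j (Suc t))
   & b_act (bstep l ?b ?rb) = b_act (body r j (Suc t))"
 proof (cases "t < 2 + j")
  case True
  then have "b_iw ?b = None" "t - 2 - j = 0" "Suc t - 2 - j = 0" by (auto simp: body_def)
  then show ?thesis by (simp add: bstep_def) (simp add: body_def)
 next
  case False
  then have u: "t = 2 + j + u" "Suc t - 2 - j = Suc u" by (simp_all add: u_def)
  have iw: "b_iw ?b = reaches j (issued u) (issue_at u)"
   using False by (simp add: b_iw_body u_def)
  have b: "b_bars ?b = {q. j < reg (issued u) q}" "b_stg ?b = stg (issued u) j" "b_act ?b = acv (issued u) j"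
   by (simp_all add: body_def u_def)
  have b': "b_bars (body r j (Suc t)) = {q. j < reg (issued (Suc u)) q}"
   "b_stg (body r j (Suc t)) = stg (issued (Suc u)) j" "b_act (body r j (Suc t)) = acv (issued (Suc u)) j"
   by (simp_all add: body_def u)
  show ?thesis
  proof (cases u rule: issue_at_cases)
   case 2
   then have "b_iw ?b = None" by (simp add: iw reaches_def)
   then show ?thesis using 2 unfolding bstep_def b b' by (simp add: b)
  next
   case (1 n)
   \<comment> \<open>The wave reaches the right neighbour one step later, so this neighbour still
     shows the state before the instruction. For the last cell the age bound gives n < r, and with e
     <= r no register extends beyond the body.\<close>
   have rb: "(\<exists>b'. ?rb = Some b' & q \<in> b_bars b') \<longleftrightarrow> Suc j < reg n q" for q
   proof (cases "Suc j < r")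
    case True
    have "t - 2 - Suc j = issue n - 1" using u 1 by simp
    then show ?thesis using True by (simp add: right_def body_def)
   next
    case False
    have "n < r"
    proof (rule ccontr)
     assume "~ n < r"
     then have "issue r <= issue n" using issue_strict_mono by (simp add: strict_mono_less_eq)
     then show False using t u 1 by (simp add: issue_def)
    qed
    then have "reg n q <= r" using reg_0_bound[of n] reg_bound[of q n] e by (cases "q = 0") auto
    then show ?thesis using False j by (simp add: right_def)
   qed
   have c: "issued u = n" "issued (Suc u) = Suc n" "issue_at u = wave (stk n)" using 1 by auto
   show ?thesis
   proof (cases "wave (stk n)")
    case None
    then show ?thesis
     unfolding bstep_def b b' c iw by (simp add: reaches_def conf_Suc(2-4) b c)
   next
    case (Some w)
    show ?thesis
    proof (cases w)
     case (Inc q)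
     then show ?thesis using Some
      unfolding bstep_def b b' c iw by (auto simp add: reaches_def conf_Suc(2-4) b c)
    next
     case (Dec q)
     then show ?thesis using Some rb[of q]
      unfolding bstep_def b b' c iw by (auto simp add: reaches_def conf_Suc(2-4) b c)
    next
     case (Put q t)
     then show ?thesis using Some
      unfolding bstep_def b b' c iw by (auto simp add: reaches_def conf_Suc(2-4) b c)
    next
     case Com
     then show ?thesis using Some
      unfolding bstep_def b b' c iw by (auto simp add: reaches_def conf_Suc(2-4) b c)
    next
     case (Seq c1 c2)
     then show ?thesis using Some by (cases "stk n" rule: wave.cases) (auto split: if_splits)
    next
     case (While q c1)
     then show ?thesis using Some by (cases "stk n" rule: wave.cases) (auto split: if_splits)
    qed
   qed
  qed
 qed
 then show "b_bars (bstep l ?b ?rb) = b_bars (body r j (Suc t))"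
  "b_stg (bstep l ?b ?rb) = b_stg (body r j (Suc t))"
  "b_act (bstep l ?b ?rb) = b_act (body r j (Suc t))" by auto
qed

lemma body_iw: "b_iw (bstep (left r j t) b rb) = b_iw (body r j (Suc t))"
proof (cases j)
 case 0
 have "reaches 0 n c = c" for n c by (auto simp: reaches_def split: option.split cmd.split)
 then show ?thesis using 0 by (auto simp: bstep_def left_def wall_def body_def)
next
 case (Suc i)
 have *: "passes (body r i t) (b_iw (body r i t)) = b_iw (body r j (Suc t))"
 proof (cases "t < 2 + i")
  case True
  then show ?thesis using Suc by (simp add: body_def passes_def)
 next
  case False
  define u where "u = t - 2 - i"
  have u: "Suc t - 2 - j = u" "t - 2 - i = u" using Suc by (simp_all add: u_def)
  have "b_iw (body r j (Suc t)) = reaches j (issued u) (issue_at u)"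
   using False Suc by (subst b_iw_body) (auto simp: u_def)
  moreover have "b_iw (body r i t) = reaches i (issued u) (issue_at u)"
   using False by (subst b_iw_body) (auto simp: u_def)
  moreover have "b_bars (body r i t) = {q. i < reg (issued u) q}"
   by (simp add: body_def u_def)
  ultimately show ?thesis
   using Suc by (auto simp: passes_def reaches_def split: option.split cmd.split)
 qed
 then show ?thesis using Suc by (simp add: bstep_def left_def)
qed

lemma body_lw: "b_lw (bstep (left r j t) b rb) = b_lw (body r j (Suc t))"
proof (cases j)
 case 0
 then show ?thesis by (auto simp: bstep_def left_def wall_def body_def)
next
 case (Suc i)
 define h where "h = (t + i) div 2"
 show ?thesis
 proof (cases "odd (t + i)")
  case True
  have h: "(Suc t + j) div 2 = Suc h" using Suc by (simp add: h_def)
  have lw: "b_lw (body r i t) \<longleftrightarrow> pos h = i" using True by (simp add: body_def h_def)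
  have act: "b_act (body r i t) = symw h" if "pos h = i"
   using packet_body[of r i t] that True lw by (simp add: packet_def flip: h_def)
  have "b_lw (bstep (left r j t) b rb) \<longleftrightarrow> b_lw (body r i t) & ~ last_of (b_act (body r i t))"
   using Suc by (simp add: bstep_def left_def)
  also have "\<dots> \<longleftrightarrow> pos (Suc h) = j"
   using act Suc unfolding lw by (auto simp: pos_Suc)
  also have "\<dots> \<longleftrightarrow> b_lw (body r j (Suc t))"
   using True Suc h by (simp add: body_def)
  finally show ?thesis .
 next
  case False
  then show ?thesis using Suc by (auto simp: bstep_def left_def) (auto simp: body_def)
 qed
qed

lemma body_pk:
 assumes "j < r" "t < 64 ^ r + 2 * r - 2"
 shows "b_pk (bstep l b (right r j t)) = b_pk (body r j (Suc t))"
proof (cases "Suc j < r")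
 case True
 then show ?thesis by (auto simp: bstep_def right_def packet_body) (auto simp: body_def)
next
 case False
 \<comment> \<open>Nothing arrives from beyond the last cell, because until the counter overflows
   all words end within the body.\<close>
 have "~ j < pos ((Suc t + j) div 2)" if "odd (Suc t + j)"
 proof -
  have "2 * ((Suc t + j) div 2) = t + j" using that by auto
  moreover have "t + j - 2 * r <= issue r" using assms by (simp add: issue_def)
  ultimately have "issued (2 * ((Suc t + j) div 2) - 2 * r) <= r" by (simp only: issued_le_iff)
  from pos_less[OF this] show ?thesis using assms False by simp
 qed
 then have "b_pk (body r j (Suc t)) = None"
  by (auto simp only: body_def bst.select_convs split: if_split)
 then show ?thesis using False by (simp add: bstep_def right_def)
qed

lemma carry_in_left: "carry_in (left r j t) \<longleftrightarrow> j <= t & 64 ^ j dvd (Suc t - j)"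
 by (cases j) (auto simp: carry_in_def left_def body_def)

lemma Suc_div_mod_carry:
 fixes m x :: nat
 assumes "0 < m"
 shows "(Suc x div m) mod 64 = (if m dvd Suc x then (if (x div m) mod 64 = 63 then 0 else Suc ((x div m) mod 64)) else (x div m) mod 64)"
  and "64 * m dvd Suc x \<longleftrightarrow> m dvd Suc x & (x div m) mod 64 = 63"
proof -
 have 1: "Suc x div m = (if m dvd Suc x then Suc (x div m) else x div m)"
  using assms by (simp add: div_Suc dvd_eq_mod_eq_0)
 show "(Suc x div m) mod 64 = (if m dvd Suc x then (if (x div m) mod 64 = 63 then 0 else Suc ((x div m) mod 64)) else (x div m) mod 64)"
  unfolding 1 by (simp add: mod_Suc)
 have "64 * m dvd Suc x \<longleftrightarrow> m dvd Suc x & 64 dvd (Suc x div m)"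
  using assms by (auto elim!: dvdE simp: mult.commute mult.assoc)
 moreover have "64 dvd (Suc x div m) \<longleftrightarrow> (x div m) mod 64 = 63" if "m dvd Suc x"
  using that unfolding 1 by (simp add: dvd_eq_mod_eq_0 mod_Suc)
 ultimately show "64 * m dvd Suc x \<longleftrightarrow> m dvd Suc x & (x div m) mod 64 = 63" by blast
qed

lemma body_digits:
 "b_dg (bstep (left r j t) (body r j t) rb) = b_dg (body r j (Suc t))"
 "b_cy (bstep (left r j t) (body r j t) rb) = b_cy (body r j (Suc t))"
 "b_fr (bstep (left r j t) (body r j t) rb) = b_fr (body r j (Suc t))"
proof -
 have "b_dg (bstep (left r j t) (body r j t) rb) = b_dg (body r j (Suc t)) &
  b_cy (bstep (left r j t) (body r j t) rb) = b_cy (body r j (Suc t)) &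
  b_fr (bstep (left r j t) (body r j t) rb) = b_fr (body r j (Suc t))"
 proof (cases "j <= t")
  case True
  define x where "x = t - j"
  have x: "t = x + j" "Suc t - j = Suc x" using True by (simp_all add: x_def)
  have p: "0 < (64::nat) ^ j" by simp
  have cin: "carry_in (left r j t) \<longleftrightarrow> 64 ^ j dvd Suc x"
   using True x by (simp add: carry_in_left)
  have "b_fr (body r j (Suc t)) \<longleftrightarrow> b_fr (body r j t) & ~ 64 ^ j dvd Suc x"
  proof -
   have "64 ^ j dvd Suc x \<longleftrightarrow> Suc x = 64 ^ j" if "Suc x <= 64 ^ j"
    using that by (auto dest: dvd_imp_le)
   then show ?thesis by (auto simp: body_def x)
  qed
  then show ?thesis
   unfolding bstep_def cin using Suc_div_mod_carry[OF p, of x]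
   by (simp add: body_def x)
 next
  case False
  have "t < 64 ^ j + j" "Suc t < 64 ^ j + j" using False one_le_power[of "64::nat" j] by linarith+
  then show ?thesis using False by (simp add: bstep_def carry_in_left body_def)
 qed
 then show "b_dg (bstep (left r j t) (body r j t) rb) = b_dg (body r j (Suc t))"
  "b_cy (bstep (left r j t) (body r j t) rb) = b_cy (body r j (Suc t))"
  "b_fr (bstep (left r j t) (body r j t) rb) = b_fr (body r j (Suc t))" by auto
qed

lemma fr_carry: "b_fr (body r j t) & carry_in (left r j t) \<longleftrightarrow> Suc t + j = issue j"
proof
 assume a: "b_fr (body r j t) & carry_in (left r j t)"
 then have "j <= t" "64 ^ j dvd Suc t - j" "Suc t - j <= 64 ^ j"
  by (auto simp: carry_in_left body_def)
 then have "Suc t - j = 64 ^ j" by (auto dest!: dvd_imp_le)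
 then show "Suc t + j = issue j" using \<open>j <= t\<close> by (simp add: issue_def)
next
 assume "Suc t + j = issue j"
 then have t: "Suc t = 64 ^ j + j" by (simp add: issue_def)
 moreover have "j <= t" using t one_le_power[of "64::nat" j] by linarith
 ultimately show "b_fr (body r j t) & carry_in (left r j t)"
  by (simp add: carry_in_left body_def)
qed

lemma body_xt:
 assumes "j < r"
 shows "b_xt (bstep (left r j t) (body r j t) (right r j t)) = b_xt (body r j (Suc t))"
proof -
 have "b_xt (bstep (left r j t) (body r j t) (right r j t)) \<longleftrightarrow>
   Suc t + j = issue j \<or> (\<exists>b'. right r j t = Some b' & b_xt b')"
  unfolding bstep_def bst.select_convs fr_carry ..
 also have "(\<exists>b'. right r j t = Some b' & b_xt b') \<longleftrightarrow> (\<exists>i. Suc j <= i & i < r & t + Suc j = issue i)"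
  unfolding right_def by (auto simp: body_def)
 also have "t + Suc j = Suc t + j" by simp
 also have "(Suc t + j = issue j \<or> (\<exists>i. Suc j <= i & i < r & Suc t + j = issue i))
   \<longleftrightarrow> (\<exists>i. j <= i & i < r & Suc t + j = issue i)"
  using assms by (metis Suc_le_eq le_eq_less_or_eq)
 also have "(\<exists>i. j <= i & i < r & Suc t + j = issue i) \<longleftrightarrow> b_xt (body r j (Suc t))"
  by (simp add: body_def)
 finally show ?thesis .
qed

lemma body_dt:
 assumes j: "j < r" and t: "t < 64 ^ r + 2 * r - 2"
 shows "b_dt (bstep (left r j t) (body r j t) (right r j t)) = b_dt (body r j (Suc t))"
proof (cases "Suc j < r")
 case True
 then show ?thesis by (simp add: bstep_def right_def) (simp add: body_def)
next
 case False
 then have r: "r = Suc j" using j by simp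
 have "carry_in (left r j t) & b_dg (body r j t) = 63 \<longleftrightarrow> b_cy (body r j (Suc t))"
  using body_digits(2)[of r j t None] by (simp add: bstep_def)
 also have "\<dots> \<longleftrightarrow> j <= t & 64 ^ r dvd Suc t - j"
  by (simp add: body_def r less_Suc_eq_le)
 also have "\<dots> \<longleftrightarrow> Suc t + j = 64 ^ r + 2 * r - 2"
 proof
  assume "j <= t & 64 ^ r dvd Suc t - j"
  then obtain k where k: "Suc t - j = 64 ^ r * k" "j <= t" by (auto elim: dvdE)
  \<comment> \<open>A second overflow would take about twice as long as the wall lives.\<close>
  have "k = 1"
  proof -
   have "k ~= 0" using k by (cases k) auto
   moreover have "k < 2"
   proof -
    define M where "M = (64::nat) ^ r"
    have "r < M" unfolding M_def by (rule power_gt_expt) simp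
    moreover have "t < M + 2 * r - 2" "Suc t - j = M * k" using t k(1) by (simp_all only: M_def)
    ultimately have "M * k < M * 2" using r by linarith
    then show ?thesis by simp
   qed
   ultimately show ?thesis by linarith
  qed
  then show "Suc t + j = 64 ^ r + 2 * r - 2" using k r by simp
 next
  assume "Suc t + j = 64 ^ r + 2 * r - 2"
  then have "Suc t = 64 ^ r + j" using r by simp
  moreover have "j <= t" using calculation one_le_power[of "64::nat" r] by linarith
  ultimately show "j <= t & 64 ^ r dvd Suc t - j" by simp
 qed
 finally show ?thesis
  using False by (auto simp: bstep_def right_def) (auto simp: body_def)
qed

theorem bstep_body:
 assumes "j < r" "t < 64 ^ r + 2 * r - 2" "e <= r"
 shows "bstep (left r j t) (body r j t) (right r j t) = body r j (Suc t)"
 by (rule bst.equality)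
  (simp_all add: body_bars assms body_iw body_lw body_pk body_digits body_xt body_dt)

end

subsection \<open>Every machine dies\<close>

lemma sum_power_64: "63 * (\<Sum>j<r. 64 ^ j) + 1 = (64 :: nat) ^ r"
 by (induction r) auto

text \<open>The counter value, including the carries in transit, grows by one in each step until the last
  cell overflows.\<close>

lemma machine_dies:
 fixes w :: "nat => wst" and b :: "nat => nat => bst"
 assumes r: "0 < r" and dg: "\<And>j. j < r ==> b_dg (b 0 j) < 64"
  and step: "\<And>t j. t < T ==> j < r ==> b (Suc t) j = bstep (if j = 0 then Inl (w t) else Inr (b t (j - 1)))
    (b t j) (if Suc j < r then Some (b t (Suc j)) else None)"
  and alive: "\<And>t. t < T ==> ~ b_dt (b t 0)"
 shows "T <= 4 * 64 ^ r"
proof (rule ccontr)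
 assume "~ T <= 4 * 64 ^ r"
 obtain q where q: "r = Suc q" using r by (cases r) auto
 define c where "c t j = (of_bool (b_cy (b t j)) :: nat)" for t j
 define g where "g t j = b_dg (b t j)" for t j
 define i where "i t j = (if j = 0 then 1 else c t (j - 1))" for t j
 define V where "V t = (\<Sum>j<r. 64 ^ j * g t j) + (\<Sum>j<q. 64 ^ Suc j * c t j)" for t
 have dg': "g t j < 64" if "t <= T" "j < r" for t j
  using that
 proof (induction t)
  case (Suc t)
  then show ?case using step[of t j] by (auto simp: g_def bstep_def)
 qed (use dg in \<open>simp add: g_def\<close>)
 have cell: "g (Suc t) j + 64 * c (Suc t) j = g t j + i t j" if "t < T" "j < r" for t j
  using step[OF that] dg'[of t j] that
  by (auto simp: g_def c_def i_def bstep_def carry_in_def)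
 have in_sum: "(\<Sum>j<r. 64 ^ j * i t j) = 1 + (\<Sum>j<q. 64 ^ Suc j * c t j)" for t
  unfolding q sum.lessThan_Suc_shift by (simp add: i_def)
 have V_Suc: "V (Suc t) + 64 ^ r * c (Suc t) q = V t + 1" if "t < T" for t
 proof -
  have "V (Suc t) + 64 ^ r * c (Suc t) q = (\<Sum>j<r. 64 ^ j * g (Suc t) j) + (\<Sum>j<r. 64 ^ Suc j * c (Suc t) j)"
   by (simp add: V_def q)
  also have "\<dots> = (\<Sum>j<r. 64 ^ j * (g (Suc t) j + 64 * c (Suc t) j))"
   by (simp add: sum.distrib algebra_simps)
  also have "\<dots> = (\<Sum>j<r. 64 ^ j * (g t j + i t j))"
   using cell[OF that] by (intro sum.cong) auto
  also have "\<dots> = V t + 1"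
   using in_sum[of t] by (simp add: sum.distrib algebra_simps V_def)
  finally show ?thesis .
 qed
 have V_le: "V t <= 2 * 64 ^ r" if "t <= T" for t
 proof -
  have "V t <= (\<Sum>j<r. 64 ^ j * 63) + (\<Sum>j<q. 64 ^ Suc j * 1)"
   unfolding V_def using dg'[OF that] by (intro add_mono sum_mono mult_left_mono) (auto simp: c_def less_Suc_eq_le[symmetric])
  also have "(\<Sum>j<q. (64::nat) ^ Suc j * 1) <= (\<Sum>j<r. 64 ^ j * 63)"
   unfolding q sum.lessThan_Suc_shift[of "\<lambda>j. 64 ^ j * 63"] by (rule trans_le_add2[OF sum_mono]) simp
  also have "(\<Sum>j<r. (64::nat) ^ j * 63) <= 64 ^ r"
   using sum_power_64[of r] by (simp add: sum_distrib_left mult.commute)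
  finally show ?thesis by simp
 qed
 \<comment> \<open>Without an overflow V grows by one per step, but it never exceeds 2 * 64^r. After
   the overflow the death token crosses the remaining cells, one per step.\<close>
 have "\<exists>t < 2 * 64 ^ r + 1. c (Suc t) q ~= 0"
 proof (rule ccontr)
  assume no: "~ (\<exists>t < 2 * 64 ^ r + 1. c (Suc t) q ~= 0)"
  have "t <= 2 * 64 ^ r + 1 ==> V t = V 0 + t" for t
  proof (induction t)
   case (Suc t)
   then have "c (Suc t) q = 0" using no by auto
   then show ?case using V_Suc[of t] Suc \<open>~ T <= 4 * 64 ^ r\<close> by simp
  qed simp
  from this[of "2 * 64 ^ r + 1"] V_le[of "2 * 64 ^ r + 1"] \<open>~ T <= 4 * 64 ^ r\<close> show False by simp
 qed
 then obtain t where t: "t < 2 * 64 ^ r + 1" "c (Suc t) q ~= 0" by blast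
 have rT: "t + r < T"
 proof -
  have "r < 64 ^ r" by (rule power_gt_expt) simp
  then show ?thesis using t(1) \<open>~ T <= 4 * 64 ^ r\<close> by linarith
 qed
 have "n <= q ==> b_dt (b (Suc t + n) (q - n))" for n
 proof (induction n)
  case 0
  have "b (Suc t) q = bstep (if q = 0 then Inl (w t) else Inr (b t (q - 1))) (b t q) None"
   using step[of t q] rT q by simp
  then show ?case using t(2) by (auto simp: c_def bstep_def)
 next
  case (Suc n)
  then have "b_dt (b (Suc t + n) (Suc (q - Suc n)))" by (simp add: Suc_diff_Suc)
  then show ?case using step[of "Suc t + n" "q - Suc n"] Suc.prems rT q by (simp add: bstep_def)
 qed
 from this[of q] alive[of "t + r"] rT q show False by simp
qed

subsection \<open>Finiteness of the state space\<close>

text \<open>The stacks that occur while a command runs on top of K, before K is exposed. They are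
  finitely many because the body of a loop runs on top of that loop and not of a growing stack; this
  keeps the alphabet finite.\<close>

fun conts :: "cmd => cmd list => cmd list set" where
 "conts (Seq c d) K = insert (Seq c d # K) (conts c (d # K) \<union> conts d K)"
| "conts (While r c) K = insert (While r c # K) (conts c (While r c # K))"
| "conts c K = {c # K}"

lemma conts_self: "C # K \<in> conts C K"
 by (cases C) auto

lemma finite_conts: "finite (conts C K)"
 by (induction C K rule: conts.induct) auto

lemma nextk_conts: "K' \<in> conts C K ==> nextk S K' \<in> insert K (conts C K)"
proof (induction C K arbitrary: K' rule: conts.induct)
 case (1 c d K)
 from 1(3) consider "K' = Seq c d # K" | "K' \<in> conts c (d # K)" | "K' \<in> conts d K" by auto
 then show ?case
 proof cases
  case 2
  from 1(1)[OF this] conts_self[of d K] show ?thesis by auto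
 next
  case 3
  from 1(2)[OF this] show ?thesis by auto
 qed (use conts_self[of c "d # K"] in simp)
next
 case (2 r c K)
 from 2(2) consider "K' = While r c # K" | "K' \<in> conts c (While r c # K)" by auto
 then show ?case
 proof cases
  case 2
  from "2.IH"[OF this] show ?thesis by auto
 qed (use conts_self[of c "While r c # K"] in simp)
qed auto

fun put_trips :: "cmd => trip set" where
 "put_trips (Seq c d) = put_trips c \<union> put_trips d"
| "put_trips (While r c) = put_trips c"
| "put_trips (Put r t) = {t}"
| "put_trips c = {}"

lemma put_trips_conts: "K' \<in> conts C K ==> (\<Union>c\<in>set K'. put_trips c) \<subseteq> put_trips C \<union> (\<Union>c\<in>set K. put_trips c)"
 by (induction C K arbitrary: K' rule: conts.induct) fastforce+

definition stacks :: "cmd => cmd list set" where "stacks C = insert [] (conts C [])"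
definition waves :: "cmd => cmd option set" where "waves C = insert None (wave ` stacks C)"
definition regs :: "cmd => nat set" where "regs C = insert 0 {r. Some (Inc r) \<in> waves C}"

definition wsts :: "cmd => nat set => wst set" where
 "wsts C B = {w. w_stk w \<in> stacks C & w_iw w \<in> waves C & w_out w \<in> B & w_buf w \<in> B}"

definition bsts :: "cmd => trip set => bst set" where
 "bsts C T = {b. b_bars b \<subseteq> regs C & b_stg b \<in> T & b_act b \<in> T & b_iw b \<in> waves C &
   b_pk b \<in> insert None (Some ` T) & b_dg b < 64}"

lemma finite_waves: "finite (waves C)"
 by (simp add: waves_def stacks_def finite_conts)

lemma finite_regs: "finite (regs C)"
proof -
 have "inj (\<lambda>r. Some (Inc r))" by (rule injI) simp
 from finite_vimageI[OF finite_waves this] show ?thesis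
  by (simp add: regs_def vimage_def)
qed

lemma finite_wsts:
 assumes "finite B"
 shows "finite (wsts C B)"
proof -
 have "finite (stacks C \<times> waves C \<times> (UNIV :: bool set) \<times> B \<times> B)"
  using assms by (auto simp: stacks_def finite_conts finite_waves)
 from finite_imageI[OF this, of "\<lambda>(k, i, l, x, y). wst.make k i l x y"] show ?thesis
 proof (rule rev_finite_subset, intro subsetI)
  fix w assume "w \<in> wsts C B"
  then show "w \<in> (\<lambda>(k, i, l, x, y). wst.make k i l x y) ` (stacks C \<times> waves C \<times> UNIV \<times> B \<times> B)"
   by (intro image_eqI[where x = "(w_stk w, w_iw w, w_lw w, w_out w, w_buf w)"]) (simp_all add: wst.make_def wsts_def)
 qed
qed

lemma finite_bsts:
 assumes "finite T"
 shows "finite (bsts C T)"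
proof -
 let ?P = "Pow (regs C) \<times> T \<times> T \<times> waves C \<times> (UNIV :: bool set) \<times> insert None (Some ` T) \<times> {..<64::nat}
  \<times> (UNIV :: bool set) \<times> (UNIV :: bool set) \<times> (UNIV :: bool set) \<times> (UNIV :: bool set)"
 let ?f = "\<lambda>(a, b, c, i, l, p, g, y, f, x, z). bst.make a b c i l p g y f x z"
 have "finite ?P"
  using assms by (intro finite_cartesian_product) (auto simp: finite_regs finite_waves)
 from finite_imageI[OF this, of ?f] show ?thesis
 proof (rule rev_finite_subset, intro subsetI)
  fix b assume "b \<in> bsts C T"
  then show "b \<in> ?f ` ?P"
   by (intro image_eqI[where x = "(b_bars b, b_stg b, b_act b, b_iw b, b_lw b, b_pk b, b_dg b, b_cy b, b_fr b, b_xt b, b_dt b)"])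
    (simp_all add: bst.make_def bsts_def)
 qed
qed

lemma nextk_stacks: "K \<in> stacks C ==> nextk S K \<in> stacks C"
 using nextk_conts[of K C "[]" S] by (auto simp: stacks_def)

lemma packet_bsts: "b \<in> bsts C T ==> packet b = Some t ==> t \<in> T"
 by (auto simp: packet_def bsts_def split: if_splits)

lemma wstep_wsts:
 assumes "w \<in> wsts C B" "b \<in> bsts C T" "\<And>t. t \<in> T ==> fst t \<in> B & fst (snd t) \<in> B" "wstep w b = Some w'"
 shows "w' \<in> wsts C B"
 using assms packet_bsts[OF assms(2)]
 by (auto simp: wstep_def wsts_def nextk_stacks waves_def split: if_splits option.splits)

lemma passes_waves: "c \<in> waves C ==> passes b c \<in> waves C"
proof -
 have "passes b c = c \<or> passes b c = None"
  by (simp add: passes_def split: option.split cmd.split)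
 then show "c \<in> waves C ==> passes b c \<in> waves C" by (auto simp: waves_def)
qed

lemma waves_Put: "Some (Put r t) \<in> waves C ==> t \<in> put_trips C"
proof -
 assume "Some (Put r t) \<in> waves C"
 then obtain K where K: "K \<in> conts C []" "wave K = Some (Put r t)"
  by (auto simp: waves_def stacks_def)
 then have "t \<in> (\<Union>c\<in>set K. put_trips c)"
  by (cases K rule: wave.cases) (auto split: if_splits)
 then show ?thesis using put_trips_conts[OF K(1)] by auto
qed

lemma bstep_bsts:
 assumes b: "b \<in> bsts C T" and T: "put_trips C \<subseteq> T"
  and l: "\<And>w. l = Inl w ==> w \<in> wsts C B" "\<And>b'. l = Inr b' ==> b' \<in> bsts C T"
  and rb: "\<And>b'. rb = Some b' ==> b' \<in> bsts C T"
 shows "bstep l b rb \<in> bsts C T"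
proof -
 have "b_bars (bstep l b rb) \<subseteq> regs C"
  using b by (auto simp: bstep_def bsts_def regs_def split: option.splits cmd.splits if_splits)
 moreover have "b_stg (bstep l b rb) \<in> T"
  using b T waves_Put by (fastforce simp: bstep_def bsts_def split: option.splits cmd.splits if_splits)
 moreover have "b_iw (bstep l b rb) \<in> waves C"
  using l by (cases l) (auto simp: bstep_def bsts_def wsts_def passes_waves)
 moreover have "b_pk (bstep l b rb) \<in> insert None (Some ` T)"
  using rb packet_bsts by (cases rb; cases "packet (the rb)") (auto simp: bstep_def)
 ultimately show ?thesis
  using b by (auto simp: bsts_def bstep_def)
qed

section \<open>Walls, fronts and machines on a line\<close>

text \<open>
  A waiting wall \<open>Ww\<close> sends a front \<open>Fr\<close> to the right, which reserves the inert cells it meets. At the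
  first cell that is not inert the signal \<open>Sg\<close> returns, turns the reserved cells into fresh machine
  cells, and starts the wall. Cells without proper support at their left become inert. The flag carried
  by \<open>Sg\<close> tells whether the cell lies at distance at most \<open>e\<close> from the wall, so that a fresh machine
  holds \<open>e\<close> in register 0.
\<close>

datatype cell = In | Ww | Fr | Rs | Sg bool | Wr wst | Tp bst

definition isW :: "cell => bool" where
 "isW c \<longleftrightarrow> (case c of Ww => True | Wr w => True | _ => False)"

lemma isW_simps [simp]: "isW Ww" "isW (Wr w)" "~ isW In" "~ isW Fr" "~ isW Rs" "~ isW (Sg b)" "~ isW (Tp x)"
 by (simp_all add: isW_def)

definition tape :: "cell => bst option" where
 "tape c = (case c of Tp b => Some b | _ => None)"

lemma tape_simps [simp]: "tape (Tp b) = Some b" "(\<And>b. c ~= Tp b) ==> tape c = None"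
 by (auto simp: tape_def split: cell.split)

definition support :: "cell => bool" where
 "support c \<longleftrightarrow> c = Ww \<or> c = Rs"

context
 fixes C :: cmd and d :: trip
begin

text \<open>\<open>le\<close> is the cell e places to the left. On its way back the signal sees its
  wall there at distance e and keeps the flag from then on; thus a position of the neighbourhood
  becomes a number in unary. Cells other than walls persist only next to a suitable left neighbour,
  which clears away debris of the initial configuration.\<close>

fun cstep :: "cell => cell => cell => cell => cell" where
 "cstep le l In r = (if l = Ww \<or> l = Fr then Fr else In)"
| "cstep le l Fr r = (if ~ support l then In else if r = In then Rs else Sg (isW le))"
| "cstep le l Rs r = (if ~ support l then In else
   (case r of Sg b => Sg (b \<or> isW le) | Rs => Rs | Fr => Rs | _ => Sg (isW le)))"
| "cstep le l (Sg b) r = (if ~ support l then In else Tp (fresh d b))"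
| "cstep le l Ww r = (case r of In => Ww | Fr => Ww | Rs => Ww | Sg b => Wr (start_wall C d) | _ => In)"
| "cstep le l (Wr w) r = (case tape r of Some b => (case wstep w b of None => In | Some w' => Wr w') | None => In)"
| "cstep le l (Tp b) r = (case l of Wr w => Tp (bstep (Inl w) b (tape r))
   | Tp b' => Tp (bstep (Inr b') b (tape r)) | Sg f => Tp b | _ => In)"

end

text \<open>As walls never arise, being a wall at time t is an event that decreases with t, from any
  initial configuration.\<close>

lemma isW_cstep: "isW (cstep C d le l c r) ==> isW c"
 by (cases c) (auto split: if_splits cell.splits option.splits)

lemma cstep_Tp_cases:
 assumes "cstep C d le l c r = Tp b"
 shows "(\<exists>b'. c = Tp b') \<or> (\<exists>f. c = Sg f) & support l"
 using assms by (cases c) (auto split: if_splits cell.splits option.splits)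

lemma cstep_Ww_cases:
 assumes "cstep C d le l c r = Ww"
 shows "c = Ww & (r = In \<or> r = Fr \<or> r = Rs)"
 using assms by (cases c) (auto split: if_splits cell.splits option.splits)

locale evolution = machine C d e for C :: cmd and d :: trip and e :: nat +
 fixes c :: "nat => int => cell"
 assumes step: "c (Suc t) j = cstep C d (c t (j - int e)) (c t (j - 1)) (c t j) (c t (j + 1))"
  and e_pos: "0 < e"
  and dg_start: "c 0 j = Tp b ==> b_dg b < 64"
begin

lemma isW_antimono: "isW (c t j) ==> s <= t ==> isW (c s j)"
proof (induction t)
 case (Suc t)
 then show ?case
  using isW_cstep[of C d] step[of t j] by (cases "s = Suc t") auto
qed simp

subsection \<open>The origin of a reserved cell\<close>

lemma Fr_diagonal: "c t j = Fr ==> i < t ==> c (t - i) (j - int i) = Fr"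
proof (induction i)
 case (Suc i)
 have 1: "c (t - i) (j - int i) = Fr" and t: "t - i = Suc (t - Suc i)" "t - Suc i ~= 0"
  using Suc by auto
 have "c (Suc (t - Suc i)) (j - int i) = Fr"
  using 1 t(1) by simp
 then have l: "c (t - Suc i) (j - int i - 1) \<in> {Ww, Fr}" and In: "c (t - Suc i) (j - int i) = In"
  unfolding step by (cases "c (t - Suc i) (j - int i)"; auto split: if_splits cell.splits option.splits)+
 \<comment> \<open>A wall still waiting at a positive time had an inert cell, a front or a reserved
   cell to its right one step before, and none of these turns inert next to a waiting wall.\<close>
 have "c (t - Suc i) (j - int i - 1) ~= Ww"
 proof
  obtain u where u: "t - Suc i = Suc u" using t(2) by (cases "t - Suc i") auto
  assume "c (t - Suc i) (j - int i - 1) = Ww"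
  then have w: "c u (j - int i - 1) = Ww" "c u (j - int i) \<in> {In, Fr, Rs}"
   using cstep_Ww_cases[of C d] step[of u "j - int i - 1"] u by auto
  have "c (Suc u) (j - int i) = In" using In u by simp
  then show False
   using w unfolding step[of u "j - int i"] by (auto simp: support_def split: if_splits cell.splits)
 qed
 then show ?case using l by (simp add: algebra_simps)
qed simp

text \<open>Every cell that is neither inert nor a wall was laid by a front that started at some \<open>a\<close> and
  crossed all cells in between at speed one.\<close>

lemma origin:
 assumes "c t p ~= In" "~ isW (c t p)"
 shows "\<exists>a. p - int t <= a & a <= p & (\<forall>j. a < j --> j <= p --> ~ isW (c (nat (j - a)) j)) & ~ isW (c (nat (p - a)) p)"
 using assms
proof (induction t arbitrary: p)
 case 0
 then show ?case by (intro exI[of _ p]) auto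
next
 case (Suc t)
 show ?case
 proof (cases "c t p ~= In & ~ isW (c t p)")
  case True
  from Suc.IH[of p] True obtain a where "p - int t <= a" "a <= p"
   "\<forall>j. a < j --> j <= p --> ~ isW (c (nat (j - a)) j)" "~ isW (c (nat (p - a)) p)" by blast
  then show ?thesis by (intro exI[of _ a]) auto
 next
  case False
  have "~ isW (c t p)"
  proof
   assume w: "isW (c t p)"
   then show False using Suc.prems unfolding step
    by (cases "c t p") (auto split: if_splits cell.splits option.splits)
  qed
  then have "c t p = In" using False by blast
  then have F: "c (Suc t) p = Fr" using Suc.prems unfolding step by (auto split: if_splits)
  have *: "~ isW (c (nat (j - (p - int (Suc t)))) j)" if j: "p - int (Suc t) < j" "j <= p" for j
  proof -
   define i where "i = nat (p - j)"
   have "i < Suc t" "Suc t - i = nat (j - (p - int (Suc t)))" "p - int i = j"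
    using j by (auto simp: i_def)
   then show ?thesis using Fr_diagonal[OF F, of i] by simp
  qed
  show ?thesis using *[of p] by (intro exI[of _ "p - int (Suc t)"] conjI allI impI *) auto
 qed
qed


lemma dg_bound: "c t j = Tp b ==> b_dg b < 64"
proof (induction t arbitrary: j b)
 case (Suc t)
 consider b' where "c t j = Tp b'" | f where "c t j = Sg f"
  using cstep_Tp_cases[of C d] Suc.prems unfolding step by blast
 then show ?case
 proof cases
  case 1
  then show ?thesis using Suc.prems Suc.IH[OF 1] unfolding step
   by (cases "c t (j - 1)") (auto simp: bstep_def split: if_splits)
 next
  case 2
  then show ?thesis using Suc.prems unfolding step by (auto simp: fresh_def split: if_splits)
 qed
qed (rule dg_start)

context
 fixes y :: int
begin

definition z :: "nat => nat => cell" where "z t i = c t (y + int i)"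

lemma z_Suc: "z (Suc t) (Suc i) = cstep C d (c t (y + int (Suc i) - int e)) (z t i) (z t (Suc i)) (z t (Suc (Suc i)))"
 using step[of t "y + int (Suc i)"] by (simp add: z_def algebra_simps)

lemma z_0: "z (Suc t) 0 = cstep C d (c t (y - int e)) (c t (y - 1)) (z t 0) (z t (Suc 0))"
 using step[of t y] by (simp add: z_def)

lemma z_antimono: "isW (z t i) ==> s <= t ==> isW (z s i)"
 unfolding z_def by (rule isW_antimono)

lemma Ww_antimono: "z t 0 = Ww ==> s <= t ==> z s 0 = Ww"
proof (induction t)
 case (Suc t)
 then have "z t 0 = Ww" using cstep_Ww_cases[of C d] unfolding z_0 by blast
 then show ?case using Suc by (cases "s = Suc t") auto
qed simp

subsection \<open>A running machine\<close>

definition Run :: "nat => nat => bool" where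
 "Run t r \<longleftrightarrow> (\<exists>w. z t 0 = Wr w) & (\<forall>i. 0 < i --> i <= r --> (\<exists>b. z t i = Tp b)) & tape (z t (Suc r)) = None"

lemma tape_None_Suc:
 assumes "tape (z t (Suc i)) = None" "~ support (z t i)"
 shows "tape (z (Suc t) (Suc i)) = None"
proof (rule ccontr)
 assume "tape (z (Suc t) (Suc i)) ~= None"
 then obtain b where "z (Suc t) (Suc i) = Tp b" by (auto simp: tape_def split: cell.splits)
 then have "(\<exists>b'. z t (Suc i) = Tp b') \<or> (\<exists>f. z t (Suc i) = Sg f) & support (z t i)"
  unfolding z_Suc by (rule cstep_Tp_cases)
 then show False using assms by auto
qed

lemma Run_step:
 assumes "Run t r" "isW (z (Suc t) 0)"
 shows "Run (Suc t) r"
proof -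
 obtain w where w: "z t 0 = Wr w" using assms(1) by (auto simp: Run_def)
 have T: "\<exists>b. z t i = Tp b" if "0 < i" "i <= r" for i using assms(1) that by (auto simp: Run_def)
 have "\<exists>w. z (Suc t) 0 = Wr w"
  using assms(2) w unfolding z_0 by (auto split: option.splits)
 moreover have "\<exists>b. z (Suc t) i = Tp b" if i0: "0 < i" "i <= r" for i
 proof -
  obtain j where j: "i = Suc j" using i0 by (cases i) auto
  obtain b where b: "z t (Suc j) = Tp b" using T[of i] i0 j by auto
  show ?thesis
  proof (cases j)
   case 0
   then show ?thesis using w b j by (simp add: z_Suc)
  next
   case (Suc k)
   then obtain b' where "z t j = Tp b'" using T[of j] i0 j by auto
   then show ?thesis using b j by (simp add: z_Suc)
  qed
 qed
 moreover have "tape (z (Suc t) (Suc r)) = None"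
 proof (rule tape_None_Suc)
  show "tape (z t (Suc r)) = None" using assms(1) by (simp add: Run_def)
  show "~ support (z t r)" using w T[of r] by (cases r) (auto simp: support_def)
 qed
 ultimately show ?thesis by (simp add: Run_def)
qed

text \<open>The contents of the r cells are arbitrary, so the bound also covers machines that the
  initial configuration happens to contain.\<close>

lemma Run_dies:
 assumes "Run t r" "isW (z (t + s) 0)"
 shows "s <= 4 * 64 ^ r"
proof -
 have run: "Run (t + n) r" if "n <= s" for n
  using that
 proof (induction n)
  case (Suc n)
  then have "isW (z (t + Suc n) 0)" by (intro z_antimono[OF assms(2)]) simp
  then show ?case using Run_step[of "t + n" r] Suc by simp
 qed (use assms in simp)
 have alive: "isW (z (t + n) 0)" if "n <= s" for n
  using that by (intro z_antimono[OF assms(2)]) simp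
 define w where "w n = (SOME w. z (t + n) 0 = Wr w)" for n
 define b where "b n j = the (tape (z (t + n) (Suc j)))" for n j
 have w: "z (t + n) 0 = Wr (w n)" if "n <= s" for n
  using run[OF that] unfolding w_def by (intro someI_ex[of "\<lambda>w. z (t + n) 0 = Wr w"]) (simp add: Run_def)
 have b: "z (t + n) (Suc j) = Tp (b n j)" if "n <= s" "j < r" for n j
  using run[OF that(1)] that(2) by (auto simp: Run_def b_def dest!: spec[of _ "Suc j"])
 have tp: "tape (z (t + n) (Suc (Suc j))) = (if Suc j < r then Some (b n (Suc j)) else None)" if "n <= s" "j < r" for n j
  using b[of n "Suc j"] run[of n] that by (cases "Suc j < r") (auto simp: Run_def dest: le_antisym simp: Suc_le_eq not_less less_Suc_eq_le)
 show ?thesis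
 proof (cases "r = 0")
  case True
  have "~ isW (z (Suc t) 0)"
   using assms(1) True by (auto simp: Run_def z_0)
  then have "s = 0" using alive[of 1] by (cases s) auto
  then show ?thesis by simp
 next
  case False
  show ?thesis
  proof (rule machine_dies[of r b s w])
   show "0 < r" using False by simp
   show "b_dg (b 0 j) < 64" if "j < r" for j
    using b[of 0 j] that dg_bound[of t "y + int (Suc j)"] by (simp add: z_def)
   show "b (Suc n) j = bstep (if j = 0 then Inl (w n) else Inr (b n (j - 1))) (b n j)
     (if Suc j < r then Some (b n (Suc j)) else None)" if "n < s" "j < r" for n j
   proof -
    have "Tp (b (Suc n) j) = z (Suc (t + n)) (Suc j)" using b[of "Suc n" j] that by simp
    also have "\<dots> = Tp (bstep (if j = 0 then Inl (w n) else Inr (b n (j - 1))) (b n j)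
     (if Suc j < r then Some (b n (Suc j)) else None))"
     using that w[of n] b[of n j] b[of n "j - 1"] tp[of n j] by (cases j) (simp_all add: z_Suc)
    finally show ?thesis by simp
   qed
   show "~ b_dt (b n 0)" if "n < s" for n
   proof
    assume "b_dt (b n 0)"
    then have "z (Suc (t + n)) 0 = In"
     using w[of n] b[of n 0] that False by (simp add: z_0 wstep_def)
    then show False using alive[of "Suc n"] that by simp
   qed
  qed
 qed
qed

subsection \<open>The returning signal\<close>

definition Ret :: "nat => nat => nat => bool" where
 "Ret t p r \<longleftrightarrow> 0 < p & p <= r & z t 0 = Ww & (\<forall>i. 0 < i --> i < p --> z t i = Rs) & (\<exists>f. z t p = Sg f)
   & (\<forall>i. p < i --> i <= r --> (\<exists>b. z t i = Tp b)) & tape (z t (Suc r)) = None"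

lemma Ret_step:
 assumes "Ret t (Suc p) r"
 shows "if p = 0 then Run (Suc t) r else Ret (Suc t) p r"
proof -
 have R: "z t i = Rs" if "0 < i" "i <= p" for i using assms that by (auto simp: Ret_def)
 have W: "z t 0 = Ww" and T: "\<exists>b. z t i = Tp b" if "Suc p < i" "i <= r" for i
  using assms that by (auto simp: Ret_def)
 have W: "z t 0 = Ww" and pr: "Suc p <= r" using assms by (auto simp: Ret_def)
 obtain f where f: "z t (Suc p) = Sg f" using assms by (auto simp: Ret_def)
 have sup: "support (z t i)" if "i <= p" for i using R[of i] W that by (cases i) (auto simp: support_def)
 have 1: "\<exists>b. z (Suc t) i = Tp b" if i: "p < i" "i <= r" for i
 proof -
  obtain j where j: "i = Suc j" using i by (cases i) auto
  consider "j = p" | "j = Suc p" | "Suc p < j" using i j by linarith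
  then show ?thesis
  proof cases
   case 1
   then show ?thesis using f sup[of p] j by (simp add: z_Suc)
  next
   case 2
   then show ?thesis using f T[of i] i j by (auto simp: z_Suc)
  next
   case 3
   then show ?thesis using T[of i] T[of j] i j by (auto simp: z_Suc)
  qed
 qed
 have 2: "tape (z (Suc t) (Suc r)) = None"
 proof (rule tape_None_Suc)
  show "tape (z t (Suc r)) = None" using assms by (simp add: Ret_def)
  show "~ support (z t r)"
   using T[of r] f pr by (cases "r = Suc p") (auto simp: support_def)
 qed
 show ?thesis
 proof (cases "p = 0")
  case True
  then have "z (Suc t) 0 = Wr (start_wall C d)" using W f by (simp add: z_0)
  then show ?thesis using True 1 2 by (simp add: Run_def)
 next
  case False
  then obtain q where q: "p = Suc q" by (cases p) auto
  have "z (Suc t) 0 = Ww" using W R[of "Suc 0"] q by (simp add: z_0)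
  moreover have "z (Suc t) i = Rs" if i0: "0 < i" "i < p" for i
  proof -
   obtain j where "i = Suc j" using i0 by (cases i) auto
   then show ?thesis using R[of i] R[of "Suc i"] sup[of j] that by (simp add: z_Suc)
  qed
  moreover have "\<exists>f. z (Suc t) p = Sg f"
   using f R[of p] sup[of q] q by (simp add: z_Suc)
  ultimately show ?thesis using False 1 2 pr by (auto simp: Ret_def)
 qed
qed

lemma Ret_Run: "Ret t p r ==> Run (t + p) r"
proof (induction p arbitrary: t)
 case (Suc p)
 then show ?case using Ret_step[of t p r] Suc.IH[of "Suc t"] by (cases "p = 0") auto
qed (simp add: Ret_def)

lemma Ret_dies:
 assumes "Ret t p r" "isW (z s 0)"
 shows "s <= t + p + 4 * 64 ^ r"
proof (cases "s <= t + p")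
 case False
 then show ?thesis using Run_dies[OF Ret_Run[OF assms(1)], of "s - (t + p)"] assms(2) by simp
qed simp

subsection \<open>The front\<close>

definition Fro :: "nat => nat => bool" where
 "Fro t p \<longleftrightarrow> 0 < p & z t 0 = Ww & (\<forall>i. 0 < i --> i < p --> z t i = Rs) & z t p = Fr"

lemma Fro_step:
 assumes "Fro t p"
 shows "if z t (Suc p) = In then Fro (Suc t) (Suc p) else Ret (Suc t) p p"
proof -
 have R: "z t i = Rs" if "0 < i" "i < p" for i using assms that by (auto simp: Fro_def)
 have W: "z t 0 = Ww" and F: "z t p = Fr" "0 < p" using assms by (auto simp: Fro_def)
 obtain q where q: "p = Suc q" using F by (cases p) auto
 have sup: "support (z t i)" if "i < p" for i using R[of i] W that by (cases i) (auto simp: support_def)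
 have W': "z (Suc t) 0 = Ww" using W R[of "Suc 0"] F q by (cases "p = 1") (auto simp: z_0)
 have R': "z (Suc t) i = Rs" if i0: "0 < i" "i < p" for i
 proof -
  obtain j where j: "i = Suc j" using i0 by (cases i) auto
  have "z t (Suc i) = Rs \<or> z t (Suc i) = Fr" using R[of "Suc i"] F that by (cases "Suc i = p") auto
  then show ?thesis using R[of i] sup[of j] that j by (auto simp: z_Suc)
 qed
 show ?thesis
 proof (cases "z t (Suc p) = In")
  case True
  have "z (Suc t) p = Rs" using F True sup[of q] q by (simp add: z_Suc)
  moreover have "z (Suc t) (Suc p) = Fr" using F True by (simp add: z_Suc)
  ultimately show ?thesis using W' R' True by (auto simp: Fro_def less_Suc_eq)
 next
  case False
  have "\<exists>f. z (Suc t) p = Sg f" using F False sup[of q] q by (simp add: z_Suc)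
  moreover have "tape (z (Suc t) (Suc p)) = None"
  proof (cases "\<exists>b. z t (Suc p) = Tp b")
   case True
   then show ?thesis using F by (auto simp: z_Suc)
  next
   case False
   then have "tape (z t (Suc p)) = None" by simp
   then show ?thesis by (rule tape_None_Suc) (simp add: F support_def)
  qed
  ultimately show ?thesis using W' R' F False by (auto simp: Ret_def)
 qed
qed

lemma Fro_run:
 assumes "Fro t p"
 shows "Fro (t + n) (p + n) \<or> (\<exists>m<n. Fro (t + m) (p + m) & z (t + m) (Suc (p + m)) ~= In)"
proof (induction n)
 case (Suc n)
 then show ?case using Fro_step[of "t + n" "p + n"] by (auto simp: less_Suc_eq)
qed (use assms in simp)

text \<open>Within one step a waiting wall with arbitrary surroundings enters one of the regular
  phases or dies, unless the k cells to its right are all occupied. The first cell that is not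
  reserved decides: a front, a signal, an inert cell or an obstacle.\<close>

lemma Ww_start:
 assumes "z 0 0 = Ww"
 shows "(\<forall>i. 0 < i --> i <= k --> z 0 i ~= In & ~ isW (z 0 i)) \<or> (\<exists>t p. t <= 1 & p <= Suc k & Fro t p)
   \<or> (\<exists>t p r. t <= 1 & r <= k & Ret t p r & r < k) \<or> ~ isW (z 1 0)"
proof (cases "\<forall>i. 0 < i --> i <= k --> z 0 i = Rs")
 case True
 then show ?thesis by auto
next
 case False
 define p where "p = (LEAST i. 0 < i & z 0 i ~= Rs)"
 obtain p1 where p1: "0 < p1" "p1 <= k" "z 0 p1 ~= Rs" using False by blast
 have p: "0 < p & z 0 p ~= Rs" unfolding p_def by (rule LeastI[of _ p1]) (use p1 in blast)
 have pk: "p <= k" unfolding p_def by (rule order_trans[OF Least_le p1(2)]) (use p1 in blast)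
 have R: "z 0 i = Rs" if "0 < i" "i < p" for i
  using not_less_Least[OF that(2)[unfolded p_def]] that by auto
 obtain q where q: "p = Suc q" using p by (cases p) auto
 have sup: "support (z 0 i)" if "i < p" for i using R[of i] assms that by (cases i) (auto simp: support_def)
 have fro: "\<exists>t p. t <= 1 & p <= Suc k & Fro t p" if "z 0 p = Fr"
  using that p pk assms R by (intro exI[of _ 0] exI[of _ p]) (auto simp: Fro_def)
 show ?thesis
 proof (cases "\<exists>f. z 0 p = Sg f")
  case True
  show ?thesis
  proof (cases "\<forall>i. p < i --> i <= k --> (\<exists>b. z 0 i = Tp b)")
   case T: True
   have "z 0 i ~= In & ~ isW (z 0 i)" if "0 < i" "i <= k" for i
   proof -
    consider "i < p" | "i = p" | "p < i" by linarith
    then show ?thesis using R[of i] True T that by cases auto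
   qed
   then show ?thesis by blast
  next
   case F: False
   define r where "r = (LEAST i. p <= i & tape (z 0 (Suc i)) = None)"
   obtain i where i: "p < i" "i <= k" "~ (\<exists>b. z 0 i = Tp b)" using F by blast
   have ex: "p <= i - 1 & tape (z 0 (Suc (i - 1))) = None" using i by simp
   have r: "p <= r & tape (z 0 (Suc r)) = None" unfolding r_def by (rule LeastI[of _ "i - 1"]) (rule ex)
   have rk: "r <= i - 1" unfolding r_def by (rule Least_le) (rule ex)
   have "\<exists>b. z 0 m = Tp b" if m: "p < m" "m <= r" for m
   proof -
    have "~ (p <= m - 1 & tape (z 0 (Suc (m - 1))) = None)"
     by (rule not_less_Least) (use m in \<open>simp add: r_def\<close>)
    then show ?thesis using m by (auto simp: tape_def split: cell.splits)
   qed
   then have "Ret 0 p r" using p r R assms True by (auto simp: Ret_def)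
   then show ?thesis using rk i by (intro disjI2 disjI1 exI[of _ 0] exI[of _ p] exI[of _ r]) auto
  qed
 next
  case nS: False
  show ?thesis
  proof (cases "z 0 p = Fr")
   case True
   then show ?thesis using fro by blast
  next
   case nF: False
   show ?thesis
   proof (cases q)
    case 0
    show ?thesis
    proof (cases "z 0 1 = In")
     case True
     then have "Fro 1 1" using assms by (simp add: Fro_def z_Suc[of 0 0] z_0[of 0])
     then show ?thesis using pk by (intro disjI2 disjI1 exI[of _ 1]) auto
    next
     case False
     then have "~ isW (z 1 0)"
      using assms p nS nF q 0 unfolding One_nat_def z_0 by (cases "z 0 (Suc 0)") auto
     then show ?thesis by blast
    qed
   next
    case (Suc m)
    have "z (Suc 0) i = Rs" if i0: "0 < i" "i < q" for i
    proof -
     obtain j where "i = Suc j" using i0 by (cases i) auto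
     then show ?thesis using R[of i] R[of "Suc i"] sup[of j] that q by (simp add: z_Suc)
    qed
    moreover have "z (Suc 0) 0 = Ww" using assms R[of "Suc 0"] q Suc by (simp add: z_0)
    moreover have "\<exists>f. z (Suc 0) q = Sg f"
     using R[of q] sup[of m] p nS nF q Suc by (auto simp: z_Suc split: cell.split)
    moreover have "tape (z (Suc 0) (Suc q)) = None"
     using R[of q] nS q Suc unfolding z_Suc
     by (cases "z 0 (Suc q)") (auto simp: tape_def split: cell.splits if_splits option.splits)
    ultimately have "Ret 1 q q" using Suc by (auto simp: Ret_def)
    then show ?thesis using pk q Suc by (intro disjI2 disjI1 exI[of _ 1] exI[of _ q]) auto
   qed
  qed
 qed
qed

text \<open>A machine with fewer than k cells would be dead by time t. So the front of this wall, or
  an occupied stretch given at time 0, covers each of the k cells.\<close>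

lemma alive_covers:
 assumes w: "isW (z t 0)" and t: "4 * 64 ^ k + 2 * k + 4 < t" and i: "0 < i" "i <= k"
 shows "\<exists>s. z s i ~= In & ~ isW (z s i)"
proof (cases "z 0 0")
 case (Wr w)
 show ?thesis
 proof (rule ccontr)
  assume no: "~ ?thesis"
  define r where "r = (LEAST i. tape (z 0 (Suc i)) = None)"
  have ex: "tape (z 0 (Suc (i - 1))) = None"
   using no i by (auto simp: tape_def split: cell.split dest!: spec[of _ "0 :: nat"])
  have "tape (z 0 (Suc r)) = None" unfolding r_def by (rule LeastI) (rule ex)
  moreover have "\<exists>b. z 0 m = Tp b" if m: "0 < m" "m <= r" for m
  proof -
   have "~ (tape (z 0 (Suc (m - 1))) = None)"
    by (rule not_less_Least) (use m in \<open>simp add: r_def\<close>)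
   then show ?thesis using m by (auto simp: tape_def split: cell.splits)
  qed
  ultimately have run: "Run 0 r" using Wr by (simp add: Run_def)
  have "r < k" using Least_le[of "\<lambda>i. tape (z 0 (Suc i)) = None", OF ex] i by (simp add: r_def)
  then have "(64::nat) ^ r <= 64 ^ k" by (intro power_increasing) auto
  moreover have "t <= 4 * 64 ^ r" using Run_dies[OF run, of t] w by simp
  ultimately show False using t by linarith
 qed
next
 case Ww
 have ret: "k <= r" if "Ret s p r" "s <= k + 2" "p <= r" for s p r
 proof (rule ccontr)
  assume "~ k <= r"
  then have "(64::nat) ^ r <= 64 ^ k" by (intro power_increasing) auto
  then show False using Ret_dies[OF that(1) w] t that \<open>~ k <= r\<close> by linarith
 qed
 have "isW (z 1 0)" using w by (rule z_antimono) (use t in simp)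
 then consider "\<forall>i. 0 < i --> i <= k --> z 0 i ~= In & ~ isW (z 0 i)"
  | s p where "s <= 1" "Fro s p" | s p r where "s <= 1" "r < k" "Ret s p r"
  using Ww_start[OF Ww, of k] by blast
 then show ?thesis
 proof cases
  case 1
  then show ?thesis using i by blast
 next
  case 2
  have covers: ?thesis if "Fro s' p'" "k <= p'" for s' p'
  proof -
   have "z s' i = Rs \<or> z s' i = Fr" using that i by (cases "i = p'") (auto simp: Fro_def)
   then show ?thesis by (intro exI[of _ s']) auto
  qed
  from Fro_run[OF 2(2), of k] show ?thesis
  proof (elim disjE exE conjE)
   assume "Fro (s + k) (p + k)"
   then show ?thesis by (rule covers) simp
  next
   fix m assume m: "m < k" "Fro (s + m) (p + m)" "z (s + m) (Suc (p + m)) ~= In"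
   then have "Ret (Suc (s + m)) (p + m) (p + m)" using Fro_step[of "s + m" "p + m"] by simp
   then have "k <= p + m" by (rule ret) (use m 2 in auto)
   then show ?thesis by (rule covers[OF m(2)])
  qed
 next
  case 3
  then show ?thesis using ret[of s p r] by (auto simp: Ret_def)
 qed
qed (use z_antimono[OF w, of 0] in auto)


subsection \<open>Machines started by a returning signal\<close>

definition flag :: "nat => nat => nat => bool" where
 "flag t r j \<longleftrightarrow> (\<exists>i. j <= i & i <= r & isW (c (t + (r - i)) (y + int i - int e)))"

lemma flag_step: "j < r ==> flag t r j \<longleftrightarrow> flag t r (Suc j) \<or> isW (c (t + (r - j)) (y + int j - int e))"
 unfolding flag_def by (metis Suc_leD Suc_le_eq le_eq_less_or_eq)

text \<open>Cells behind the returning signal already obey the rule of the machine; without carries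
  and waves from a wall they stay fresh until the signal arrives there.\<close>

lemma bstep_fresh:
 "rb = None \<or> (\<exists>f''. rb = Some (fresh d f'')) ==> bstep (Inr (fresh d f')) (fresh d f) rb = fresh d f"
 by (auto simp: bstep_def fresh_def carry_in_def passes_def packet_def)

lemma Fro_Ret:
 assumes F: "Fro t r" "z t (Suc r) ~= In" and i: "i < r"
 shows "Ret (Suc (t + i)) (r - i) r & z (Suc (t + i)) (r - i) = Sg (flag t r (r - i)) &
   (\<forall>j. r - i < j --> j <= r --> z (Suc (t + i)) j = Tp (fresh d (flag t r j)))"
 using i
proof (induction i)
 case 0
 have R: "Ret (Suc t) r r" using Fro_step[OF F(1)] F(2) by simp
 obtain q where q: "r = Suc q" using 0 by (cases r) auto
 have "support (z t q)" using F(1) q by (cases q) (auto simp: Fro_def support_def)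
 moreover have "flag t r r \<longleftrightarrow> isW (c t (y + int r - int e))" by (auto simp: flag_def)
 ultimately have "z (Suc t) r = Sg (flag t r r)"
  using F q by (simp add: Fro_def z_Suc)
 then show ?case using R by simp
next
 case (Suc i)
 let ?t = "Suc (t + i)" and ?p = "r - i"
 obtain q where q: "?p = Suc q" "q = r - Suc i" "q ~= 0" using Suc.prems by (cases "?p") auto
 have IH: "Ret ?t ?p r" "z ?t ?p = Sg (flag t r ?p)"
  "\<And>j. ?p < j ==> j <= r ==> z ?t j = Tp (fresh d (flag t r j))" using Suc by auto
 have R: "Ret (Suc ?t) q r" using Ret_step[of ?t q r] IH(1) q by simp
 have Rs: "z ?t q = Rs" using IH(1) q by (auto simp: Ret_def)
 obtain q' where q': "q = Suc q'" using q(3) not0_implies_Suc by blast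
 have sup: "support (z ?t q')" using IH(1) q q' by (cases q') (auto simp: Ret_def support_def)
 have "t + (r - q) = ?t" using q Suc.prems by simp
 then have "flag t r q \<longleftrightarrow> flag t r ?p \<or> isW (c ?t (y + int q - int e))"
  using flag_step[of q r t] q Suc.prems by simp
 then have "z (Suc ?t) q = Sg (flag t r q)"
  using Rs sup IH(2) q(1) q' by (simp add: z_Suc)
 moreover have "z (Suc ?t) j = Tp (fresh d (flag t r j))" if j: "q < j" "j <= r" for j
 proof -
  obtain m where m: "j = Suc m" using j(1) gr0_implies_Suc[of j] by auto
  consider "m = q" | "m = ?p" | "?p < m" using j m q by linarith
  then show ?thesis
  proof cases
   case 1
   then show ?thesis using IH(2) q(1) Rs m by (simp add: z_Suc support_def)
  next
   case 2
   then show ?thesis using IH(2) IH(3)[of j] j m by (simp add: z_Suc)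
  next
   case 3
   have "tape (z ?t (Suc j)) = None \<or> (\<exists>f. tape (z ?t (Suc j)) = Some (fresh d f))"
    using IH(1) IH(3)[of "Suc j"] 3 j m by (cases "j = r") (auto simp: Ret_def)
   then show ?thesis using IH(3)[of j] IH(3)[of m] 3 j m by (simp add: z_Suc bstep_fresh)
  qed
 qed
 ultimately show ?case using R q(2) by simp
qed

text \<open>While the signal returns, all cells between it and the wall are reserved. Beyond
  distance e the cell e places to the left is one of these, at distance e it is the wall; walls
  further left come into view only later, when the flag is already set.\<close>

lemma Fro_flag:
 assumes F: "Fro t r" "z t (Suc r) ~= In" and e: "e <= r" and j: "0 < j" "j <= r"
 shows "flag t r j \<longleftrightarrow> j <= e"
proof
 assume "j <= e"
 have "isW (z (t + (r - e)) 0)"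
 proof (cases "r = e")
  case False
  then have "Ret (Suc (t + (r - e - 1))) (r - (r - e - 1)) r"
   using Fro_Ret[OF F, of "r - e - 1"] e_pos e by auto
  moreover have "Suc (t + (r - e - 1)) = t + (r - e)" using False e by simp
  ultimately show ?thesis by (simp add: Ret_def)
 qed (use F in \<open>simp add: Fro_def\<close>)
 then show "flag t r j"
  unfolding flag_def using \<open>j <= e\<close> e by (intro exI[of _ e]) (simp add: z_def)
next
 assume "flag t r j"
 then obtain i where i: "j <= i" "i <= r" "isW (c (t + (r - i)) (y + int i - int e))" by (auto simp: flag_def)
 show "j <= e"
 proof (rule ccontr)
  assume "~ j <= e"
  then have ie: "0 < i - e" "i - e < i" "y + int i - int e = y + int (i - e)" using i e_pos by auto
  have "z (t + (r - i)) (i - e) = Rs"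
  proof (cases "i = r")
   case True
   then show ?thesis using F(1) ie by (simp add: Fro_def)
  next
   case False
   then have "Ret (Suc (t + (r - i - 1))) (r - (r - i - 1)) r"
    using Fro_Ret[OF F, of "r - i - 1"] i j by auto
   moreover have "Suc (t + (r - i - 1)) = t + (r - i)" "r - (r - i - 1) = Suc i" using False i by auto
   ultimately show ?thesis using ie by (auto simp: Ret_def)
  qed
  then show False using i(3) unfolding ie(3) by (simp add: z_def)
 qed
qed

lemma started_at:
 assumes F: "Fro t r" "z t (Suc r) ~= In" and e: "e <= r"
 shows "z (Suc (t + r)) 0 = Wr (wall 0)" "\<And>j. j < r ==> z (Suc (t + r)) (Suc j) = Tp (body r j 0)"
  "tape (z (Suc (t + r)) (Suc r)) = None"
proof -
 have r: "0 < r" using F by (simp add: Fro_def)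
 have l: "Ret (t + r) 1 r" "z (t + r) 1 = Sg (flag t r 1)"
  "\<And>j. 1 < j ==> j <= r ==> z (t + r) j = Tp (fresh d (flag t r j))"
  using Fro_Ret[OF F, of "r - 1"] r by auto
 have W: "z (t + r) 0 = Ww" using l(1) by (simp add: Ret_def)
 show "z (Suc (t + r)) 0 = Wr (wall 0)" using W l(2) by (simp add: z_0 wall_0)
 show "tape (z (Suc (t + r)) (Suc r)) = None"
  using Ret_step[of "t + r" 0 r] l(1) by (simp add: Run_def)
 show "z (Suc (t + r)) (Suc j) = Tp (body r j 0)" if j: "j < r" for j
 proof -
  have fl: "fresh d (flag t r (Suc j)) = body r j 0"
   using Fro_flag[OF F e, of "Suc j"] j by (simp add: body_0 Suc_le_eq)
  consider "j = 0" | "j = 1" | "1 < j" by linarith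
  then have "z (Suc (t + r)) (Suc j) = Tp (fresh d (flag t r (Suc j)))"
  proof cases
   case 1
   then show ?thesis using l(2) W by (simp add: z_Suc support_def)
  next
   case 2
   then show ?thesis using l(2) l(3)[of "Suc j"] j by (simp add: z_Suc)
  next
   case 3
   have "tape (z (t + r) (Suc (Suc j))) = None \<or> (\<exists>f. tape (z (t + r) (Suc (Suc j))) = Some (fresh d f))"
    using l(1) l(3)[of "Suc (Suc j)"] 3 j by (cases "Suc j = r") (auto simp: Ret_def)
   then show ?thesis using l(3)[of j] l(3)[of "Suc j"] 3 j by (simp add: z_Suc bstep_fresh)
  qed
  then show ?thesis unfolding fl .
 qed
qed

lemma started_run:
 assumes s0: "z s 0 = Wr (wall 0)" and b0: "\<And>j. j < r ==> z s (Suc j) = Tp (body r j 0)"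
  and n0: "tape (z s (Suc r)) = None" and e: "e <= r" and t: "t <= 64 ^ r + 2 * r - 2"
 shows "z (s + t) 0 = Wr (wall t) & (\<forall>j<r. z (s + t) (Suc j) = Tp (body r j t)) & tape (z (s + t) (Suc r)) = None"
 using t
proof (induction t)
 case 0
 then show ?case using s0 b0 n0 by simp
next
 case (Suc t)
 have r: "0 < r" using e e_pos by simp
 have t: "t < 64 ^ r + 2 * r - 2" using Suc.prems by simp
 have IH: "z (s + t) 0 = Wr (wall t)" "\<And>j. j < r ==> z (s + t) (Suc j) = Tp (body r j t)"
  "tape (z (s + t) (Suc r)) = None" using Suc by auto
 have "z (Suc (s + t)) 0 = Wr (wall (Suc t))"
  using IH(1) IH(2)[OF r] wstep_wall[OF t r] by (simp add: z_0)
 moreover have "z (Suc (s + t)) (Suc j) = Tp (body r j (Suc t))" if j: "j < r" for j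
 proof -
  have "tape (z (s + t) (Suc (Suc j))) = right r j t"
   using IH(2)[of "Suc j"] IH(3) j by (cases "Suc j = r") (auto simp: right_def)
  moreover have "z (s + t) j = (case left r j t of Inl w => Wr w | Inr b => Tp b)"
   using IH(1) IH(2)[of "j - 1"] j by (cases j) (auto simp: left_def)
  ultimately have "z (Suc (s + t)) (Suc j) = Tp (bstep (left r j t) (body r j t) (right r j t))"
   using IH(2)[OF j] by (cases "left r j t") (simp_all add: z_Suc)
  then show ?thesis using bstep_body[OF j t e] by simp
 qed
 moreover have "tape (z (Suc (s + t)) (Suc r)) = None"
 proof (rule tape_None_Suc)
  obtain q where "r = Suc q" using r by (cases r) auto
  then show "~ support (z (s + t) r)" using IH(2)[of q] by (simp add: support_def)
 qed (rule IH(3))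
 ultimately show ?case by simp
qed

text \<open>An inert cell changes only through its left neighbour, so the g cells stay inert until
  the front arrives, whatever surrounds them. The machine then has at least g cells, and its counter
  lasts at least 64^g steps.\<close>

lemma good_wall_alive:
 assumes W: "z 0 0 = Ww" and I: "\<And>i. 0 < i ==> i <= g ==> z 0 i = In" and e: "e <= g" and t: "t <= 64 ^ g"
 shows "isW (z t 0)"
proof -
 have g: "0 < g" using e e_pos by simp
 have 1: "Fro 1 1" using W I[of "Suc 0"] g by (simp add: Fro_def z_Suc[of 0 0] z_0[of 0])
 have In: "z s i = In" if s: "s < i" "i <= g" for s i
  using s
 proof (induction s arbitrary: i)
  case (Suc s)
  then obtain j where j: "i = Suc j" by (cases i) auto
  have "z s i = In" "z s j = In" using Suc j by auto
  then show ?case using j by (simp add: z_Suc)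
 qed (use I in auto)
 have "Fro (Suc n) (Suc n)" if "n < g" for n
  using that
 proof (induction n)
  case (Suc n)
  then show ?case using Fro_step[of "Suc n" "Suc n"] In[of "Suc n" "Suc (Suc n)"] by simp
 qed (use 1 in simp)
 from this[of "g - 1"] have F: "Fro g g" using g by simp
 show ?thesis
 proof (cases "t <= g")
  case True
  have "isW (z g 0)" using F by (simp add: Fro_def)
  then show ?thesis using True by (rule z_antimono)
 next
  case False
  from Fro_run[OF F, of "t - g"] show ?thesis
  proof (elim disjE exE conjE)
   assume "Fro (g + (t - g)) (g + (t - g))"
   then show ?thesis using False by (simp add: Fro_def)
  next
   fix m assume m: "Fro (g + m) (g + m)" "z (g + m) (Suc (g + m)) ~= In"
   let ?r = "g + m" and ?s = "Suc (g + m + (g + m))"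
   have er: "e <= ?r" using e by simp
   have p: "(64::nat) ^ g <= 64 ^ ?r" by (rule power_increasing) auto
   have "z (?s + (64 ^ ?r + 2 * ?r - 2)) 0 = Wr (wall (64 ^ ?r + 2 * ?r - 2))"
    using started_run[OF started_at[OF m er] er order_refl] by blast
   then have "isW (z (?s + (64 ^ ?r + 2 * ?r - 2)) 0)" by simp
   moreover have "t <= ?s + (64 ^ ?r + 2 * ?r - 2)" using t p g by linarith
   ultimately show ?thesis by (rule z_antimono)
  qed
 qed
qed

text \<open>By time t every machine of at most k cells is dead. This rules out machines present at
  time 0 or begun by a stray signal, whose length the inert cell i0 limits. What remains is a wall
  started by its own front, with more than e cells or just e, to which the closed form
  applies.\<close>

lemma alive_started:
 assumes w: "isW (z t 0)" and i0: "0 < i0" "i0 <= k" "z 0 i0 = In" and D: "z D 0 ~= Ww"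
  and t: "4 * 64 ^ k + 2 * k + 4 + D < t" and k: "e <= k"
 obtains s where "s <= D" "z s 0 ~= Ww" "\<And>u. u < s ==> z u 0 = Ww"
  "\<And>u. s <= u ==> u <= t ==> z u 0 = Wr (wall (u - s))"
proof -
 have pw: "(64::nat) ^ r <= 64 ^ k" if "r <= k" for r using that by (intro power_increasing) auto
 have "z 0 0 = Ww"
 proof (cases "z 0 0")
  case (Wr w0)
  define r where "r = (LEAST i. tape (z 0 (Suc i)) = None)"
  have ex: "tape (z 0 (Suc (i0 - 1))) = None" using i0 by simp
  have "tape (z 0 (Suc r)) = None" unfolding r_def by (rule LeastI) (rule ex)
  moreover have "\<exists>b. z 0 m = Tp b" if m: "0 < m" "m <= r" for m
  proof -
   have "~ (tape (z 0 (Suc (m - 1))) = None)"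
    by (rule not_less_Least) (use m in \<open>simp add: r_def\<close>)
   then show ?thesis using m by (auto simp: tape_def split: cell.splits)
  qed
  ultimately have run: "Run 0 r" using Wr by (simp add: Run_def)
  have "r <= k" using Least_le[of "\<lambda>i. tape (z 0 (Suc i)) = None", OF ex] i0 by (simp add: r_def)
  then have "(64::nat) ^ r <= 64 ^ k" by (rule pw)
  moreover have "t <= 4 * 64 ^ r" using Run_dies[OF run, of t] w by simp
  ultimately have False using t by linarith
  then show ?thesis ..
 qed (use z_antimono[OF w, of 0] in auto)
 note Ww = this
 have "isW (z 1 0)" using w by (rule z_antimono) (use t in simp)
 then consider "\<forall>i. 0 < i --> i <= k --> z 0 i ~= In & ~ isW (z 0 i)"
  | s p where "s <= 1" "Fro s p" | s p r where "s <= 1" "r < k" "Ret s p r"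
  using Ww_start[OF Ww, of k] by blast
 then show ?thesis
 proof cases
  case 1
  then show ?thesis using i0 by blast
 next
  case 3
  then have "(64::nat) ^ r <= 64 ^ k" "p <= r" by (auto simp: Ret_def intro: pw)
  moreover have "t <= s + p + 4 * 64 ^ r" by (rule Ret_dies[OF 3(3) w])
  ultimately have False using t 3 by linarith
  then show ?thesis ..
 next
  case 2
  from Fro_run[OF 2(2), of D] show ?thesis
  proof (elim disjE exE conjE)
   assume "Fro (s + D) (p + D)"
   then have "z D 0 = Ww" using Ww_antimono[of "s + D" D] by (simp add: Fro_def)
   then show ?thesis using D by simp
  next
   fix m assume m: "m < D" "Fro (s + m) (p + m)" "z (s + m) (Suc (p + m)) ~= In"
   define r where "r = p + m"
   define u0 where "u0 = Suc (s + m + r)"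
   have r0: "0 < r" using m(2) by (simp add: Fro_def r_def)
   have ret: "Ret (s + m + r) 1 r"
    using Fro_Ret[OF m(2,3), of "r - 1"] r0 by (simp add: r_def)
   have u0: "u0 <= D"
   proof (rule ccontr)
    assume "~ u0 <= D"
    then have "D <= s + m + r" by (simp add: u0_def)
    then have "z D 0 = Ww" using ret Ww_antimono[of "s + m + r" D] by (simp add: Ret_def)
    then show False using D by simp
   qed
   have run: "Run u0 r" using Ret_step[of "s + m + r" 0 r] ret by (simp add: u0_def)
   have le: "t - u0 <= 4 * 64 ^ r" using Run_dies[OF run, of "t - u0"] w u0 t by simp
   have "k <= r"
   proof (rule ccontr)
    assume "~ k <= r"
    then have "(64::nat) ^ r <= 64 ^ k" by (intro pw) simp
    then show False using le t u0 by linarith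
   qed
   then have e: "e <= r" using k by simp
   have st: "z u0 0 = Wr (wall 0)" "\<And>j. j < r ==> z u0 (Suc j) = Tp (body r j 0)" "tape (z u0 (Suc r)) = None"
    using started_at[OF m(2,3)] e by (simp_all add: r_def u0_def)
   note run_formula = started_run[OF st e]
   have alive: "t - u0 <= 64 ^ r + 2 * r - 2"
   proof (rule ccontr)
    assume n: "~ t - u0 <= 64 ^ r + 2 * r - 2"
    let ?u = "64 ^ r + 2 * r - 2 :: nat"
    have "z (u0 + ?u) 0 = Wr (wall ?u)" "z (u0 + ?u) (Suc 0) = Tp (body r 0 ?u)"
     using run_formula[of ?u] r0 by auto
    then have "z (Suc (u0 + ?u)) 0 = In" using wstep_dies[OF r0] by (simp add: z_0)
    moreover have "isW (z (Suc (u0 + ?u)) 0)" by (rule z_antimono[OF w]) (use n in simp)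
    ultimately show False by simp
   qed
   show ?thesis
   proof (rule that[OF u0])
    show "z u0 0 ~= Ww" using st(1) by simp
    show "z u 0 = Ww" if "u < u0" for u
     using ret Ww_antimono[of "s + m + r" u] that by (simp add: Ret_def u0_def)
    fix u assume u: "u0 <= u" "u <= t"
    then show "z u 0 = Wr (wall (u - u0))"
     using run_formula[of "u - u0"] alive by simp
   qed
  qed
 qed
qed

text \<open>A wall waiting at time D has not seen a signal return; so its front has passed cell i,
  or this cell was occupied from the start.\<close>

lemma Ww_covers:
 assumes w: "z D 0 = Ww" and i: "0 < i" "2 * i + 4 <= D"
 shows "\<exists>s\<le>D. ~ isW (z s i)"
proof -
 have noRun: "~ Run s r" if "s <= D" for s r
  using Ww_antimono[OF w that] by (auto simp: Run_def)
 have "isW (z 1 0)" using Ww_antimono[OF w, of 1] i by simp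
 then consider "\<forall>j. 0 < j --> j <= i --> z 0 j ~= In & ~ isW (z 0 j)"
  | s p where "s <= 1" "p <= Suc i" "Fro s p" | s p r where "s <= 1" "r < i" "Ret s p r"
  using Ww_start[OF Ww_antimono[OF w, of 0], of i] by blast
 then show ?thesis
 proof cases
  case 1
  then show ?thesis using i by (intro exI[of _ 0]) auto
 next
  case 3
  then have "p <= r" by (simp add: Ret_def)
  then show ?thesis using noRun[of "s + p" r] Ret_Run[OF 3(3)] 3 i by simp
 next
  case 2
  have covers: ?thesis if "Fro s' p'" "i <= p'" "s' <= D" for s' p'
  proof -
   have "z s' i = Rs \<or> z s' i = Fr" using that i by (cases "i = p'") (auto simp: Fro_def)
   then show ?thesis using that(3) by (intro exI[of _ s']) auto
  qed
  from Fro_run[OF 2(3), of i] show ?thesis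
  proof (elim disjE exE conjE)
   assume "Fro (s + i) (p + i)"
   then show ?thesis by (rule covers) (use 2 i in auto)
  next
   fix m assume m: "m < i" "Fro (s + m) (p + m)" "z (s + m) (Suc (p + m)) ~= In"
   then have "Ret (Suc (s + m)) (p + m) (p + m)" using Fro_step[of "s + m" "p + m"] by simp
   then have R: "Run (Suc (s + m) + (p + m)) (p + m)" by (rule Ret_Run)
   show ?thesis
   proof (cases "i <= p + m")
    case True
    show ?thesis by (rule covers[OF m(2) True]) (use 2 i m in auto)
   next
    case False
    then show ?thesis using noRun[of "Suc (s + m) + (p + m)" "p + m"] R 2 i m by simp
   qed
  qed
 qed
qed

end

subsection \<open>Rare situations\<close>

definition good :: "nat => int => bool" where
 "good g j \<longleftrightarrow> c 0 j = Ww & (\<forall>i. 0 < i --> i <= g --> c 0 (j + int i) = In)"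

definition clear_of :: "nat => nat => int => bool" where
 "clear_of g n p \<longleftrightarrow> (\<forall>j. p - int n < j --> j <= p --> ~ good g j)"

lemma good_alive: "good g j ==> e <= g ==> t <= 64 ^ g ==> isW (c t j)"
 using good_wall_alive[of j g t] by (simp add: good_def z_def)

context
 fixes \<gamma> :: "nat => nat"
 assumes \<gamma>: "\<And>n. e <= \<gamma> n" "\<And>n. 4 * n + 8 <= 64 ^ \<gamma> n"
begin

text \<open>By \<open>origin\<close> a path of speed one over the last n cells met no wall. A good
  wall survives long enough to be met; so there was none in these n cells, or, if n < S, none at p
  itself.\<close>

lemma occupied_cases:
 assumes "c t p ~= In" "~ isW (c t p)"
 shows "(\<exists>n\<ge>S. clear_of (\<gamma> n) n p) \<or> ~ good (\<gamma> S) p"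
proof -
 obtain a where a: "a <= p" "\<And>j. a < j ==> j <= p ==> ~ isW (c (nat (j - a)) j)" "~ isW (c (nat (p - a)) p)"
  using origin[OF assms] by blast
 define n where "n = nat (p - a)"
 show ?thesis
 proof (cases "S <= n")
  case True
  have "clear_of (\<gamma> n) n p"
   unfolding clear_of_def
  proof (intro allI impI notI)
   fix j assume j: "p - int n < j" "j <= p" "good (\<gamma> n) j"
   have "nat (j - a) <= n" using j(2) a(1) by (simp add: n_def)
   then have "nat (j - a) <= 64 ^ \<gamma> n" using \<gamma>(2)[of n] by linarith
   from good_alive[OF j(3) \<gamma>(1) this] show False using a(1) a(2)[of j] j by (simp add: n_def)
  qed
  then show ?thesis using True by blast
 next
  case False
  then have "n <= 64 ^ \<gamma> S" using \<gamma>(2)[of S] by simp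
  then show ?thesis using good_alive[of "\<gamma> S" p n] a(3) \<gamma>(1) by (auto simp: n_def)
 qed
qed

text \<open>A long-lived wall covers the k cells to its right. If one of them carries a good wall,
  this site is at some time occupied by something else, and \<open>occupied_cases\<close> applies
  there.\<close>

lemma alive_rare:
 assumes w: "isW (c t y)" and t: "4 * 64 ^ k + 2 * k + 4 < t"
 shows "(\<exists>i\<in>{1..k}. \<exists>n\<ge>k. clear_of (\<gamma> n) n (y + int i)) \<or> clear_of (\<gamma> k) k (y + int k)"
proof (rule disjCI)
 assume no: "~ clear_of (\<gamma> k) k (y + int k)"
 then obtain j where j: "y < j" "j <= y + int k" "good (\<gamma> k) j" by (auto simp: clear_of_def)
 define i where "i = nat (j - y)"
 have i: "0 < i" "i <= k" "j = y + int i" using j by (auto simp: i_def)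
 obtain s where "c s j ~= In" "~ isW (c s j)"
  using alive_covers[of y t k i] w t i by (auto simp: z_def)
 from occupied_cases[OF this, of k] j(3) have "\<exists>n\<ge>k. clear_of (\<gamma> n) n j" by blast
 then show "\<exists>i\<in>{1..k}. \<exists>n\<ge>k. clear_of (\<gamma> n) n (y + int i)"
  using i by (intro bexI[of _ i]) auto
qed

lemma Ww_rare:
 assumes "c D y = Ww" "6 <= D"
 shows "clear_of (\<gamma> ((D - 4) div 2)) ((D - 4) div 2) (y + int ((D - 4) div 2))" (is "clear_of (\<gamma> ?k) _ _")
 unfolding clear_of_def
proof (intro allI impI notI)
 fix j assume j: "y + int ?k - int ?k < j" "j <= y + int ?k" "good (\<gamma> ?k) j"
 define i where "i = nat (j - y)"
 have i: "0 < i" "i <= ?k" "j = y + int i" using j by (auto simp: i_def)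
 have "2 * i + 4 <= D" using i(2) assms(2) by linarith
 then obtain s where "s <= D" "~ isW (c s j)"
  using i Ww_covers[of y D i] assms by (auto simp: z_def)
 moreover have "D <= 4 * ?k + 8" using assms(2) by linarith
 ultimately show False using good_alive[OF j(3) \<gamma>(1), of s] \<gamma>(2)[of ?k] by linarith
qed

lemma occupied_left: "c (Suc t) p ~= In ==> ~ isW (c (Suc t) p) ==> c t (p - 1) ~= In"
 unfolding step by (cases "c t p") (auto simp: support_def split: if_splits cell.splits option.splits)

text \<open>An occupied cell leans on an occupied left neighbour one step before, so the diagonal
  back from p stays occupied until it meets a wall. On its way it passes the site of a good wall,
  unless there is none.\<close>

lemma occupied_rare:
 assumes "c t p ~= In" "~ isW (c t p)" "S <= t"
 shows "(\<exists>s\<le>S. isW (c (t - s) (p - int s))) \<or> (\<exists>s\<le>S. \<exists>n\<ge>S. clear_of (\<gamma> n) n (p - int s))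
   \<or> clear_of (\<gamma> S) S p"
proof (rule ccontr)
 assume no: "~ ?thesis"
 have occ: "c (t - s) (p - int s) ~= In" if "s <= S" for s
  using that
 proof (induction s)
  case (Suc s)
  have "t - s = Suc (t - Suc s)" using Suc.prems assms(3) by simp
  moreover have "~ isW (c (t - s) (p - int s))" using no Suc.prems by auto
  ultimately show ?case
   using occupied_left[of "t - Suc s" "p - int s"] Suc by (simp add: algebra_simps)
 qed (use assms in simp)
 obtain j where j: "p - int S < j" "j <= p" "good (\<gamma> S) j" using no by (auto simp: clear_of_def)
 define s where "s = nat (p - j)"
 have s: "s <= S" "p - int s = j" using j by (auto simp: s_def)
 then have "(\<exists>n\<ge>S. clear_of (\<gamma> n) n j) \<or> ~ good (\<gamma> S) j"
  using occupied_cases[of "t - s" j S] occ[OF s(1)] no by metis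
 then show False using j(3) no s by metis
qed

end

end

lemma start_wall_wsts: "fst d \<in> B ==> fst (snd d) \<in> B ==> start_wall C d \<in> wsts C B"
 by (simp add: start_wall_def wsts_def stacks_def conts_self waves_def)

lemma fresh_bsts: "d \<in> T ==> fresh d f \<in> bsts C T"
 by (simp add: fresh_def bsts_def regs_def waves_def)

definition cells :: "cmd => nat set => trip set => cell set" where
 "cells C B T = {In, Ww, Fr, Rs} \<union> range Sg \<union> Wr ` wsts C B \<union> Tp ` bsts C T"

lemma finite_cells: "finite B ==> finite T ==> finite (cells C B T)"
 by (simp add: cells_def finite_wsts finite_bsts)

lemma cstep_cells:
 assumes c: "l \<in> cells C B T" "c \<in> cells C B T" "r \<in> cells C B T"
  and T: "d \<in> T" "put_trips C \<subseteq> T" "\<And>t. t \<in> T ==> fst t \<in> B & fst (snd t) \<in> B"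
 shows "cstep C d le l c r \<in> cells C B T"
proof (cases c)
 case (Wr w)
 have w: "w \<in> wsts C B" using c(2) Wr by (auto simp: cells_def)
 show ?thesis
 proof (cases "tape r")
  case (Some b)
  then have b: "b \<in> bsts C T" using c(3) by (auto simp: tape_def cells_def split: cell.splits)
  show ?thesis
   using wstep_wsts[OF w b T(3)] Wr Some by (auto simp: cells_def split: option.split)
 qed (simp add: Wr cells_def)
next
 case (Tp b)
 have b: "b \<in> bsts C T" using c(2) Tp by (auto simp: cells_def)
 have rb: "b' \<in> bsts C T" if "tape r = Some b'" for b'
  using that c(3) by (auto simp: tape_def cells_def split: cell.splits)
 have 1: "bstep (Inl w) b (tape r) \<in> bsts C T" if "l = Wr w" for w
  by (rule bstep_bsts[OF b T(2), where B = B]) (use that c(1) rb in \<open>auto simp: cells_def\<close>)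
 have 2: "bstep (Inr b') b (tape r) \<in> bsts C T" if "l = Tp b'" for b'
  by (rule bstep_bsts[OF b T(2), where B = B]) (use that c(1) rb in \<open>auto simp: cells_def\<close>)
 show ?thesis using 1 2 Tp b by (cases l) (auto simp: cells_def)
qed (use T start_wall_wsts[of d B C] fresh_bsts[OF T(1), of _ C] in \<open>auto simp: cells_def split: cell.splits\<close>)

section \<open>Stationary and mixing measures\<close>

definition translate :: "int => config => config" where
 "translate m x = (\<lambda>i. x (i + m))"

lemma translate_apply: "translate m x i = x (i + m)"
 by (simp add: translate_def)

lemma translate_translate [simp]: "translate m (translate n x) = translate (m + n) x"
 by (simp add: translate_def algebra_simps)

lemma translate_0 [simp]: "translate 0 = id"
 by (rule ext) (simp add: translate_def)

lemma shift_pow: "(shift ^^ n) = translate (int n)"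
 by (induction n) (auto simp: translate_def shift_def algebra_simps)

lemma measurable_coordinate: "(\<lambda>x :: config. x i) \<in> borel \<rightarrow>\<^sub>M borel"
 by (rule measurable_product_coordinates)

lemma measurable_translate: "translate m \<in> borel \<rightarrow>\<^sub>M borel"
 by (rule measurable_coordinatewise_then_product) (simp add: translate_apply measurable_coordinate)

lemma site_borel: "{x :: config. x i \<in> S} \<in> sets borel"
 using measurable_sets[OF measurable_coordinate, of S i] by (simp add: vimage_def sets_borel_eq_count_space)

lemma sigma_on_borel: "X \<in> sigma_on U ==> X \<in> sets borel"
 unfolding sigma_on_def
proof (induction rule: sigma_sets.induct)
 case (Basic a)
 then obtain S w where a: "a = {x. \<forall>i\<in>S. x i = w i}" "finite S" by blast
 have "{x :: config. \<forall>i\<in>S. x i = w i} = (\<Inter>i\<in>S. {x. x i \<in> {w i}})" by auto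
 moreover have "\<dots> \<in> sets borel"
 proof (cases "S = {}")
  case False
  then show ?thesis using a(2) by (intro sets.finite_INT site_borel) auto
 qed simp
 ultimately show ?case using a by simp
next
 case (Compl a)
 then show ?case using sets.compl_sets[of a borel] by (simp add: Compl_eq_Diff_UNIV)
qed auto

lemma sigma_on_mono: "X \<in> sigma_on U ==> U \<subseteq> V ==> X \<in> sigma_on V"
 unfolding sigma_on_def by (erule sigma_sets_mono'[THEN subsetD, rotated]) blast

lemma sigma_on_site: "i \<in> U ==> {x. x i \<in> S} \<in> sigma_on U"
proof -
 assume i: "i \<in> U"
 have "{x. x i = a} \<in> sigma_on U" for a
  unfolding sigma_on_def
  by (rule sigma_sets.Basic) (use i in \<open>auto intro!: exI[of _ "{i}"] exI[of _ "\<lambda>_. a"]\<close>)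
 moreover have "{x :: config. x i \<in> S} = (\<Union>a. if a \<in> S then {x. x i = a} else {})" by (auto split: if_splits)
 moreover have "{} \<in> sigma_on U" unfolding sigma_on_def by (rule sigma_sets.Empty)
 ultimately show ?thesis
  unfolding sigma_on_def by (simp only:) (rule sigma_sets.Union, simp)
qed

lemma sigma_algebra_on: "sigma_algebra UNIV (sigma_on U)"
 unfolding sigma_on_def by (rule sigma_algebra_sigma_sets) simp

lemma sigma_on_not: "{x. P x} \<in> sigma_on U ==> {x. ~ P x} \<in> sigma_on U"
proof -
 interpret sigma_algebra UNIV "sigma_on U" by (rule sigma_algebra_on)
 show "{x. P x} \<in> sigma_on U ==> ?thesis" using sets_Collect_neg[of P] by simp
qed

lemma sigma_on_all: "finite I ==> (\<And>i. i \<in> I ==> {x. P i x} \<in> sigma_on U) ==> {x. \<forall>i\<in>I. P i x} \<in> sigma_on U"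
proof -
 interpret sigma_algebra UNIV "sigma_on U" by (rule sigma_algebra_on)
 show "finite I ==> (\<And>i. i \<in> I ==> {x. P i x} \<in> sigma_on U) ==> ?thesis"
  using sets_Collect_finite_All[of I P] by simp
qed

lemma sigma_on_translate: "{x. P x} \<in> sigma_on U ==> (\<And>i. i \<in> U ==> i + k \<in> V) ==> {x. P (translate k x)} \<in> sigma_on V"
proof -
 have "X \<in> sigma_on U ==> (\<And>i. i \<in> U ==> i + k \<in> V) ==> {x. translate k x \<in> X} \<in> sigma_on V" for X
  unfolding sigma_on_def
 proof (induction rule: sigma_sets.induct)
  case (Basic a)
  then obtain S w where a: "a = {x. \<forall>i\<in>S. x i = w i}" "finite S" "S \<subseteq> U" by blast
  have "{x. translate k x \<in> a} = {x. \<forall>i\<in>(\<lambda>i. i + k) ` S. x i = (\<lambda>i. w (i - k)) i}"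
   using a by (auto simp: translate_apply)
  moreover have "finite ((\<lambda>i. i + k) ` S)" "(\<lambda>i. i + k) ` S \<subseteq> V" using a Basic.prems by auto
  ultimately show ?case by (intro sigma_sets.Basic CollectI exI conjI)
 next
  case (Compl a)
  then have "UNIV - {x. translate k x \<in> a} \<in> sigma_sets UNIV {{x. \<forall>i\<in>S. x i = w i} |S w. finite S & S \<subseteq> V}"
   by (intro sigma_sets.Compl) blast
  moreover have "UNIV - {x. translate k x \<in> a} = {x. translate k x \<in> UNIV - a}" by blast
  ultimately show ?case by (simp only:)
 next
  case (Union a)
  then have "(\<Union>i. {x. translate k x \<in> a i}) \<in> sigma_sets UNIV {{x. \<forall>i\<in>S. x i = w i} |S w. finite S & S \<subseteq> V}"
   by (intro sigma_sets.Union) blast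
  moreover have "(\<Union>i. {x. translate k x \<in> a i}) = {x. translate k x \<in> (\<Union>i. a i)}" by blast
  ultimately show ?case by (simp only:)
 qed (auto intro: sigma_sets.Empty)
 from this[of "{x. P x}"] show "{x. P x} \<in> sigma_on U ==> (\<And>i. i \<in> U ==> i + k \<in> V) ==> ?thesis" by simp
qed

section \<open>Invariance under all translations\<close>

locale stationary = prob_space M for M :: "config measure" +
 assumes sets_M: "sets M = sets borel" and shift_invariant: "distr M borel shift = M"
begin

lemma space_M: "space M = UNIV"
 using sets_eq_imp_space_eq[OF sets_M] by simp

lemma measurable_M: "f \<in> M \<rightarrow>\<^sub>M N \<longleftrightarrow> f \<in> borel \<rightarrow>\<^sub>M N"
 using measurable_cong_sets[OF sets_M refl, of N] by simp

lemma distr_translate: "distr M borel (translate m) = M"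
proof -
 have nat: "distr M borel (translate (int n)) = M" for n
 proof (induction n)
  case 0
  have "distr M borel id = distr M M id" by (rule distr_cong) (simp_all add: sets_M)
  then show ?case by (simp add: distr_id id_def)
 next
  case (Suc n)
  have sh: "shift = translate 1" using shift_pow[of 1] by simp
  have "distr (distr M borel shift) borel (translate (int n)) = M" using Suc shift_invariant by simp
  moreover have "distr (distr M borel shift) borel (translate (int n)) = distr M borel (translate (int n) \<circ> shift)"
   by (rule distr_distr) (simp_all add: measurable_M measurable_translate sh)
  moreover have "translate (int n) \<circ> shift = translate (int (Suc n))" by (simp add: sh fun_eq_iff add.commute)
  ultimately show ?case by simp
 qed
 show ?thesis
 proof (cases "0 <= m")
  case True
  then show ?thesis using nat[of "nat m"] by simp
 next
  case False
  have "distr M borel (translate m) = distr (distr M borel (translate (- m))) borel (translate m)"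
   using nat[of "nat (- m)"] False by simp
  also have "\<dots> = distr M borel (translate m \<circ> translate (- m))"
   by (rule distr_distr) (simp_all add: measurable_M measurable_translate)
  also have "translate m \<circ> translate (- m) = translate (int 0)" by (auto simp: fun_eq_iff)
  finally show ?thesis using nat[of 0] by (simp add: id_def)
 qed
qed

lemma prob_translate:
 assumes "{x. P x} \<in> sets borel"
 shows "prob {x. P (translate m x)} = prob {x. P x}"
proof -
 have "prob {x. P x} = measure (distr M borel (translate m)) {x. P x}" by (simp add: distr_translate)
 also have "\<dots> = prob (translate m -` {x. P x} \<inter> space M)"
  by (rule measure_distr) (use assms in \<open>simp_all add: measurable_M measurable_translate\<close>)
 finally show ?thesis by (simp add: space_M vimage_def)
qed

lemma translate_borel: "{x. P x} \<in> sets borel ==> {x. P (translate m x)} \<in> sets borel"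
 using measurable_sets[OF measurable_translate, of "{x. P x}" m] by (simp add: vimage_def)

end

section \<open>Consequences of psi-mixing at a single distance\<close>

locale mixing = stationary +
 fixes n0 :: nat
 assumes psi_half: "psi M n0 <= 1 / 2"
begin

text \<open>Up to the factors 1/2 and 3/2, past and distant future are independent, uniformly in how
  small the events are. This is the only form in which psi-mixing enters.\<close>

lemma mix:
 assumes X: "X \<in> sigma_on {..0}" and Y: "Y \<in> sigma_on {int n0..}"
 shows "prob X * prob Y / 2 <= prob (X \<inter> Y)" "prob (X \<inter> Y) <= 3 / 2 * prob X * prob Y"
proof -
 have "prob X * prob Y / 2 <= prob (X \<inter> Y) & prob (X \<inter> Y) <= 3 / 2 * prob X * prob Y"
 proof (cases "prob X > 0 & prob Y > 0")
  case True
  have "ereal \<bar>prob (X \<inter> Y) / (prob X * prob Y) - 1\<bar> <= psi M n0"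
   unfolding psi_def using True X Y by (intro Sup_upper) blast
  also have "\<dots> <= ereal (1 / 2)" using psi_half by (simp add: one_ereal_def divide_ereal_def)
  finally have *: "\<bar>prob (X \<inter> Y) / (prob X * prob Y) - 1\<bar> <= 1 / 2" by simp
  define p where "p = prob X * prob Y"
  have p: "p > 0" using True by (simp add: p_def)
  have "prob (X \<inter> Y) / p >= 1 / 2" "prob (X \<inter> Y) / p <= 3 / 2"
   using * unfolding p_def[symmetric] by linarith+
  then have "p / 2 <= prob (X \<inter> Y)" "prob (X \<inter> Y) <= 3 / 2 * p"
   using p by (simp_all add: field_simps)
  then show ?thesis by (simp add: p_def)
 next
  case False
  have XY: "X \<in> events" "Y \<in> events" using X Y sigma_on_borel by (auto simp: sets_M)
  have "prob (X \<inter> Y) <= prob X" "prob (X \<inter> Y) <= prob Y" using XY by (auto intro!: finite_measure_mono)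
  moreover have "prob X = 0 \<or> prob Y = 0" using False measure_nonneg[of M X] measure_nonneg[of M Y] by linarith
  ultimately have "prob (X \<inter> Y) = 0" using measure_nonneg[of M "X \<inter> Y"] by linarith
  moreover have "prob X * prob Y = 0" using \<open>prob X = 0 \<or> prob Y = 0\<close> by auto
  ultimately show ?thesis by auto
 qed
 then show "prob X * prob Y / 2 <= prob (X \<inter> Y)" "prob (X \<inter> Y) <= 3 / 2 * prob X * prob Y" by blast+
qed

text \<open>The sites have mutual distance n0, so that each further site costs exactly one mixing
  factor.\<close>

definition chain :: "nat => (nat => nat set) => config set" where
 "chain m S = {x. \<forall>j\<in>{..m}. x (int n0 * int j) \<in> S j}"

lemma chain_sigma: "chain m S \<in> sigma_on {0..int n0 * int m}"
 unfolding chain_def by (intro sigma_on_all sigma_on_site) (auto intro!: mult_left_mono)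

lemma chain_borel: "chain m S \<in> sets borel"
 by (rule sigma_on_borel[OF chain_sigma])

lemma chain_Suc: "chain (Suc m) S = {x. x 0 \<in> S 0} \<inter> {x. translate (int n0) x \<in> chain m (\<lambda>j. S (Suc j))}"
 unfolding chain_def atMost_Suc_eq_insert_0 by (auto simp: translate_apply algebra_simps)

lemma chain_Suc_bounds:
 fixes m :: nat and S :: "nat => nat set"
 defines "p \<equiv> prob {x. x 0 \<in> S 0} * prob (chain m (\<lambda>j. S (Suc j)))"
 shows "p / 2 <= prob (chain (Suc m) S)" "prob (chain (Suc m) S) <= 3 / 2 * p"
proof -
 let ?Y = "{x. translate (int n0) x \<in> chain m (\<lambda>j. S (Suc j))}"
 have Y: "?Y \<in> sigma_on {int n0..}"
  by (rule sigma_on_translate[where P = "\<lambda>x. x \<in> chain m (\<lambda>j. S (Suc j))" and U = "{0..int n0 * int m}"])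
   (use chain_sigma in auto)
 have X: "{x. x 0 \<in> S 0} \<in> sigma_on {..0}" by (rule sigma_on_site) simp
 have "prob ?Y = prob (chain m (\<lambda>j. S (Suc j)))"
  using prob_translate[of "\<lambda>x. x \<in> chain m (\<lambda>j. S (Suc j))" "int n0"] chain_borel by simp
 then show "p / 2 <= prob (chain (Suc m) S)" "prob (chain (Suc m) S) <= 3 / 2 * p"
  unfolding chain_Suc p_def using mix[OF X Y] by simp_all
qed

lemma chain_0: "chain 0 S = {x. x 0 \<in> S 0}"
 by (simp add: chain_def)

lemma chain_lower:
 assumes "p <= prob {x. x 0 \<in> S 0}" "\<And>j. 0 < j ==> q <= prob {x. x 0 \<in> S j}" "0 <= p" "0 <= q"
 shows "p * (q / 2) ^ m <= prob (chain m S)"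
 using assms
proof (induction m arbitrary: S p)
 case (Suc m)
 have IH: "q * (q / 2) ^ m <= prob (chain m (\<lambda>j. S (Suc j)))"
  by (rule Suc.IH) (use Suc.prems in auto)
 have "p * (q / 2) ^ Suc m = p * (q * (q / 2) ^ m) / 2" by simp
 also have "\<dots> <= prob {x. x 0 \<in> S 0} * prob (chain m (\<lambda>j. S (Suc j))) / 2"
  using IH Suc.prems by (intro divide_right_mono mult_mono) auto
 also have "\<dots> <= prob (chain (Suc m) S)" by (rule chain_Suc_bounds)
 finally show ?case .
qed (simp add: chain_0)

lemma chain_upper:
 assumes "prob {x. x 0 \<in> S 0} <= p" "\<And>j. 0 < j ==> prob {x. x 0 \<in> S j} <= q"
 shows "prob (chain m S) <= p * (3 / 2 * q) ^ m"
 using assms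
proof (induction m arbitrary: S p)
 case (Suc m)
 have IH: "prob (chain m (\<lambda>j. S (Suc j))) <= q * (3 / 2 * q) ^ m"
  by (rule Suc.IH) (use Suc.prems in auto)
 have q: "0 <= q" using Suc.prems(2)[of 1] measure_nonneg[of M "{x. x 0 \<in> S 1}"] by linarith
 have p: "0 <= p" using Suc.prems(1) measure_nonneg[of M "{x. x 0 \<in> S 0}"] by linarith
 have "prob (chain (Suc m) S) <= 3 / 2 * (prob {x. x 0 \<in> S 0} * prob (chain m (\<lambda>j. S (Suc j))))"
  by (rule chain_Suc_bounds)
 also have "\<dots> <= 3 / 2 * (p * (q * (3 / 2 * q) ^ m))"
  using IH Suc.prems p q by (intro mult_left_mono mult_mono) auto
 finally show ?case by (simp add: mult_ac)
qed (simp add: chain_0)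

text \<open>Mixing is used in the form \<open>\<mu>(Y - X) \<le> \<mu>(Y) (1 - \<mu>(X) / 2)\<close>, which stays useful when the
  complement of \<open>X\<close> has measure close to 1.\<close>

lemma none_of_blocks:
 assumes G: "{x. G x} \<in> sigma_on {- int w..0}" and p: "p <= prob {x. G x}" "0 <= p" "p <= 1"
  and b: "w + n0 <= b"
 shows "prob {x. \<forall>i\<in>{..<r}. ~ G (translate (int (b * i)) x)} <= (1 - p / 2) ^ r"
proof (induction r)
 case 0
 show ?case by simp
next
 case (Suc r)
 let ?N = "\<lambda>r. {x. \<forall>i\<in>{..<r}. ~ G (translate (int (b * i)) x)}"
 let ?Y = "{x. \<forall>i\<in>{..<r}. ~ G (translate (int (b * i)) (translate (int b) x))}"
 have Gb: "{x. G (translate m x)} \<in> sigma_on {m - int w..}" for m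
  by (rule sigma_on_translate[OF G]) auto
 have N: "?N r \<in> sets borel"
  by (rule sigma_on_borel[where U = UNIV], intro sigma_on_all sigma_on_not sigma_on_mono[OF Gb]) auto
 have "int n0 <= int b * int i + int b - int w" for i
  using b mult_nonneg_nonneg[of "int b" "int i"] by linarith
 then have *: "{int (b * i) + int b - int w..} \<subseteq> {int n0..}" for i by auto
 have "{x. G (translate (int (b * i)) (translate (int b) x))} \<in> sigma_on {int n0..}" for i
  using sigma_on_mono[OF Gb *] by simp
 then have Y: "?Y \<in> sigma_on {int n0..}"
  by (intro sigma_on_all sigma_on_not) auto
 have X: "{x. G x} \<in> sigma_on {..0}" by (rule sigma_on_mono[OF G]) auto
 have ev: "{x. G x} \<in> events" "?Y \<in> events" using sigma_on_borel X Y by (auto simp: sets_M)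
 have "?N (Suc r) = ?Y - {x. G x}"
 by (auto simp: lessThan_Suc_eq_insert_0 algebra_simps)
 then have "prob (?N (Suc r)) = prob ?Y - prob ({x. G x} \<inter> ?Y)"
  using finite_measure_Diff'[of ?Y "{x. G x}"] ev by (simp add: Int_commute)
 also have "\<dots> <= prob ?Y - prob {x. G x} * prob ?Y / 2" using mix(1)[OF X Y] by linarith
 also have "\<dots> <= prob ?Y * (1 - p / 2)"
  using mult_right_mono[OF p(1), of "prob ?Y"] by (simp add: algebra_simps)
 also have "prob ?Y = prob (?N r)" using prob_translate[OF N, of "int b"] by simp
 also have "\<dots> * (1 - p / 2) <= (1 - p / 2) ^ r * (1 - p / 2)"
  using Suc.IH p by (intro mult_right_mono) auto
 finally show ?case by (simp add: mult.commute)
qed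

definition newborn :: "nat set => nat set => nat => config => bool" where
 "newborn W I g x \<longleftrightarrow> x 0 \<in> W & (\<forall>i. 0 < i --> i <= g --> x (int n0 * int i) \<in> I)"

lemma newborn_chain: "{x. newborn W I g x} = chain g (\<lambda>j. if j = 0 then W else I)"
 by (auto simp: chain_def newborn_def)

definition barren :: "nat set => nat set => nat => nat => config => bool" where
 "barren W I g K x \<longleftrightarrow> (\<forall>j\<in>{..<K}. ~ newborn W I g (translate (int n0 * int j) x))"

lemma newborn_sigma: "{x. newborn W I g x} \<in> sigma_on {0..int n0 * int g}"
 unfolding newborn_chain by (rule chain_sigma)

lemma barren_borel: "{x. barren W I g K x} \<in> sets borel"
 unfolding barren_def
 by (rule sigma_on_borel[where U = UNIV], intro sigma_on_all sigma_on_not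
   sigma_on_translate[where P = "newborn W I g", OF newborn_sigma]) auto

lemma prob_barren:
 assumes "p <= prob {x. x 0 \<in> W}" "0 <= p" "1 / 2 <= prob {x. x 0 \<in> I}"
 shows "prob {x. barren W I g K x} <= (1 - p / 4 ^ g / 2) ^ (K div (g + 1))"
proof -
 \<comment> \<open>Each of the g inert cells contributes its mass, at least 1/2, and a mixing factor
   1/2: this is the origin of the powers of 4.\<close>
 have "p * (1 / 2 / 2) ^ g <= prob {x. newborn W I g x}"
  unfolding newborn_chain using assms by (intro chain_lower) auto
 then have G: "p / 4 ^ g <= prob {x. newborn W I g x}"
  by (simp add: power_one_over)
 have b: "{x. newborn W I g x} \<in> sets borel" using newborn_sigma by (rule sigma_on_borel)
 \<comment> \<open>The pattern is moved to the left of the origin, where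
   \<open>none_of_blocks\<close> wants it; blocks of g + 1 lattice sites leave a gap of n0 between
   successive patterns.\<close>
 let ?t = "- (int n0 * int g)" and ?r = "K div (g + 1)" and ?b = "n0 * (g + 1)"
 let ?G = "\<lambda>x. newborn W I g (translate ?t x)"
 have "prob {x. \<forall>i\<in>{..<?r}. ~ ?G (translate (int (?b * i)) x)} <= (1 - p / 4 ^ g / 2) ^ ?r"
 proof (rule none_of_blocks)
  show "{x. ?G x} \<in> sigma_on {- int (n0 * g)..0}"
   by (rule sigma_on_translate[OF newborn_sigma]) auto
  show "p / 4 ^ g <= prob {x. ?G x}" using G prob_translate[OF b, of ?t] by simp
  have "p <= 1" using assms(1) prob_le_1 order_trans by blast
  then show "p / 4 ^ g <= 1"
   using order_trans[OF _ one_le_power[of "4::real" g]] by (simp add: divide_le_eq)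
  show "0 <= p / 4 ^ g" using assms(2) by simp
  show "n0 * g + n0 <= ?b" by simp
 qed
 moreover have "{x. \<forall>i\<in>{..<?r}. ~ ?G (translate (int (?b * i)) x)} \<in> sets borel"
  by (rule sigma_on_borel[where U = UNIV], intro sigma_on_all sigma_on_not, simp, simp only: translate_translate,
    rule sigma_on_translate[where P = "newborn W I g", OF newborn_sigma]) auto
 then have "prob {x. \<forall>i\<in>{..<?r}. ~ ?G (translate (int (?b * i)) (translate (- ?t) x))} =
   prob {x. \<forall>i\<in>{..<?r}. ~ ?G (translate (int (?b * i)) x)}" (is "prob ?A = _")
  by (rule prob_translate)
 moreover have "prob {x. barren W I g K x} <= prob ?A"
 proof (rule finite_measure_mono)
  show "?A \<in> events"
   unfolding sets_M
   by (rule translate_borel[OF \<open>{x. \<forall>i\<in>{..<?r}. ~ ?G (translate (int (?b * i)) x)} \<in> sets borel\<close>])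
  show "{x. barren W I g K x} \<subseteq> ?A"
  proof clarify
   fix x i assume x: "barren W I g K x" and i: "i < ?r"
    and G: "?G (translate (int (?b * i)) (translate (- ?t) x))"
   have "(g + 1) * i < K"
   proof -
    have "(g + 1) * (i + 1) <= (g + 1) * ?r" using i by (intro mult_left_mono) auto
    also have "\<dots> <= K" by (rule times_div_less_eq_dividend)
    finally show ?thesis by simp
   qed
   moreover have "?t + (int (?b * i) + - ?t) = int n0 * int ((g + 1) * i)" by (simp add: algebra_simps)
   moreover have "newborn W I g (translate (?t + (int (?b * i) + - ?t)) x)"
    using G by (simp only: translate_translate add.assoc)
   ultimately show False using x unfolding barren_def by (metis lessThan_iff)
  qed
 qed
 ultimately show ?thesis by simp
qed

end

section \<open>Decay of the probability that a long stretch contains no good wall\<close>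

lemma real_div_le: "real m / real n <= real (m div n) + 1"
proof (cases "n = 0")
 case False
 have "m <= n * (m div n) + n"
  using mod_less_divisor[of n m] mult_div_mod_eq[of n m] False by linarith
 then have "real m <= real n * (real (m div n) + 1)"
  by (simp add: algebra_simps flip: of_nat_mult of_nat_add)
 then show ?thesis using False by (simp add: divide_le_eq mult.commute)
qed simp

text \<open>Adding e to the rounded logarithm to base 64 meets both demands on the length at once
  and costs only the constant factor 4^e in the probability.\<close>

definition gap :: "nat => nat => nat" where
 "gap e K = e + (LEAST g. 4 * K + 8 <= 64 ^ g)"

lemma gap: "e <= gap e K" "4 * K + 8 <= 64 ^ gap e K"
proof -
 have "4 * K + 8 <= 64 ^ (4 * K + 8)"
  using less_exp[of "4 * K + 8"] power_mono[of 2 "64::nat" "4 * K + 8"] by linarith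
 then have "4 * K + 8 <= 64 ^ (LEAST g. 4 * K + 8 <= (64::nat) ^ g)" by (rule LeastI)
 also have "\<dots> <= 64 ^ gap e K" by (rule power_increasing) (auto simp: gap_def)
 finally show "4 * K + 8 <= 64 ^ gap e K" .
qed (simp add: gap_def)

lemma gap_upper:
 obtains l where "gap e K = e + l" "64 ^ l <= 256 * real K + 512"
proof -
 define l where "l = (LEAST g. 4 * K + 8 <= (64::nat) ^ g)"
 have "real (64 ^ l) <= 256 * real K + 512"
 proof (cases l)
  case (Suc m)
  then have "~ 4 * K + 8 <= (64::nat) ^ m" using not_less_Least[of m "\<lambda>g. 4 * K + 8 <= (64::nat) ^ g"] by (simp add: l_def)
  then have "real (64 ^ m) <= real (4 * K + 8)" by linarith
  then show ?thesis using Suc by simp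
 qed simp
 then show ?thesis using that[of l] by (simp add: gap_def l_def)
qed

text \<open>The power of 4 is of order K^(1/3), as 4 is the cube root of 64, while there are about K
  / log K disjoint blocks. So the exponent is of order K^(2/3) / log K, which beats every power of
  K.\<close>

lemma gap_rate:
 fixes a :: real
 assumes a: "0 < a" "a <= 1"
 shows "eventually (\<lambda>K. (1 - a / 4 ^ gap e K) ^ (K div (gap e K + 1)) <= 1 / real K ^ 8) sequentially"
proof -
 define H where "H K = 4 ^ e * (256 * real K + 512) powr (1 / 3)" for K
 define \<Gamma> where "\<Gamma> K = real e + 1 + ln (256 * real K + 512) / ln 64" for K
 have bound: "(1 - a / 4 ^ gap e K) ^ (K div (gap e K + 1)) <= exp (- (a / H K * (real K / \<Gamma> K - 1)))" for K
 proof -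
  obtain l where l: "gap e K = e + l" "64 ^ l <= 256 * real K + 512" by (rule gap_upper)
  define n where "n = K div (gap e K + 1)"
  have H0: "0 < H K" by (simp add: H_def)
  have "(4::real) ^ l = (64 ^ l) powr (1 / 3)"
  proof -
   have "(64::real) ^ l = (4 ^ l) ^ 3" by (simp flip: power_mult) (simp add: mult.commute[of l] power_mult)
   also have "\<dots> = (4 ^ l) powr 3" by simp
   finally show ?thesis by (simp only: powr_powr) simp
  qed
  also have "\<dots> <= (256 * real K + 512) powr (1 / 3)" using l(2) by (intro powr_mono2) auto
  finally have H: "4 ^ gap e K <= H K" by (simp add: l(1) H_def power_add)
  have "real l * ln 64 = ln (64 ^ l)" by (simp add: ln_realpow)
  also have "\<dots> <= ln (256 * real K + 512)" using l(2) by (subst ln_le_cancel_iff) auto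
  finally have "real l <= ln (256 * real K + 512) / ln 64" by (simp add: field_simps)
  then have \<Gamma>: "real (gap e K + 1) <= \<Gamma> K" by (simp add: l(1) \<Gamma>_def)
  have "real K / \<Gamma> K <= real K / real (gap e K + 1)" using \<Gamma> by (intro divide_left_mono) auto
  also have "\<dots> <= real n + 1"
   unfolding n_def by (rule real_div_le)
  finally have n: "real K / \<Gamma> K - 1 <= real n" by simp
  have "a / H K * (real K / \<Gamma> K - 1) <= a / H K * real n"
   using n a H0 by (intro mult_left_mono) auto
  also have "\<dots> <= a / 4 ^ gap e K * real n"
   using H a by (intro mult_right_mono divide_left_mono) (auto simp: H0)
  finally have *: "a / H K * (real K / \<Gamma> K - 1) <= a / 4 ^ gap e K * real n" .
  have "0 <= 1 - a / 4 ^ gap e K"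
   using order_trans[OF a(2) one_le_power[of "4::real" "gap e K"]] by (simp add: divide_le_eq)
  moreover have "1 - a / 4 ^ gap e K <= exp (- (a / 4 ^ gap e K))"
   using exp_ge_add_one_self[of "- (a / 4 ^ gap e K)"] by simp
  ultimately have "(1 - a / 4 ^ gap e K) ^ n <= exp (- (a / 4 ^ gap e K)) ^ n" by (intro power_mono)
  also have "\<dots> = exp (- (a / 4 ^ gap e K * real n))" by (simp add: mult.commute flip: exp_of_nat_mult)
  also have "\<dots> <= exp (- (a / H K * (real K / \<Gamma> K - 1)))" using * by simp
  finally show ?thesis by (simp add: n_def)
 qed
 have "eventually (\<lambda>K. exp (- (a / H K * (real K / \<Gamma> K - 1))) <= 1 / real K ^ 8) sequentially"
  unfolding H_def \<Gamma>_def using a(1) by real_asymp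
 then show ?thesis by eventually_elim (use bound order_trans in blast)
qed

text \<open>About 16^k / k blocks, each successful with probability of order 4^-k.\<close>

lemma barren_rate:
 fixes a :: real
 assumes "0 < a" "a <= 1" "0 < n0"
 shows "(\<lambda>k. (1 - a / 4 ^ (k + 2)) ^ ((16 ^ k div n0) div (k + 3))) \<longlonglongrightarrow> 0"
proof (rule tendsto_sandwich)
 have nn: "0 <= 1 - a / 4 ^ (k + 2)" for k
  using order_trans[OF assms(2) one_le_power[of "4::real" "k + 2"]] by (simp add: divide_le_eq)
 show "\<forall>\<^sub>F k in sequentially. 0 <= (1 - a / 4 ^ (k + 2)) ^ ((16 ^ k div n0) div (k + 3))"
  using nn by (intro always_eventually allI zero_le_power)
 show "\<forall>\<^sub>F k in sequentially. (1 - a / 4 ^ (k + 2)) ^ ((16 ^ k div n0) div (k + 3)) <=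
   exp (- (a / 4 ^ (k + 2) * ((16 ^ k / real n0) / (real k + 3) - 1)))"
 proof (intro always_eventually allI)
  fix k
  define n where "n = (16 ^ k div n0) div (k + 3)"
  have "real (16 ^ k) / real (n0 * (k + 3)) <= real n + 1"
   unfolding n_def div_mult2_eq[symmetric] by (rule real_div_le)
  then have n: "(16 ^ k / real n0) / (real k + 3) - 1 <= real n" by (simp add: algebra_simps)
  have "1 - a / 4 ^ (k + 2) <= exp (- (a / 4 ^ (k + 2)))"
   using exp_ge_add_one_self[of "- (a / 4 ^ (k + 2))"] by simp
  then have "(1 - a / 4 ^ (k + 2)) ^ n <= exp (- (a / 4 ^ (k + 2))) ^ n" using nn by (intro power_mono)
  also have "\<dots> = exp (- (a / 4 ^ (k + 2) * real n))" by (simp add: mult.commute flip: exp_of_nat_mult)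
  also have "\<dots> <= exp (- (a / 4 ^ (k + 2) * ((16 ^ k / real n0) / (real k + 3) - 1)))"
   using mult_left_mono[OF n, of "a / 4 ^ (k + 2)"] assms by simp
  finally show "(1 - a / 4 ^ (k + 2)) ^ ((16 ^ k div n0) div (k + 3)) <=
   exp (- (a / 4 ^ (k + 2) * ((16 ^ k / real n0) / (real k + 3) - 1)))" by (simp add: n_def)
 qed
 show "(\<lambda>k. exp (- (a / 4 ^ (k + 2) * ((16 ^ k / real n0) / (real k + 3) - 1)))) \<longlonglongrightarrow> 0"
  using assms(1,3) by real_asymp
qed simp

section \<open>The cellular automaton\<close>

lemma local_open:
 fixes P :: "config => bool"
 assumes I: "finite I" and P: "\<And>x y. (\<And>i. i \<in> I ==> x i = y i) ==> P x ==> P y"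
 shows "open {x. P x}"
proof (subst open_subopen, rule ballI)
 fix x assume "x \<in> {x. P x}"
 then have x: "P x" by simp
 have "open {y :: config. y i = x i}" for i
  using open_vimage[OF Topological_Spaces.open_discrete continuous_on_product_coordinates[of i], of "{x i}"] by (simp add: vimage_def)
 then have "open (\<Inter>i\<in>I. {y :: config. y i = x i})"
  using I by (intro open_INT) auto
 moreover have "(\<Inter>i\<in>I. {y :: config. y i = x i}) = {y. \<forall>i\<in>I. y i = x i}" by blast
 ultimately have "open {y. \<forall>i\<in>I. y i = x i}" by simp
 then show "\<exists>T. open T & x \<in> T & T \<subseteq> {x. P x}"
  by (intro exI[of _ "{y. \<forall>i\<in>I. y i = x i}"] conjI) (simp_all, use P[OF _ x] in force)
qed

lemma local_continuous:
 fixes g :: "config => 'b :: topological_space"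
 assumes "finite I" "\<And>x y. (\<And>i. i \<in> I ==> x i = y i) ==> g x = g y"
 shows "continuous_on UNIV g"
 unfolding continuous_on_open_vimage[OF open_UNIV]
proof (intro allI impI)
 fix S :: "'b set"
 have "open {x. g x \<in> S}" by (rule local_open[OF assms(1)]) (metis assms(2))
 then show "open (g -` S \<inter> UNIV)" by (simp add: vimage_def)
qed

definition nbh :: "nat => nat => int set" where
 "nbh n0 e = {- int (e * n0), - int n0, - 1, 0, int n0}"

definition nbl :: "nat => nat => int list" where
 "nbl n0 e = [- int (e * n0), - int n0, - 1, 0, int n0]"

text \<open>n0 >= 2 separates - n0 from - 1, and e >= 2 separates - e n0 from - n0; so the table has
  five arguments, in this order.\<close>

lemma sorted_nbh:
 assumes "2 <= n0" "2 <= e"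
 shows "sorted_list_of_set (nbh n0 e) = nbl n0 e" "card (nbh n0 e) = 5"
proof -
 have "1 * n0 < e * n0" using assms by (intro mult_strict_right_mono) auto
 then have "int n0 < int (e * n0)" unfolding of_nat_less_iff by simp
 then have s: "sorted (nbl n0 e)" "distinct (nbl n0 e)" using assms by (simp_all add: nbl_def del: of_nat_mult)
 have n: "nbh n0 e = set (nbl n0 e)" by (simp add: nbh_def nbl_def)
 show "sorted_list_of_set (nbh n0 e) = nbl n0 e"
  unfolding n by (rule sorted_list_of_set.idem_if_sorted_distinct[OF s])
 show "card (nbh n0 e) = 5"
  unfolding n distinct_card[OF s(2)] by (simp add: nbl_def)
qed

section \<open>Letters, colours and the local rule\<close>

locale alphabet =
 fixes B :: "nat set" and C :: cmd and d :: trip and T :: "trip set"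
 assumes fin: "finite B" "finite T" and dT: "d \<in> T" and CT: "put_trips C \<subseteq> T"
  and TB: "\<And>t. t \<in> T ==> fst t \<in> B & fst (snd t) \<in> B"
  and C: "\<exists>c1 c2. C = Seq c1 c2" and d: "last_of d"
begin

text \<open>The second component is a colour. An automaton working with colour k reads the letters
  of all other colours as inert; as the colours are disjoint, one of them has small mass under any
  given measure.\<close>

definition codes :: "(nat \<times> nat \<times> cell) set" where
 "codes = B \<times> {..<64} \<times> (cells C B T - {In})"

definition enc :: "nat \<times> nat \<times> cell => nat" where
 "enc = (SOME f. inj_on f codes & f ` codes \<inter> B = {})"

lemma finite_codes: "finite codes"
 unfolding codes_def using fin finite_cells[of B T C] by (intro finite_cartesian_product) auto

lemma enc: "inj_on enc codes" "enc ` codes \<inter> B = {}"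
proof -
 obtain f :: "nat \<times> nat \<times> cell => nat" where f: "inj_on f codes"
  using finite_imp_inj_to_nat_seg[OF finite_codes] by blast
 obtain m where m: "\<And>b. b \<in> B ==> b < m" using fin(1) finite_nat_set_iff_bounded by auto
 have "inj_on (\<lambda>c. f c + m) codes & (\<lambda>c. f c + m) ` codes \<inter> B = {}"
  using f m by (fastforce simp: inj_on_def)
 then have "inj_on enc codes & enc ` codes \<inter> B = {}"
  unfolding enc_def by (rule someI[where P = "\<lambda>f. inj_on f codes & f ` codes \<inter> B = {}"])
 then show "inj_on enc codes" "enc ` codes \<inter> B = {}" by blast+
qed

definition A :: "nat set" where "A = B \<union> enc ` codes"

lemma finite_A: "finite A" and B_A: "B \<subseteq> A"
 by (auto simp: A_def fin finite_codes)

definition strm :: "nat => nat" where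
 "strm a = (if a \<in> enc ` codes then fst (inv_into codes enc a) else a)"

definition cel :: "nat => nat => cell" where
 "cel k a = (if a \<in> enc ` codes & fst (snd (inv_into codes enc a)) = k then snd (snd (inv_into codes enc a)) else In)"

text \<open>An inert cell is stored as the bare letter of B, so that wherever the automaton has
  become inert the configuration itself is the stream of emitted letters.\<close>

definition lett :: "nat => nat => cell => nat" where
 "lett k s c = (if c = In then s else enc (s, k, c))"

lemma lett:
 assumes "s \<in> B" "k < 64" "c \<in> cells C B T"
 shows "lett k s c \<in> A" "strm (lett k s c) = s" "cel k (lett k s c) = c"
proof -
 have "s \<notin> enc ` codes" using assms enc(2) by blast
 moreover have "(s, k, c) \<in> codes" if "c ~= In" using assms that by (simp add: codes_def)
 ultimately show "lett k s c \<in> A" "strm (lett k s c) = s" "cel k (lett k s c) = c"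
  using assms enc(1) by (auto simp: lett_def strm_def cel_def A_def)
qed

lemma strm_A:
 assumes "a \<in> A"
 shows "strm a \<in> B"
proof (cases "a \<in> enc ` codes")
 case True
 then have "inv_into codes enc a \<in> codes" by (rule inv_into_into)
 then have "fst (inv_into codes enc a) \<in> B" unfolding codes_def mem_Times_iff by blast
 then show ?thesis using True by (simp add: strm_def)
qed (use assms in \<open>simp add: strm_def A_def\<close>)

lemma cel_A: "cel k a \<in> cells C B T"
proof (cases "a \<in> enc ` codes")
 case True
 then have "inv_into codes enc a \<in> codes" by (rule inv_into_into)
 then have "snd (snd (inv_into codes enc a)) \<in> cells C B T" unfolding codes_def mem_Times_iff by blast
 then show ?thesis by (simp add: cel_def cells_def[of C B T])
qed (simp add: cel_def cells_def[of C B T])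

definition out :: "cell => nat" where
 "out c = (case c of Wr w => w_out w | _ => fst d)"

lemma out_B: "c \<in> cells C B T ==> out c \<in> B"
 using TB[OF dT] by (auto simp: out_def cells_def wsts_def)

text \<open>Cells interact along a lattice of step n0, but the stream moves by one site of the
  integers per step; the walls on all n0 sublattices thus feed one stream.\<close>

definition rule :: "nat => nat => nat => nat => nat => nat => nat" where
 "rule k p q l a r = (let c = cstep C d (cel k p) (cel k q) (cel k a) (cel k r)
   in lett k (if isW c then out c else strm l) c)"

definition local_rule :: "nat => nat list => nat" where
 "local_rule k xs = rule k (xs ! 0) (xs ! 1) (xs ! 2) (xs ! 3) (xs ! 4)"

lemma step_cells: "cstep C d (cel k p) (cel k q) (cel k a) (cel k r) \<in> cells C B T"
 by (intro cstep_cells cel_A dT CT TB)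

lemma rule_lett:
 fixes k p q l a r :: nat
 assumes "k < 64" "l \<in> A"
 defines "c \<equiv> cstep C d (cel k p) (cel k q) (cel k a) (cel k r)"
 shows "rule k p q l a r \<in> A" "strm (rule k p q l a r) = (if isW c then out c else strm l)"
  "cel k (rule k p q l a r) = c" "c = In ==> rule k p q l a r = strm (rule k p q l a r)"
proof -
 let ?s = "if isW c then out c else strm l"
 have c: "c \<in> cells C B T" unfolding c_def by (rule step_cells)
 have "?s \<in> B" using out_B[OF c] strm_A[OF assms(2)] by simp
 note l = lett[OF this assms(1) c]
 have r: "rule k p q l a r = lett k ?s c" by (simp add: rule_def c_def Let_def)
 show "rule k p q l a r \<in> A" "strm (rule k p q l a r) = ?s" "cel k (rule k p q l a r) = c"
  unfolding r by (rule l)+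
 show "rule k p q l a r = strm (rule k p q l a r)" if "c = In"
  using l(2) that unfolding r by (simp add: lett_def)
qed

end

locale automaton = alphabet +
 fixes k n0 e :: nat
 assumes k: "k < 64" and n0: "2 <= n0" and e: "2 <= e"
begin

definition F :: "config => config" where
 "F x = (\<lambda>i. rule k (x (i - int (e * n0))) (x (i - int n0)) (x (i - 1)) (x i) (x (i + int n0)))"

lemma F_configs: "x \<in> configs A ==> F x \<in> configs A"
 by (auto simp: configs_def F_def intro!: rule_lett(1) k)

lemma F_translate: "F (translate m x) = translate m (F x)"
 by (rule ext) (simp add: F_def translate_apply algebra_simps)

lemma continuous_F: "continuous_on UNIV F"
proof (rule continuous_on_coordinatewise_then_product)
 fix i
 show "continuous_on UNIV (\<lambda>x. F x i)"
  by (rule local_continuous[of "(\<lambda>j. i + j) ` nbh n0 e"]) (simp_all add: nbh_def F_def)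
qed

lemma cellular_automaton_F: "cellular_automaton A F"
proof -
 have "shift = translate 1" using shift_pow[of 1] by simp
 then show ?thesis
  using F_configs continuous_on_subset[OF continuous_F, of "configs A"] F_translate[of 1]
  by (auto simp: cellular_automaton_def)
qed

lemma local_rule_F: "given_by_local_rule A F (nbh n0 e) (local_rule k)"
 unfolding given_by_local_rule_def sorted_nbh(1)[OF n0 e]
 by (simp add: nbh_def nbl_def local_rule_def F_def)

lemma measurable_F: "F \<in> borel \<rightarrow>\<^sub>M borel"
 by (rule borel_measurable_continuous_onI[OF continuous_F])

lemma measurable_iterate: "F ^^ t \<in> borel \<rightarrow>\<^sub>M borel"
 by (rule measurable_compose_n[OF measurable_F])

lemma iterate_configs: "x \<in> configs A ==> (F ^^ t) x \<in> configs A"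
 by (induction t) (auto intro: F_configs)

lemma iterate_translate: "(F ^^ t) (translate m x) = translate m ((F ^^ t) x)"
 by (induction t) (simp_all add: F_translate)

definition mc :: "nat => config => int => cell" where "mc t x i = cel k ((F ^^ t) x i)"
definition st :: "nat => config => int => nat" where "st t x i = strm ((F ^^ t) x i)"

lemma mc_translate: "mc t (translate m x) i = mc t x (i + m)"
 by (simp add: mc_def iterate_translate translate_apply)

lemma mc_borel: "{x. P (mc t x i)} \<in> sets borel"
proof -
 have "(F ^^ t) -` {x. x i \<in> {a. P (cel k a)}} \<inter> space borel \<in> sets borel"
  by (rule measurable_sets[OF measurable_iterate site_borel])
 then show ?thesis by (simp add: vimage_def mc_def)
qed

context
 fixes x :: config
 assumes x: "x \<in> configs A"
begin

lemma mc_Suc: "mc (Suc t) x i = cstep C d (mc t x (i - int (e * n0))) (mc t x (i - int n0)) (mc t x i) (mc t x (i + int n0))"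
 and st_Suc: "st (Suc t) x i = (if isW (mc (Suc t) x i) then out (mc (Suc t) x i) else st t x (i - 1))"
 and letter_Suc: "mc (Suc t) x i = In ==> (F ^^ Suc t) x i = st (Suc t) x i"
proof -
 define y where "y = (F ^^ t) x"
 have l: "y (i - 1) \<in> A" using iterate_configs[OF x] by (simp add: y_def configs_def)
 note r = rule_lett[OF k l, of "y (i - int (e * n0))" "y (i - int n0)" "y i" "y (i + int n0)"]
 have y: "(F ^^ Suc t) x i = rule k (y (i - int (e * n0))) (y (i - int n0)) (y (i - 1)) (y i) (y (i + int n0))"
  by (simp add: y_def F_def)
 show 1: "mc (Suc t) x i = cstep C d (mc t x (i - int (e * n0))) (mc t x (i - int n0)) (mc t x i) (mc t x (i + int n0))"
  unfolding mc_def y y_def[symmetric] by (rule r(3))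
 then show "st (Suc t) x i = (if isW (mc (Suc t) x i) then out (mc (Suc t) x i) else st t x (i - 1))"
  unfolding st_def y y_def[symmetric] r(2) mc_def by simp
 show "mc (Suc t) x i = In ==> (F ^^ Suc t) x i = st (Suc t) x i"
  unfolding 1 st_def y unfolding mc_def y_def[symmetric] by (rule r(4))
qed

lemma evolution_mc: "evolution C d e (\<lambda>t j. mc t x (y + int n0 * j))"
proof
 show "\<exists>c1 c2. C = Seq c1 c2" "last_of d" "0 < e" using C d e by auto
 show "mc (Suc t) x (y + int n0 * j) = cstep C d (mc t x (y + int n0 * (j - int e)))
   (mc t x (y + int n0 * (j - 1))) (mc t x (y + int n0 * j)) (mc t x (y + int n0 * (j + 1)))" for t j
  by (subst mc_Suc) (simp add: algebra_simps)
 show "b_dg b < 64" if "mc 0 x (y + int n0 * j) = Tp b" for j b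
  using cel_A[of k "x (y + int n0 * j)"] that by (auto simp: mc_def cells_def bsts_def)
qed

text \<open>The stream letter is followed back along its diagonal to the first wall. The condition n
  < t places this wall at a positive time; at time 0 the stream is arbitrary, even on walls.\<close>

lemma st_source:
 assumes "isW (mc (t - n) x (i - int n))" "n < t" "\<And>m. m < n ==> ~ isW (mc (t - m) x (i - int m))"
 shows "st t x i = out (mc (t - n) x (i - int n))"
 using assms
proof (induction n arbitrary: t i)
 case 0
 then obtain s where "t = Suc s" by (cases t) auto
 then show ?case using 0 st_Suc[of s i] by simp
next
 case (Suc n)
 then obtain s where s: "t = Suc s" by (cases t) auto
 have "st t x i = st s x (i - 1)"
  using st_Suc[of s i] Suc.prems(3)[of 0] s by simp
 also have "\<dots> = out (mc (s - n) x (i - 1 - int n))"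
 proof (rule Suc.IH)
  show "isW (mc (s - n) x (i - 1 - int n))" using Suc.prems(1) s by (simp add: algebra_simps)
  show "n < s" using Suc.prems(2) s by simp
  show "~ isW (mc (s - m) x (i - 1 - int m))" if "m < n" for m
   using Suc.prems(3)[of "Suc m"] that s by (simp add: algebra_simps)
 qed
 finally show ?case using s by (simp add: algebra_simps)
qed

end

end

section \<open>The word written in a window\<close>

context machine
begin

text \<open>The word is stored backwards since the stream is read against the direction of time, and twice
  since each cell holds two letters.\<close>

definition spells :: "nat => nat list => bool" where
 "spells m w \<longleftrightarrow> w ~= [] & (\<forall>j<length w. acv m j =
   (rev w ! (2 * j mod length w), rev w ! ((2 * j + 1) mod length w), Suc j = length w))"

lemma spells_length:
 assumes "spells m w" "0 < m"
 shows "length w <= m"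
proof (rule ccontr)
 assume "~ length w <= m"
 moreover have "last_of (acv m (m - 1))" using acv_untouched[of m "m - 1"] d by simp
 ultimately show False using assms by (auto simp: spells_def)
qed

text \<open>A letter at a position below m is read less than 2 m steps after its launch, so from
  half-step \<open>h0\<close> on only words launched after T0 are read, and one word is repeated
  without a break.\<close>

lemma emission:
 assumes w: "spells m w" and m: "0 < m" and c: "\<And>u. T0 <= u ==> u <= T1 ==> issued u = m"
 obtains c :: int where
  "\<And>u. T0 + 2 * m + 4 <= u ==> u <= T1 ==> emit u = rev w ! nat ((int u + c) mod int (length w))"
proof -
 let ?l = "length w"
 have l: "0 < ?l" using w by (simp add: spells_def)
 have W: "acv m j = (rev w ! (2 * j mod ?l), rev w ! ((2 * j + 1) mod ?l), Suc j = ?l)" if "j < ?l" for j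
  using w that by (simp add: spells_def)
 define h0 where "h0 = (T0 + 2 * m + 2) div 2"
 have wrd: "wrd h = acv m" if h: "h0 <= h" "2 * h <= T1" for h
 proof -
  have h2: "T0 + 2 * m + 1 <= 2 * h" using h(1) unfolding h0_def by linarith
  have "issued (2 * h) = m" using h h2 by (intro c) auto
  then have "issued (2 * h - 2 * m) <= m" using issued_mono[of "2 * h - 2 * m" "2 * h"] by simp
  then have "pos h < m" by (rule pos_less) (rule m)
  then have "issued (2 * h - 2 * pos h - 1) = m" using h h2 by (intro c) linarith+
  then show ?thesis by (simp add: wrd_eq)
 qed
 have pos: "pos h < ?l" if h: "h0 <= h" "2 * h <= T1" for h
 proof (rule ccontr)
  assume "~ pos h < ?l"
  then have "~ last_of (wrd h (?l - 1))" by (intro not_last_below_pos) (use l in linarith)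
  then show False using W[of "?l - 1"] wrd[OF h] l by simp
 qed
 have pos_mod: "2 * (h0 + i) <= T1 ==> pos (h0 + i) = (pos h0 + i) mod ?l" for i
 proof (induction i)
  case 0
  then show ?case using pos[of h0] by simp
 next
  case (Suc i)
  have IH: "pos (h0 + i) = (pos h0 + i) mod ?l" using Suc by simp
  have p: "pos (h0 + i) < ?l" using pos[of "h0 + i"] Suc.prems by simp
  have "symw (h0 + i) = acv m (pos (h0 + i))" using wrd[of "h0 + i"] Suc.prems by (simp add: symw_def)
  then have "pos (Suc (h0 + i)) = (if Suc (pos (h0 + i)) = ?l then 0 else Suc (pos (h0 + i)))"
   using W[OF p] by (simp add: pos_Suc)
  also have "\<dots> = Suc (pos (h0 + i)) mod ?l" using p by (simp add: mod_Suc)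
  finally show ?case by (simp add: IH mod_Suc_eq)
 qed
 show ?thesis
 proof (rule that)
  fix u assume u: "T0 + 2 * m + 4 <= u" "u <= T1"
  define h where "h = (u - 2) div 2"
  have h: "h0 <= h" "2 * h <= T1" using u unfolding h_def h0_def by linarith+
  obtain i where i: "h = h0 + i" using h(1) le_Suc_ex by blast
  have s: "symw h = acv m (pos h)" by (simp add: symw_def wrd[OF h])
  have p: "int (pos h) = (int (pos h0) + int i) mod int ?l"
   using pos_mod[of i] h i by (simp add: zmod_int)
  \<comment> \<open>One circuit through the cells emits the word twice, and the parity of u selects
    the letter within a packet; hence letter 2 \<open>pos h\<close> + b modulo the length.\<close>
  define b where "b = u mod 2"
  have ub: "u = 2 * h + 2 + b" "b < 2" using u unfolding h_def b_def by presburger+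
  have "emit u = rev w ! ((2 * pos h + b) mod ?l)"
  proof (cases "b = 0")
   case True
   then have "even u" by (simp add: b_def even_iff_mod_2_eq_zero)
   then show ?thesis using True u W[OF pos[OF h]] s by (simp add: emit_def h_def)
  next
   case False
   then have "b = 1" "odd u" using ub(2) by (simp, simp add: b_def odd_iff_mod_2_eq_one)
   then show ?thesis using u W[OF pos[OF h]] s by (simp add: emit_def h_def)
  qed
  also have "(2 * pos h + b) mod ?l = nat ((2 * int (pos h) + int b) mod int ?l)"
   by (simp add: nat_mod_distrib nat_add_distrib nat_mult_distrib)
  also have "(2 * int (pos h) + int b) mod int ?l = (2 * (int (pos h0) + int i) + int b) mod int ?l"
   unfolding p by (metis mod_add_left_eq mod_mult_right_eq)
  also have "2 * (int (pos h0) + int i) + int b = int u + (2 * int (pos h0) - 2 * int h0 - 2)"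
   using ub(1) i by simp
  finally show "emit u = rev w ! nat ((int u + (2 * int (pos h0) - 2 * int h0 - 2)) mod int ?l)" .
 qed
qed

end

lemma rev_periodic:
 assumes "w ~= []"
 shows "rev w ! nat (a mod int (length w)) = periodic_config w (- a - 1)"
proof -
 let ?l = "int (length w)"
 have l: "0 < ?l" using assms by simp
 have a: "0 <= a mod ?l" "a mod ?l < ?l" using l by simp_all
 have "(- a - 1) mod ?l = (?l - 1 - a mod ?l) mod ?l"
  by (metis (no_types, opaque_lifting) add.commute diff_add_cancel mod_add_self2 mod_diff_left_eq mod_diff_right_eq minus_diff_commute uminus_add_conv_diff)
 also have "\<dots> = ?l - 1 - a mod ?l" using a by (intro mod_pos_pos_trivial) auto
 finally have "nat ((- a - 1) mod ?l) = length w - Suc (nat (a mod ?l))" using a by linarith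
 then show ?thesis using a by (simp add: periodic_config_def rev_nth nat_less_iff)
qed

context automaton
begin

sublocale machine C d e by unfold_locales (use C d in auto)

definition born :: "nat => config => int => bool" where
 "born s x y \<longleftrightarrow> mc s x y ~= Ww & (\<forall>u<s. mc u x y = Ww)"

lemma born_unique: "born s x y ==> born s' x y ==> s = s'"
 by (auto simp: born_def) (metis linorder_neqE_nat)

lemma isW_mc_antimono:
 assumes "x \<in> configs A" "isW (mc t x y)" "s <= t"
 shows "isW (mc s x y)"
 using evolution.isW_antimono[OF evolution_mc[OF assms(1), of y], of t 0 s] assms by simp

text \<open>All L letters come from one wall, the nearest one alive when they pass: walls in between
  are dead by then, and this wall started properly and issues no instruction while it emits them. D
  bounds both its distance and the time until it was born, and L' leaves room for the lag in
  \<open>emission\<close>.\<close>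

lemma window:
 assumes x: "x \<in> configs A"
  and r: "e <= r" "4 * 64 ^ r + 2 * r + 4 + 3 * D + L + 2 < t"
  and fake: "\<And>q. q \<in> {1..D} ==> \<exists>i. 0 < i & i <= r & mc 0 x (int n0 * int i - int q) = In"
  and early: "\<And>q. q \<in> {1..D} ==> mc D x (- int q) ~= Ww"
  and some_wall: "\<exists>q\<in>{1..D}. isW (mc t x (- int q))"
  and inert: "\<And>i. i < L ==> mc t x (int i) = In" "\<And>i. i < L ==> ~ isW (mc (t - L) x (int i))"
  and stable: "\<And>q. q \<in> {1..D} ==> isW (mc (t - q - L) x (- int q)) ==> isW (mc (t - q) x (- int q))"
  and clean: "\<And>q s n. q \<in> {1..D} ==> s <= D ==> born s x (- int q) ==> isW (mc (t - q - L) x (- int q)) ==>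
    t - q - s <= issue n + L' ==> issue n < t - q - s ==> False"
  and m0: "0 < m0" and word: "\<And>\<tau>. t - 2 * D <= \<tau> ==> \<tau> <= t ==> m0 <= issued \<tau> & issued \<tau> <= m1"
  and w: "\<And>m. m0 <= m ==> m <= m1 ==> spells m (w m)" and L': "L + 2 * m1 + 4 <= L'" "L' + 2 * D <= t"
 shows "\<exists>m c. m0 <= m & m <= m1 & (\<forall>i<L. (F ^^ t) x (int i) = periodic_config (w m) (int i + c))"
proof -
 \<comment> \<open>Letter i of the window passes the site - q at time t - q - i, so t - q - L
   precedes all these times. The least q gives the last wall that the letters have crossed.\<close>
 define q where "q = (LEAST q. q \<in> {1..D} & isW (mc (t - q - L) x (- int q)))"
 obtain q0 where q0: "q0 \<in> {1..D}" "isW (mc t x (- int q0))" using some_wall by blast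
 have "q0 \<in> {1..D} & isW (mc (t - q0 - L) x (- int q0))"
  using isW_mc_antimono[OF x q0(2)] q0 by simp
 then have q: "q \<in> {1..D}" "isW (mc (t - q - L) x (- int q))"
  unfolding q_def by (metis (mono_tags, lifting) LeastI)+
 have least: "~ isW (mc (t - p - L) x (- int p))" if "0 < p" "p < q" for p
  using not_less_Least[OF that(2)[unfolded q_def]] that q(1) by auto
 have qD: "0 < q" "q <= D" and tD: "3 * D + L + 2 < t" using q(1) r(2) by (simp, simp, linarith)
 have alive: "isW (mc (t - q) x (- int q))" by (rule stable[OF q])
 define row where "row = (\<lambda>t j. mc t x (- int q + int n0 * j))"
 interpret E: evolution C d e row unfolding row_def by (rule evolution_mc[OF x])
 obtain i0 where i0: "0 < i0" "i0 <= r" "mc 0 x (int n0 * int i0 - int q) = In" using fake[OF q(1)] by blast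
 have z: "E.z 0 u i = mc u x (- int q + int n0 * int i)" for u i unfolding E.z_def unfolding row_def by simp
 obtain s where s: "s <= D" "mc s x (- int q) ~= Ww" "\<And>u. u < s ==> mc u x (- int q) = Ww"
  "\<And>u. s <= u ==> u <= t - q ==> mc u x (- int q) = Wr (wall (u - s))"
 proof (rule E.alive_started[of 0 "t - q" i0 r D])
  show "isW (E.z 0 (t - q) 0)" using alive by (simp add: z)
  show "E.z 0 0 i0 = In" using i0(3) by (simp add: z algebra_simps)
  show "E.z 0 D 0 ~= Ww" using early[OF q(1)] by (simp add: z)
  show "4 * 64 ^ r + 2 * r + 4 + D < t - q" using r(2) qD by linarith
 qed (use i0 r in \<open>auto simp: z\<close>)
 have born: "born s x (- int q)" using s by (simp add: born_def)
 \<comment> \<open>The age of the wall when it emits letter 0, the last one of the window to be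
   emitted; letter i is emitted at age \<tau> - i.\<close>
 define \<tau> where "\<tau> = t - q - s"
 have \<tau>: "t - 2 * D <= \<tau>" "\<tau> <= t" "q + s <= 2 * D" "2 * D < t" using qD s(1) tD unfolding \<tau>_def by linarith+
 define m where "m = issued \<tau>"
 have m: "m0 <= m" "m <= m1" "0 < m" using word[OF \<tau>(1,2)] m0 by (auto simp: m_def)
 have const: "issued u = m" if u: "\<tau> - L' <= u" "u <= \<tau>" for u
 proof (rule ccontr)
  assume "issued u ~= m"
  then have "issued u < m" using issued_mono[OF u(2)] by (simp add: m_def)
  then have "~ \<tau> <= issue (issued u)" "u <= issue (issued u)"
   using issued_le_iff[of \<tau> "issued u"] issued_le_iff[of u "issued u"] by (auto simp: m_def)
  then show False using clean[OF q(1) s(1) born q(2), of "issued u"] u unfolding \<tau>_def by linarith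
 qed
 obtain c where c: "\<And>u. \<tau> - L' + 2 * m + 4 <= u ==> u <= \<tau> ==>
   emit u = rev (w m) ! nat ((int u + c) mod int (length (w m)))"
  using emission[OF w[OF m(1,2)] m(3) const] by blast
 have "(F ^^ t) x (int i) = periodic_config (w m) (int i + (- int \<tau> - c - 1))" if i: "i < L" for i
 proof -
  obtain t' where t': "t = Suc t'" using tD by (cases t) auto
  have iL: "t - q - L <= t - (i + q)" "t - (i + q) <= t - q" using i by linarith+
  have "(F ^^ t) x (int i) = st t x (int i)"
   using letter_Suc[OF x, of t' "int i"] inert(1)[OF i] t' by simp
  also have "\<dots> = out (mc (t - (i + q)) x (int i - int (i + q)))"
  proof (rule st_source[OF x])
   show "isW (mc (t - (i + q)) x (int i - int (i + q)))"
    using isW_mc_antimono[OF x alive iL(2)] by simp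
   show "i + q < t" using i tD qD by linarith
   show "~ isW (mc (t - p) x (int i - int p))" if p: "p < i + q" for p
   proof
    assume a: "isW (mc (t - p) x (int i - int p))"
    show False
    proof (cases "p <= i")
     case True
     have "t - L <= t - p" using True i by linarith
     then have "isW (mc (t - L) x (int (i - p)))"
      using isW_mc_antimono[OF x a, of "t - L"] True by (simp add: of_nat_diff)
     then show False using inert(2)[of "i - p"] i by simp
    next
     case False
     have "t - (p - i) - L <= t - p" using False i by linarith
     moreover have "int i - int p = - int (p - i)" using False by simp
     ultimately have "isW (mc (t - (p - i) - L) x (- int (p - i)))"
      using isW_mc_antimono[OF x a] by metis
     moreover have "0 < p - i" "p - i < q" using p False by linarith+
     ultimately show False using least by blast
    qed
   qed
  qed
  also have "\<dots> = emit (\<tau> - i)"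
  proof -
   have "s <= t - (i + q)" using s(1) qD i tD by linarith
   then have "mc (t - (i + q)) x (- int q) = Wr (wall (t - (i + q) - s))" using s(4) iL(2) by blast
   moreover have "t - (i + q) - s = \<tau> - i" unfolding \<tau>_def by linarith
   moreover have "w_out (wall (\<tau> - i)) = emit (\<tau> - i)" by (simp add: wall_def)
   ultimately show ?thesis by (simp only: out_def cell.case) simp
  qed
  also have "\<dots> = rev (w m) ! nat ((int (\<tau> - i) + c) mod int (length (w m)))"
   using L' m \<tau> i by (intro c) linarith+
  also have "\<dots> = periodic_config (w m) (- (int (\<tau> - i) + c) - 1)"
   using w[OF m(1,2)] by (intro rev_periodic) (simp add: spells_def)
  also have "- (int (\<tau> - i) + c) - 1 = int i + (- int \<tau> - c - 1)" using L' \<tau> i by simp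
  finally show ?thesis .
 qed
 then show ?thesis using m by blast
qed

end

section \<open>Convergence along the written words\<close>

locale random_automaton = automaton + mixing +
 assumes M_A: "AE x in M. x \<in> configs A"
  and inert_mass: "prob {x. cel k (x 0) ~= In} <= 1 / 64"
  and wall_mass: "0 < prob {x. cel k (x 0) = Ww}"
begin

lemma eventI: "Measurable.pred M P ==> {x. P x} \<in> events"
 by (simp add: pred_def space_M)

lemma predI: "{x. P x} \<in> sets borel ==> Measurable.pred M P"
 by (simp add: pred_def space_M sets_M)

lemma pred_isW [measurable]: "Measurable.pred M (\<lambda>x. isW (mc t x i))"
 and pred_mc [measurable]: "Measurable.pred M (\<lambda>x. mc t x i = c)"
 by (rule predI, rule mc_borel)+

lemma prob_le:
 assumes "\<And>x. x \<in> configs A ==> P x ==> Q x" "Measurable.pred M Q"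
 shows "prob {x. P x} <= prob {x. Q x}"
proof (rule finite_measure_mono_AE)
 show "AE x in M. x \<in> {x. P x} --> x \<in> {x. Q x}"
  using M_A by eventually_elim (simp add: assms(1))
 show "{x. Q x} \<in> events" by (rule eventI[OF assms(2)])
qed

lemma prob_disj: "Measurable.pred M P ==> Measurable.pred M Q ==> prob {x. P x \<or> Q x} <= prob {x. P x} + prob {x. Q x}"
 using measure_Un_le[OF eventI eventI, of P Q] by (simp add: Collect_disj_eq)

lemma prob_ex: "finite J ==> (\<And>i. i \<in> J ==> Measurable.pred M (P i)) ==>
  (\<And>i. i \<in> J ==> prob {x. P i x} <= b) ==> prob {x. \<exists>i\<in>J. P i x} <= real (card J) * b"
 for b :: real
proof -
 assume J: "finite J" "\<And>i. i \<in> J ==> Measurable.pred M (P i)" "\<And>i. i \<in> J ==> prob {x. P i x} <= b"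
 have "prob (\<Union>i\<in>J. {x. P i x}) <= (\<Sum>i\<in>J. prob {x. P i x})"
  by (rule finite_measure_subadditive_finite) (use J(1) in \<open>simp, auto intro!: eventI J(2)\<close>)
 also have "\<dots> <= real (card J) * b" using sum_bounded_above[of J "\<lambda>i. prob {x. P i x}" b] J by simp
 finally show ?thesis by (simp add: Collect_bex_eq)
qed

text \<open>Double counting. Moved to the origin, the events for the D possible sites become events
  for one wall at different times, few of which can occur together. This saves a factor D, which the
  density of walls could not compensate.\<close>

lemma prob_counting:
 assumes J: "finite J" "\<And>q. q \<in> J ==> Measurable.pred M (E q)" "Measurable.pred M Q"
  and sub: "\<And>x q. x \<in> configs A ==> q \<in> J ==> E q x ==> Q x"
  and card: "\<And>x. x \<in> configs A ==> card {q \<in> J. E q x} <= m"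
 shows "(\<Sum>q\<in>J. prob {x. E q x}) <= m * prob {x. Q x}"
proof -
 have ind: "integrable M (indicator {x. P x} :: config => real)" if "Measurable.pred M P" for P
  using eventI[OF that] by (simp add: integrable_indicator_iff emeasure_eq_measure)
 have "(\<Sum>q\<in>J. prob {x. E q x}) = (\<integral>x. (\<Sum>q\<in>J. indicat_real {x. E q x} x) \<partial>M)"
  by (subst Bochner_Integration.integral_sum) (use ind J in \<open>auto simp: space_M\<close>)
 also have "\<dots> <= (\<integral>x. real m * indicat_real {x. Q x} x \<partial>M)"
 proof (rule integral_mono_AE)
  show "AE x in M. (\<Sum>q\<in>J. indicator {x. E q x} x) <= real m * indicator {x. Q x} x"
   using M_A
  by (auto simp: J indicator_def Int_def sub card)
 qed (use ind J in auto)
 also have "\<dots> = m * prob {x. Q x}" by (simp add: space_M)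
 finally show ?thesis .
qed

subsection \<open>Rare events\<close>

abbreviation "WW \<equiv> {a. cel k a = Ww}"
abbreviation "II \<equiv> {a. cel k a = In}"

definition "pW = prob {x. x 0 \<in> WW}"

lemma pW: "0 < pW" "pW <= 1"
 using wall_mass by (simp_all add: pW_def)

lemma prob_II: "63 / 64 <= prob {x. x 0 \<in> II}"
proof -
 have "{x :: config. cel k (x 0) ~= In} = {x. x 0 \<in> {a. cel k a ~= In}}" by simp
 then have "{x. cel k (x 0) ~= In} \<in> events" using site_borel[of 0] by (simp only: sets_M)
 from prob_compl[OF this] have "prob (- {x. cel k (x 0) ~= In}) = 1 - prob {x. cel k (x 0) ~= In}"
  by (simp add: space_M Compl_eq_Diff_UNIV)
 moreover have "- {x :: config. cel k (x 0) ~= In} = {x. x 0 \<in> II}" by auto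
 ultimately show ?thesis using inert_mass by simp
qed

lemma pred_barren [measurable]: "Measurable.pred M (\<lambda>x. barren WW II g n (translate m x))"
 by (rule predI, rule translate_borel, rule barren_borel)

lemma prob_barren': "prob {x. barren WW II g n (translate m x)} <= (1 - pW / 2 / 4 ^ g) ^ (n div (g + 1))"
proof -
 have "prob {x. barren WW II g n (translate m x)} = prob {x. barren WW II g n x}"
  by (rule prob_translate, rule barren_borel)
 also have "\<dots> <= (1 - pW / 4 ^ g / 2) ^ (n div (g + 1))"
  by (rule prob_barren) (use pW prob_II in \<open>auto simp: pW_def\<close>)
 finally show ?thesis by (simp add: mult.commute)
qed

definition clr :: "nat => int => config => bool" where
 "clr n y x \<longleftrightarrow> barren WW II (gap e n) n (translate (y - int n0 * (int n - 1)) x)"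

definition far :: "nat => int => config => bool" where
 "far S y x \<longleftrightarrow> (\<exists>n\<ge>S. clr n y x)"

lemma pred_clr [measurable]: "Measurable.pred M (clr n y)"
 using pred_barren by (simp add: clr_def[abs_def])

lemma pred_far [measurable]: "Measurable.pred M (far S y)"
 unfolding far_def[abs_def] by measurable

lemma far_rate:
 obtains N Z where "0 < Z" "\<And>S y. N <= S ==> prob {x. clr S y x} <= 1 / real S ^ 8"
  "\<And>S y. N <= S ==> prob {x. far S y x} <= Z / real S ^ 6"
proof -
 have "eventually (\<lambda>n. (1 - pW / 2 / 4 ^ gap e n) ^ (n div (gap e n + 1)) <= 1 / real n ^ 8) sequentially"
  by (rule gap_rate) (use pW in auto)
 then obtain N0 where N0: "\<And>n. N0 <= n ==> (1 - pW / 2 / 4 ^ gap e n) ^ (n div (gap e n + 1)) <= 1 / real n ^ 8"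
  by (auto simp: eventually_sequentially)
 define N where "N = Suc N0"
 have clr: "prob {x. clr n y x} <= 1 / real n ^ 8" if "N <= n" for n y
  unfolding clr_def by (rule order_trans[OF prob_barren' N0]) (use that in \<open>simp add: N_def\<close>)
 define Z where "Z = (\<Sum>n. 1 / real (Suc n) ^ 2)"
 have sm: "summable (\<lambda>n. 1 / real (Suc n) ^ 2)"
  using inverse_power_summable[of 2, where 'a = real] summable_Suc_iff[of "\<lambda>n. inverse (real n ^ 2)"]
  by (simp add: inverse_eq_divide)
 have "prob {x. far S y x} <= Z / real S ^ 6" if S: "N <= S" for S y
 proof -
  have S0: "0 < S" using S by (simp add: N_def)
  have le: "prob {x. clr (n + S) y x} <= 1 / real S ^ 6 * (1 / real (Suc n) ^ 2)" for n
  proof -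
   have "prob {x. clr (n + S) y x} <= 1 / real (n + S) ^ 8" by (rule clr) (use S in simp)
   \<comment> \<open>Six powers give the decay in S, the other two make the series over n
     converge.\<close>
   also have "real (n + S) ^ 8 = real (n + S) ^ 6 * real (n + S) ^ 2" by (simp flip: power_add)
   also have "1 / (real (n + S) ^ 6 * real (n + S) ^ 2) <= 1 / (real S ^ 6 * real (Suc n) ^ 2)"
    using S0 by (intro divide_left_mono mult_mono power_mono mult_pos_pos) auto
   finally show ?thesis by simp
  qed
  have sm': "summable (\<lambda>n. 1 / real S ^ 6 * (1 / real (Suc n) ^ 2))" by (rule summable_mult[OF sm])
  have sc: "summable (\<lambda>n. prob {x. clr (n + S) y x})"
   by (rule summable_comparison_test'[OF sm', of 0]) (use le in simp)
  have "far S y x \<longleftrightarrow> (\<exists>n. clr (n + S) y x)" for x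
   unfolding far_def by (metis le_add2 le_add_diff_inverse2)
  then have "{x. far S y x} = (\<Union>n. {x. clr (n + S) y x})" by auto
  then have "prob {x. far S y x} <= (\<Sum>n. prob {x. clr (n + S) y x})"
   using finite_measure_subadditive_countably[of "\<lambda>n. {x. clr (n + S) y x}"] sc eventI[OF pred_clr] by auto
  also have "\<dots> <= (\<Sum>n. 1 / real S ^ 6 * (1 / real (Suc n) ^ 2))" by (rule suminf_le[OF le sc sm'])
  also have "\<dots> = Z / real S ^ 6" unfolding Z_def suminf_mult[OF sm] by simp
  finally show ?thesis .
 qed
 moreover have "0 < Z" unfolding Z_def by (rule suminf_pos[OF sm]) simp
 ultimately show ?thesis using clr by (intro that) auto
qed

definition rho :: "nat => real" where "rho t = prob {x. isW (mc t x 0)}"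

lemma prob_isW: "prob {x. isW (mc t x y)} = rho t"
 using prob_translate[of "\<lambda>x. isW (mc t x 0)" y] mc_borel by (simp add: mc_translate rho_def)

lemma row:
 fixes x :: config and y :: int
 assumes x: "x \<in> configs A"
 defines "c \<equiv> \<lambda>t j. mc t x (y + int n0 * j)"
 shows "evolution.good c g j \<longleftrightarrow> newborn WW II g (translate (y + int n0 * j) x)"
  "evolution.clear_of c (gap e n) n p \<longleftrightarrow> clr n (y + int n0 * p) x"
proof -
 interpret E: evolution C d e c unfolding c_def by (rule evolution_mc[OF x])
 show g: "E.good g j \<longleftrightarrow> newborn WW II g (translate (y + int n0 * j) x)" for g j
  unfolding E.good_def unfolding c_def
  by (auto simp: newborn_def mc_def translate_apply algebra_simps)
 show "E.clear_of (gap e n) n p \<longleftrightarrow> clr n (y + int n0 * p) x"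
 proof (rule iffI)
  assume l: "E.clear_of (gap e n) n p"
  show "clr n (y + int n0 * p) x"
   unfolding clr_def barren_def
  proof
   fix j assume j: "j \<in> {..<n}"
   have "~ E.good (gap e n) (p - int n + 1 + int j)"
    using l j by (auto simp: E.clear_of_def)
   then show "~ newborn WW II (gap e n) (translate (int n0 * int j) (translate (y + int n0 * p - int n0 * (int n - 1)) x))"
    unfolding g by (simp add: algebra_simps)
  qed
 next
  assume r: "clr n (y + int n0 * p) x"
  show "E.clear_of (gap e n) n p"
   unfolding E.clear_of_def
  proof (intro allI impI)
   fix j assume j: "p - int n < j" "j <= p"
   define i where "i = nat (j - (p - int n) - 1)"
   have i: "i < n" "int i = j - (p - int n) - 1" using j by (auto simp: i_def)
   have "~ newborn WW II (gap e n) (translate (int n0 * int i) (translate (y + int n0 * p - int n0 * (int n - 1)) x))"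
    using r i(1) by (auto simp: clr_def barren_def)
   then show "~ E.good (gap e n) j"
    unfolding g i(2) by (simp add: algebra_simps)
  qed
 qed
qed

lemma gap_conds: "\<And>n. e <= gap e n" "\<And>n. 4 * n + 8 <= 64 ^ gap e n"
 by (rule gap)+

lemma isW_rare:
 assumes x: "x \<in> configs A" and w: "isW (mc t x y)" and t: "4 * 64 ^ r + 2 * r + 4 < t"
 shows "(\<exists>i\<in>{1..r}. far r (y + int n0 * int i) x) \<or> clr r (y + int n0 * int r) x"
proof -
 interpret E: evolution C d e "\<lambda>t j. mc t x (y + int n0 * j)" by (rule evolution_mc[OF x])
 show ?thesis
  using E.alive_rare[of "gap e" t 0 r, OF gap_conds _ t] w unfolding row[OF x] by (auto simp: far_def)
qed

lemma occupied_rare':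
 assumes x: "x \<in> configs A" and o: "mc t x y ~= In" and t: "S <= t"
 shows "(\<exists>s\<in>{..S}. isW (mc (t - s) x (y - int n0 * int s))) \<or> (\<exists>s\<in>{..S}. far S (y - int n0 * int s) x) \<or> clr S y x"
proof (cases "isW (mc t x y)")
 case True
 then show ?thesis by (intro disjI1 bexI[of _ 0]) auto
next
 case False
 interpret E: evolution C d e "\<lambda>t j. mc t x (y + int n0 * j)" by (rule evolution_mc[OF x])
 show ?thesis
  using E.occupied_rare[of "gap e" t 0 S, OF gap_conds _ _ t] o False
  unfolding row[OF x] by (auto simp: far_def)
qed

lemma Ww_rare':
 assumes x: "x \<in> configs A" and w: "mc D x y = Ww" "6 <= D"
 shows "clr ((D - 4) div 2) (y + int n0 * int ((D - 4) div 2)) x"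
proof -
 interpret E: evolution C d e "\<lambda>t j. mc t x (y + int n0 * j)" by (rule evolution_mc[OF x])
 show ?thesis
  using E.Ww_rare[of "gap e" D 0, OF gap_conds] w unfolding row[OF x] by simp
qed

lemma newborn_isW:
 assumes x: "x \<in> configs A" and w: "newborn WW II g (translate y x)" "e <= g" "t <= 64 ^ g"
 shows "isW (mc t x y)"
proof -
 interpret E: evolution C d e "\<lambda>t j. mc t x (y + int n0 * j)" by (rule evolution_mc[OF x])
 show ?thesis using E.good_alive[of g 0 t] w unfolding row(1)[OF x] by simp
qed

end

lemma budget:
 fixes Y D L r t :: nat
 assumes "5 * Y + 8 * D + 100 * (L + 2 * r + 3) < t"
 shows "4 * Y + 2 * r + 4 + 3 * D + L + 2 < t"
 by (rule le_less_trans[OF _ assms]) simp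

context random_automaton
begin

section \<open>Probabilities of the ways in which a window can fail\<close>

lemma pred_born [measurable]: "Measurable.pred M (\<lambda>x. born s x y)"
 unfolding born_def by measurable

lemma prob_ex_sum:
 assumes "finite J" "\<And>i. i \<in> J ==> Measurable.pred M (P i)"
 shows "prob {x. \<exists>i\<in>J. P i x} <= (\<Sum>i\<in>J. prob {x. P i x})"
proof -
 have "prob (\<Union>i\<in>J. {x. P i x}) <= (\<Sum>i\<in>J. prob {x. P i x})"
  by (rule finite_measure_subadditive_finite) (use assms(1) in \<open>simp, auto intro!: eventI assms(2)\<close>)
 then show ?thesis by (simp add: Collect_bex_eq)
qed

lemma prob_translate': "Measurable.pred M P ==> prob {x. P (translate m x)} = prob {x. P x}"
 by (rule prob_translate) (use eventI sets_M in blast)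

text \<open>3/128 is the bound 1/64 on the occupied mass times the mixing factor 3/2. It is below
  1/16, as the union over 16^(r + 1) sites requires.\<close>

lemma prob_fake: "prob {x. \<forall>i\<in>{1..Suc r}. mc 0 x (int n0 * int i + y) ~= In} <= (3 / 128) ^ r"
proof -
 have c: "{x. \<forall>i\<in>{1..Suc r}. mc 0 x (int n0 * int i + y) ~= In} =
   {x. translate (int n0 + y) x \<in> chain r (\<lambda>_. - II)}"
 proof -
  have "(\<forall>i\<in>{1..Suc r}. Q i) \<longleftrightarrow> (\<forall>j\<in>{..r}. Q (Suc j))" for Q :: "nat => bool"
   by (auto simp: Ball_def) (metis Suc_le_D Suc_le_mono)
  then show ?thesis by (simp add: chain_def mc_def translate_apply algebra_simps)
 qed
 have "prob {x. x 0 \<in> - II} <= 1 / 64" using inert_mass by simp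
 then have "prob (chain r (\<lambda>_. - II)) <= 1 / 64 * (3 / 2 * (1 / 64)) ^ r" by (intro chain_upper)
 also have "\<dots> <= (3 / 128) ^ r" by simp
 finally show ?thesis
  unfolding c using prob_translate[of "\<lambda>x. x \<in> chain r (\<lambda>_. - II)" "int n0 + y"] chain_borel by simp
qed

lemma prob_no_wall:
 assumes g: "e <= g" "t <= 64 ^ g"
 shows "prob {x. ~ (\<exists>q\<in>{1..D}. isW (mc t x (- int q)))} <= (1 - pW / 2 / 4 ^ g) ^ ((D div n0) div (g + 1))"
proof -
 have "prob {x. ~ (\<exists>q\<in>{1..D}. isW (mc t x (- int q)))} <= prob {x. barren WW II g (D div n0) (translate (- int (n0 * (D div n0))) x)}"
 proof (rule prob_le)
  fix x assume x: "x \<in> configs A" and no: "~ (\<exists>q\<in>{1..D}. isW (mc t x (- int q)))"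
  show "barren WW II g (D div n0) (translate (- int (n0 * (D div n0))) x)"
   unfolding barren_def translate_translate
  proof (intro ballI notI)
   fix j assume j: "j \<in> {..<D div n0}"
    and nb: "newborn WW II g (translate (int n0 * int j + - int (n0 * (D div n0))) x)"
   define q where "q = n0 * (D div n0 - j)"
   have "q <= n0 * (D div n0)" "0 < q" using j n0 by (auto simp: q_def)
   then have q: "q \<in> {1..D}" using order_trans[OF _ times_div_less_eq_dividend[of n0 D], of q] by simp
   have "int n0 * int j + - int (n0 * (D div n0)) = - int q"
    using j by (simp add: q_def of_nat_diff algebra_simps)
   then have "newborn WW II g (translate (- int q) x)" using nb by (simp only:)
   then have "isW (mc t x (- int q))" by (rule newborn_isW[OF x _ g])
   then show False using no q by blast
  qed
 qed measurable
 also have "\<dots> <= (1 - pW / 2 / 4 ^ g) ^ ((D div n0) div (g + 1))" by (rule prob_barren')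
 finally show ?thesis .
qed

text \<open>A wall dies only once: moved to the origin, its death falls between t - q - L and t - q
  for at most L values of q.\<close>

lemma prob_dying:
 assumes "D + L <= t"
 shows "prob {x. \<exists>q\<in>{1..D}. isW (mc (t - q - L) x (- int q)) & ~ isW (mc (t - q) x (- int q))} <= L * rho (t - D - L)"
proof -
 have "prob {x. \<exists>q\<in>{1..D}. isW (mc (t - q - L) x (- int q)) & ~ isW (mc (t - q) x (- int q))}
   <= (\<Sum>q\<in>{1..D}. prob {x. isW (mc (t - q - L) x (- int q)) & ~ isW (mc (t - q) x (- int q))})"
  by (rule prob_ex_sum) (simp, measurable)
 also have "\<dots> = (\<Sum>q\<in>{1..D}. prob {x. isW (mc (t - q - L) x 0) & ~ isW (mc (t - q) x 0)})"
 proof (rule sum.cong[OF refl])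
  fix q
  have "Measurable.pred M (\<lambda>x. isW (mc (t - q - L) x 0) & ~ isW (mc (t - q) x 0))" by measurable
  from prob_translate'[OF this, of "- int q"]
  show "prob {x. isW (mc (t - q - L) x (- int q)) & ~ isW (mc (t - q) x (- int q))} =
    prob {x. isW (mc (t - q - L) x 0) & ~ isW (mc (t - q) x 0)}" by (simp add: mc_translate)
 qed
 also have "\<dots> <= L * prob {x. isW (mc (t - D - L) x 0)}"
 proof (rule prob_counting)
  fix x assume x: "x \<in> configs A"
  show "isW (mc (t - D - L) x 0)" if "q \<in> {1..D}" "isW (mc (t - q - L) x 0) & ~ isW (mc (t - q) x 0)" for q
   using isW_mc_antimono[OF x, of "t - q - L" 0 "t - D - L"] that by auto
  let ?S = "{q \<in> {1..D}. isW (mc (t - q - L) x 0) & ~ isW (mc (t - q) x 0)}"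
  show "card ?S <= L"
  proof (cases "?S = {}")
   case False
   define q1 where "q1 = Min ?S"
   have fin: "finite ?S" by simp
   have q1: "q1 \<in> ?S" unfolding q1_def by (rule Min_in[OF fin False])
   have "?S \<subseteq> {q1..<q1 + L}"
   proof
    fix q assume q: "q \<in> ?S"
    then have "q1 <= q" unfolding q1_def by (intro Min_le[OF fin])
    moreover have "q < q1 + L"
    proof (rule ccontr)
     assume "~ q < q1 + L"
     then have "t - q <= t - q1 - L" by linarith
     then show False using isW_mc_antimono[OF x, of "t - q1 - L" 0 "t - q"] q q1 by simp
    qed
    ultimately show "q \<in> {q1..<q1 + L}" by simp
   qed
   then have "card ?S <= card {q1..<q1 + L}" by (intro card_mono) auto
   then show ?thesis by simp
  next
   case True
   then show ?thesis by (simp only: card.empty)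
  qed
 qed (simp, measurable)
 finally show ?thesis by (simp add: rho_def)
qed

text \<open>Moved to the origin, the wall has a single birth time s. At ages between 64^r and 64^(r
  + 2) the only issue time in question is that of instruction r + 1, and it lies within the L' steps
  before age t - q - s for at most L' values of q.\<close>

lemma prob_unclean:
 assumes r: "2 * D + L + L' + 64 ^ r + 2 * r + 1 < t" "t < 64 ^ (r + 2)" "L <= t"
 shows "prob {x. \<exists>q\<in>{1..D}. \<exists>s\<in>{..D}. born s x (- int q) & isW (mc (t - q - L) x (- int q)) &
   (\<exists>n. t - q - s <= issue n + L' & issue n < t - q - s)} <= L' * rho (t - D - L)"
  (is "prob {x. \<exists>q\<in>_. ?E q x (- int q)} <= _")
proof -
 have meas: "Measurable.pred M (\<lambda>x. ?E q x y)" for q y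
  by measurable
 have "prob {x. \<exists>q\<in>{1..D}. ?E q x (- int q)} <= (\<Sum>q\<in>{1..D}. prob {x. ?E q x (- int q)})"
  by (rule prob_ex_sum) (simp, rule meas)
 also have "\<dots> = (\<Sum>q\<in>{1..D}. prob {x. ?E q x 0})"
 proof (rule sum.cong[OF refl])
  fix q
  have "Measurable.pred M (\<lambda>x. ?E q x 0)" by (rule meas)
  then show "prob {x. ?E q x (- int q)} = prob {x. ?E q x 0}"
   using prob_translate'[of "\<lambda>x. ?E q x 0" "- int q"] by (simp add: mc_translate born_def)
 qed
 also have "\<dots> <= L' * prob {x. isW (mc (t - D - L) x 0)}"
 proof (rule prob_counting)
  fix x assume x: "x \<in> configs A"
  show "isW (mc (t - D - L) x 0)" if q: "q \<in> {1..D}" and E: "?E q x 0" for q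
  using E q isW_mc_antimono x by auto
  let ?S = "{q \<in> {1..D}. ?E q x 0}"
  show "card ?S <= L'"
  proof (cases "?S = {}")
   case False
   then obtain q0 where "?E q0 x 0" by blast
   then obtain s where s: "born s x 0" "s <= D" by auto
   have "?S \<subseteq> {t - s - issue (Suc r) - L'..<t - s - issue (Suc r)}"
   proof
    fix q assume q: "q \<in> ?S"
    then obtain s' n where *: "born s' x 0" "t - q - s' <= issue n + L'" "issue n < t - q - s'" by blast
    have ss: "s' = s" by (rule born_unique[OF *(1) s(1)])
    have "issue n < issue (r + 2)" using *(3) r(2) unfolding issue_def[of "r + 2"] by linarith
    then have "n < r + 2" using strict_mono_less[OF issue_strict_mono, of n "r + 2"] by simp
    moreover have "issue r < issue n"
    proof -
     have "q <= D" using q by simp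
     then have "64 ^ r + 2 * r < issue n" using * r(1) s(2) ss by linarith
     then show ?thesis by (simp add: issue_def)
    qed
    then have "r < n" using strict_mono_less[OF issue_strict_mono, of r n] by simp
    ultimately have "n = Suc r" by simp
    note * = *[unfolded ss this]
    show "q \<in> {t - s - issue (Suc r) - L'..<t - s - issue (Suc r)}"
     using * unfolding atLeastLessThan_iff by linarith
   qed
   then have "card ?S <= card {t - s - issue (Suc r) - L'..<t - s - issue (Suc r)}"
    by (intro card_mono) auto
   then show ?thesis by simp
  next
   case True
   then show ?thesis by (simp only: card.empty)
  qed
 qed (simp, rule meas, measurable)
 finally show ?thesis by (simp add: rho_def)
qed

context
 fixes N :: nat and Z :: real
 assumes clr_rate: "\<And>S y. N <= S ==> prob {x. clr S y x} <= 1 / real S ^ 8"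
  and far_rate': "\<And>S y. N <= S ==> prob {x. far S y x} <= Z / real S ^ 6"
begin

lemma rho_rate:
 assumes "N <= r" "4 * 64 ^ r + 2 * r + 4 < t"
 shows "rho t <= real r * (Z / real r ^ 6) + 1 / real r ^ 8"
proof -
 have "rho t <= prob {x. (\<exists>i\<in>{1..r}. far r (int n0 * int i) x) \<or> clr r (int n0 * int r) x}"
  unfolding rho_def by (rule prob_le) (use isW_rare[of _ t 0 r] assms(2) in simp, measurable)
 also have "\<dots> <= prob {x. \<exists>i\<in>{1..r}. far r (int n0 * int i) x} + prob {x. clr r (int n0 * int r) x}"
  by (rule prob_disj) measurable
 also have "prob {x. \<exists>i\<in>{1..r}. far r (int n0 * int i) x} <= card {1..r} * (Z / real r ^ 6)"
  by (rule prob_ex) (simp, measurable, rule far_rate'[OF assms(1)])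
 also have "prob {x. clr r (int n0 * int r) x} <= 1 / real r ^ 8" by (rule clr_rate[OF assms(1)])
 finally show ?thesis by simp
qed

lemma occupied_rate:
 assumes "N <= r" "4 * 64 ^ r + 3 * r + 4 < t"
 defines "R \<equiv> real r * (Z / real r ^ 6) + 1 / real r ^ 8"
 shows "prob {x. mc t x y ~= In} <= (r + 1) * R + (r + 1) * (Z / real r ^ 6) + 1 / real r ^ 8"
proof -
 have r: "r <= t" using assms(2) by simp
 have "prob {x. mc t x y ~= In} <= prob {x. ((\<exists>s\<in>{..r}. isW (mc (t - s) x (y - int n0 * int s))) \<or>
   (\<exists>s\<in>{..r}. far r (y - int n0 * int s) x)) \<or> clr r y x}"
  by (rule prob_le) (use occupied_rare'[of _ t y r] r in blast, measurable)
 also have "\<dots> <= prob {x. (\<exists>s\<in>{..r}. isW (mc (t - s) x (y - int n0 * int s))) \<or>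
   (\<exists>s\<in>{..r}. far r (y - int n0 * int s) x)} + prob {x. clr r y x}"
  by (rule prob_disj) measurable
 also have "\<dots> <= (prob {x. \<exists>s\<in>{..r}. isW (mc (t - s) x (y - int n0 * int s))} +
   prob {x. \<exists>s\<in>{..r}. far r (y - int n0 * int s) x}) + prob {x. clr r y x}"
  by (intro add_right_mono prob_disj) measurable
 also have "prob {x. \<exists>s\<in>{..r}. isW (mc (t - s) x (y - int n0 * int s))} <= card {..r} * R"
 proof (rule prob_ex)
  fix s assume "s \<in> {..r}"
  then show "prob {x. isW (mc (t - s) x (y - int n0 * int s))} <= R"
   unfolding prob_isW R_def using assms(1,2) by (intro rho_rate) auto
 qed (simp, measurable)
 also have "prob {x. \<exists>s\<in>{..r}. far r (y - int n0 * int s) x} <= card {..r} * (Z / real r ^ 6)"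
  by (rule prob_ex) (simp, measurable, rule far_rate'[OF assms(1)])
 also have "prob {x. clr r y x} <= 1 / real r ^ 8" by (rule clr_rate[OF assms(1)])
 finally show ?thesis by (simp add: add.commute)
qed

text \<open>The bounds for the seven failures in \<open>window_prob\<close>, in their order; the
  last three share the bound for the density of walls as a factor. The window of (r + 1)^2 sites is
  affordable because occupied sites have density of order r^-4.\<close>

definition beta :: "nat => real" where
 "beta r = 16 ^ (r + 1) * ((3 / 128) ^ r * (128 / 3)) + (16 ^ (r + 1) * (1 / (16 ^ (r + 1) / 4) ^ 8) +
   ((1 - pW / 2 / 4 ^ (r + 3)) ^ ((16 ^ (r + 1) div n0) div (r + 4)) +
   ((real r + 1)\<^sup>2 * ((real r + 1) * (real r * (Z / real r ^ 6) + 1 / real r ^ 8) +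
     (real r + 1) * (Z / real r ^ 6) + 1 / real r ^ 8) +
   (2 * (real r + 1)\<^sup>2 + ((real r + 1)\<^sup>2 + 2 * real r + 8)) * (real r * (Z / real r ^ 6) + 1 / real r ^ 8))))"

lemma beta_tendsto: "beta \<longlonglongrightarrow> 0"
proof -
 have 1: "(\<lambda>r. (1 - pW / 2 / 4 ^ (r + 3)) ^ ((16 ^ (r + 1) div n0) div (r + 4))) \<longlonglongrightarrow> 0"
 proof -
  have "Suc r = r + 1" "Suc r + 2 = r + 3" "Suc r + 3 = r + 4" for r by simp_all
  moreover have "0 < pW / 2" "pW / 2 <= 1" "0 < n0" using pW n0 by auto
  ultimately show ?thesis using LIMSEQ_Suc[OF barren_rate[of "pW / 2" n0]] by (simp only:)
 qed
 have 2: "(\<lambda>r. 16 ^ (r + 1) * ((3 / 128) ^ r * (128 / 3)) :: real) \<longlonglongrightarrow> 0"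
 proof -
  have "16 ^ (r + 1) * ((3 / 128) ^ r * (128 / 3)) = 2048 / 3 * (3 / 8 :: real) ^ r" for r
  proof -
   have "16 ^ r * (3 / 128) ^ r = (3 / 8 :: real) ^ r"
    using power_mult_distrib[of 16 "3 / 128 :: real" r] by simp
   then show ?thesis by simp
  qed
  moreover have "(\<lambda>r. 2048 / 3 * (3 / 8 :: real) ^ r) \<longlonglongrightarrow> 2048 / 3 * 0"
   by (intro tendsto_mult tendsto_const LIMSEQ_realpow_zero) auto
  ultimately show ?thesis by simp
 qed
 have 4: "(\<lambda>r. 16 ^ (r + 1) * (1 / (16 ^ (r + 1) / 4) ^ 8) :: real) \<longlonglongrightarrow> 0"
  by real_asymp
 have 3: "(\<lambda>r. (real r + 1)\<^sup>2 * ((real r + 1) * (real r * (Z / real r ^ 6) + 1 / real r ^ 8) +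
     (real r + 1) * (Z / real r ^ 6) + 1 / real r ^ 8) +
   (2 * (real r + 1)\<^sup>2 + ((real r + 1)\<^sup>2 + 2 * real r + 8)) * (real r * (Z / real r ^ 6) + 1 / real r ^ 8)) \<longlonglongrightarrow> 0"
  by real_asymp
 have "beta \<longlonglongrightarrow> 0 + (0 + (0 + 0))"
  unfolding beta_def[abs_def] by (intro tendsto_add 1 2 3 4)
 then show ?thesis by simp
qed

lemma window_prob:
 assumes r: "1 <= r" "e <= r" "N <= r" and big: "5 * 64 ^ r + 8 * 16 ^ (r + 1) + 100 * (r + 2)\<^sup>2 < (64::nat) ^ (r + 1)"
  and t: "64 ^ (r + 1) <= t" "t < 64 ^ (r + 2)"
  and w: "spells (r + 1) (w (r + 1))" "spells (r + 2) (w (r + 2))"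
 shows "prob {x. ~ (\<exists>m c. r + 1 <= m & m <= r + 2 &
   (\<forall>i<(r + 1)\<^sup>2. (F ^^ t) x (int i) = periodic_config (w m) (int i + c)))} <= beta r"
proof -
 \<comment> \<open>16^(r + 1) sites are many compared with 4^(r + 3), so that one of them carries a
   wall that outlives t, and few compared with (128/3)^r and 64^r. The window of (r + 1)^2 sites is
   long compared with the words, whose length is at most r + 2.\<close>
 define D where "D = (16::nat) ^ (r + 1)"
 define L where "L = (r + 1)\<^sup>2"
 define L' where "L' = L + 2 * (r + 2) + 4"
 define R where "R = real r * (Z / real r ^ 6) + 1 / real r ^ 8"
 define Y where "Y = (64::nat) ^ r"
 have Y: "64 ^ r = Y" by (simp add: Y_def)
 have "L + 2 * r + 3 = (r + 2)\<^sup>2" by (simp add: L_def power2_eq_square algebra_simps)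
 then have num: "5 * Y + 8 * D + 100 * (L + 2 * r + 3) < t"
  unfolding D_def Y_def using less_le_trans[OF big t(1)] by (simp only:)
 have D: "256 <= D" "N <= (D - 4) div 2" "1 <= D div n0 \<or> True"
 proof -
  have "(16::nat) ^ 2 <= D" unfolding D_def using r(1) by (intro power_increasing) auto
  then show "256 <= D" by simp
  have "r < 2 ^ r" by (rule less_exp)
  also have "(2::nat) ^ r <= 16 ^ r" by (rule power_mono) auto
  finally have "16 * r < D" by (simp add: D_def)
  then show "N <= (D - 4) div 2" using r(3) \<open>256 <= D\<close> by linarith
 qed auto
 define P1 where "P1 x \<longleftrightarrow> (\<exists>q\<in>{1..D}. \<forall>i\<in>{1..r}. mc 0 x (int n0 * int i - int q) ~= In)" for x
 define P2 where "P2 x \<longleftrightarrow> (\<exists>q\<in>{1..D}. mc D x (- int q) = Ww)" for x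
 define P3 where "P3 x \<longleftrightarrow> ~ (\<exists>q\<in>{1..D}. isW (mc t x (- int q)))" for x
 define P4 where "P4 x \<longleftrightarrow> (\<exists>i\<in>{..<L}. mc t x (int i) ~= In)" for x
 define P5 where "P5 x \<longleftrightarrow> (\<exists>i\<in>{..<L}. isW (mc (t - L) x (int i)))" for x
 define P6 where "P6 x \<longleftrightarrow> (\<exists>q\<in>{1..D}. isW (mc (t - q - L) x (- int q)) & ~ isW (mc (t - q) x (- int q)))" for x
 define P7 where "P7 x \<longleftrightarrow> (\<exists>q\<in>{1..D}. \<exists>s\<in>{..D}. born s x (- int q) & isW (mc (t - q - L) x (- int q)) &
   (\<exists>n. t - q - s <= issue n + L' & issue n < t - q - s))" for x
 have [measurable]: "Measurable.pred M P1" "Measurable.pred M P2" "Measurable.pred M P3" "Measurable.pred M P4"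
  "Measurable.pred M P5" "Measurable.pred M P6" "Measurable.pred M P7"
  unfolding P1_def[abs_def] P2_def[abs_def] P3_def[abs_def] P4_def[abs_def] P5_def[abs_def] P6_def[abs_def] P7_def[abs_def]
  by measurable
 have rho: "rho u <= R" if "t - D - L - r <= u" for u
  unfolding R_def by (rule rho_rate[OF r(3)], unfold Y) (use that num in simp)
 have p1: "prob {x. P1 x} <= 16 ^ (r + 1) * ((3 / 128) ^ r * (128 / 3))"
 proof -
  obtain r' where r': "r = Suc r'" using r(1) by (cases r) auto
  have "prob {x. P1 x} <= real (card {1..D}) * (3 / 128) ^ r'"
   unfolding P1_def
  proof (rule prob_ex)
   fix q
   show "prob {x. \<forall>i\<in>{1..r}. mc 0 x (int n0 * int i - int q) ~= In} <= (3 / 128) ^ r'"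
    using prob_fake[of r' "- int q"] by (simp add: r')
  qed (simp, measurable)
  then show ?thesis by (simp add: D_def r')
 qed
 have p2: "prob {x. P2 x} <= 16 ^ (r + 1) * (1 / (16 ^ (r + 1) / 4) ^ 8)"
 proof -
  have "prob {x. P2 x} <= real (card {1..D}) * (1 / (real D / 4) ^ 8)"
   unfolding P2_def
  proof (rule prob_ex)
   fix q
   let ?k = "(D - 4) div 2"
   have "prob {x. mc D x (- int q) = Ww} <= prob {x. clr ?k (- int q + int n0 * int ?k) x}"
    by (rule prob_le) (use Ww_rare'[of _ D "- int q"] D in simp, measurable)
   also have "\<dots> <= 1 / real ?k ^ 8" by (rule clr_rate[OF D(2)])
   also have "\<dots> <= 1 / (real D / 4) ^ 8"
   proof -
    have "D <= 4 * ?k" using D(1) by linarith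
    then have "real D / 4 <= real ?k" by linarith
    then show ?thesis using D(1) by (intro divide_left_mono power_mono mult_pos_pos zero_less_power) auto
   qed
   finally show "prob {x. mc D x (- int q) = Ww} <= 1 / (real D / 4) ^ 8" .
  qed (simp, measurable)
  then show ?thesis by (simp add: D_def)
 qed
 have p3: "prob {x. P3 x} <= (1 - pW / 2 / 4 ^ (r + 3)) ^ ((16 ^ (r + 1) div n0) div (r + 4))"
 proof -
  have "(64::nat) ^ (r + 2) <= 64 ^ (r + 3)" by (rule power_increasing) auto
  then have "t <= 64 ^ (r + 3)" using t(2) by linarith
  then show ?thesis
   using prob_no_wall[of "r + 3" t D] r(2) unfolding P3_def D_def by (simp add: add.commute[of _ r])
 qed
 have p4: "prob {x. P4 x} <= (real r + 1)\<^sup>2 * ((real r + 1) * R + (real r + 1) * (Z / real r ^ 6) + 1 / real r ^ 8)"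
 proof -
  have "prob {x. P4 x} <= real (card {..<L}) * ((real r + 1) * R + (real r + 1) * (Z / real r ^ 6) + 1 / real r ^ 8)"
   unfolding P4_def R_def
  proof (rule prob_ex)
   have "4 * 64 ^ r + 3 * r + 4 < t" using num unfolding Y by simp
   from occupied_rate[OF r(3) this]
   show "prob {x. mc t x (int i) ~= In} <= (real r + 1) * (real r * (Z / real r ^ 6) + 1 / real r ^ 8)
     + (real r + 1) * (Z / real r ^ 6) + 1 / real r ^ 8" for i
    by simp
  qed (simp, measurable)
  then show ?thesis by (simp add: L_def add.commute)
 qed
 have p5: "prob {x. P5 x} <= (real r + 1)\<^sup>2 * R"
 proof -
  have "prob {x. P5 x} <= real (card {..<L}) * R"
   unfolding P5_def by (rule prob_ex) (simp, measurable, unfold prob_isW, rule rho, simp)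
  then show ?thesis by (simp add: L_def add.commute)
 qed
 have p6: "prob {x. P6 x} <= (real r + 1)\<^sup>2 * R"
 proof -
  have "D + L <= t" using num by simp
  from prob_dying[OF this] have "prob {x. P6 x} <= L * rho (t - D - L)" unfolding P6_def .
  also have "\<dots> <= L * R" by (intro mult_left_mono rho) auto
  finally show ?thesis by (simp add: L_def add.commute)
 qed
 have p7: "prob {x. P7 x} <= ((real r + 1)\<^sup>2 + 2 * real r + 8) * R"
 proof -
  have "2 * D + L + L' + 64 ^ r + 2 * r + 1 < t" using num unfolding L'_def Y by simp
  moreover have "L <= t" using num by simp
  ultimately have c: "2 * D + L + L' + 64 ^ r + 2 * r + 1 < t" "L <= t" by blast+
  from prob_unclean[OF c(1) t(2) c(2)] have "prob {x. P7 x} <= L' * rho (t - D - L)" unfolding P7_def .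
  also have "\<dots> <= L' * R" by (intro mult_left_mono rho) auto
  finally show ?thesis by (simp add: L'_def L_def add_ac)
 qed
 have "prob {x. ~ (\<exists>m c. r + 1 <= m & m <= r + 2 &
   (\<forall>i<(r + 1)\<^sup>2. (F ^^ t) x (int i) = periodic_config (w m) (int i + c)))}
  <= prob {x. P1 x \<or> P2 x \<or> P3 x \<or> P4 x \<or> P5 x \<or> P6 x \<or> P7 x}" (is "prob {x. ~ ?W x} <= _")
 proof (rule prob_le)
  fix x assume x: "x \<in> configs A" and nW: "~ ?W x"
  show "P1 x \<or> P2 x \<or> P3 x \<or> P4 x \<or> P5 x \<or> P6 x \<or> P7 x"
  proof (rule ccontr)
   assume n: "~ ?thesis"
   have "\<exists>m c. r + 1 <= m & m <= r + 2 & (\<forall>i<L. (F ^^ t) x (int i) = periodic_config (w m) (int i + c))"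
   proof -
    have nP: "~ P1 x" "~ P2 x" "~ P3 x" "~ P4 x" "~ P5 x" "~ P6 x" "~ P7 x"
     using n by blast+
    have c1: "4 * 64 ^ r + 2 * r + 4 + 3 * D + L + 2 < t" unfolding Y by (rule budget[OF num])
    have c2: "\<exists>i. 0 < i & i <= r & mc 0 x (int n0 * int i - int q) = In" if q: "q \<in> {1..D}" for q
    proof -
     obtain i where "i \<in> {1..r}" "mc 0 x (int n0 * int i - int q) = In"
      using nP(1) q unfolding P1_def by blast
     then show ?thesis by (intro exI[of _ i]) auto
    qed
    have c3: "mc D x (- int q) ~= Ww" if "q \<in> {1..D}" for q using nP(2) that unfolding P2_def by blast
    have c4: "\<exists>q\<in>{1..D}. isW (mc t x (- int q))" using nP(3) unfolding P3_def by blast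
    have c5: "mc t x (int i) = In" if "i < L" for i using nP(4) that unfolding P4_def by blast
    have c6: "~ isW (mc (t - L) x (int i))" if "i < L" for i using nP(5) that unfolding P5_def by blast
    have c7: "isW (mc (t - q) x (- int q))" if "q \<in> {1..D}" "isW (mc (t - q - L) x (- int q))" for q
     using nP(6) that unfolding P6_def by blast
    have c8: False if "q \<in> {1..D}" "s <= D" "born s x (- int q)" "isW (mc (t - q - L) x (- int q))"
     "t - q - s <= issue n' + L'" "issue n' < t - q - s" for q s n'
     using nP(7) that unfolding P7_def atMost_iff Bex_def by blast
    \<comment> \<open>The distance and birth time of the wall reduce its age to at least t - 2 D; at
      such ages r + 1 or r + 2 instructions have been issued, whence two candidates for the
      word.\<close>
    have c9: "r + 1 <= issued T' & issued T' <= r + 2" if "t - 2 * D <= T'" "T' <= t" for T'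
    proof -
     have "~ T' <= issue r" using that(1) num unfolding issue_def Y by simp
     moreover have "T' <= issue (r + 2)" using that(2) t(2) unfolding issue_def by linarith
     ultimately show ?thesis using issued_le_iff[of T' r] issued_le_iff[of T' "r + 2"] by auto
    qed
    have c10: "spells m (w m)" if "r + 1 <= m" "m <= r + 2" for m
    proof -
     have "m = r + 1 \<or> m = r + 2" using that by linarith
     then show ?thesis using w by auto
    qed
    have c11: "L + 2 * (r + 2) + 4 <= L'" by (simp add: L'_def)
    have c12: "L' + 2 * D <= t" using num unfolding L'_def Y by simp
    show ?thesis
     by (rule window[OF x r(2) c1 c2 c3 c4 c5 c6 c7 c8 _ c9 c10 c11 c12]) auto
   qed
   then show False using nW by (simp add: L_def)
  qed
 qed measurable
 also have "\<dots> <= prob {x. P1 x} + (prob {x. P2 x} + (prob {x. P3 x} + (prob {x. P4 x} + (prob {x. P5 x} +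
   (prob {x. P6 x} + prob {x. P7 x})))))"
 proof -
  have "prob {x. P6 x \<or> P7 x} <= prob {x. P6 x} + prob {x. P7 x}" by (rule prob_disj) measurable
  moreover have "prob {x. P5 x \<or> P6 x \<or> P7 x} <= prob {x. P5 x} + prob {x. P6 x \<or> P7 x}" by (rule prob_disj) measurable
  moreover have "prob {x. P4 x \<or> P5 x \<or> P6 x \<or> P7 x} <= prob {x. P4 x} + prob {x. P5 x \<or> P6 x \<or> P7 x}"
   by (rule prob_disj) measurable
  moreover have "prob {x. P3 x \<or> P4 x \<or> P5 x \<or> P6 x \<or> P7 x} <= prob {x. P3 x} + prob {x. P4 x \<or> P5 x \<or> P6 x \<or> P7 x}"
   by (rule prob_disj) measurable
  moreover have "prob {x. P2 x \<or> P3 x \<or> P4 x \<or> P5 x \<or> P6 x \<or> P7 x} <=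
    prob {x. P2 x} + prob {x. P3 x \<or> P4 x \<or> P5 x \<or> P6 x \<or> P7 x}"
   by (rule prob_disj) measurable
  moreover have "prob {x. P1 x \<or> P2 x \<or> P3 x \<or> P4 x \<or> P5 x \<or> P6 x \<or> P7 x} <=
    prob {x. P1 x} + prob {x. P2 x \<or> P3 x \<or> P4 x \<or> P5 x \<or> P6 x \<or> P7 x}"
   by (rule prob_disj) measurable
  ultimately show ?thesis by linarith
 qed
 also have "\<dots> <= beta r"
  using p1 p2 p3 p4 p5 p6 p7 unfolding beta_def R_def[symmetric] distrib_right by linarith
 finally show ?thesis .
qed

end

end

section \<open>Frequencies\<close>

lemma cyl_open: "open (cyl u)"
proof -
 have "open {x. x \<in> cyl u}"
  by (rule local_open[of "int ` {..<length u}"]) (auto simp: cyl_def)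
 then show ?thesis by simp
qed

lemma cyl_borel [measurable]: "cyl u \<in> sets borel"
 using cyl_open by (rule borel_open)

lemma translate_cyl: "translate c x \<in> cyl u \<longleftrightarrow> (\<forall>j<length u. x (int j + c) = u ! j)"
 by (simp add: cyl_def translate_apply)

lemma measure_periodic:
 assumes "w ~= []" "E \<in> sets borel"
 shows "measure (periodic_measure w) E =
  real (card {i \<in> {..<length w}. translate (int i) (periodic_config w) \<in> E}) / real (length w)"
proof -
 let ?f = "\<lambda>i. (shift ^^ i) (periodic_config w)" and ?U = "uniform_count_measure {..<length w}"
 have sp: "space ?U = {..<length w}" "sets ?U = Pow {..<length w}"
  by (simp_all add: space_uniform_count_measure sets_uniform_count_measure)
 have "measure (periodic_measure w) E = measure ?U (?f -` E \<inter> space ?U)"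
  unfolding periodic_measure_def using assms(2) by (intro measure_distr) (auto simp: measurable_def sp)
 also have "?f -` E \<inter> space ?U = {i \<in> {..<length w}. translate (int i) (periodic_config w) \<in> E}"
  by (auto simp: sp shift_pow)
 also have "measure ?U \<dots> = real (card \<dots>) / real (length w)"
  by (subst measure_uniform_count_measure) auto
 finally show ?thesis .
qed

lemma periodic_config_period: "periodic_config w (i + int (length w)) = periodic_config w i"
 by (simp add: periodic_config_def)

lemma periodic_sum:
 fixes g :: "int => real"
 assumes per: "\<And>i. g (i + int l) = g i"
 shows "(\<Sum>i<l. g (int i + c)) = (\<Sum>i<l. g (int i))"
proof -
 define G where "G c = (\<Sum>i<l. g (int i + c))" for c
 have step: "G (c + 1) = G c" for c
 proof -
  have "G (c + 1) = (\<Sum>i<l. g (int (Suc i) + c))" by (simp add: G_def algebra_simps)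
  also have "\<dots> = (\<Sum>i<Suc l. g (int i + c)) - g c"
   by (subst sum.lessThan_Suc_shift) simp
  also have "\<dots> = G c + g (int l + c) - g c" by (simp add: G_def)
  finally show ?thesis using per[of c] by (simp add: add.commute)
 qed
 have "G c = G 0" for c
 proof (induction c rule: int_induct[where k = 0])
  case (step1 i)
  then show ?case using step[of i] by simp
 next
  case (step2 i)
  then show ?case using step[of "i - 1"] by simp
 qed simp
 then show ?thesis by (simp add: G_def)
qed

text \<open>Complete periods contribute exactly the mean; the error comes from the last, incomplete
  one.\<close>

lemma periodic_average:
 fixes g :: "int => real"
 assumes l: "0 < l" and per: "\<And>i. g (i + int l) = g i" and g: "\<And>i. 0 <= g i" "\<And>i. g i <= 1"
 shows "\<bar>(\<Sum>i<n. g (int i + c)) - n * ((\<Sum>i<l. g (int i)) / l)\<bar> <= l"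
proof -
 define G where "G c = (\<Sum>i<l. g (int i + c))" for c
 have G: "G c = G 0" for c using periodic_sum[of g l c] per by (simp add: G_def)
 define a where "a = G 0 / l"
 have "0 <= G 0" unfolding G_def by (intro sum_nonneg g)
 moreover have "G 0 <= real (card {..<l}) * 1" unfolding G_def by (intro sum_bounded_above g)
 ultimately have a: "0 <= a" "a <= 1" using l by (simp_all add: a_def)
 have "\<bar>(\<Sum>i<n. g (int i + c)) - n * a\<bar> <= l" for c
 proof (induction n arbitrary: c rule: less_induct)
  case (less n)
  show ?case
  proof (cases "n < l")
   case True
   have "0 <= (\<Sum>i<n. g (int i + c))" by (intro sum_nonneg g)
   moreover have "(\<Sum>i<n. g (int i + c)) <= real (card {..<n}) * 1" by (intro sum_bounded_above g)
   moreover have "0 <= n * a" "n * a <= n" using a by (simp_all add: mult_left_le)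
   ultimately show ?thesis using True by simp
  next
   case False
   have split: "(\<Sum>i<l + b. h i) = (\<Sum>i<l. h i) + (\<Sum>i<b. h (l + i))" for b and h :: "nat => real"
    by (induction b) simp_all
   have "(\<Sum>i<n. g (int i + c)) = (\<Sum>i<l. g (int i + c)) + (\<Sum>i<n - l. g (int i + (int l + c)))"
    using split[of "\<lambda>i. g (int i + c)" "n - l"] False by (simp add: add_ac)
   also have "(\<Sum>i<l. g (int i + c)) = l * a" using G[of c] l by (simp add: G_def a_def)
   finally have "(\<Sum>i<n. g (int i + c)) - n * a = (\<Sum>i<n - l. g (int i + (int l + c))) - (n - l) * a"
    using False by (simp add: of_nat_diff algebra_simps)
   then show ?thesis using less.IH[of "n - l" "int l + c"] False l by (simp add: of_nat_diff)
  qed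
 qed
 then show ?thesis by (simp add: a_def G_def)
qed

lemma window_frequency:
 assumes w: "w ~= []" and L: "n + length u <= L" and x: "\<And>i. i < L ==> x (int i) = periodic_config w (int i + c)"
 shows "\<bar>(\<Sum>i<n. indicat_real (cyl u) (translate (int i) x)) - n * measure (periodic_measure w) (cyl u)\<bar> <= length w"
proof -
 define g where "g i = indicat_real (cyl u) (translate i (periodic_config w))" for i
 have "indicat_real (cyl u) (translate (int i) x) = g (int i + c)" if "i < n" for i
 proof -
  have "x (int j + int i) = periodic_config w (int j + (int i + c))" if "j < length u" for j
   using x[of "j + i"] that \<open>i < n\<close> L by (simp add: add_ac)
  then show ?thesis by (simp add: g_def indicator_def translate_cyl)
 qed
 then have "(\<Sum>i<n. indicat_real (cyl u) (translate (int i) x)) = (\<Sum>i<n. g (int i + c))" by simp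
 moreover have "measure (periodic_measure w) (cyl u) = (\<Sum>i<length w. g (int i)) / length w"
  using measure_periodic[OF w cyl_borel] by (simp add: g_def indicator_def sum.If_cases Int_def)
 moreover have "\<bar>(\<Sum>i<n. g (int i + c)) - n * ((\<Sum>i<length w. g (int i)) / length w)\<bar> <= length w"
 proof (rule periodic_average)
  show "g (i + int (length w)) = g i" for i
   unfolding g_def indicator_def translate_cyl
   using periodic_config_period[of w] by (simp flip: add.assoc)
 qed (use w in \<open>auto simp: g_def\<close>)
 ultimately show ?thesis by simp
qed

section \<open>Time on a logarithmic scale\<close>

definition level :: "nat => nat" where
 "level t = (LEAST k. t < 64 ^ Suc k)"

lemma level:
 shows "t < 64 ^ Suc (level t)" "0 < t ==> 64 ^ level t <= t"
proof -
 have "t < 2 ^ Suc t" using less_exp[of "Suc t"] by (rule Suc_lessD)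
 also have "\<dots> <= (64::nat) ^ Suc t" by (rule power_mono) auto
 finally have "t < 64 ^ Suc t" .
 then show "t < 64 ^ Suc (level t)" unfolding level_def by (rule LeastI)
 show "64 ^ level t <= t" if "0 < t"
 proof (cases "level t")
  case (Suc k)
  then have "~ t < 64 ^ Suc k" using not_less_Least[of k "\<lambda>k. t < 64 ^ Suc k"] by (simp add: level_def)
  then show ?thesis using Suc by simp
 qed (use that in simp)
qed

lemma level_eqI: "64 ^ k <= t ==> t < 64 ^ Suc k ==> level t = k"
proof -
 assume k: "64 ^ k <= t" "t < 64 ^ Suc k"
 then have t: "0 < t" using zero_less_power[of "64::nat" k] by linarith
 have l: "(64::nat) ^ k < 64 ^ Suc (level t)" "(64::nat) ^ level t < 64 ^ Suc k"
  using le_less_trans[OF k(1) level(1)] le_less_trans[OF level(2)[OF t] k(2)] .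
 have "k < Suc (level t)" "level t < Suc k"
  by (rule power_less_imp_less_exp[OF _ l(1)], simp) (rule power_less_imp_less_exp[OF _ l(2)], simp)
 then show ?thesis by simp
qed

lemma level_at_top: "filterlim level at_top sequentially"
 unfolding filterlim_at_top
proof
 fix Z
 have "Z <= level t" if "64 ^ Z <= t" for t
 proof -
  have l: "(64::nat) ^ Z < 64 ^ Suc (level t)" using le_less_trans[OF that level(1)] .
  have "Z < Suc (level t)" by (rule power_less_imp_less_exp[OF _ l]) simp
  then show ?thesis by simp
 qed
 then show "\<forall>\<^sub>F t in sequentially. Z <= level t" unfolding eventually_sequentially by blast
qed

context random_automaton
begin

lemma pred_letter [measurable]: "Measurable.pred M (\<lambda>x. (F ^^ t) x i = a)"
proof (rule predI)
 have "(F ^^ t) -` {x. x i \<in> {a}} \<inter> space borel \<in> sets borel"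
  by (rule measurable_sets[OF measurable_iterate site_borel])
 then show "{x. (F ^^ t) x i = a} \<in> sets borel" by (simp add: vimage_def)
qed

text \<open>By stationarity the probability of a cylinder is the expected frequency of its
  occurrences in a window. In a good window this is the frequency in a periodic configuration, up to
  the length of the word divided by n.\<close>

lemma window_average:
 fixes r n t :: nat and u :: "nat list" and w :: "nat => nat list"
 assumes w: "\<And>m. r + 1 <= m ==> m <= r + 2 ==> spells m (w m)" and n: "n + length u <= (r + 1)\<^sup>2" "0 < n"
 defines "W \<equiv> \<lambda>x. \<exists>m c. r + 1 <= m & m <= r + 2 & (\<forall>i<(r + 1)\<^sup>2. (F ^^ t) x (int i) = periodic_config (w m) (int i + c))"
  and "\<phi> \<equiv> \<lambda>m. measure (periodic_measure (w m)) (cyl u)"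
 shows "\<bar>prob {x. (F ^^ t) x \<in> cyl u} - \<phi> (r + 1)\<bar> <= (r + 2) / n + \<bar>\<phi> (r + 1) - \<phi> (r + 2)\<bar> + prob {x. ~ W x}"
proof -
 have cyl_ev: "Measurable.pred M (\<lambda>x. translate (int i) ((F ^^ t) x) \<in> cyl u)" for i
  unfolding translate_cyl by measurable
 have W_ev [measurable]: "Measurable.pred M (\<lambda>x. ~ W x)"
  unfolding W_def by measurable
 define f where "f x = (\<Sum>i<n. indicat_real {x. translate (int i) ((F ^^ t) x) \<in> cyl u} x)" for x
 define \<eta> where "\<eta> = \<bar>\<phi> (r + 1) - \<phi> (r + 2)\<bar>"
 have int_ind: "integrable M (indicat_real {x. P x})" if "Measurable.pred M P" for P
  using eventI[OF that] by (simp add: integrable_indicator_iff emeasure_eq_measure)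
 have f_int: "integrable M f" unfolding f_def by (intro Bochner_Integration.integrable_sum int_ind cyl_ev)
 have f_eq: "(\<integral>x. f x \<partial>M) = n * prob {x. (F ^^ t) x \<in> cyl u}"
 proof -
  have "prob {x. translate (int i) ((F ^^ t) x) \<in> cyl u} = prob {x. (F ^^ t) x \<in> cyl u}" for i
   using prob_translate'[OF cyl_ev[of 0], of "int i"] by (simp add: iterate_translate)
  moreover have "(\<integral>x. f x \<partial>M) = (\<Sum>i<n. prob {x. translate (int i) ((F ^^ t) x) \<in> cyl u})"
   unfolding f_def by (subst Bochner_Integration.integral_sum) (use int_ind[OF cyl_ev] in \<open>auto simp: space_M\<close>)
  ultimately show ?thesis by simp
 qed
 have \<phi>: "0 <= \<phi> m" "\<phi> m <= 1" if m: "r + 1 <= m" "m <= r + 2" for m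
 proof -
  have w0: "w m ~= []" using w[OF m] by (simp add: spells_def)
  have "card {i \<in> {..<length (w m)}. translate (int i) (periodic_config (w m)) \<in> cyl u} <= card {..<length (w m)}"
   by (intro card_mono) auto
  then show "\<phi> m <= 1" unfolding \<phi>_def measure_periodic[OF w0 cyl_borel] using w0 by (simp add: divide_le_eq)
 qed (simp add: \<phi>_def)
 have pw: "\<bar>f x - n * \<phi> (r + 1)\<bar> <= (r + 2) + n * \<eta> + n * indicat_real {x. ~ W x} x" for x
 proof (cases "W x")
  case True
  then obtain m c where m: "r + 1 <= m" "m <= r + 2"
   and x: "\<And>i. i < (r + 1)\<^sup>2 ==> (F ^^ t) x (int i) = periodic_config (w m) (int i + c)" unfolding W_def by blast
  have "\<bar>f x - n * \<phi> m\<bar> <= length (w m)"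
   using window_frequency[OF _ n(1) x] w[OF m] by (simp add: f_def \<phi>_def spells_def indicator_def)
  moreover have "length (w m) <= m" using spells_length[OF w[OF m]] m by simp
  moreover have "\<bar>\<phi> m - \<phi> (r + 1)\<bar> <= \<eta>"
  proof -
   have "m = r + 1 \<or> m = r + 2" using m by linarith
   then show ?thesis by (auto simp: \<eta>_def)
  qed
  then have "\<bar>n * \<phi> m - n * \<phi> (r + 1)\<bar> <= n * \<eta>"
   using mult_left_mono[of "\<bar>\<phi> m - \<phi> (r + 1)\<bar>" \<eta> "real n"] by (simp add: abs_mult flip: right_diff_distrib)
  moreover have "0 <= n * indicat_real {x. ~ W x} x" by simp
  ultimately show ?thesis using m by linarith
 next
  case False
  have "0 <= f x" "f x <= real (card {..<n}) * 1"
   unfolding f_def by (intro sum_nonneg sum_bounded_above; simp add: indicator_def)+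
  moreover have "0 <= n * \<phi> (r + 1)" "n * \<phi> (r + 1) <= n" using \<phi>[of "r + 1"] by (simp_all add: mult_left_le)
  moreover have "0 <= n * \<eta>" by (simp add: \<eta>_def)
  ultimately show ?thesis using False by simp
 qed
 have "\<bar>(\<integral>x. f x \<partial>M) - n * \<phi> (r + 1)\<bar> = \<bar>\<integral>x. (f x - n * \<phi> (r + 1)) \<partial>M\<bar>"
  using f_int by (simp add: prob_space)
 also have "\<dots> <= (\<integral>x. \<bar>f x - n * \<phi> (r + 1)\<bar> \<partial>M)" by (rule integral_abs_bound)
 also have "\<dots> <= (\<integral>x. (r + 2) + n * \<eta> + n * indicat_real {x. ~ W x} x \<partial>M)"
  by (intro integral_mono pw Bochner_Integration.integrable_add integrable_mult_right int_ind[OF W_ev]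
    integrable_abs Bochner_Integration.integrable_diff f_int integrable_const)
 also have "\<dots> = (r + 2) + n * \<eta> + n * prob {x. ~ W x}"
  using int_ind[OF W_ev] prob_space by (simp add: space_M)
 finally have "\<bar>n * (prob {x. (F ^^ t) x \<in> cyl u} - \<phi> (r + 1))\<bar> <= (r + 2) + n * \<eta> + n * prob {x. ~ W x}"
  by (simp add: f_eq right_diff_distrib)
 moreover have "n * ((r + 2) / n + \<eta> + prob {x. ~ W x}) = (r + 2) + n * \<eta> + n * prob {x. ~ W x}"
  using n(2) unfolding distrib_left by (simp del: of_nat_add)
 moreover have "\<bar>n * (prob {x. (F ^^ t) x \<in> cyl u} - \<phi> (r + 1))\<bar> = n * \<bar>prob {x. (F ^^ t) x \<in> cyl u} - \<phi> (r + 1)\<bar>"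
  by (simp add: abs_mult)
 ultimately have "n * \<bar>prob {x. (F ^^ t) x \<in> cyl u} - \<phi> (r + 1)\<bar> <= n * ((r + 2) / n + \<eta> + prob {x. ~ W x})"
  by linarith
 then show ?thesis using n(2) by (simp add: \<eta>_def)
qed

theorem tends_to_words:
 assumes w: "\<And>m. N1 <= m ==> spells m (w m)"
  and close: "(\<lambda>m. measure (periodic_measure (w m)) (cyl u) - measure (periodic_measure (w (Suc m))) (cyl u)) \<longlonglongrightarrow> 0"
 shows "(\<lambda>t. prob {x. (F ^^ t) x \<in> cyl u} - measure (periodic_measure (w (level t))) (cyl u)) \<longlonglongrightarrow> 0"
proof -
 obtain Z N where Z: "0 < Z" "\<And>S y. N <= S ==> prob {x. clr S y x} <= 1 / real S ^ 8"
  "\<And>S y. N <= S ==> prob {x. far S y x} <= Z / real S ^ 6" by (rule far_rate) (rule that, assumption+)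
 define \<phi> where "\<phi> m = measure (periodic_measure (w m)) (cyl u)" for m
 \<comment> \<open>The three errors: word length over window length, difference of the two candidate
   words, probability of a bad window.\<close>
 define a where "a r = (real r + 2) / ((real r + 1)\<^sup>2 - length u) + \<bar>\<phi> (r + 1) - \<phi> (r + 2)\<bar> + beta Z r" for r
 have "(\<lambda>r. \<bar>\<phi> (r + 1) - \<phi> (r + 2)\<bar>) \<longlonglongrightarrow> 0"
  using LIMSEQ_Suc[OF close] tendsto_rabs_zero_iff[of "\<lambda>r. \<phi> (r + 1) - \<phi> (r + 2)" sequentially] by (simp add: \<phi>_def)
 moreover have "(\<lambda>r. (real r + 2) / ((real r + 1)\<^sup>2 - length u)) \<longlonglongrightarrow> 0" by real_asymp
 ultimately have "a \<longlonglongrightarrow> 0 + 0 + 0" unfolding a_def[abs_def] by (intro tendsto_add beta_tendsto[OF Z(2,3)])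
 then have a0: "a \<longlonglongrightarrow> 0" by simp
 have "\<forall>\<^sub>F r in sequentially. 5 * 64 ^ r + 8 * 16 ^ (r + 1) + 100 * (real r + 2)\<^sup>2 < 64 ^ (r + 1)" by real_asymp
 then have "\<forall>\<^sub>F r in sequentially. 5 * 64 ^ r + 8 * 16 ^ (r + 1) + 100 * (r + 2)\<^sup>2 < (64::nat) ^ (r + 1)"
 proof eventually_elim
  case (elim r)
  then have "real (5 * 64 ^ r + 8 * 16 ^ (r + 1) + 100 * (r + 2)\<^sup>2) < real (64 ^ (r + 1))" by (simp add: add.commute)
  then show ?case unfolding of_nat_less_iff .
 qed
 then have big: "\<forall>\<^sub>F r in sequentially. r >= 1 & r >= e & r >= N & r >= N1 & length u < (r + 1)\<^sup>2 &
   5 * 64 ^ r + 8 * 16 ^ (r + 1) + 100 * (r + 2)\<^sup>2 < (64::nat) ^ (r + 1)"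
  using eventually_ge_at_top[of 1] eventually_ge_at_top[of e] eventually_ge_at_top[of N] eventually_ge_at_top[of N1]
   eventually_ge_at_top[of "length u"]
 proof eventually_elim
  case (elim r)
  have "r + 1 <= (r + 1)\<^sup>2" by (simp add: power2_eq_square)
  then show ?case using elim by linarith
 qed
 have est: "\<bar>prob {x. (F ^^ t) x \<in> cyl u} - \<phi> (r + 1)\<bar> <= a r"
  if r: "r >= 1" "r >= e" "r >= N" "r >= N1" "length u < (r + 1)\<^sup>2"
   "5 * 64 ^ r + 8 * 16 ^ (r + 1) + 100 * (r + 2)\<^sup>2 < (64::nat) ^ (r + 1)" and t: "level t = r + 1" for r t
 proof -
  have t1: "t < 64 ^ (r + 2)" using level(1)[of t] t by simp
  have "level 0 = 0" unfolding level_def by (rule Least_eq_0) simp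
  then have "t ~= 0" using t by (cases "t = 0") simp_all
  then have t2: "64 ^ (r + 1) <= t" using level(2)[of t] t by simp
  have "\<bar>prob {x. (F ^^ t) x \<in> cyl u} - \<phi> (r + 1)\<bar> <= (r + 2) / real ((r + 1)\<^sup>2 - length u) + \<bar>\<phi> (r + 1) - \<phi> (r + 2)\<bar>
   + prob {x. ~ (\<exists>m c. r + 1 <= m & m <= r + 2 & (\<forall>i<(r + 1)\<^sup>2. (F ^^ t) x (int i) = periodic_config (w m) (int i + c)))}"
   unfolding \<phi>_def by (rule window_average) (use r w in auto)
  also have "\<dots> <= (r + 2) / real ((r + 1)\<^sup>2 - length u) + \<bar>\<phi> (r + 1) - \<phi> (r + 2)\<bar> + beta Z r"
   by (intro add_left_mono window_prob[of N Z, OF Z(2,3) r(1-3) r(6) t2 t1] w) (use r in auto)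
  also have "\<dots> = a r" using r(5) by (simp add: a_def of_nat_diff add.commute)
  finally show ?thesis .
 qed
 have fl: "filterlim (\<lambda>t. level t - 1) at_top sequentially"
  using filterlim_compose[OF filterlim_minus_const_nat_at_top[of 1] level_at_top] by simp
 have al: "(\<lambda>t. a (level t - 1)) \<longlonglongrightarrow> 0" by (rule filterlim_compose[OF a0 fl])
 note bl = eventually_compose_filterlim[OF big fl]
 have "\<forall>\<^sub>F t in sequentially. \<bar>prob {x. (F ^^ t) x \<in> cyl u} - \<phi> (level t)\<bar> <= a (level t - 1)"
  using bl
 proof eventually_elim
  case (elim t)
  define r where "r = level t - 1"
  note r = elim[folded r_def]
  have l: "level t = r + 1" using r[THEN conjunct1] unfolding r_def by linarith
  have "\<bar>prob {x. (F ^^ t) x \<in> cyl u} - \<phi> (r + 1)\<bar> <= a r"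
   by (rule est[OF _ _ _ _ _ _ l]) (use r in blast)+
  then show ?case unfolding r_def[symmetric] by (simp only: l)
 qed
 then show ?thesis unfolding \<phi>_def by (intro Lim_null_comparison[OF _ al]) simp
qed

end

section \<open>Invariant measures and the weak* topology\<close>

lemma inv_stationary: "\<mu> \<in> inv_measures A ==> stationary \<mu>"
 by (auto simp: inv_measures_def stationary_def stationary_axioms_def)

lemma configs_mono: "B \<subseteq> A ==> configs B \<subseteq> configs A"
 by (auto simp: configs_def)

lemma inv_measures_mono: "B \<subseteq> A ==> inv_measures B \<subseteq> inv_measures A"
 unfolding inv_measures_def using configs_mono by (blast intro: eventually_mono)

lemma configs_borel: "configs A \<in> sets borel"
proof -
 have "configs A = (\<Inter>i. {x. x i \<in> A})" by (auto simp: configs_def)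
 then show ?thesis using site_borel by (auto intro!: sets.countable_INT'')
qed

lemma inv_null:
 assumes "\<mu> \<in> inv_measures B" "u \<notin> lists B"
 shows "measure \<mu> (cyl u) = 0"
proof -
 interpret stationary \<mu> using assms(1) by (rule inv_stationary)
 obtain i where "i < length u" "u ! i \<notin> B" using assms(2) by (auto simp: in_lists_conv_set in_set_conv_nth)
 then have no: "x \<notin> cyl u" if x: "x \<in> configs B" for x
 proof -
  have "x (int i) \<in> B" using x by (simp add: configs_def)
  then show ?thesis using \<open>i < length u\<close> \<open>u ! i \<notin> B\<close> unfolding cyl_def by auto
 qed
 have "AE x in \<mu>. x \<in> configs B" using assms(1) by (simp add: inv_measures_def)
 then have "AE x in \<mu>. x \<notin> cyl u" by (rule eventually_mono) (rule no)
 then show ?thesis by (subst (asm) AE_iff_measurable[of "cyl u"]) (auto simp: space_M sets_M cyl_borel measure_def)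
qed

section \<open>Symmetric windows, cylinders and Borel sets\<close>

definition frame :: "nat => config => config set" where
 "frame n x = {y. \<forall>i\<in>{- int n..int n}. y i = x i}"

definition window_word :: "nat => config => nat list" where
 "window_word n x = map (\<lambda>j. x (int j - int n)) [0..<2 * n + 1]"

lemma length_window_word [simp]: "length (window_word n x) = 2 * n + 1"
 by (simp add: window_word_def)

lemma nth_window_word: "j < 2 * n + 1 ==> window_word n x ! j = x (int j - int n)"
 unfolding window_word_def by (subst nth_map_upt) auto

lemma frame_cyl: "frame n x = {y. translate (- int n) y \<in> cyl (window_word n x)}"
proof -
 have "(\<forall>i\<in>{- int n..int n}. Q i) \<longleftrightarrow> (\<forall>j<2 * n + 1. Q (int j - int n))" for Q
 proof (intro iffI ballI allI impI)
  fix i assume a: "\<forall>j<2 * n + 1. Q (int j - int n)" "i \<in> {- int n..int n}"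
  then have "nat (i + int n) < 2 * n + 1" by auto
  then have "Q (int (nat (i + int n)) - int n)" using a(1) by blast
  then show "Q i" using a(2) by simp
 qed auto
 then show ?thesis by (auto simp: frame_def translate_cyl nth_window_word)
qed

lemma frame_eq_iff: "y \<in> frame n x \<longleftrightarrow> window_word n y = window_word n x"
 unfolding frame_cyl by (auto simp: translate_cyl list_eq_iff_nth_eq nth_window_word)

lemma frame_open: "open (frame n x)"
proof -
 have "open {y. y \<in> frame n x}"
  by (rule local_open[of "{- int n..int n}"]) (auto simp: frame_def)
 then show ?thesis by simp
qed

lemma (in stationary) prob_frame: "prob (frame n x) = prob (cyl (window_word n x))"
 unfolding frame_cyl using prob_translate[of "\<lambda>y. y \<in> cyl (window_word n x)" "- int n"] cyl_borel by simp

lemma open_contains_frame: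
 assumes "open U" "x \<in> U"
 obtains n where "frame n x \<subseteq> U"
proof -
 have "openin (product_topology (\<lambda>i. euclidean) UNIV) U" using assms(1) by (simp add: euclidean_product_topology)
 from product_topology_open_contains_basis[OF this assms(2)] obtain X
  where X: "x \<in> Pi\<^sub>E UNIV X" "finite {i. X i ~= topspace euclidean}" "Pi\<^sub>E UNIV X \<subseteq> U" by blast
 let ?I = "{i. X i ~= topspace (euclidean :: nat topology)}"
 define n where "n = Max (insert 0 ((\<lambda>i. nat \<bar>i\<bar>) ` ?I))"
 have n: "nat \<bar>i\<bar> <= n" if "i \<in> ?I" for i
  unfolding n_def using X(2) that by (intro Max_ge) auto
 have "frame n x \<subseteq> Pi\<^sub>E UNIV X"
 proof
  fix y assume y: "y \<in> frame n x"
  have "y i \<in> X i" for i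
  proof (cases "i \<in> ?I")
   case True
   have "i \<in> {- int n..int n}" using n[OF True] unfolding atLeastAtMost_iff by linarith
   then have "y i = x i" using y by (simp add: frame_def)
   then show ?thesis using X(1) by (auto simp: PiE_iff)
  qed auto
  then show "y \<in> Pi\<^sub>E UNIV X" by (auto simp: PiE_iff)
 qed
 then have "frame n x \<subseteq> U" using X(3) by (rule order_trans)
 then show ?thesis by (rule that)
qed

lemma borel_frames: "sets (borel :: config measure) = sigma_sets UNIV (insert {} {frame n x | n x. True})"
proof
 show "sigma_sets UNIV (insert {} {frame n x | n x. True}) \<subseteq> sets borel"
  using sets.sigma_sets_subset[of "insert {} {frame n x | n x. True}" borel] borel_open[OF frame_open] by auto
 have "U \<in> sigma_sets UNIV (insert {} {frame n x | n x. True})" if U: "open U" for U :: "config set"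
 proof -
  let ?E = "{frame n x | n x. frame n x \<subseteq> U}"
  have "?E \<subseteq> (\<lambda>(n, u). {y. translate (- int n) y \<in> cyl u}) ` UNIV"
  by (auto simp: frame_cyl)
  then have c: "countable ?E" by (rule countable_subset) simp
  have "\<Union>?E = U"
  proof
   show "U \<subseteq> \<Union>?E"
   proof
    fix x assume "x \<in> U"
    then obtain n where "frame n x \<subseteq> U" by (rule open_contains_frame[OF U])
    moreover have "x \<in> frame n x" by (simp add: frame_def)
    ultimately show "x \<in> \<Union>?E" by blast
   qed
  qed blast
  moreover have "\<Union>?E \<in> sigma_sets UNIV (insert {} {frame n x | n x. True})"
   by (rule sigma_sets_UNION[OF c]) (auto intro!: sigma_sets.Basic)
  ultimately show ?thesis by simp
 qed
 then have "sigma_sets UNIV {U :: config set. open U} \<subseteq> sigma_sets UNIV (insert {} {frame n x | n x. True})"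
  by (intro sigma_sets_mono) auto
 then show "sets borel \<subseteq> sigma_sets UNIV (insert {} {frame n x | n x. True})"
  by (simp add: borel_def)
qed

text \<open>Stationarity moves the cylinders based at 0 to symmetric windows. These are nested or
  disjoint, hence closed under intersection, and they generate the Borel sets.\<close>

lemma stationary_unique:
 assumes "stationary \<mu>" "stationary \<nu>" and eq: "\<And>u. measure \<mu> (cyl u) = measure \<nu> (cyl u)"
 shows "\<mu> = \<nu>"
proof -
 interpret M: stationary \<mu> by fact
 interpret N: stationary \<nu> by fact
 show ?thesis
 proof (rule measure_eqI_generator_eq[where \<Omega> = UNIV and E = "insert {} {frame n x | n x. True}" and A = "\<lambda>i. frame 0 (\<lambda>_. i)"])
  show "Int_stable (insert {} {frame n x | n x. True})"
  proof (rule Int_stableI)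
   have le: "frame n x \<inter> frame m y \<in> insert {} {frame n x | n x. True}" if "n <= m" for n m x y
   proof (cases "frame n x \<inter> frame m y = {}")
    case False
    then obtain z where z: "z \<in> frame n x" "z \<in> frame m y" by blast
    have "frame m y \<subseteq> frame n x"
    proof
     fix v assume v: "v \<in> frame m y"
     have "v i = x i" if i: "i \<in> {- int n..int n}" for i
     proof -
      have "i \<in> {- int m..int m}" using i \<open>n <= m\<close> by auto
      then have "v i = y i" "z i = y i" using v z(2) by (simp_all add: frame_def)
      moreover have "z i = x i" using z(1) i by (simp add: frame_def)
      ultimately show ?thesis by simp
     qed
     then show "v \<in> frame n x" by (simp add: frame_def)
    qed
    then have "frame n x \<inter> frame m y = frame m y" by blast
    then show ?thesis by blast
   qed simp
   fix a b :: "config set"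
   assume "a \<in> insert {} {frame n x | n x. True}" "b \<in> insert {} {frame n x | n x. True}"
   then consider "a = {} \<or> b = {}" | n x m y where "a = frame n x" "b = frame m y" by blast
   then show "a \<inter> b \<in> insert {} {frame n x | n x. True}"
   proof cases
    case 2
    then show ?thesis using le[of n m x y] le[of m n y x] by (cases "n <= m") (simp_all add: Int_commute)
   qed auto
  qed
  show "emeasure \<mu> X = emeasure \<nu> X" if "X \<in> insert {} {frame n x | n x. True}" for X
   using that eq by (auto simp: M.emeasure_eq_measure N.emeasure_eq_measure M.prob_frame N.prob_frame)
  show "sets \<mu> = sigma_sets UNIV (insert {} {frame n x | n x. True})"
   "sets \<nu> = sigma_sets UNIV (insert {} {frame n x | n x. True})"
   by (simp_all add: M.sets_M N.sets_M borel_frames)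
  show "(\<Union>i. frame 0 (\<lambda>_. i)) = UNIV" by (auto simp: frame_def)
 qed auto
qed

lemma compact_configs: "finite A ==> compact (configs A)"
proof -
 assume "finite A"
 then have "compactin (product_topology (\<lambda>i :: int. euclidean) UNIV) (Pi\<^sub>E UNIV (\<lambda>i. A))"
  by (simp add: compactin_PiE finite_imp_compact)
 moreover have "Pi\<^sub>E UNIV (\<lambda>i. A) = configs A" by (auto simp: configs_def PiE_iff)
 ultimately show ?thesis by (simp add: euclidean_product_topology)
qed

lemma uniform_on_configs:
 fixes f :: "config => real"
 assumes A: "finite A" and f: "continuous_on (configs A) f" and \<epsilon>: "0 < \<epsilon>"
 obtains n where "\<And>x y. x \<in> configs A ==> y \<in> configs A ==> y \<in> frame n x ==> \<bar>f y - f x\<bar> < \<epsilon>"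
proof -
 have "\<exists>n. \<forall>y\<in>configs A. y \<in> frame n x --> \<bar>f y - f x\<bar> < \<epsilon> / 2" if x: "x \<in> configs A" for x
 proof -
  have "open (ball (f x) (\<epsilon> / 2))" by simp
  with f obtain T where T: "open T" "T \<inter> configs A = f -` ball (f x) (\<epsilon> / 2) \<inter> configs A"
   unfolding continuous_on_open_invariant by blast
  have "x \<in> T" using T(2) x \<epsilon> by auto
  then obtain n where n: "frame n x \<subseteq> T" by (rule open_contains_frame[OF T(1)])
  have "\<bar>f y - f x\<bar> < \<epsilon> / 2" if y: "y \<in> configs A" "y \<in> frame n x" for y
  proof -
   have "y \<in> f -` ball (f x) (\<epsilon> / 2) \<inter> configs A" using n y T(2) by blast
   then show ?thesis by (simp add: dist_real_def abs_minus_commute)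
  qed
  then show ?thesis by blast
 qed
 then obtain N where N: "\<And>x y. x \<in> configs A ==> y \<in> configs A ==> y \<in> frame (N x) x ==> \<bar>f y - f x\<bar> < \<epsilon> / 2" by metis
 have "configs A \<subseteq> (\<Union>x\<in>configs A. frame (N x) x)" by (auto simp: frame_def)
 then obtain X where X: "X \<subseteq> configs A" "finite X" "configs A \<subseteq> (\<Union>x\<in>X. frame (N x) x)"
  by (rule compactE_image[OF compact_configs[OF A], rotated]) (auto intro: frame_open)
 define n where "n = Max (insert 0 (N ` X))"
 show ?thesis
 proof (rule that[of n])
  fix x y assume x: "x \<in> configs A" and y: "y \<in> configs A" "y \<in> frame n x"
  obtain z where z: "z \<in> X" "x \<in> frame (N z) z" using X x by blast
  have "N z <= n" unfolding n_def using X z by (intro Max_ge) auto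
  then have "y \<in> frame (N z) z" using y(2) z(2) by (auto simp: frame_def)
  then have "\<bar>f y - f z\<bar> < \<epsilon> / 2" "\<bar>f x - f z\<bar> < \<epsilon> / 2" using N z X x y by blast+
  then show "\<bar>f y - f x\<bar> < \<epsilon>" by linarith
 qed
qed

subsection \<open>Neighbourhoods\<close>

lemma integral_configs:
 assumes \<mu>: "\<mu> \<in> inv_measures A" and f: "f \<in> borel_measurable borel"
 shows "set_lebesgue_integral \<mu> (configs A) f = (\<integral>x. f x \<partial>\<mu>)"
proof -
 interpret stationary \<mu> using \<mu> by (rule inv_stationary)
 have AE: "AE x in \<mu>. x \<in> configs A" using \<mu> by (simp add: inv_measures_def)
 show ?thesis
  unfolding set_lebesgue_integral_def
 proof (rule integral_cong_AE)
  show "AE x in \<mu>. indicator (configs A) x *\<^sub>R f x = f x" using AE by eventually_elim simp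
 qed (use f configs_borel in \<open>auto simp: measurable_M intro!: borel_measurable_scaleR borel_measurable_indicator\<close>)
qed

lemma openin_weak_star_cyl:
 assumes "open V"
 shows "openin (weak_star A) {\<mu> \<in> inv_measures A. measure \<mu> (cyl u) \<in> V}"
proof -
 have c: "continuous_on (configs A) (indicat_real (cyl u))"
  by (rule continuous_on_subset[OF local_continuous[of "int ` {..<length u}"]]) (auto simp: indicator_def cyl_def)
 have "set_lebesgue_integral \<mu> (configs A) (indicat_real (cyl u)) = measure \<mu> (cyl u)" if \<mu>: "\<mu> \<in> inv_measures A" for \<mu>
 proof -
  interpret stationary \<mu> using \<mu> by (rule inv_stationary)
  show ?thesis by (subst integral_configs[OF \<mu>]) (auto simp: space_M cyl_borel)
 qed
 then have "{\<mu> \<in> inv_measures A. measure \<mu> (cyl u) \<in> V} =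
   {\<mu> \<in> inv_measures A. set_lebesgue_integral \<mu> (configs A) (indicat_real (cyl u)) \<in> V}" by auto
 then show ?thesis
  unfolding weak_star_def using c assms
  by (intro topology_generated_by_Basis) blast
qed

text \<open>These conditions describe a neighbourhood base of the weak* topology, by
  \<open>openin_close\<close> and \<open>weak_star_nbhd\<close>. Unlike the metric they are
  convenient while both alphabets are in play.\<close>

definition close :: "nat set => nat => real => config measure => config measure => bool" where
 "close A n \<delta> \<mu> \<nu> \<longleftrightarrow> (\<forall>u\<in>lists A. length u <= n --> \<bar>measure \<mu> (cyl u) - measure \<nu> (cyl u)\<bar> < \<delta>)"

lemma close_mono: "close A n \<delta> \<mu> \<nu> ==> m <= n ==> \<delta> <= \<delta>' ==> close A m \<delta>' \<mu> \<nu>"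
 unfolding close_def by (meson order_trans less_le_trans)

lemma close_sym: "close A n \<delta> \<mu> \<nu> \<longleftrightarrow> close A n \<delta> \<nu> \<mu>"
 by (simp add: close_def abs_minus_commute)

lemma close_trans: "close A n \<delta> \<mu> \<nu> ==> close A n \<delta>' \<nu> \<kappa> ==> close A n (\<delta> + \<delta>') \<mu> \<kappa>"
 unfolding close_def by force

lemma finite_short: "finite A ==> finite {u \<in> lists A. length u <= n}"
 using finite_lists_length_le[of A n] by (rule back_subst) (auto simp: in_lists_conv_set)

lemma openin_close:
 assumes "finite A"
 shows "openin (weak_star A) {\<mu> \<in> inv_measures A. close A n \<delta> \<mu> \<nu>}"
proof -
 let ?S = "{u \<in> lists A. length u <= n}"
 let ?V = "\<lambda>u. {\<mu> \<in> inv_measures A. measure \<mu> (cyl u) \<in> ball (measure \<nu> (cyl u)) \<delta>}"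
 have "openin (weak_star A) (\<Inter>u\<in>?S. ?V u)"
  using finite_short[OF assms, of n] by (intro openin_INT2 openin_weak_star_cyl) (auto intro: exI[of _ "[]"])
 moreover have "(\<Inter>u\<in>?S. ?V u) = {\<mu> \<in> inv_measures A. close A n \<delta> \<mu> \<nu>}"
 proof -
  have "[] \<in> ?S" by simp
  then show ?thesis by (auto simp: close_def dist_real_def abs_minus_commute simp del: lists.Nil)
 qed
 ultimately show ?thesis by simp
qed

lemma integral_close:
 fixes f :: "config => real"
 assumes A: "finite A" and f: "continuous_on (configs A) f" and \<epsilon>: "0 < \<epsilon>"
 obtains n \<delta> where "0 < \<delta>" "\<And>\<mu> \<nu>. \<mu> \<in> inv_measures A ==> \<nu> \<in> inv_measures A ==> close A n \<delta> \<mu> \<nu> ==>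
  \<bar>set_lebesgue_integral \<mu> (configs A) f - set_lebesgue_integral \<nu> (configs A) f\<bar> < \<epsilon>"
proof -
 obtain n where n: "\<And>x y. x \<in> configs A ==> y \<in> configs A ==> y \<in> frame n x ==> \<bar>f y - f x\<bar> < \<epsilon> / 3"
  using uniform_on_configs[OF A f, of "\<epsilon> / 3"] \<epsilon> by auto
 let ?W = "{u \<in> lists A. length u = 2 * n + 1}"
 \<comment> \<open>A representative showing u in the window; outside, the first letter of u is
   repeated, which keeps the configuration in \<open>configs A\<close>.\<close>
 define x where "x u = (\<lambda>i. if i \<in> {- int n..int n} then u ! nat (i + int n) else hd u)" for u :: "nat list"
 have W: "finite ?W" using A by (intro finite_subset[OF _ finite_short[OF A, of "2 * n + 1"]]) auto
 have x: "x u \<in> configs A" "window_word n (x u) = u" if u: "u \<in> ?W" for u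
 proof -
  have "u ~= []" using u by auto
  then show "x u \<in> configs A"
   using u by (auto simp: configs_def x_def in_lists_conv_set intro!: nth_mem)
  show "window_word n (x u) = u"
   using u by (intro nth_equalityI) (auto simp: nth_window_word x_def)
 qed
 define g where "g y = (\<Sum>u\<in>?W. f (x u) * indicat_real (frame n (x u)) y)" for y
 have g_eq: "g y = f (x (window_word n y))" if y: "y \<in> configs A" for y
 proof -
  have w: "window_word n y \<in> ?W" using y by (auto simp: configs_def window_word_def)
  have "g y = (\<Sum>u\<in>?W. if u = window_word n y then f (x u) else 0)"
   unfolding g_def by (intro sum.cong refl) (auto simp: indicator_def frame_eq_iff x(2))
  then show ?thesis using w W by simp
 qed
 have fg: "\<bar>f y - g y\<bar> <= \<epsilon> / 3" if y: "y \<in> configs A" for y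
 proof -
  have w: "window_word n y \<in> ?W" using y by (auto simp: configs_def window_word_def)
  then have "y \<in> frame n (x (window_word n y))" by (simp add: frame_eq_iff x(2))
  then show ?thesis using n[OF x(1)[OF w] y] by (simp add: g_eq[OF y])
 qed
 define c where "c = (\<Sum>u\<in>?W. \<bar>f (x u)\<bar>)"
 have c0: "0 <= c" by (simp add: c_def sum_nonneg)
 define \<delta> where "\<delta> = \<epsilon> / (3 * (c + 1))"
 have \<delta>: "0 < \<delta>" "c * \<delta> < \<epsilon> / 3" using c0 \<epsilon> by (simp_all add: \<delta>_def field_simps)
 have ind: "(\<lambda>y. indicat_real (configs A) y *\<^sub>R f y) \<in> borel_measurable borel"
  by (rule borel_measurable_continuous_on_indicator[OF configs_borel f])
 obtain b where b: "\<And>y. y \<in> configs A ==> \<bar>f y\<bar> <= b"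
  using compact_imp_bounded[OF compact_continuous_image[OF f compact_configs[OF A]]]
  unfolding bounded_iff by (auto simp: real_norm_def)
 have est: "\<bar>set_lebesgue_integral \<mu> (configs A) f - (\<Sum>u\<in>?W. f (x u) * measure \<mu> (cyl u))\<bar> <= \<epsilon> / 3"
  if \<mu>: "\<mu> \<in> inv_measures A" for \<mu>
 proof -
  interpret stationary \<mu> using \<mu> by (rule inv_stationary)
  have AE: "AE y in \<mu>. y \<in> configs A" using \<mu> by (simp add: inv_measures_def)
  have fr: "frame n z \<in> events" for z using borel_open[OF frame_open] by (simp add: sets_M)
  have ig: "integrable \<mu> g" unfolding g_def
   using fr by (intro Bochner_Integration.integrable_sum integrable_mult_right integrable_real_indicator) (simp_all add: emeasure_eq_measure)
  have if': "integrable \<mu> (\<lambda>y. indicat_real (configs A) y *\<^sub>R f y)"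
   by (rule integrable_const_bound[of _ b]) (use AE ind b in \<open>auto simp: measurable_M elim!: eventually_mono\<close>)
  have "(\<integral>y. g y \<partial>\<mu>) = (\<Sum>u\<in>?W. f (x u) * prob (frame n (x u)))"
   unfolding g_def using fr by (subst Bochner_Integration.integral_sum)
    (auto simp: space_M emeasure_eq_measure intro!: integrable_mult_right integrable_real_indicator)
  also have "\<dots> = (\<Sum>u\<in>?W. f (x u) * measure \<mu> (cyl u))"
   by (intro sum.cong refl) (simp add: prob_frame x(2))
  finally have "set_lebesgue_integral \<mu> (configs A) f - (\<Sum>u\<in>?W. f (x u) * measure \<mu> (cyl u)) =
    (\<integral>y. indicat_real (configs A) y *\<^sub>R f y - g y \<partial>\<mu>)"
   unfolding set_lebesgue_integral_def using if' ig by simp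
  also have "\<bar>\<dots>\<bar> <= (\<integral>y. \<bar>indicat_real (configs A) y *\<^sub>R f y - g y\<bar> \<partial>\<mu>)" by (rule integral_abs_bound)
  also have "\<dots> <= (\<integral>y. \<epsilon> / 3 \<partial>\<mu>)"
  proof (rule integral_mono_AE)
   show "AE y in \<mu>. \<bar>indicat_real (configs A) y *\<^sub>R f y - g y\<bar> <= \<epsilon> / 3"
    using AE by eventually_elim (use fg in simp)
  qed (use if' ig in auto)
  also have "\<dots> = \<epsilon> / 3" using prob_space by simp
  finally show ?thesis .
 qed
 show ?thesis
 proof (rule that[OF \<delta>(1), of "2 * n + 1"])
  fix \<mu> \<nu> assume \<mu>: "\<mu> \<in> inv_measures A" and \<nu>: "\<nu> \<in> inv_measures A" and cl: "close A (2 * n + 1) \<delta> \<mu> \<nu>"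
  have "\<bar>(\<Sum>u\<in>?W. f (x u) * measure \<mu> (cyl u)) - (\<Sum>u\<in>?W. f (x u) * measure \<nu> (cyl u))\<bar>
    = \<bar>\<Sum>u\<in>?W. f (x u) * (measure \<mu> (cyl u) - measure \<nu> (cyl u))\<bar>"
   by (simp add: sum_subtractf right_diff_distrib)
  also have "\<dots> <= (\<Sum>u\<in>?W. \<bar>f (x u)\<bar> * \<delta>)"
  proof (rule order_trans[OF sum_abs], rule sum_mono)
   fix u assume "u \<in> ?W"
   then have "\<bar>measure \<mu> (cyl u) - measure \<nu> (cyl u)\<bar> <= \<delta>"
    using cl unfolding close_def by (intro less_imp_le) auto
   then show "\<bar>f (x u) * (measure \<mu> (cyl u) - measure \<nu> (cyl u))\<bar> <= \<bar>f (x u)\<bar> * \<delta>"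
    by (simp add: abs_mult mult_left_mono)
  qed
  also have "\<dots> = c * \<delta>" by (simp add: c_def sum_distrib_right)
  finally show "\<bar>set_lebesgue_integral \<mu> (configs A) f - set_lebesgue_integral \<nu> (configs A) f\<bar> < \<epsilon>"
   using est[OF \<mu>] est[OF \<nu>] \<delta>(2) by linarith
 qed
qed

lemma weak_star_nbhd:
 assumes A: "finite A" and U: "openin (weak_star A) U" "\<nu> \<in> U"
 obtains n \<delta> where "0 < \<delta>" "\<And>\<mu>. \<mu> \<in> inv_measures A ==> close A n \<delta> \<mu> \<nu> ==> \<mu> \<in> U"
proof -
 let ?G = "{{\<mu> \<in> inv_measures A. set_lebesgue_integral \<mu> (configs A) f \<in> U} | (f :: config => real) U.
    continuous_on (configs A) f & open U}"
 have "generate_topology_on ?G U" using U(1) unfolding weak_star_def openin_topology_generated_by_iff .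
 then have "\<nu> \<in> U --> (\<exists>n \<delta>. 0 < \<delta> & (\<forall>\<mu>\<in>inv_measures A. close A n \<delta> \<mu> \<nu> --> \<mu> \<in> U))"
 proof (induction rule: generate_topology_on.induct)
  case (Int a b)
  show ?case
  proof
   assume "\<nu> \<in> a \<inter> b"
   then obtain n \<delta> m \<delta>' where 1: "0 < \<delta>" "\<forall>\<mu>\<in>inv_measures A. close A n \<delta> \<mu> \<nu> --> \<mu> \<in> a"
    and 2: "0 < \<delta>'" "\<forall>\<mu>\<in>inv_measures A. close A m \<delta>' \<mu> \<nu> --> \<mu> \<in> b"
    using Int by blast
   have "close A n \<delta> \<mu> \<nu> & close A m \<delta>' \<mu> \<nu>" if "close A (max n m) (min \<delta> \<delta>') \<mu> \<nu>" for \<mu>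
    using that by (auto intro: close_mono)
   then show "\<exists>n \<delta>. 0 < \<delta> & (\<forall>\<mu>\<in>inv_measures A. close A n \<delta> \<mu> \<nu> --> \<mu> \<in> a \<inter> b)"
    using 1 2 by (intro exI[of _ "max n m"] exI[of _ "min \<delta> \<delta>'"]) auto
  qed
 next
  case (UN K)
  show ?case
  using UN by blast
 next
  case (Basis s)
  then obtain f :: "config => real" and V where s: "s = {\<mu> \<in> inv_measures A. set_lebesgue_integral \<mu> (configs A) f \<in> V}"
   and f: "continuous_on (configs A) f" and V: "open V" by blast
  show ?case
  proof
   assume \<nu>: "\<nu> \<in> s"
   then have "set_lebesgue_integral \<nu> (configs A) f \<in> V" using s by simp
   then obtain \<epsilon> where \<epsilon>: "0 < \<epsilon>" "ball (set_lebesgue_integral \<nu> (configs A) f) \<epsilon> \<subseteq> V"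
    by (rule openE[OF V])
   obtain n \<delta> where *: "0 < \<delta>" "\<And>\<mu> \<nu>. \<mu> \<in> inv_measures A ==> \<nu> \<in> inv_measures A ==> close A n \<delta> \<mu> \<nu> ==>
     \<bar>set_lebesgue_integral \<mu> (configs A) f - set_lebesgue_integral \<nu> (configs A) f\<bar> < \<epsilon>"
    by (rule integral_close[OF A f \<epsilon>(1)]) (rule that, assumption+)
   have "\<mu> \<in> s" if "\<mu> \<in> inv_measures A" "close A n \<delta> \<mu> \<nu>" for \<mu>
   proof -
    have "set_lebesgue_integral \<mu> (configs A) f \<in> ball (set_lebesgue_integral \<nu> (configs A) f) \<epsilon>"
     using *(2)[OF that(1) _ that(2)] \<nu> s by (simp add: dist_real_def abs_minus_commute)
    then show ?thesis using s that(1) \<epsilon>(2) by blast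
   qed
   then show "\<exists>n \<delta>. 0 < \<delta> & (\<forall>\<mu>\<in>inv_measures A. close A n \<delta> \<mu> \<nu> --> \<mu> \<in> s)"
    using *(1) by blast
  qed
 qed auto
 then obtain n \<delta> where "0 < \<delta>" "\<forall>\<mu>\<in>inv_measures A. close A n \<delta> \<mu> \<nu> --> \<mu> \<in> U" using U(2) by blast
 then show ?thesis by (intro that[of \<delta> n]) auto
qed

section \<open>Limit sets\<close>

lemma periodic_measure_inv:
 assumes w: "w \<in> lists B" "w ~= []"
 shows "periodic_measure w \<in> inv_measures B"
proof -
 let ?U = "uniform_count_measure {..<length w}" and ?f = "\<lambda>i. (shift ^^ i) (periodic_config w)"
 have U: "prob_space ?U" using w by (intro prob_space_uniform_count_measure) auto
 have f: "?f \<in> ?U \<rightarrow>\<^sub>M borel" by (auto simp: measurable_def sets_uniform_count_measure space_uniform_count_measure)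
 have P: "prob_space (periodic_measure w)"
  unfolding periodic_measure_def by (rule prob_space.prob_space_distr[OF U f])
 have S: "sets (periodic_measure w) = sets borel" by (simp add: periodic_measure_def)
 interpret P: prob_space "periodic_measure w" by (rule P)
 have "?f i \<in> configs B" for i
  using w by (auto simp: shift_pow translate_apply configs_def periodic_config_def in_lists_conv_set nat_less_iff intro!: nth_mem)
 then have AE: "AE x in periodic_measure w. x \<in> configs B"
  unfolding periodic_measure_def using configs_borel[of B]
  by (subst AE_distr_iff[OF f]) auto
 have sp: "space (periodic_measure w) = UNIV" using sets_eq_imp_space_eq[OF S] by simp
 have tr: "shift = translate 1" using shift_pow[of 1] by simp
 have sh: "shift \<in> periodic_measure w \<rightarrow>\<^sub>M borel"
  unfolding tr measurable_cong_sets[OF S refl] by (rule measurable_translate)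
 have "distr (periodic_measure w) borel shift = periodic_measure w"
 proof (rule measure_eqI)
  fix E assume "E \<in> sets (distr (periodic_measure w) borel shift)"
  then have E: "E \<in> sets borel" by simp
  interpret D: prob_space "distr (periodic_measure w) borel shift" by (rule P.prob_space_distr[OF sh])
  let ?g = "\<lambda>i. indicat_real E (translate i (periodic_config w))"
  have E': "{x. translate 1 x \<in> E} \<in> sets borel"
   using measurable_sets[OF measurable_translate E, of 1] by (simp add: vimage_def)
  have per: "?g (i + int (length w)) = ?g i" for i
  by (metis periodic_config_period translate_apply fun_eq_iff add.assoc)
  have "measure (distr (periodic_measure w) borel shift) E = measure (periodic_measure w) {x. translate 1 x \<in> E}"
   using E sh by (subst measure_distr) (auto simp: sp tr vimage_def)
  also have "\<dots> = (\<Sum>i<length w. ?g (int i + 1)) / length w"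
   by (subst measure_periodic[OF w(2) E']) (simp add: indicator_def sum.If_cases Int_def add.commute)
  also have "\<dots> = (\<Sum>i<length w. ?g (int i)) / length w" using periodic_sum[of ?g "length w" 1] per by simp
  also have "\<dots> = measure (periodic_measure w) E"
   by (subst measure_periodic[OF w(2) E]) (simp add: indicator_def sum.If_cases Int_def)
  finally show "emeasure (distr (periodic_measure w) borel shift) E = emeasure (periodic_measure w) E"
   by (simp add: P.emeasure_eq_measure D.emeasure_eq_measure)
 qed (simp add: S)
 then show ?thesis using P S AE by (simp add: inv_measures_def)
qed

lemma push_forward_iterate:
 assumes \<mu>: "\<mu> \<in> inv_measures A" and F: "F \<in> borel \<rightarrow>\<^sub>M borel" "\<And>x. x \<in> configs A ==> F x \<in> configs A"
  and comm: "\<And>x. F (shift x) = shift (F x)"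
 shows "(push_forward A F ^^ t) \<mu> \<in> inv_measures A"
  "measure ((push_forward A F ^^ t) \<mu>) (cyl u) = measure \<mu> {x. (F ^^ t) x \<in> cyl u}"
proof -
 have one: "push_forward A F \<nu> = distr \<nu> borel F & push_forward A F \<nu> \<in> inv_measures A" if \<nu>: "\<nu> \<in> inv_measures A" for \<nu>
 proof -
  interpret stationary \<nu> using \<nu> by (rule inv_stationary)
  have AE: "AE x in \<nu>. x \<in> configs A" using \<nu> by (simp add: inv_measures_def)
  have F': "F \<in> \<nu> \<rightarrow>\<^sub>M borel" using F(1) by (simp add: measurable_M)
  have cA: "configs A \<in> events" using configs_borel by (simp add: sets_M)
  have push: "push_forward A F \<nu> = distr \<nu> borel F"
  proof (rule measure_eqI)
   fix E assume "E \<in> sets (push_forward A F \<nu>)"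
   then have E: "E \<in> sets borel" by (simp add: push_forward_def)
   have FE: "F -` E \<in> events" using measurable_sets[OF F' E] by (simp add: space_M)
   have "emeasure (push_forward A F \<nu>) E = emeasure (restrict_space \<nu> (configs A)) (F -` E \<inter> configs A)"
    unfolding push_forward_def
    using E F' by (subst emeasure_distr) (auto simp: space_restrict_space space_M intro: measurable_restrict_space1)
   also have "\<dots> = emeasure \<nu> (F -` E \<inter> configs A)"
    using cA by (subst emeasure_restrict_space) (auto simp: space_M)
   also have "\<dots> = emeasure \<nu> (F -` E)"
    using AE FE cA by (intro emeasure_eq_AE) auto
   also have "\<dots> = emeasure (distr \<nu> borel F) E" using E F' by (subst emeasure_distr) (auto simp: space_M)
   finally show "emeasure (push_forward A F \<nu>) E = emeasure (distr \<nu> borel F) E" .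
  qed (simp add: push_forward_def)
  have tr: "shift = translate 1" using shift_pow[of 1] by simp
  have sh: "shift \<in> borel \<rightarrow>\<^sub>M borel" by (simp add: tr measurable_translate)
  have "prob_space (distr \<nu> borel F)" by (rule prob_space_distr[OF F'])
  moreover have "AE x in distr \<nu> borel F. x \<in> configs A"
   using AE F(2) configs_borel[of A] by (subst AE_distr_iff[OF F']) (auto elim!: eventually_mono)
  moreover have "distr (distr \<nu> borel F) borel shift = distr \<nu> borel F"
  proof -
   have "distr (distr \<nu> borel F) borel shift = distr \<nu> borel (shift \<circ> F)" by (rule distr_distr[OF sh F'])
   also have "shift \<circ> F = F \<circ> shift" using comm by (simp add: fun_eq_iff)
   also have "distr \<nu> borel (F \<circ> shift) = distr (distr \<nu> borel shift) borel F"
    using sh by (intro distr_distr[symmetric] F(1)) (simp add: measurable_M)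
   finally show ?thesis by (simp add: shift_invariant)
  qed
  ultimately show ?thesis using push by (simp add: inv_measures_def)
 qed
 have "(push_forward A F ^^ t) \<mu> = distr \<mu> borel (F ^^ t) & (push_forward A F ^^ t) \<mu> \<in> inv_measures A"
 proof (induction t)
  case 0
  interpret stationary \<mu> using \<mu> by (rule inv_stationary)
  have "distr \<mu> borel id = distr \<mu> \<mu> id" by (rule distr_cong) (simp_all add: sets_M)
  then show ?case using \<mu> by (simp add: distr_id id_def)
 next
  case (Suc t)
  interpret stationary \<mu> using \<mu> by (rule inv_stationary)
  have "distr (distr \<mu> borel (F ^^ t)) borel F = distr \<mu> borel (F \<circ> F ^^ t)"
   by (rule distr_distr[OF F(1)]) (simp add: measurable_M measurable_compose_n[OF F(1)])
  moreover note one[of "(push_forward A F ^^ t) \<mu>"] Suc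
  ultimately have "push_forward A F ((push_forward A F ^^ t) \<mu>) = distr \<mu> borel (F \<circ> F ^^ t)"
   "push_forward A F ((push_forward A F ^^ t) \<mu>) \<in> inv_measures A" by metis+
  then show ?case by (simp only: funpow.simps o_def simp_thms)
 qed
 moreover have "measure (distr \<mu> borel (F ^^ t)) (cyl u) = measure \<mu> {x. (F ^^ t) x \<in> cyl u}"
 proof -
  interpret stationary \<mu> using \<mu> by (rule inv_stationary)
  show ?thesis
   by (subst measure_distr) (simp_all add: measurable_M measurable_compose_n[OF F(1)] cyl_borel space_M vimage_def)
 qed
 ultimately show "(push_forward A F ^^ t) \<mu> \<in> inv_measures A"
  "measure ((push_forward A F ^^ t) \<mu>) (cyl u) = measure \<mu> {x. (F ^^ t) x \<in> cyl u}" by metis+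
qed

subsection \<open>The metric\<close>

lemma prob_cyl: "\<mu> \<in> inv_measures A ==> 0 <= measure \<mu> (cyl u) & measure \<mu> (cyl u) <= 1"
 using stationary.axioms(1)[OF inv_stationary] by (auto simp: prob_space.prob_le_1)

context
 fixes B :: "nat set"
 assumes B: "finite B" "B ~= {}"
begin

definition level_dist :: "config measure => config measure => nat => real" where
 "level_dist \<mu> \<nu> n = Max ((\<lambda>u. \<bar>measure \<mu> (cyl u) - measure \<nu> (cyl u)\<bar>) ` {u \<in> lists B. length u = n})"

lemma words_n: "finite {u \<in> lists B. length u = n}" "{u \<in> lists B. length u = n} ~= {}"
proof -
 show "finite {u \<in> lists B. length u = n}"
  by (rule finite_subset[OF _ finite_short[OF B(1), of n]]) auto
 obtain b where "b \<in> B" using B by blast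
 then have "replicate n b \<in> {u \<in> lists B. length u = n}" by (auto simp: in_lists_conv_set)
 then show "{u \<in> lists B. length u = n} ~= {}" by blast
qed

lemma level_dist_ge: "u \<in> lists B ==> length u = n ==> \<bar>measure \<mu> (cyl u) - measure \<nu> (cyl u)\<bar> <= level_dist \<mu> \<nu> n"
 unfolding level_dist_def using words_n[of n] by (intro Max_ge) auto

lemma level_dist_le: "(\<And>u. u \<in> lists B ==> length u = n ==> \<bar>measure \<mu> (cyl u) - measure \<nu> (cyl u)\<bar> <= c) ==> level_dist \<mu> \<nu> n <= c"
 unfolding level_dist_def using words_n[of n] by (intro Max.boundedI) auto

lemma level_dist_bounds:
 assumes "\<mu> \<in> inv_measures B" "\<nu> \<in> inv_measures B"
 shows "0 <= level_dist \<mu> \<nu> n" "level_dist \<mu> \<nu> n <= 1"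
proof -
 obtain u where "u \<in> lists B" "length u = n" using words_n(2)[of n] by blast
 from level_dist_ge[OF this, of \<mu> \<nu>] show "0 <= level_dist \<mu> \<nu> n" by linarith
 show "level_dist \<mu> \<nu> n <= 1"
  using prob_cyl[OF assms(1)] prob_cyl[OF assms(2)] by (intro level_dist_le) (smt (verit))
qed

lemma dist_summable:
 assumes "\<mu> \<in> inv_measures B" "\<nu> \<in> inv_measures B"
 shows "summable (\<lambda>n. (1 / 2) ^ n * level_dist \<mu> \<nu> n)"
proof (rule summable_comparison_test'[of "\<lambda>n. (1 / 2 :: real) ^ n" 0])
 show "norm ((1 / 2) ^ n * level_dist \<mu> \<nu> n) <= (1 / 2) ^ n" for n
  using level_dist_bounds[OF assms, of n] by (simp add: mult_left_le)
qed (simp add: summable_geometric)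

lemma dist_M_eq: "dist_M B \<mu> \<nu> = (\<Sum>n. (1 / 2) ^ n * level_dist \<mu> \<nu> n)"
 by (simp add: dist_M_def level_dist_def)

lemma dist_ge:
 assumes "\<mu> \<in> inv_measures B" "\<nu> \<in> inv_measures B" "u \<in> lists B"
 shows "\<bar>measure \<mu> (cyl u) - measure \<nu> (cyl u)\<bar> <= 2 ^ length u * dist_M B \<mu> \<nu>"
proof -
 have "(\<Sum>n\<in>{length u}. (1 / 2) ^ n * level_dist \<mu> \<nu> n) <= dist_M B \<mu> \<nu>"
  unfolding dist_M_eq using level_dist_bounds[OF assms(1,2)]
  by (intro sum_le_suminf dist_summable assms) auto
 then have "level_dist \<mu> \<nu> (length u) <= 2 ^ length u * dist_M B \<mu> \<nu>"
  by (simp add: power_one_over field_simps)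
 then show ?thesis using level_dist_ge[OF assms(3) refl, of \<mu> \<nu>] by linarith
qed

lemma dist_le:
 assumes "\<mu> \<in> inv_measures B" "\<nu> \<in> inv_measures B" "0 <= \<eta>"
  and "\<And>u. u \<in> lists B ==> length u <= n ==> \<bar>measure \<mu> (cyl u) - measure \<nu> (cyl u)\<bar> <= \<eta>"
 shows "dist_M B \<mu> \<nu> <= 2 * \<eta> + (1 / 2) ^ n"
proof -
 let ?f = "\<lambda>n. (1 / 2) ^ n * level_dist \<mu> \<nu> n"
 have sm: "summable ?f" by (rule dist_summable[OF assms(1,2)])
 have geo: "(\<lambda>m. (1 / 2 :: real) ^ m) sums 2" using geometric_sums[of "1 / 2 :: real"] by simp
 have "(\<Sum>m<Suc n. ?f m) <= (\<Sum>m<Suc n. (1 / 2) ^ m * \<eta>)"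
  using assms(4) by (intro sum_mono mult_left_mono level_dist_le) auto
 also have "\<dots> = (\<Sum>m<Suc n. (1 / 2) ^ m) * \<eta>" by (simp only: sum_distrib_right)
 also have "\<dots> <= 2 * \<eta>"
  using sum_le_suminf[OF sums_summable[OF geo], of "{..<Suc n}"] sums_unique[OF geo] assms(3)
  by (intro mult_right_mono) auto
 finally have 1: "(\<Sum>m<Suc n. ?f m) <= 2 * \<eta>" .
 have "(\<Sum>m. ?f (m + Suc n)) <= (\<Sum>m. (1 / 2) ^ Suc n * (1 / 2) ^ m)"
 proof (rule suminf_le)
  show "?f (m + Suc n) <= (1 / 2) ^ Suc n * (1 / 2) ^ m" for m
   using level_dist_bounds[OF assms(1,2), of "m + Suc n"] by (simp add: power_add mult_left_le mult.commute)
  show "summable (\<lambda>m. ?f (m + Suc n))" using sm by (rule summable_ignore_initial_segment)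
  show "summable (\<lambda>m. (1 / 2 :: real) ^ Suc n * (1 / 2) ^ m)" by (intro summable_mult summable_geometric) simp
 qed
 also have "\<dots> = (1 / 2) ^ Suc n * 2" using suminf_mult[OF sums_summable[OF geo], of "(1 / 2) ^ Suc n"] sums_unique[OF geo] by simp
 finally have "(\<Sum>m. ?f (m + Suc n)) <= (1 / 2) ^ n" by simp
 then show ?thesis
  unfolding dist_M_eq using suminf_split_initial_segment[OF sm, of "Suc n"] 1 by linarith
qed

lemma dist_nonneg: "\<mu> \<in> inv_measures B ==> \<nu> \<in> inv_measures B ==> 0 <= dist_M B \<mu> \<nu>"
 using dist_ge[of \<mu> \<nu> "[]"] by simp

lemma dist_sym: "dist_M B \<mu> \<nu> = dist_M B \<nu> \<mu>"
 by (simp add: dist_M_def abs_minus_commute)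

lemma dist_triangle_M:
 assumes "\<mu> \<in> inv_measures B" "\<nu> \<in> inv_measures B" "\<kappa> \<in> inv_measures B"
 shows "dist_M B \<mu> \<kappa> <= dist_M B \<mu> \<nu> + dist_M B \<nu> \<kappa>"
proof -
 have "level_dist \<mu> \<kappa> n <= level_dist \<mu> \<nu> n + level_dist \<nu> \<kappa> n" for n
  using level_dist_ge[of _ n \<mu> \<nu>] level_dist_ge[of _ n \<nu> \<kappa>] by (intro level_dist_le) (smt (verit))
 then have le: "(1 / 2) ^ n * level_dist \<mu> \<kappa> n <= (1 / 2) ^ n * level_dist \<mu> \<nu> n + (1 / 2) ^ n * level_dist \<nu> \<kappa> n" for n
  by (simp flip: distrib_left)
 have s: "summable (\<lambda>n. (1 / 2) ^ n * level_dist \<mu> \<nu> n)" "summable (\<lambda>n. (1 / 2) ^ n * level_dist \<nu> \<kappa> n)"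
  "summable (\<lambda>n. (1 / 2) ^ n * level_dist \<mu> \<kappa> n)" using assms by (auto intro: dist_summable)
 show ?thesis
  unfolding dist_M_eq suminf_add[OF s(1,2)] by (rule suminf_le[OF le s(3) summable_add[OF s(1,2)]])
qed

lemma close_dist:
 assumes "\<mu> \<in> inv_measures B" "\<nu> \<in> inv_measures B" "0 <= \<delta>" "close B n \<delta> \<mu> \<nu>"
 shows "dist_M B \<mu> \<nu> <= 2 * \<delta> + (1 / 2) ^ n"
 using assms(4) by (intro dist_le assms) (auto simp: close_def intro: less_imp_le)

lemma dist_close:
 assumes "\<mu> \<in> inv_measures B" "\<nu> \<in> inv_measures B" "2 ^ n * dist_M B \<mu> \<nu> < \<delta>"
 shows "close B n \<delta> \<mu> \<nu>"
 unfolding close_def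
proof (intro ballI impI)
 fix u assume u: "u \<in> lists B" "length u <= n"
 have "(2::real) ^ length u * dist_M B \<mu> \<nu> <= 2 ^ n * dist_M B \<mu> \<nu>"
  using u(2) dist_nonneg[OF assms(1,2)] by (intro mult_right_mono power_increasing) auto
 then show "\<bar>measure \<mu> (cyl u) - measure \<nu> (cyl u)\<bar> < \<delta>"
  using dist_ge[OF assms(1,2) u(1)] assms(3) by linarith
qed

lemma dist_nbhd:
 assumes "0 < \<epsilon>"
 obtains n \<delta> where "0 < \<delta>" "\<And>\<mu> \<nu>. \<mu> \<in> inv_measures B ==> \<nu> \<in> inv_measures B ==> close B n \<delta> \<mu> \<nu> ==> dist_M B \<mu> \<nu> < \<epsilon>"
proof -
 obtain n where n: "(1 / 2 :: real) ^ n < \<epsilon> / 2" using real_arch_pow_inv[of "\<epsilon> / 2" "1 / 2"] assms by auto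
 show ?thesis
 proof (rule that[of "\<epsilon> / 4" n])
  show "dist_M B \<mu> \<nu> < \<epsilon>" if "\<mu> \<in> inv_measures B" "\<nu> \<in> inv_measures B" "close B n (\<epsilon> / 4) \<mu> \<nu>" for \<mu> \<nu>
   using close_dist[OF that(1,2) _ that(3)] n assms by simp
 qed (use assms in simp)
qed

subsection \<open>Compact connected sets of measures\<close>

context
 fixes K :: "config measure set"
 assumes K: "K \<subseteq> inv_measures B" "compactin (weak_star B) K"
begin

lemma finite_net:
 assumes "0 < \<epsilon>"
 obtains N where "finite N" "N \<subseteq> K" "\<And>\<kappa>. \<kappa> \<in> K ==> \<exists>\<nu>\<in>N. dist_M B \<kappa> \<nu> < \<epsilon>"
proof -
 obtain n \<delta> where n: "0 < \<delta>" "\<And>\<mu> \<nu>. \<mu> \<in> inv_measures B ==> \<nu> \<in> inv_measures B ==> close B n \<delta> \<mu> \<nu> ==> dist_M B \<mu> \<nu> < \<epsilon>"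
  by (rule dist_nbhd[OF assms]) (rule that, assumption+)
 let ?O = "\<lambda>\<nu>. {\<mu> \<in> inv_measures B. close B n \<delta> \<mu> \<nu>}"
 have self: "\<nu> \<in> ?O \<nu>" if "\<nu> \<in> K" for \<nu> using that K(1) n(1) by (auto simp: close_def)
 have "openin (weak_star B) U" if "U \<in> ?O ` K" for U using that openin_close[OF B(1)] by auto
 moreover have "K \<subseteq> \<Union>(?O ` K)" using self by blast
 ultimately obtain \<F> where \<F>: "finite \<F>" "\<F> \<subseteq> ?O ` K" "K \<subseteq> \<Union>\<F>"
  using compactinD[OF K(2), of "?O ` K"] by blast
 from finite_subset_image[OF \<F>(1,2)] obtain N where "N \<subseteq> K" "finite N" "\<F> = ?O ` N" by blast
 with \<F>(3) have N: "finite N" "N \<subseteq> K" "K \<subseteq> (\<Union>\<nu>\<in>N. ?O \<nu>)" by simp_all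
 show ?thesis
 proof (rule that[OF N(1,2)])
  fix \<kappa> assume "\<kappa> \<in> K"
  then obtain \<nu> where "\<nu> \<in> N" "\<kappa> \<in> ?O \<nu>" using N(3) by blast
  then show "\<exists>\<nu>\<in>N. dist_M B \<kappa> \<nu> < \<epsilon>" using n(2)[of \<kappa> \<nu>] N(2) K(1) by blast
 qed
qed

text \<open>Compact sets are closed: finitely many cylinders separate \<nu> from all of K. A second
  alphabet D appears because \<nu> may live on more letters than B, while compactness is given over
  B.\<close>

lemma limit_in_K:
 assumes \<nu>: "stationary \<nu>" and appr: "\<And>n \<delta>. 0 < \<delta> ==> \<exists>\<kappa>\<in>K. \<forall>u. length u <= n --> u \<in> lists D --> \<bar>measure \<kappa> (cyl u) - measure \<nu> (cyl u)\<bar> < \<delta>"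
  and D: "B \<subseteq> D" "\<And>u. u \<notin> lists D ==> measure \<nu> (cyl u) = 0"
 shows "\<nu> \<in> K"
proof (rule ccontr)
 assume no: "\<nu> \<notin> K"
 have "\<exists>u. u \<in> lists D & measure \<kappa> (cyl u) ~= measure \<nu> (cyl u)" if \<kappa>: "\<kappa> \<in> K" for \<kappa>
 proof -
  have \<kappa>B: "\<kappa> \<in> inv_measures B" using \<kappa> K by blast
  have "measure \<kappa> (cyl u) = 0" if "u \<notin> lists D" for u
  proof (rule inv_null[OF \<kappa>B])
   show "u \<notin> lists B" using that D(1) lists_mono[of B D] by blast
  qed
  then show ?thesis
   using stationary_unique[OF inv_stationary[OF \<kappa>B] \<nu>] no \<kappa> D(2) by metis
 qed
 then obtain u where u: "\<And>\<kappa>. \<kappa> \<in> K ==> u \<kappa> \<in> lists D" "\<And>\<kappa>. \<kappa> \<in> K ==> measure \<kappa> (cyl (u \<kappa>)) ~= measure \<nu> (cyl (u \<kappa>))" by metis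
 define \<delta> where "\<delta> \<kappa> = \<bar>measure \<kappa> (cyl (u \<kappa>)) - measure \<nu> (cyl (u \<kappa>))\<bar> / 2" for \<kappa>
 have \<delta>: "0 < \<delta> \<kappa>" if "\<kappa> \<in> K" for \<kappa> using u(2)[OF that] by (simp add: \<delta>_def)
 let ?O = "\<lambda>\<kappa>. {\<mu> \<in> inv_measures B. measure \<mu> (cyl (u \<kappa>)) \<in> {r. \<delta> \<kappa> < \<bar>r - measure \<nu> (cyl (u \<kappa>))\<bar>}}"
 have op: "openin (weak_star B) (?O \<kappa>)" for \<kappa>
  by (rule openin_weak_star_cyl) (intro open_Collect_less continuous_intros)
 have self: "\<kappa> \<in> ?O \<kappa>" if "\<kappa> \<in> K" for \<kappa> using that K(1) \<delta>[OF that] by (auto simp: \<delta>_def)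
 have "openin (weak_star B) U" if "U \<in> ?O ` K" for U using that op by auto
 moreover have "K \<subseteq> \<Union>(?O ` K)" using self by blast
 ultimately obtain \<F> where \<F>: "finite \<F>" "\<F> \<subseteq> ?O ` K" "K \<subseteq> \<Union>\<F>"
  using compactinD[OF K(2), of "?O ` K"] by blast
 from finite_subset_image[OF \<F>(1,2)] obtain N where "N \<subseteq> K" "finite N" "\<F> = ?O ` N" by blast
 with \<F>(3) have N: "finite N" "N \<subseteq> K" "K \<subseteq> (\<Union>\<kappa>\<in>N. ?O \<kappa>)" by simp_all
 define n where "n = Max (insert 0 ((\<lambda>\<kappa>. length (u \<kappa>)) ` N))"
 define d where "d = Min (insert 1 (\<delta> ` N))"
 have "0 < d" unfolding d_def using N \<delta> by auto
 from appr[OF this, of n] obtain \<kappa> where \<kappa>: "\<kappa> \<in> K"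
  "\<And>v. length v <= n ==> v \<in> lists D ==> \<bar>measure \<kappa> (cyl v) - measure \<nu> (cyl v)\<bar> < d" by blast
 obtain \<kappa>' where \<kappa>': "\<kappa>' \<in> N" "\<kappa> \<in> ?O \<kappa>'" using \<kappa>(1) N(3) by blast
 have "length (u \<kappa>') <= n" unfolding n_def using N(1) \<kappa>'(1) by (intro Max_ge) auto
 moreover have "u \<kappa>' \<in> lists D" using u(1) \<kappa>'(1) N(2) by blast
 moreover have "d <= \<delta> \<kappa>'" unfolding d_def using N(1) \<kappa>'(1) by (intro Min_le) auto
 ultimately show False using \<kappa>(2)[of "u \<kappa>'"] \<kappa>'(2) by simp
qed

text \<open>The set of points reachable from x by steps shorter than \<epsilon> is open in K, and so
  is its complement.\<close>

lemma chain_connected: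
 assumes conn: "connectedin (weak_star B) K" and \<epsilon>: "0 < \<epsilon>" and xy: "x \<in> K" "y \<in> K"
 shows "(x, y) \<in> {(\<mu>, \<nu>). \<mu> \<in> K & \<nu> \<in> K & dist_M B \<mu> \<nu> < \<epsilon>}\<^sup>*"
proof (rule ccontr)
 let ?R = "{(\<mu>, \<nu>). \<mu> \<in> K & \<nu> \<in> K & dist_M B \<mu> \<nu> < \<epsilon>}"
 assume no: "(x, y) \<notin> ?R\<^sup>*"
 obtain n \<delta> where n: "0 < \<delta>" "\<And>\<mu> \<nu>. \<mu> \<in> inv_measures B ==> \<nu> \<in> inv_measures B ==> close B n \<delta> \<mu> \<nu> ==> dist_M B \<mu> \<nu> < \<epsilon>"
  by (rule dist_nbhd[OF \<epsilon>]) (rule that, assumption+)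
 let ?O = "\<lambda>\<nu>. {\<mu> \<in> inv_measures B. close B n \<delta> \<mu> \<nu>}"
 have self: "\<nu> \<in> ?O \<nu>" if "\<nu> \<in> K" for \<nu> using that K(1) n(1) by (auto simp: close_def)
 have R: "(\<nu>, \<mu>) \<in> ?R" "(\<mu>, \<nu>) \<in> ?R" if "\<nu> \<in> K" "\<mu> \<in> K" "\<mu> \<in> ?O \<nu>" for \<mu> \<nu>
  using that n(2)[of \<mu> \<nu>] K(1) dist_sym[of \<mu> \<nu>] by auto
 define S where "S = {\<mu> \<in> K. (x, \<mu>) \<in> ?R\<^sup>*}"
 let ?E1 = "\<Union>(?O ` S)" and ?E2 = "\<Union>(?O ` (K - S))"
 have "openin (weak_star B) ?E1" "openin (weak_star B) ?E2"
  using openin_close[OF B(1)] by (intro openin_Union; blast)+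
 moreover have "K \<subseteq> ?E1 \<union> ?E2" using self by blast
 moreover have "?E1 \<inter> ?E2 \<inter> K = {}"
 proof (rule ccontr)
  assume "?E1 \<inter> ?E2 \<inter> K ~= {}"
  then obtain \<mu> \<nu> \<kappa> where *: "\<mu> \<in> K" "\<nu> \<in> S" "\<mu> \<in> ?O \<nu>" "\<kappa> \<in> K - S" "\<mu> \<in> ?O \<kappa>" by blast
  have "\<nu> \<in> K" "(x, \<nu>) \<in> ?R\<^sup>*" using *(2) by (simp_all add: S_def)
  then have "(x, \<mu>) \<in> ?R\<^sup>*" using R(1)[OF _ *(1,3)] by (meson rtrancl.rtrancl_into_rtrancl)
  then have "(x, \<kappa>) \<in> ?R\<^sup>*" using R(2)[OF _ *(1,5)] *(4) by (meson DiffD1 rtrancl.rtrancl_into_rtrancl)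
  then show False using *(4) by (simp add: S_def)
 qed
 moreover have "x \<in> ?E1 \<inter> K" using self[OF xy(1)] xy(1) by (auto simp: S_def)
 moreover have "y \<in> ?E2 \<inter> K" using self[OF xy(2)] xy(2) no by (auto simp: S_def)
 ultimately show False using conn unfolding connectedin by blast
qed

lemma close_extend:
 fixes A :: "nat set"
 assumes "\<mu> \<in> inv_measures B" "\<nu> \<in> inv_measures B" "0 < \<delta>" "close B n \<delta> \<mu> \<nu>"
 shows "close A n \<delta> \<mu> \<nu>"
 unfolding close_def
proof (intro ballI impI)
 fix u :: "nat list" assume "length u <= n"
 then show "\<bar>measure \<mu> (cyl u) - measure \<nu> (cyl u)\<bar> < \<delta>"
  using assms inv_null[OF assms(1), of u] inv_null[OF assms(2), of u]
  by (cases "u \<in> lists B") (auto simp: close_def)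
qed

text \<open>Level m is attained at time 64^m, so every word governs some moment. Therefore
  \<open>dense\<close> makes each point of K a limit point, and \<open>near\<close> with the
  compactness of K excludes all others.\<close>

lemma limit_set_eq:
 assumes A: "finite A" "B \<subseteq> A" and \<nu>: "\<And>t. \<nu> t \<in> inv_measures A" and w: "\<And>m. w m \<in> lists B" "\<And>m. w m ~= []"
  and conv: "\<And>u. (\<lambda>t. measure (\<nu> t) (cyl u) - measure (periodic_measure (w (level t))) (cyl u)) \<longlonglongrightarrow> 0"
  and near: "\<And>\<epsilon>. 0 < \<epsilon> ==> \<forall>\<^sub>F m in sequentially. \<exists>\<kappa>\<in>K. dist_M B (periodic_measure (w m)) \<kappa> < \<epsilon>"
  and dense: "\<And>\<kappa> \<epsilon>. \<kappa> \<in> K ==> 0 < \<epsilon> ==> \<exists>\<^sub>F m in sequentially. dist_M B (periodic_measure (w m)) \<kappa> < \<epsilon>"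
 shows "{\<mu> \<in> inv_measures A. \<forall>U. openin (weak_star A) U & \<mu> \<in> U --> (\<exists>\<^sub>F t in sequentially. \<nu> t \<in> U)} = K"
  (is "?L = K")
proof -
 let ?p = "\<lambda>m. periodic_measure (w m)"
 have p: "?p m \<in> inv_measures B" for m by (rule periodic_measure_inv[OF w])
 have cl: "\<forall>\<^sub>F t in sequentially. close A n \<delta> (\<nu> t) (?p (level t))" if \<delta>: "0 < \<delta>" for n \<delta>
 proof -
  have "\<forall>\<^sub>F t in sequentially. \<forall>u\<in>{u \<in> lists A. length u <= n}.
    \<bar>measure (\<nu> t) (cyl u) - measure (?p (level t)) (cyl u)\<bar> < \<delta>"
  proof (intro eventually_ball_finite finite_short[OF A(1)] ballI)
   show "\<forall>\<^sub>F t in sequentially. \<bar>measure (\<nu> t) (cyl u) - measure (?p (level t)) (cyl u)\<bar> < \<delta>" for u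
    using tendstoD[OF conv \<delta>, of u] by (simp add: dist_real_def)
  qed
  then show ?thesis by eventually_elim (simp add: close_def)
 qed
 have dc: "close A n \<delta> (?p m) \<kappa>" if "\<kappa> \<in> K" "dist_M B (?p m) \<kappa> < \<delta> / 2 ^ n" "0 < \<delta>" for m n \<delta> \<kappa>
 proof (rule close_extend[OF p _ that(3)])
  show \<kappa>: "\<kappa> \<in> inv_measures B" using that(1) K(1) by blast
  have "dist_M B (?p m) \<kappa> * 2 ^ n < \<delta>" using that(2) by (subst (asm) pos_less_divide_eq) simp_all
  then show "close B n \<delta> (?p m) \<kappa>" by (intro dist_close p \<kappa>) (simp only: mult.commute)
 qed
 have "\<kappa> \<in> ?L" if \<kappa>: "\<kappa> \<in> K" for \<kappa>
 proof -
  have "\<exists>\<^sub>F t in sequentially. \<nu> t \<in> U" if U: "openin (weak_star A) U" "\<kappa> \<in> U" for U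
  proof -
   obtain n \<delta> where n: "0 < \<delta>" "\<And>\<mu>. \<mu> \<in> inv_measures A ==> close A n \<delta> \<mu> \<kappa> ==> \<mu> \<in> U"
    by (rule weak_star_nbhd[OF A(1) U]) (rule that, assumption+)
   obtain T1 where T1: "\<And>t. T1 <= t ==> close A n (\<delta> / 2) (\<nu> t) (?p (level t))"
    using cl[of "\<delta> / 2" n] n(1) unfolding eventually_sequentially by auto
   show ?thesis
    unfolding frequently_sequentially
   proof
    fix T0
    have "\<exists>\<^sub>F m in sequentially. dist_M B (?p m) \<kappa> < \<delta> / 2 / 2 ^ n" using dense[OF \<kappa>] n(1) by simp
    then obtain m where m: "T0 + T1 <= m" "dist_M B (?p m) \<kappa> < \<delta> / 2 / 2 ^ n"
     unfolding frequently_sequentially by blast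
    have t: "T0 <= 64 ^ m" "T1 <= 64 ^ m"
     using m(1) less_exp[of m] power_mono[of 2 "64::nat" m] by linarith+
    have lv: "level (64 ^ m) = m" by (rule level_eqI) auto
    have "close A n (\<delta> / 2) (\<nu> (64 ^ m)) (?p m)" using T1[OF t(2)] by (simp only: lv)
    moreover have "close A n (\<delta> / 2) (?p m) \<kappa>" using dc[OF \<kappa> m(2)] n(1) by simp
    ultimately have "close A n (\<delta> / 2 + \<delta> / 2) (\<nu> (64 ^ m)) \<kappa>" by (rule close_trans)
    then have "\<nu> (64 ^ m) \<in> U" by (intro n(2) \<nu>) simp
    then show "\<exists>t\<ge>T0. \<nu> t \<in> U" using t(1) by blast
   qed
  qed
  moreover have "\<kappa> \<in> inv_measures A" using \<kappa> K(1) inv_measures_mono[OF A(2)] by blast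
  ultimately show ?thesis by blast
 qed
 moreover have "\<mu> \<in> K" if \<mu>: "\<mu> \<in> ?L" for \<mu>
 proof (rule limit_in_K[where D = A])
  have \<mu>A: "\<mu> \<in> inv_measures A" using \<mu> by blast
  then show "stationary \<mu>" by (rule inv_stationary)
  show "B \<subseteq> A" by (rule A(2))
  show "measure \<mu> (cyl u) = 0" if "u \<notin> lists A" for u by (rule inv_null[OF \<mu>A that])
  fix n and \<delta> :: real assume \<delta>: "0 < \<delta>"
  let ?U = "{\<nu>' \<in> inv_measures A. close A n (\<delta> / 3) \<nu>' \<mu>}"
  have "openin (weak_star A) ?U" by (rule openin_close[OF A(1)])
  moreover have "\<mu> \<in> ?U" using \<mu>A \<delta> by (simp add: close_def)
  ultimately have 1: "\<exists>\<^sub>F t in sequentially. \<nu> t \<in> ?U" using \<mu> by blast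
  have 2: "\<forall>\<^sub>F t in sequentially. close A n (\<delta> / 3) (\<nu> t) (?p (level t))" using cl \<delta> by simp
  have 3: "\<forall>\<^sub>F t in sequentially. \<exists>\<kappa>\<in>K. dist_M B (?p (level t)) \<kappa> < \<delta> / 3 / 2 ^ n"
   by (rule eventually_compose_filterlim[OF near level_at_top]) (use \<delta> in simp)
  obtain t0 where t0: "\<And>t. t0 <= t ==> close A n (\<delta> / 3) (\<nu> t) (?p (level t)) &
    (\<exists>\<kappa>\<in>K. dist_M B (?p (level t)) \<kappa> < \<delta> / 3 / 2 ^ n)"
   using eventually_conj[OF 2 3] unfolding eventually_sequentially by blast
  obtain t where "t0 <= t" and t: "\<nu> t \<in> ?U" using 1 unfolding frequently_sequentially by blast
  with t0 have t: "\<nu> t \<in> ?U" "close A n (\<delta> / 3) (\<nu> t) (?p (level t))"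
   "\<exists>\<kappa>\<in>K. dist_M B (?p (level t)) \<kappa> < \<delta> / 3 / 2 ^ n" by blast+
  then obtain \<kappa> where \<kappa>: "\<kappa> \<in> K" "dist_M B (?p (level t)) \<kappa> < \<delta> / 3 / 2 ^ n" by blast
  have "close A n (\<delta> / 3) \<mu> (\<nu> t)" using t(1) by (subst close_sym) simp
  from close_trans[OF this t(2)] have "close A n (\<delta> / 3 + \<delta> / 3) \<mu> (?p (level t))" .
  from close_trans[OF this dc[OF \<kappa>]] have "close A n (\<delta> / 3 + \<delta> / 3 + \<delta> / 3) \<mu> \<kappa>" using \<delta> by simp
  then have "close A n \<delta> \<kappa> \<mu>" by (subst close_sym) simp
  then show "\<exists>\<kappa>\<in>K. \<forall>u. length u <= n --> u \<in> lists A --> \<bar>measure \<kappa> (cyl u) - measure \<mu> (cyl u)\<bar> < \<delta>"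
   using \<kappa>(1) by (auto simp: close_def)
 qed
 ultimately show ?thesis by blast
qed

end

end

section \<open>Periodic measures are dense\<close>

definition matches :: "nat list => nat => nat list => bool" where
 "matches x s u \<longleftrightarrow> (\<forall>j<length u. x ! (s + j) = u ! j)"

definition hits :: "nat => nat list => nat list => real" where
 "hits k x u = (\<Sum>s<k. of_bool (matches x s u))"

lemma hits_bounds: "0 <= hits k x u" "hits k x u <= k"
proof -
 show "0 <= hits k x u" unfolding hits_def by (rule sum_nonneg) simp
 have "hits k x u <= real (card {..<k}) * 1" unfolding hits_def by (rule sum_bounded_above) simp
 then show "hits k x u <= k" by simp
qed

lemma measure_by_words:
 assumes B: "finite B" and \<nu>: "\<nu> \<in> inv_measures B" and u: "k + length u <= N"
 shows "k * measure \<nu> (cyl u) = (\<Sum>x\<in>{x \<in> lists B. length x = N}. measure \<nu> (cyl x) * hits k x u)"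
proof -
 interpret stationary \<nu> using \<nu> by (rule inv_stationary)
 let ?S = "{x \<in> lists B. length x = N}"
 have AE: "AE y in \<nu>. y \<in> configs B" using \<nu> by (simp add: inv_measures_def)
 have fin: "finite ?S" by (rule finite_subset[OF _ finite_short[OF B, of N]]) auto
 have one: "measure \<nu> (cyl u) = (\<Sum>x\<in>?S. measure \<nu> (cyl x) * of_bool (matches x s u))" if s: "s < k" for s
 proof -
  let ?T = "{x \<in> ?S. matches x s u}"
  have finT: "finite ?T" by (rule finite_subset[OF _ fin]) blast
  have "measure \<nu> (cyl u) = prob {y. translate (int s) y \<in> cyl u}"
   using prob_translate[of "\<lambda>y. y \<in> cyl u" "int s"] cyl_borel by simp
  also have "\<dots> = prob (\<Union>x\<in>?T. cyl x)"
  proof (rule measure_eq_AE)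
   show "AE y in \<nu>. y \<in> {y. translate (int s) y \<in> cyl u} \<longleftrightarrow> y \<in> (\<Union>x\<in>?T. cyl x)"
    using AE
   proof eventually_elim
    case (elim y)
    define x where "x = map (\<lambda>i. y (int i)) [0..<N]"
    have x: "x \<in> ?S" "y \<in> cyl x" using elim by (auto simp: x_def configs_def cyl_def)
    have uniq: "x' = x" if "x' \<in> ?S" "y \<in> cyl x'" for x'
     using that by (intro nth_equalityI) (auto simp: x_def cyl_def)
    have "translate (int s) y \<in> cyl u \<longleftrightarrow> matches x s u"
    proof -
     have "x ! (s + j) = y (int j + int s)" if "j < length u" for j
      using that s u by (simp add: x_def add.commute)
     then show ?thesis by (simp add: translate_cyl matches_def)
    qed
    moreover have "y \<in> (\<Union>x\<in>?T. cyl x) \<longleftrightarrow> matches x s u"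
    using uniq x by blast
    ultimately show ?case by (simp only: mem_Collect_eq)
   qed
   show "{y. translate (int s) y \<in> cyl u} \<in> events"
    using translate_borel[of "\<lambda>y. y \<in> cyl u" "int s"] cyl_borel by (simp add: sets_M)
   show "(\<Union>x\<in>?T. cyl x) \<in> events" using finT cyl_borel unfolding sets_M by (intro sets.finite_UN) auto
  qed
  also have "\<dots> = (\<Sum>x\<in>?T. measure \<nu> (cyl x))"
  proof (rule finite_measure_finite_Union)
   show "disjoint_family_on cyl ?T"
    unfolding disjoint_family_on_def
   proof (intro ballI impI)
    fix x x' assume x: "x \<in> ?T" "x' \<in> ?T" "x ~= x'"
    then obtain i where "i < N" "x ! i ~= x' ! i" by (auto simp: list_eq_iff_nth_eq)
    then show "cyl x \<inter> cyl x' = {}" using x by (auto simp: cyl_def)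
   qed
  qed (use finT cyl_borel in \<open>auto simp: sets_M\<close>)
  also have "\<dots> = (\<Sum>x\<in>?S. measure \<nu> (cyl x) * of_bool (matches x s u))"
   unfolding sum.inter_filter[OF fin] by (intro sum.cong refl) simp
  finally show ?thesis .
 qed
 have "k * measure \<nu> (cyl u) = (\<Sum>s<k. \<Sum>x\<in>?S. measure \<nu> (cyl x) * of_bool (matches x s u))"
  using sum.cong[OF refl one, of "{..<k}" "\<lambda>s. s"] by simp
 also have "\<dots> = (\<Sum>x\<in>?S. measure \<nu> (cyl x) * hits k x u)"
  by (subst sum.swap) (simp only: hits_def sum_distrib_left)
 finally show ?thesis .
qed

text \<open>Only occurrences starting in the last n places of a block can run across its
  end.\<close>

lemma concatenation_frequency:
 assumes X: "\<And>x. x \<in> set X ==> length x = N" "X ~= []" and N: "n < N" and u: "length u <= n"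
 defines "W \<equiv> map (\<lambda>i. X ! (i div N) ! (i mod N)) [0..<length X * N]"
 shows "\<bar>length X * N * measure (periodic_measure W) (cyl u) - (\<Sum>q<length X. hits (N - n) (X ! q) u)\<bar> <= length X * n"
proof -
 have lW: "length W = length X * N" by (simp add: W_def)
 have W0: "W ~= []" using X(2) N lW by (intro notI) auto
 define g where "g i = (of_bool (translate (int i) (periodic_config W) \<in> cyl u) :: real)" for i
 have "length X * N * measure (periodic_measure W) (cyl u) = (\<Sum>i<length X * N. g i)"
  using measure_periodic[OF W0 cyl_borel, of u] W0 lW
  by (simp add: g_def of_bool_def sum.If_cases Int_def)
 also have "\<dots> = (\<Sum>q<length X. \<Sum>i\<in>{q * N..<q * N + N}. g i)" by (rule sum.nat_group[symmetric])
 also have "\<dots> = (\<Sum>q<length X. \<Sum>s<N. g (q * N + s))"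
  by (rule sum.cong[OF refl], subst sum.atLeastLessThan_shift_0) (simp add: lessThan_atLeast0)
 finally have eq: "length X * N * measure (periodic_measure W) (cyl u) = (\<Sum>q<length X. \<Sum>s<N. g (q * N + s))" .
 have blk: "\<bar>(\<Sum>s<N. g (q * N + s)) - hits (N - n) (X ! q) u\<bar> <= n" if q: "q < length X" for q
 proof -
  have "g (q * N + s) = of_bool (matches (X ! q) s u)" if s: "s < N - n" for s
  proof -
   have "periodic_config W (int j + int (q * N + s)) = X ! q ! (s + j)" if j: "j < length u" for j
   proof -
    have sj: "s + j < N" using s j u by linarith
    have "q * N + (s + j) < (q + 1) * N" using sj by simp
    also have "\<dots> <= length X * N" using q by (intro mult_right_mono) auto
    finally have lt: "q * N + (s + j) < length X * N" .
    have "periodic_config W (int j + int (q * N + s)) = W ! nat (int (q * N + (s + j)) mod int (length X * N))"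
     unfolding periodic_config_def lW by (rule arg_cong[of _ _ "\<lambda>i. W ! nat (i mod _)"]) simp
    also have "\<dots> = W ! (q * N + (s + j))" using lt by (simp only: nat_int flip: zmod_int) simp
    also have "\<dots> = X ! q ! (s + j)" using lt sj by (simp add: W_def)
    finally show ?thesis .
   qed
   then show ?thesis unfolding g_def translate_cyl matches_def by simp
  qed
  then have "hits (N - n) (X ! q) u = (\<Sum>s<N - n. g (q * N + s))" by (simp add: hits_def)
  moreover have "(\<Sum>s<N. g (q * N + s)) = (\<Sum>s<N - n. g (q * N + s)) + (\<Sum>s\<in>{N - n..<N}. g (q * N + s))"
   using sum.atLeastLessThan_concat[of 0 "N - n" N "\<lambda>s. g (q * N + s)"] by (simp add: lessThan_atLeast0)
  moreover have "0 <= (\<Sum>s\<in>{N - n..<N}. g (q * N + s))" by (intro sum_nonneg) (simp add: g_def)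
  moreover have "(\<Sum>s\<in>{N - n..<N}. g (q * N + s)) <= real (card {N - n..<N}) * 1"
   by (intro sum_bounded_above) (simp add: g_def)
  ultimately show ?thesis using N by simp
 qed
 have "\<bar>(\<Sum>q<length X. \<Sum>s<N. g (q * N + s)) - (\<Sum>q<length X. hits (N - n) (X ! q) u)\<bar>
   <= (\<Sum>q<length X. \<bar>(\<Sum>s<N. g (q * N + s)) - hits (N - n) (X ! q) u\<bar>)"
  unfolding sum_subtractf[symmetric] by (rule sum_abs)
 also have "\<dots> <= real (card {..<length X}) * n" by (rule sum_bounded_above) (use blk in simp)
 finally show ?thesis unfolding eq by simp
qed

lemma sum_replicates:
 fixes f :: "'a => real"
 shows "sum_list (map f (concat (map (\<lambda>x. replicate (m x) x) xs))) = sum_list (map (\<lambda>x. m x * f x) xs)"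
 by (induction xs) (simp_all add: sum_list_replicate)

text \<open>All blocks of length N are concatenated with multiplicities proportional to their
  probabilities. In a full shift any concatenation is allowed, and the joints are
  negligible.\<close>

theorem periodic_dense:
 assumes B: "finite B" "B ~= {}" and \<nu>: "\<nu> \<in> inv_measures B" and \<delta>: "0 < \<delta>"
 obtains w where "w \<in> lists B" "w ~= []" "close B n \<delta> (periodic_measure w) \<nu>"
proof -
 interpret stationary \<nu> using \<nu> by (rule inv_stationary)
 \<comment> \<open>N makes the joints of the blocks negligible and M below does so for the rounding
   of the multiplicities; each error stays below half of \<delta>.\<close>
 obtain N where N: "n < N" "4 * n / \<delta> < N"
  using reals_Archimedean2[of "max (real n) (4 * n / \<delta>)"] by auto
 define S where "S = {x \<in> lists B. length x = N}"
 define J where "J = card S"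
 have fin: "finite S" unfolding S_def by (rule finite_subset[OF _ finite_short[OF B(1), of N]]) auto
 obtain M where M: "4 * J / \<delta> < real M" "0 < M" using reals_Archimedean2[of "max 0 (4 * J / \<delta>)"] by auto
 define l where "l x = measure \<nu> (cyl x)" for x
 have l0: "0 <= l x" for x by (simp add: l_def)
 \<comment> \<open>\<open>Suc\<close> makes every block occur and the rounding error
   one-sided.\<close>
 define m where "m x = Suc (nat \<lfloor>M * l x\<rfloor>)" for x
 have m: "M * l x <= m x" "m x <= M * l x + 1" for x
  using l0[of x] unfolding m_def by (simp_all add: of_nat_nat) linarith+
 have suml: "(\<Sum>x\<in>S. l x) = 1"
 proof -
  have "real 1 * measure \<nu> (cyl []) = (\<Sum>x\<in>S. l x * hits 1 x [])"
   unfolding S_def l_def by (rule measure_by_words[OF B(1) \<nu>]) (use N in simp)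
  moreover have "cyl [] = space \<nu>" by (simp add: cyl_def space_M)
  ultimately show ?thesis using prob_space by (simp add: hits_def matches_def)
 qed
 obtain xs where xs: "set xs = S" "distinct xs" using finite_distinct_list[OF fin] by blast
 define X where "X = concat (map (\<lambda>x. replicate (m x) x) xs)"
 have setX: "set X = S" using xs by (auto simp: X_def m_def)
 have sumX: "(\<Sum>q<length X. f (X ! q)) = (\<Sum>x\<in>S. m x * f x)" for f :: "nat list => real"
 proof -
  have "(\<Sum>q<length X. f (X ! q)) = sum_list (map f X)" by (simp add: sum_list_sum_nth lessThan_atLeast0)
  also have "\<dots> = sum_list (map (\<lambda>x. m x * f x) xs)" unfolding X_def by (rule sum_replicates)
  finally show ?thesis using xs by (simp add: sum_list_distinct_conv_sum_set)
 qed
 have rm: "real (length X) = (\<Sum>x\<in>S. real (m x))" using sumX[of "\<lambda>_. 1"] by simp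
 have "real M = (\<Sum>x\<in>S. M * l x)" using suml by (simp flip: sum_distrib_left)
 also have "\<dots> <= length X" unfolding rm by (intro sum_mono m)
 finally have r1: "real M <= length X" .
 have "real (length X) <= (\<Sum>x\<in>S. M * l x + 1)" unfolding rm by (intro sum_mono m)
 also have "\<dots> = M + J" using suml by (simp add: sum.distrib J_def flip: sum_distrib_left)
 finally have r2: "real (length X) <= M + J" .
 have X0: "X ~= []" using r1 M(2) by auto
 have lX: "length x = N" if "x \<in> set X" for x using that setX by (simp add: S_def)
 define W where "W = map (\<lambda>i. X ! (i div N) ! (i mod N)) [0..<length X * N]"
 have "W ~= []" using X0 N(1) by (auto simp: W_def)
 moreover have "W \<in> lists B"
 proof -
  have "X ! (i div N) ! (i mod N) \<in> B" if "i < length X * N" for i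
  proof -
   have "i div N < length X" using that N(1) by (simp add: less_mult_imp_div_less)
   then have "X ! (i div N) \<in> set X" by (rule nth_mem)
   then have x: "length (X ! (i div N)) = N" "set (X ! (i div N)) \<subseteq> B"
    unfolding setX by (auto simp: S_def in_lists_conv_set)
   have "X ! (i div N) ! (i mod N) \<in> set (X ! (i div N))"
    by (rule nth_mem) (use N(1) x(1) in simp)
   then show ?thesis using x(2) by blast
  qed
  then show ?thesis by (auto simp: W_def in_lists_conv_set)
 qed
 moreover have "close B n \<delta> (periodic_measure W) \<nu>"
  unfolding close_def
 proof (intro ballI impI)
  fix u assume u: "u \<in> lists B" "length u <= n"
  define r where "r = real (length X)"
  define p where "p = measure (periodic_measure W) (cyl u)"
  define q where "q = measure \<nu> (cyl u)"
  have r2': "M <= r" "r <= M + J" using r1 r2 unfolding r_def by simp_all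
  then have r: "0 < r" "M <= r" "r <= M + J" using M(2) by linarith+
  have N0: "0 < real N" using N(1) by simp
  have q: "0 <= q" "q <= 1" by (simp_all add: q_def)
  have 1: "\<bar>r * N * p - (\<Sum>x\<in>S. m x * hits (N - n) x u)\<bar> <= r * n"
  proof -
   have "\<bar>length X * N * p - (\<Sum>q<length X. hits (N - n) (X ! q) u)\<bar> <= length X * n"
    unfolding p_def W_def by (rule concatenation_frequency[OF lX X0 N(1) u(2)])
   then show ?thesis by (simp add: sumX[of "\<lambda>x. hits (N - n) x u"] r_def)
  qed
  have 2: "M * ((N - n) * q) = (\<Sum>x\<in>S. M * l x * hits (N - n) x u)"
  proof -
   have "(N - n) * q = (\<Sum>x\<in>S. l x * hits (N - n) x u)"
    unfolding q_def S_def l_def by (rule measure_by_words[OF B(1) \<nu>]) (use u(2) N(1) in linarith)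
   then have "M * ((N - n) * q) = M * (\<Sum>x\<in>S. l x * hits (N - n) x u)" by (simp only:)
   then show ?thesis by (simp only: sum_distrib_left mult.assoc)
  qed
  have 3: "0 <= (\<Sum>x\<in>S. m x * hits (N - n) x u) - M * ((N - n) * q)"
   "(\<Sum>x\<in>S. m x * hits (N - n) x u) - M * ((N - n) * q) <= J * N"
  proof -
   have d: "(\<Sum>x\<in>S. m x * hits (N - n) x u) - M * ((N - n) * q) = (\<Sum>x\<in>S. (m x - M * l x) * hits (N - n) x u)"
    unfolding 2 by (simp add: sum_subtractf left_diff_distrib)
   show "0 <= (\<Sum>x\<in>S. m x * hits (N - n) x u) - M * ((N - n) * q)"
    unfolding d using m(1) hits_bounds(1) by (intro sum_nonneg mult_nonneg_nonneg) auto
   have "(m x - M * l x) * hits (N - n) x u <= 1 * real N" for x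
   proof (rule mult_mono)
    show "m x - M * l x <= 1" using m(2)[of x] by simp
    show "hits (N - n) x u <= N" using hits_bounds(2)[of "N - n" x u] by simp
   qed (use hits_bounds(1) in auto)
   then show "(\<Sum>x\<in>S. m x * hits (N - n) x u) - M * ((N - n) * q) <= J * N"
    unfolding d J_def using sum_bounded_above[of S "\<lambda>x. (m x - M * l x) * hits (N - n) x u" "real N"] by simp
  qed
  have 4: "\<bar>r * N * q - M * ((N - n) * q)\<bar> <= J * N + r * n"
  proof -
   have "r * N * q - M * ((N - n) * q) = (r - M) * N * q + M * (n * q)"
    using N(1) by (simp add: of_nat_diff algebra_simps)
   moreover have "0 <= (r - M) * N * q" using r q by simp
   moreover have "(r - M) * N * q <= J * N"
   proof -
    have "(r - M) * N * q <= (r - M) * N * 1" using r q by (intro mult_left_mono) auto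
    also have "\<dots> <= J * N" using r by (simp add: mult_right_mono)
    finally show ?thesis .
   qed
   moreover have "0 <= M * (n * q)" using q by simp
   moreover have "M * (n * q) <= r * n"
   proof -
    have "M * (n * q) <= r * (n * q)" using r q by (intro mult_right_mono) auto
    also have "\<dots> <= r * (real n * 1)" using r q by (intro mult_left_mono) auto
    finally show ?thesis by simp
   qed
   ultimately show ?thesis by linarith
  qed
  have "\<bar>r * N * p - r * N * q\<bar> <= 2 * (J * N) + 2 * (r * n)" using 1 3 4 by linarith
  then have "r * N * \<bar>p - q\<bar> <= 2 * (J * N) + 2 * (r * n)"
   using r(1) N0 by (simp add: abs_mult flip: right_diff_distrib)
  also have "\<dots> < r * N * \<delta>"
  proof -
   have "4 * J < \<delta> * M" "4 * n < \<delta> * N" using M(1) N(2) \<delta> by (simp_all add: field_simps)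
   then have "4 * J * N < \<delta> * M * N" "4 * n * r < \<delta> * N * r" using N0 r(1) by simp_all
   moreover have "\<delta> * M * N <= \<delta> * r * N" using r(2) \<delta> N0 by simp
   ultimately show ?thesis by (simp add: algebra_simps)
  qed
  finally have "\<bar>p - q\<bar> < \<delta>" using r(1) N0 by simp
  then show "\<bar>measure (periodic_measure W) (cyl u) - measure \<nu> (cyl u)\<bar> < \<delta>" by (simp add: p_def q_def)
 qed
 ultimately show ?thesis by (intro that[of W])
qed

section \<open>A computable sequence of words\<close>

text \<open>Clearing denominators turns a comparison of frequencies into one of natural numbers,
  hence into a decidable relation.\<close>

lemma abs_frac_diff_le:
 fixes a c s t n :: nat
 assumes "0 < s" "0 < t"
 shows "\<bar>real a / real s - real c / real t\<bar> <= (1 / 2) ^ n \<longleftrightarrow>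
  a * t * 2 ^ n <= c * s * 2 ^ n + s * t & c * s * 2 ^ n <= a * t * 2 ^ n + s * t"
proof -
 have "\<bar>real a / real s - real c / real t\<bar> = \<bar>real a * real t - real c * real s\<bar> / (real s * real t)"
  using assms by (simp add: diff_frac_eq abs_divide)
 also have "\<dots> <= (1 / 2) ^ n \<longleftrightarrow> \<bar>real a * real t - real c * real s\<bar> * 2 ^ n <= real s * real t"
  using assms by (simp add: field_simps power_one_over)
 also have "\<bar>real a * real t - real c * real s\<bar> * 2 ^ n = \<bar>real a * real t * 2 ^ n - real c * real s * 2 ^ n\<bar>"
  by (simp add: left_diff_distrib[symmetric] abs_mult)
 also have "\<dots> <= real s * real t \<longleftrightarrow> real a * real t * 2 ^ n <= real c * real s * 2 ^ n + real s * real t &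
  real c * real s * 2 ^ n <= real a * real t * 2 ^ n + real s * real t" by linarith
 finally show ?thesis
  by (simp only: of_nat_le_iff[symmetric, where 'a=real] of_nat_add of_nat_mult of_nat_power of_nat_numeral)
qed

lemma base_digits:
 assumes "\<And>i. i < n ==> a i < b"
 shows "\<exists>x<b ^ n. \<forall>i<n. (x div b ^ i) mod b = (a i :: nat)"
 using assms
proof (induction n arbitrary: a)
 case (Suc n)
 obtain x where x: "x < b ^ n" "\<forall>i<n. (x div b ^ i) mod b = a (Suc i)"
  using Suc.IH[of "\<lambda>i. a (Suc i)"] Suc.prems by auto
 have a: "a 0 < b" using Suc.prems by simp
 have "a 0 + b * x < b * Suc x" using a by simp
 also have "\<dots> <= b * b ^ n" using x(1) by (intro mult_le_mono2) simp
 finally have l: "a 0 + b * x < b ^ Suc n" by simp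
 have "((a 0 + b * x) div b ^ i) mod b = a i" if "i < Suc n" for i
 proof (cases i)
  case (Suc j)
  have "(a 0 + b * x) div b ^ i = x div b ^ j" using a Suc by (simp add: div_mult2_eq)
  then show ?thesis using x(2) that Suc by simp
 qed (use a in simp)
 with l show ?case by blast
qed simp

lemma computable_nth: "computable f ==> computable (\<lambda>x. if f x < length bs then bs ! f x else 0)"
proof (induction bs rule: rev_induct)
 case Nil
 then show ?case by (simp add: computable_const)
next
 case (snoc a bs)
 have "(if f x < length (bs @ [a]) then (bs @ [a]) ! f x else 0)
  = (if f x = length bs then a else if f x < length bs then bs ! f x else 0)" for x
  by (auto simp: nth_append)
 then show ?case using snoc by (simp only:) (intro computable_If decidable_eq computable_const snoc)
qed

section \<open>Numbering of words and decidable closeness of periodic measures\<close>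

locale letters =
 fixes B :: "nat set"
 assumes B: "finite B" "B ~= {}"
begin

abbreviation b :: nat where "b \<equiv> card B"

lemma b_pos: "0 < b" using B by (simp add: card_gt_0_iff)

definition digit :: "nat => nat => nat" where
 "digit v j = (psnd v div b ^ j) mod b"

text \<open>The first component is the length minus 1, the second holds the digits; every number
  thus codes a nonempty word, and no well-formedness has to be decided.\<close>

definition word :: "nat => nat list" where
 "word v = map (\<lambda>j. sorted_list_of_set B ! digit v j) [0..<Suc (pfst v)]"

lemma digit_less: "digit v j < b" using b_pos by (simp add: digit_def)

lemma word [simp]: "word v \<in> lists B" "word v ~= []" "length (word v) = Suc (pfst v)"
proof -
 have "sorted_list_of_set B ! d \<in> B" if "d < b" for d
  using nth_mem[of d "sorted_list_of_set B"] that B by simp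
 then show "word v \<in> lists B" using digit_less by (auto simp: word_def)
qed (simp_all add: word_def)

lemma word_surj:
 assumes "w \<in> lists B" "length w = Suc m"
 obtains x where "x < b ^ Suc m" "word (pair m x) = w"
proof -
 have "\<exists>d<b. sorted_list_of_set B ! d = w ! i" if i: "i < Suc m" for i
 proof -
  have "w ! i \<in> B" using assms i nth_mem[of i w] by auto
  then have "w ! i \<in> set (sorted_list_of_set B)" using B by simp
  then show ?thesis using B unfolding in_set_conv_nth by auto
 qed
 then obtain a where a: "\<And>i. i < Suc m ==> a i < b & sorted_list_of_set B ! a i = w ! i" by metis
 obtain x where x: "x < b ^ Suc m" "\<forall>i<Suc m. (x div b ^ i) mod b = a i"
  using base_digits[of "Suc m" a b] a by blast
 have "word (pair m x) = w"
  by (rule nth_equalityI) (use x a assms(2) in \<open>simp_all add: word_def digit_def del: upt_Suc\<close>)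
 with x(1) show ?thesis by (rule that)
qed

lemma computable_digit: "computable f ==> computable g ==> computable (\<lambda>x. digit (f x) (g x))"
 unfolding digit_def by (intro computable_intros)

lemma computable_letter:
 assumes "computable f" "computable g"
 shows "computable (\<lambda>x. sorted_list_of_set B ! digit (f x) (g x))"
proof -
 have eq: "(\<lambda>x. sorted_list_of_set B ! digit (f x) (g x)) =
  (\<lambda>x. if digit (f x) (g x) < length (sorted_list_of_set B) then sorted_list_of_set B ! digit (f x) (g x) else 0)"
  using digit_less by auto
 show ?thesis by (subst eq) (rule computable_nth[OF computable_digit[OF assms]])
qed

lemma word_nth: "j < Suc (pfst v) ==> word v ! j = sorted_list_of_set B ! digit v j"
 unfolding word_def by (simp del: upt_Suc)

lemma computable_word: "computable f ==> computable (\<lambda>x. list_encode (word (f x)))"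
 by (rule computable_compose[of "\<lambda>v. list_encode (word v)" f], unfold word_def)
  (intro computable_list_encode_map computable_letter computable_intros)

definition occs :: "nat => nat => nat" where
 "occs v y = (\<Sum>i<Suc (pfst v). of_bool (\<forall>j<Suc (pfst y). digit v ((i + j) mod Suc (pfst v)) = digit y j))"

lemma computable_occs:
 assumes "computable f" "computable g"
 shows "computable (\<lambda>x. occs (f x) (g x))"
proof -
 have "computable (\<lambda>p. occs (pfst p) (psnd p))"
  unfolding occs_def by (intro computable_intros computable_digit)
 from computable_compose[OF this computable_pair[OF assms]] show ?thesis by simp
qed

abbreviation pmw :: "nat => config measure" where "pmw v \<equiv> periodic_measure (word v)"

lemma pmw_inv: "pmw v \<in> inv_measures B" by (rule periodic_measure_inv) simp_all

lemma measure_word: "measure (pmw v) (cyl (word y)) = occs v y / Suc (pfst v)"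
proof -
 have eq: "translate (int i) (periodic_config (word v)) \<in> cyl (word y) \<longleftrightarrow>
  (\<forall>j<Suc (pfst y). digit v ((i + j) mod Suc (pfst v)) = digit y j)" for i
 proof -
  have "translate (int i) (periodic_config (word v)) (int j) = word y ! j \<longleftrightarrow>
   digit v ((i + j) mod Suc (pfst v)) = digit y j" if j: "j < Suc (pfst y)" for j
  proof -
   have "nat ((int j + int i) mod int (Suc (pfst v))) = (i + j) mod Suc (pfst v)"
    by (simp only: of_nat_add[symmetric] zmod_int[symmetric] nat_int add.commute)
   then have "translate (int i) (periodic_config (word v)) (int j) = word v ! ((i + j) mod Suc (pfst v))"
    by (simp add: translate_def periodic_config_def)
   also have "\<dots> = sorted_list_of_set B ! digit v ((i + j) mod Suc (pfst v))" by (rule word_nth) simp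
   finally show ?thesis
    using word_nth[OF j] digit_less nth_eq_iff_index_eq[of "sorted_list_of_set B"] B by simp
  qed
  then show ?thesis by (auto simp: cyl_def)
 qed
 have "{i \<in> {..<length (word v)}. translate (int i) (periodic_config (word v)) \<in> cyl (word y)}
  = {i \<in> {..<Suc (pfst v)}. \<forall>j<Suc (pfst y). digit v ((i + j) mod Suc (pfst v)) = digit y j}"
  using eq by auto
 moreover have "card \<dots> = occs v y"
  unfolding occs_def by (simp add: sum.If_cases of_bool_def Int_def del: sum.lessThan_Suc sum.op_ivl_Suc)
 ultimately show ?thesis
  by (subst measure_periodic) (simp_all add: cyl_borel)
qed

definition near :: "nat => nat => nat => bool" where
 "near n v w \<longleftrightarrow> (\<forall>u\<in>lists B. length u <= n --> \<bar>measure (pmw v) (cyl u) - measure (pmw w) (cyl u)\<bar> <= (1 / 2) ^ n)"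

lemma near_refl [simp]: "near n v v" and near_sym: "near n v w ==> near n w v"
 by (auto simp: near_def abs_minus_commute)

lemma all_words:
 "(\<forall>u\<in>lists B. length u <= n --> P u) \<longleftrightarrow> P [] & (\<forall>m<n. \<forall>x<b ^ Suc m. P (word (pair m x)))"
proof
 assume *: "\<forall>u\<in>lists B. length u <= n --> P u"
 have "P (word (pair m x))" if "m < n" for m x
  using *[rule_format, OF word(1)[of "pair m x"]] that by simp
 then show "P [] & (\<forall>m<n. \<forall>x<b ^ Suc m. P (word (pair m x)))" using * by simp
next
 assume *: "P [] & (\<forall>m<n. \<forall>x<b ^ Suc m. P (word (pair m x)))"
 show "\<forall>u\<in>lists B. length u <= n --> P u"
 proof (intro ballI impI)
  fix u assume u: "u \<in> lists B" "length u <= n"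
  show "P u"
  proof (cases "length u")
   case (Suc m)
   from u(1) Suc obtain x where "x < b ^ Suc m" "word (pair m x) = u" by (rule word_surj)
   then show ?thesis using * u(2) Suc by auto
  qed (use * in simp)
 qed
qed

lemma measure_Nil: "measure (pmw v) (cyl []) = 1"
 using pmw_inv[of v] prob_space.prob_space[of "pmw v"]
 by (auto simp: inv_measures_def cyl_def dest!: sets_eq_imp_space_eq)

lemma near_code: "near n v w \<longleftrightarrow> (\<forall>m<n. \<forall>x<b ^ Suc m.
  occs v (pair m x) * Suc (pfst w) * 2 ^ n <= occs w (pair m x) * Suc (pfst v) * 2 ^ n + Suc (pfst v) * Suc (pfst w) &
  occs w (pair m x) * Suc (pfst v) * 2 ^ n <= occs v (pair m x) * Suc (pfst w) * 2 ^ n + Suc (pfst v) * Suc (pfst w))"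
proof -
 have "\<bar>measure (pmw v) (cyl (word y)) - measure (pmw w) (cyl (word y))\<bar> <= (1 / 2) ^ n \<longleftrightarrow>
   occs v y * Suc (pfst w) * 2 ^ n <= occs w y * Suc (pfst v) * 2 ^ n + Suc (pfst v) * Suc (pfst w) &
   occs w y * Suc (pfst v) * 2 ^ n <= occs v y * Suc (pfst w) * 2 ^ n + Suc (pfst v) * Suc (pfst w)" for y
  unfolding measure_word by (rule abs_frac_diff_le) simp_all
 then show ?thesis unfolding near_def all_words measure_Nil by simp
qed

lemma decidable_near:
 assumes "computable f" "computable g" "computable h"
 shows "decidable (\<lambda>x. near (f x) (g x) (h x))"
proof -
 have "decidable (\<lambda>p. near (pfst p) (pfst (psnd p)) (psnd (psnd p)))"
  unfolding near_code by (intro computable_intros computable_occs)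
 from decidable_compose[OF this computable_pair[OF assms(1) computable_pair[OF assms(2,3)]]] show ?thesis by simp
qed

abbreviation dst :: "config measure => config measure => real" where "dst \<equiv> dist_M B"

lemma near_dist: "near n v w ==> dst (pmw v) (pmw w) <= 3 * (1 / 2) ^ n"
 using dist_le[OF B pmw_inv[of v] pmw_inv[of w], of "(1 / 2) ^ n" n] by (simp add: near_def)

lemma dist_near:
 assumes "dst (pmw v) (pmw w) <= (1 / 4) ^ n"
 shows "near n v w"
 unfolding near_def
proof (intro ballI impI)
 fix u assume u: "u \<in> lists B" "length u <= n"
 have "\<bar>measure (pmw v) (cyl u) - measure (pmw w) (cyl u)\<bar> <= 2 ^ length u * dst (pmw v) (pmw w)"
  by (rule dist_ge[OF B pmw_inv pmw_inv u(1)])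
 also have "\<dots> <= 2 ^ n * (1 / 4) ^ n"
  using u(2) assms by (intro mult_mono power_increasing dist_nonneg[OF B pmw_inv pmw_inv]) simp_all
 also have "\<dots> = (1 / 2) ^ n" by (simp add: power_mult_distrib[symmetric])
 finally show "\<bar>measure (pmw v) (cyl u) - measure (pmw w) (cyl u)\<bar> <= (1 / 2) ^ n" .
qed

text \<open>In contrast to \<open>near\<close> this is an equivalence relation, with finitely many
  classes, being equality of finitely many rounded frequencies. The least members of the classes
  form a finite net of periodic measures that can be computed.\<close>

definition same :: "nat => nat => nat => bool" where
 "same n v w \<longleftrightarrow> (\<forall>u\<in>lists B. length u <= n -->
  nat \<lfloor>measure (pmw v) (cyl u) * 2 ^ n\<rfloor> = nat \<lfloor>measure (pmw w) (cyl u) * 2 ^ n\<rfloor>)"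

lemma same_near: "same n v w ==> near n v w"
 unfolding near_def
proof (intro ballI impI)
 fix u assume s: "same n v w" and u: "u \<in> lists B" "length u <= n"
 define p q where "p = measure (pmw v) (cyl u) * 2 ^ n" and "q = measure (pmw w) (cyl u) * 2 ^ n"
 have "0 <= p" "0 <= q" by (simp_all add: p_def q_def)
 moreover have "nat \<lfloor>p\<rfloor> = nat \<lfloor>q\<rfloor>" using s u by (simp add: same_def p_def q_def)
 ultimately have "\<lfloor>p\<rfloor> = \<lfloor>q\<rfloor>" by (simp add: eq_nat_nat_iff)
 then have "\<bar>p - q\<bar> <= 1" by linarith
 moreover have "\<bar>p - q\<bar> = \<bar>measure (pmw v) (cyl u) - measure (pmw w) (cyl u)\<bar> * 2 ^ n"
  by (simp add: p_def q_def left_diff_distrib[symmetric] abs_mult)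
 ultimately have "\<bar>measure (pmw v) (cyl u) - measure (pmw w) (cyl u)\<bar> * 2 ^ n <= 1" by (simp only:)
 then show "\<bar>measure (pmw v) (cyl u) - measure (pmw w) (cyl u)\<bar> <= (1 / 2) ^ n"
  by (simp add: field_simps power_one_over)
qed

lemma same_code: "same n v w \<longleftrightarrow> (\<forall>m<n. \<forall>x<b ^ Suc m.
  (occs v (pair m x) * 2 ^ n) div Suc (pfst v) = (occs w (pair m x) * 2 ^ n) div Suc (pfst w))"
proof -
 have "nat \<lfloor>measure (pmw v) (cyl (word y)) * 2 ^ n\<rfloor> = (occs v y * 2 ^ n) div Suc (pfst v)" for v y
 proof -
  have "measure (pmw v) (cyl (word y)) * 2 ^ n = real (occs v y * 2 ^ n) / real (Suc (pfst v))"
   by (simp only: measure_word times_divide_eq_left of_nat_mult of_nat_power of_nat_numeral)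
  then show ?thesis by (simp only: floor_divide_of_nat_eq nat_int)
 qed
 then show ?thesis unfolding same_def all_words measure_Nil by simp
qed

definition rep :: "nat => nat => nat" where
 "rep n v = (LEAST w. same n w v)"

lemma computable_rep:
 assumes "computable f" "computable g"
 shows "computable (\<lambda>x. rep (f x) (g x))"
proof -
 have "computable (\<lambda>p. rep (pfst p) (psnd p))"
  unfolding rep_def by (intro computable_LEAST; (unfold same_code)?) (intro computable_intros computable_occs, auto)
 from computable_compose[OF this computable_pair[OF assms]] show ?thesis by simp
qed

lemma same_rep: "same n (rep n v) v"
 unfolding rep_def by (rule LeastI[of _ v]) (simp add: same_def)

lemma rep_rep [simp]: "rep n (rep n v) = rep n v"
using same_rep same_def rep_def by auto

lemma finite_reps: "finite (range (rep n))"
proof -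
 define S where "S = {u \<in> lists B. length u <= n}"
 define \<phi> where "\<phi> v = (\<lambda>u\<in>S. nat \<lfloor>measure (pmw v) (cyl u) * 2 ^ n\<rfloor>)" for v
 have "range \<phi> \<subseteq> S \<rightarrow>\<^sub>E {..2 ^ n}"
 proof (rule image_subsetI)
  fix v
  have "nat \<lfloor>measure (pmw v) (cyl u) * 2 ^ n\<rfloor> <= 2 ^ n" for u
  proof -
   have "measure (pmw v) (cyl u) * 2 ^ n <= 1 * 2 ^ n" using prob_cyl[OF pmw_inv[of v]] by (intro mult_right_mono) auto
   then have "\<lfloor>measure (pmw v) (cyl u) * 2 ^ n\<rfloor> <= \<lfloor>2 ^ n :: real\<rfloor>" by (intro floor_mono) simp
   also have "\<dots> = 2 ^ n" by (metis floor_of_int of_int_numeral of_int_power)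
   finally show ?thesis by (simp add: nat_le_iff)
  qed
  then show "\<phi> v \<in> S \<rightarrow>\<^sub>E {..2 ^ n}" by (simp add: \<phi>_def)
 qed
 moreover have "finite (S \<rightarrow>\<^sub>E {..2 ^ n :: nat})"
  unfolding S_def by (intro finite_PiE finite_short B) simp
 ultimately have fin: "finite (range \<phi>)" by (rule finite_subset)
 have same: "same n w v" if "\<phi> w = \<phi> v" for v w
  unfolding same_def
 proof (intro ballI impI)
  fix u assume "u \<in> lists B" "length u <= n"
  then show "nat \<lfloor>measure (pmw w) (cyl u) * 2 ^ n\<rfloor> = nat \<lfloor>measure (pmw v) (cyl u) * 2 ^ n\<rfloor>"
   using fun_cong[OF that, of u] by (simp add: \<phi>_def S_def)
 qed
 obtain M where M: "\<And>v. inv \<phi> (\<phi> v) <= M"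
  using finite_imageI[OF fin, of "inv \<phi>"] unfolding finite_nat_set_iff_bounded_le by auto
 have "rep n v <= M" for v
 proof -
  have "\<phi> (inv \<phi> (\<phi> v)) = \<phi> v" by (rule f_inv_into_f) simp
  then have "rep n v <= inv \<phi> (\<phi> v)" unfolding rep_def by (intro Least_le same)
  then show ?thesis using M[of v] by linarith
 qed
 then show ?thesis by (auto simp: finite_nat_set_iff_bounded_le)
qed

end

section \<open>Quantifier form of Pi2-computability\<close>

lemma rat_code_power: "rat_code ((1 / 2) ^ i) = pair 2 (2 * 2 ^ i)"
proof -
 have "(1 / 2) ^ i = Fract 1 (2 ^ i)"
  by (simp add: Fract_of_int_quotient power_one_over inverse_eq_divide)
 then have "quotient_of ((1 / 2) ^ i) = (1, 2 ^ i)" by (simp add: quotient_of_Fract Rat.normalize_def)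
 then show ?thesis by (simp add: rat_code_def pair_def int_encode_def sum_encode_def nat_power_eq)
qed

lemma rat_code_half: "1 / 2 < r \<longleftrightarrow> pfst (rat_code r) mod 2 = 0 & psnd (rat_code r) < 2 * pfst (rat_code r)"
proof -
 obtain p q where pq: "quotient_of r = (p, q)" by fastforce
 then have q: "0 < q" and r: "r = of_int p / of_int q" using quotient_of_denom_pos quotient_of_div by auto
 have c: "pfst (rat_code r) = int_encode p" "psnd (rat_code r) = 2 * nat q"
  using q unfolding rat_code_def pq by (simp_all add: pfst_def psnd_def int_encode_def sum_encode_def)
 have "1 / 2 < r \<longleftrightarrow> (of_int q :: rat) < of_int (2 * p)" using q by (simp add: r field_simps)
 then have h: "1 / 2 < r \<longleftrightarrow> q < 2 * p" by (simp only: of_int_less_iff)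
 show ?thesis
 using int_encode_def sum_encode_def q h c by auto
qed

lemma half_powers: "(1 / 2 :: real) ^ (i + 3) = (1 / 2) ^ i / 8" "(1 / 2 :: real) ^ (i + 4) = (1 / 2) ^ i / 16"
 by (simp_all add: power_add power_divide)

context letters begin

text \<open>The infimum is known to be 0 or 1. Hence it is 1 iff every supremum exceeds 1/2, which a
  single j witnesses, and comparing a rational with 1/2 is decidable.\<close>

lemma Pi2_events:
 assumes "Pi2_computable B K" "K \<subseteq> inv_measures B"
 obtains E where "decidable (\<lambda>x. E (pfst x) (pfst (psnd x)) (pfst (psnd (psnd x))) (psnd (psnd (psnd x))))"
  "\<And>i u. (\<exists>\<kappa>\<in>K. dst (pmw u) \<kappa> <= (1 / 2) ^ i) \<longleftrightarrow> (\<forall>i'. \<exists>j. E i u i' j)"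
proof -
 obtain p and f :: "nat => nat => nat list => rat => rat" where
  p: "\<And>i j r w. w \<in> lists B - {[]} ==> evaluates p [i, j, list_encode w, rat_code r] (rat_code (f i j w r))"
  and f: "\<And>r w. w \<in> lists B - {[]} ==>
   (if cball_M B (periodic_measure w) (of_rat r) \<inter> K ~= {} then 1 else 0) = (INF i. SUP j. ereal (of_rat (f i j w r)))"
  using assms(1) unfolding Pi2_computable_def by blast
 define E where "E i u i' j \<longleftrightarrow> 1 / 2 < f i' j (word u) ((1 / 2) ^ i)" for i u i' j
 have wd: "word u \<in> lists B - {[]}" for u by simp
 define G where "G x = rat_code (f (pfst (psnd (psnd x))) (psnd (psnd (psnd x))) (word (pfst (psnd x))) ((1 / 2) ^ pfst x))" for x
 have "computable G"
 proof -
  obtain q1 q2 q3 q4 where q: "\<And>x. evaluates q1 [x] (pfst (psnd (psnd x)))" "\<And>x. evaluates q2 [x] (psnd (psnd (psnd x)))"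
   "\<And>x. evaluates q3 [x] (list_encode (word (pfst (psnd x))))" "\<And>x. evaluates q4 [x] (pair 2 (2 * 2 ^ pfst x))"
  using computable_intros computable_word computable_def by fastforce
  have "evaluates (Comp p [q1, q2, q3, q4]) [x] (G x)" for x
   unfolding G_def by (rule evaluates_Comp4[OF q]) (unfold rat_code_power[symmetric], rule p[OF wd])
  then show ?thesis unfolding computable_def by blast
 qed
 then have "decidable (\<lambda>x. pfst (G x) mod 2 = 0 & psnd (G x) < 2 * pfst (G x))"
  by (intro decidable_conj decidable_eq decidable_less computable_mod computable_mult computable_const computable_pfst computable_psnd)
 then have dec: "decidable (\<lambda>x. E (pfst x) (pfst (psnd x)) (pfst (psnd (psnd x))) (psnd (psnd (psnd x))))"
  by (simp only: E_def rat_code_half G_def)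
 have "(\<exists>\<kappa>\<in>K. dst (pmw u) \<kappa> <= (1 / 2) ^ i) \<longleftrightarrow> (\<forall>i'. \<exists>j. E i u i' j)" for i u
 proof -
  have e: "ereal (1 / 2) < ereal (of_rat (f i' j (word u) ((1 / 2) ^ i))) \<longleftrightarrow> E i u i' j" for i' j
  proof -
   have "(1 / 2 :: real) = of_rat (1 / 2)" by (simp add: of_rat_divide)
   then show ?thesis by (simp only: ereal_less_eq less_ereal.simps of_rat_less E_def)
  qed
  let ?S = "\<lambda>i'. SUP j. ereal (of_rat (f i' j (word u) ((1 / 2) ^ i)))"
  have "(\<exists>\<kappa>\<in>K. dst (pmw u) \<kappa> <= (1 / 2) ^ i) \<longleftrightarrow> cball_M B (pmw u) (of_rat ((1 / 2) ^ i)) \<inter> K ~= {}"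
   using assms(2) by (auto simp: cball_M_def of_rat_power of_rat_divide)
  also have "\<dots> \<longleftrightarrow> (INF i'. ?S i') = 1"
   unfolding f[OF wd, symmetric] by simp
  also have "\<dots> \<longleftrightarrow> (\<forall>i'. \<exists>j. E i u i' j)"
  proof
   assume "(INF i'. ?S i') = 1"
   then have "1 <= ?S i'" for i' using INF_lower[of i' UNIV ?S] by simp
   then have "ereal (1 / 2) < ?S i'" for i'
    by (rule less_le_trans[rotated]) simp
   then show "\<forall>i'. \<exists>j. E i u i' j" unfolding less_SUP_iff e by blast
  next
   assume ev: "\<forall>i'. \<exists>j. E i u i' j"
   have "ereal (1 / 2) <= (INF i'. ?S i')"
   proof (rule INF_greatest)
    fix i'
    obtain j where "E i u i' j" using ev by blast
    then have "ereal (1 / 2) < ?S i'" unfolding less_SUP_iff e by blast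
    then show "ereal (1 / 2) <= ?S i'" by simp
   qed
   moreover have "(INF i'. ?S i') = 1 \<or> (INF i'. ?S i') = 0"
    unfolding f[OF wd, symmetric] by simp
   moreover have "~ ereal (1 / 2) <= 0" by simp
   ultimately show "(INF i'. ?S i') = 1" by metis
  qed
  finally show ?thesis .
 qed
 with dec show ?thesis by (rule that)
qed

end

section \<open>Enumeration of words that accumulate exactly on K\<close>

locale target = letters +
 fixes K :: "config measure set" and E
 assumes K: "K \<subseteq> inv_measures B" "compactin (weak_star B) K" "connectedin (weak_star B) K" "K ~= {}"
  and E: "decidable (\<lambda>x. E (pfst x) (pfst (psnd x)) (pfst (psnd (psnd x))) (psnd (psnd (psnd x))))"
   "\<And>i u. (\<exists>\<kappa>\<in>K. dst (pmw u) \<kappa> <= (1 / 2) ^ i) \<longleftrightarrow> (\<forall>i'. \<exists>j. E i u i' j)"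
begin

text \<open>A bounded version of the Pi2 condition. It tests not u but its representative at
  precision i + 3: for each i there are only finitely many of these, so a single bound exposes all
  bad ones.\<close>

definition passes :: "nat => nat => nat => bool" where
 "passes l T u \<longleftrightarrow> (\<forall>i\<le>l. \<forall>i'\<le>l. \<exists>j\<le>T. E i (rep (i + 3) u) i' j)"

text \<open>n codes a level l, a word u and a search bound T. Asking for the least T lets each pair
  of l and u produce at most one hit, and asking for representatives leaves finitely many u per
  level.\<close>

definition hit :: "nat => bool" where
 "hit n \<longleftrightarrow> rep (pfst n + 4) (pfst (psnd n)) = pfst (psnd n) & passes (pfst n) (psnd (psnd n)) (pfst (psnd n)) &
   ~ (\<exists>T<psnd (psnd n). passes (pfst n) T (pfst (psnd n)))"

definition appr :: "nat => nat" where
 "appr n = rec_nat 0 (\<lambda>m z. if hit m then pfst (psnd m) else z) n"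

lemma computable_appr: "computable appr"
proof -
 have E': "decidable (\<lambda>x. E (f x) (g x) (h x) (k x))"
  if "computable f" "computable g" "computable h" "computable k" for f g h k
  using decidable_compose[OF E(1) computable_pair[OF that(1) computable_pair[OF that(2) computable_pair[OF that(3,4)]]]] by simp
 have passes: "decidable (\<lambda>x. passes (f x) (g x) (h x))"
  if "computable f" "computable g" "computable h" for f g h
 proof -
  have "decidable (\<lambda>x. passes (pfst x) (pfst (psnd x)) (psnd (psnd x)))"
   unfolding passes_def by (intro decidable_all_le decidable_ex_le E' computable_rep computable_intros)
  from decidable_compose[OF this computable_pair[OF that(1) computable_pair[OF that(2,3)]]] show ?thesis by simp
 qed
 have hit: "decidable (\<lambda>x. hit (pfst x))"
  unfolding hit_def by (intro decidable_conj decidable_not decidable_ex_less passes computable_rep computable_intros)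
 have "computable (\<lambda>n. rec_nat 0 (\<lambda>m z. if hit m then pfst (psnd m) else z) n)"
  by (rule computable_rec_nat) (intro computable_If hit computable_intros)+
 then show ?thesis by (simp only: appr_def[abs_def])
qed

text \<open>Each of the finitely many representatives at precision i + 3 that are farther than 2^-i
  from K fails for some i', with a common bound I. So hits of level above i + I are close to K, and
  lower levels have finitely many hits.\<close>

lemma hit_sound:
 assumes "0 < \<epsilon>"
 shows "finite {n. hit n & ~ (\<exists>\<kappa>\<in>K. dst (pmw (pfst (psnd n))) \<kappa> < \<epsilon>)}" (is "finite ?bad")
proof -
 obtain i where i: "(1 / 2) ^ i < \<epsilon> / 2" using real_arch_pow_inv[of "\<epsilon> / 2" "1 / 2"] assms by auto
 define bad where "bad = {v \<in> range (rep (i + 3)). ~ (\<exists>\<kappa>\<in>K. dst (pmw v) \<kappa> <= (1 / 2) ^ i)}"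
 have "\<exists>i'. \<forall>j. ~ E i v i' j" if "v \<in> bad" for v using that E(2)[of v i] by (auto simp: bad_def)
 then obtain f where f: "\<And>v j. v \<in> bad ==> ~ E i v (f v) j" by metis
 have "finite bad" unfolding bad_def using finite_reps by simp
 then obtain I where I: "\<And>v. v \<in> bad ==> f v <= I"
  using finite_imageI[of bad f] unfolding finite_nat_set_iff_bounded_le by auto
 have low: "pfst n < Suc (i + I)" if n: "n \<in> ?bad" for n
 proof (rule ccontr)
  assume l: "~ pfst n < Suc (i + I)"
  define u where "u = pfst (psnd n)"
  have "passes (pfst n) (psnd (psnd n)) u" using n by (simp add: hit_def u_def)
  then have "\<exists>j. E i (rep (i + 3) u) i' j" if "i' <= I" for i'
  proof -
   have "i <= pfst n" "i' <= pfst n" using l that by linarith+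
   with \<open>passes (pfst n) (psnd (psnd n)) u\<close> show ?thesis by (auto simp: passes_def)
  qed
  then have "~ rep (i + 3) u \<in> bad" using f I by blast
  then obtain \<kappa> where \<kappa>: "\<kappa> \<in> K" "dst (pmw (rep (i + 3) u)) \<kappa> <= (1 / 2) ^ i" by (auto simp: bad_def)
  have "dst (pmw (rep (i + 3) u)) (pmw u) <= 3 * (1 / 2) ^ (i + 3)"
   by (rule near_dist[OF same_near[OF same_rep]])
  then have "dst (pmw u) \<kappa> <= 3 * (1 / 2) ^ (i + 3) + (1 / 2) ^ i"
   using dist_triangle_M[OF B pmw_inv[of u] pmw_inv[of "rep (i + 3) u"], of \<kappa>] \<kappa> K(1)
   by (auto simp: dist_sym[OF B, of "pmw u"])
  also have "\<dots> <= 2 * (1 / 2) ^ i" by (simp add: half_powers)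
  also have "\<dots> < \<epsilon>" using i by simp
  finally show False using n \<kappa>(1) by (auto simp: u_def)
 qed
 have "?bad \<subseteq> (\<lambda>(l, u). pair l (pair u (LEAST T. passes l T u))) ` ({..<Suc (i + I)} \<times> (\<Union>l<Suc (i + I). range (rep (l + 4))))"
 proof
  fix n assume n: "n \<in> ?bad"
  then have h: "hit n" by simp
  have "(LEAST T. passes (pfst n) T (pfst (psnd n))) = psnd (psnd n)"
  by (metis Least_equality h hit_def not_le)
  then have "n = (\<lambda>(l, u). pair l (pair u (LEAST T. passes l T u))) (pfst n, pfst (psnd n))" by simp
  moreover have "pfst (psnd n) \<in> range (rep (pfst n + 4))"
   by (rule range_eqI[of _ _ "pfst (psnd n)"]) (use h in \<open>simp add: hit_def\<close>)
  ultimately show "n \<in> (\<lambda>(l, u). pair l (pair u (LEAST T. passes l T u))) ` ({..<Suc (i + I)} \<times> (\<Union>l<Suc (i + I). range (rep (l + 4))))"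
   using low[OF n] by (intro image_eqI[of _ _ "(pfst n, pfst (psnd n))"]) auto
 qed
 then show ?thesis by (rule finite_subset) (intro finite_imageI finite_SigmaI finite_UN_I finite_reps finite_lessThan)
qed

lemma word_dense:
 assumes "\<kappa> \<in> K" "0 < \<delta>"
 obtains v where "dst (pmw v) \<kappa> < \<delta>"
proof -
 have \<kappa>: "\<kappa> \<in> inv_measures B" using assms K by auto
 from dist_nbhd[OF B assms(2)] obtain n \<eta> where n: "0 < \<eta>"
  "\<And>\<mu> \<nu>. \<mu> \<in> inv_measures B ==> \<nu> \<in> inv_measures B ==> close B n \<eta> \<mu> \<nu> ==> dst \<mu> \<nu> < \<delta>" by metis
 obtain w where w: "w \<in> lists B" "w ~= []" "close B n \<eta> (periodic_measure w) \<kappa>"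
  by (rule periodic_dense[OF B \<kappa> n(1)])
 from w(2) have "length w = Suc (length w - 1)" by simp
 with w(1) obtain x where x: "word (pair (length w - 1) x) = w" by (rule word_surj)
 have "dst (pmw (pair (length w - 1) x)) \<kappa> < \<delta>"
  by (rule n(2)[OF pmw_inv \<kappa>], unfold x) (rule w(3))
 then show ?thesis by (rule that)
qed

text \<open>The word u approximates \<kappa> within 2^-l / 4, and passing to a representative costs
  at most 3/8 of 2^-i. As 1/4 + 3/8 < 1, the word passes all tests up to level l.\<close>

lemma hit_dense:
 assumes \<kappa>: "\<kappa> \<in> K" and \<epsilon>: "0 < \<epsilon>"
 shows "\<exists>n\<ge>N. hit n & dst (pmw (pfst (psnd n))) \<kappa> < \<epsilon>"
proof -
 have \<kappa>': "\<kappa> \<in> inv_measures B" using \<kappa> K by auto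
 obtain l0 where l0: "(1 / 2) ^ l0 < \<epsilon>" using real_arch_pow_inv[of \<epsilon> "1 / 2"] \<epsilon> by auto
 define l where "l = max N l0"
 obtain v where v: "dst (pmw v) \<kappa> < (1 / 2) ^ (l + 4)" by (rule word_dense[OF \<kappa>, of "(1 / 2) ^ (l + 4)"]) simp_all
 define u where "u = rep (l + 4) v"
 have u: "rep (l + 4) u = u" by (simp add: u_def)
 have "dst (pmw u) (pmw v) <= 3 * (1 / 2) ^ (l + 4)"
  unfolding u_def by (rule near_dist[OF same_near[OF same_rep]])
 then have "dst (pmw u) \<kappa> < 4 * (1 / 2) ^ (l + 4)"
  using dist_triangle_M[OF B pmw_inv[of u] pmw_inv[of v] \<kappa>'] v by linarith
 then have d: "dst (pmw u) \<kappa> < (1 / 4) * (1 / 2) ^ l" by (simp add: half_powers)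
 have "\<forall>i'. \<exists>j. E i (rep (i + 3) u) i' j" if "i <= l" for i
 proof -
  have "dst (pmw (rep (i + 3) u)) (pmw u) <= 3 * (1 / 2) ^ (i + 3)"
   by (rule near_dist[OF same_near[OF same_rep]])
  then have "dst (pmw (rep (i + 3) u)) \<kappa> <= 3 * (1 / 2) ^ (i + 3) + (1 / 4) * (1 / 2) ^ l"
   using dist_triangle_M[OF B pmw_inv[of "rep (i + 3) u"] pmw_inv[of u] \<kappa>'] d by linarith
  also have "\<dots> <= 3 * (1 / 2) ^ (i + 3) + (1 / 4) * (1 / 2) ^ i"
   using power_decreasing[OF that, of "1 / 2 :: real"] by simp
  also have "\<dots> <= (1 / 2) ^ i" by (simp add: half_powers)
  finally show ?thesis using \<kappa> E(2)[of "rep (i + 3) u" i] by blast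
 qed
 then obtain j where j: "\<And>i i'. i <= l ==> E i (rep (i + 3) u) i' (j i i')" by metis
 have ex: "\<exists>T. passes l T u"
 proof
  show "passes l (\<Sum>i\<le>l. \<Sum>i'\<le>l. j i i') u"
   unfolding passes_def
  proof (intro allI impI)
   fix i i' assume i: "i <= l" "i' <= l"
   have "j i i' <= (\<Sum>i'\<le>l. j i i')" using i by (intro member_le_sum) auto
   also have "\<dots> <= (\<Sum>i\<le>l. \<Sum>i'\<le>l. j i i')" by (rule member_le_sum[of i _ "\<lambda>i. \<Sum>i'\<le>l. j i i'"]) (use i in auto)
   finally show "\<exists>T\<le>\<Sum>i\<le>l. \<Sum>i'\<le>l. j i i'. E i (rep (i + 3) u) i' T" using j[OF i(1), of i'] by blast
  qed
 qed
 define T where "T = (LEAST T. passes l T u)"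
 have T: "passes l T u" unfolding T_def by (rule LeastI_ex[OF ex])
 have T': "~ (\<exists>T'<T. passes l T' u)" unfolding T_def using not_less_Least[where P = "\<lambda>T. passes l T u"] by blast
 have "hit (pair l (pair u T))" unfolding hit_def pfst_pair psnd_pair by (intro conjI u T T')
 moreover have "N <= pair l (pair u T)" using pfst_le[of "pair l (pair u T)"] by (simp add: l_def)
 moreover have "dst (pmw u) \<kappa> < \<epsilon>"
 proof -
  have "(1 / 2) ^ l <= (1 / 2 :: real) ^ l0" unfolding l_def by (rule power_decreasing) auto
  moreover have "(0 :: real) < (1 / 2) ^ l" by simp
  ultimately show ?thesis using d l0 by linarith
 qed
 ultimately show ?thesis by (intro exI[of _ "pair l (pair u T)"]) simp
qed

lemma appr_dense:
 assumes "\<kappa> \<in> K" "0 < \<epsilon>"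
 shows "\<exists>n\<ge>N. dst (pmw (appr n)) \<kappa> < \<epsilon>"
proof -
 obtain n where n: "N <= n" "hit n" "dst (pmw (pfst (psnd n))) \<kappa> < \<epsilon>" using hit_dense[OF assms, of N] by (elim exE conjE)
 then show ?thesis by (intro exI[of _ "Suc n"]) (simp add: appr_def)
qed

lemma appr_near:
 assumes "0 < \<epsilon>"
 obtains N where "\<And>n. N <= n ==> \<exists>\<kappa>\<in>K. dst (pmw (appr n)) \<kappa> < \<epsilon>"
proof -
 obtain N0 where N0: "\<forall>n\<in>{n. hit n & ~ (\<exists>\<kappa>\<in>K. dst (pmw (pfst (psnd n))) \<kappa> < \<epsilon>)}. n < N0"
  using hit_sound[OF assms] unfolding finite_nat_set_iff_bounded by (elim exE)
 obtain \<kappa> where "\<kappa> \<in> K" using K by auto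
 from hit_dense[OF \<open>\<kappa> \<in> K\<close> assms, of N0] obtain N where N: "N0 <= N" "hit N" "dst (pmw (pfst (psnd N))) \<kappa> < \<epsilon>" by (elim exE conjE)
 have "\<exists>\<kappa>\<in>K. dst (pmw (appr n)) \<kappa> < \<epsilon>" if "Suc N <= n" for n
  using that
 proof (induction n rule: dec_induct)
  case base
  then show ?case using N \<open>\<kappa> \<in> K\<close> by (auto simp: appr_def)
 next
  case (step n)
  show ?case
  using N step.hyps N0 appr_def step.IH by auto
 qed
 then show ?thesis by (rule that)
qed

end

section \<open>Joining the words by paths of small steps\<close>

definition slow :: "nat => nat" where
 "slow s = (LEAST h. s < (h + 2)\<^sup>2)"

lemma slow: "s < (slow s + 2)\<^sup>2"
 unfolding slow_def
proof (rule LeastI)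
 have "1 * s < (s + 2) * (s + 2)" by (rule mult_strict_mono) auto
 then show "s < (s + 2)\<^sup>2" by (simp add: power2_eq_square)
qed

lemma slow_ge: "(h + 1)\<^sup>2 <= s ==> h <= slow s"
proof (rule ccontr)
 assume h: "(h + 1)\<^sup>2 <= s" "~ h <= slow s"
 then have "(slow s + 2)\<^sup>2 <= (h + 1)\<^sup>2" by (intro power_mono) auto
 then show False using slow[of s] h by linarith
qed

lemma slow_le: "slow s <= h" if "s < (h + 2)\<^sup>2"
 unfolding slow_def by (rule Least_le) (rule that)

text \<open>\<open>slow s\<close> is the integer square root of s minus 1. There are thus at most s
  pairs of indices up to \<open>slow s\<close>, which bounds the length of shortest paths among
  them.\<close>

lemma slow_square: "0 < s ==> (slow s + 1)\<^sup>2 <= s"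
proof (cases "slow s")
 case (Suc h)
 assume "0 < s"
 show ?thesis
 proof (rule ccontr)
  assume "~ ?thesis"
  then have "s < (h + 2)\<^sup>2" using Suc by simp
  then have "slow s <= h" by (rule slow_le)
  then show False using Suc by simp
 qed
qed simp

lemma slow_at: "slow ((m + 1)\<^sup>2) = m"
by (auto simp: antisym power_strict_mono slow_le slow_ge)

lemma computable_slow: "computable f ==> computable (\<lambda>x. slow (f x))"
proof -
 have "computable (\<lambda>x. slow x)" unfolding slow_def
 proof (rule computable_LEAST)
  show "\<exists>h. s < (h + 2)\<^sup>2" for s :: nat using slow[of s] by blast
 qed (intro computable_intros)
 then show "computable f ==> computable (\<lambda>x. slow (f x))" by (rule computable_compose)
qed

lemma slow_self_le: "slow s <= s"
by (auto simp: power2_eq_square slow_le)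

lemma pair_Suc: "Suc (pair a (Suc c)) = pair (Suc a) c" "Suc (pair a 0) = pair 0 (Suc a)"
 by (simp_all add: pair_def prod_encode_def)

lemma rtrancl_image:
 assumes "(x, y) \<in> r\<^sup>*" "\<And>x y. (x, y) \<in> r ==> (f x, f y) \<in> s"
 shows "(f x, f y) \<in> s\<^sup>*"
 using assms(1) by induction (auto intro: assms(2) rtrancl_into_rtrancl)

context target begin

definition place :: "nat => nat => nat => nat" where
 "place s c j = (c div (s + 1) ^ j) mod (s + 1)"

text \<open>c codes a path of s steps by s + 1 digits to base s + 1. It leads from index
  \<open>slow (s - 1)\<close> to \<open>slow s\<close>, where the path of the next stage
  begins.\<close>

definition chain :: "nat => nat => nat => bool" where
 "chain s M c \<longleftrightarrow> place s c 0 = slow (s - 1) & place s c s = slow s & (\<forall>j<s + 1. M <= place s c j) &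
   (\<forall>j<s. near M (appr (place s c j)) (appr (place s c (j + 1))))"

definition linked :: "nat => nat => bool" where
 "linked s M \<longleftrightarrow> (\<exists>c<(s + 1) ^ (s + 1). chain s M c)"

text \<open>The largest precision up to s for which a path exists, or 0. From which stage on a given
  precision is available is unknown to the program, so each stage takes the best it finds.\<close>

definition best :: "nat => nat" where
 "best s = s - (LEAST q. s <= q \<or> linked s (s - q))"

definition route :: "nat => nat" where
 "route s = (LEAST c. ~ linked s (best s) \<or> chain s (best s) c)"

text \<open>\<open>pair\<close> runs through antidiagonals, so q visits stage s =
  \<open>pfst q + psnd q\<close> at positions 0 to s in order and then moves on to stage s + 1: the
  Cantor pairing concatenates the paths.\<close>

definition wnum :: "nat => nat" where
 "wnum q = appr (place (pfst q + psnd q) (route (pfst q + psnd q)) (pfst q))"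

lemma computable_wnum: "computable wnum"
proof -
 have place: "computable (\<lambda>x. place (f x) (g x) (h x))" if "computable f" "computable g" "computable h" for f g h
  unfolding place_def by (intro computable_intros that)
 note appr = computable_compose[OF computable_appr]
 have chain: "decidable (\<lambda>x. chain (f x) (g x) (h x))" if "computable f" "computable g" "computable h" for f g h
 proof -
  have "decidable (\<lambda>x. chain (pfst x) (pfst (psnd x)) (psnd (psnd x)))"
   unfolding chain_def by (intro decidable_conj decidable_eq decidable_all_less decidable_near decidable_le appr place computable_slow computable_intros)
  from decidable_compose[OF this computable_pair[OF that(1) computable_pair[OF that(2,3)]]] show ?thesis by simp
 qed
 have linked: "decidable (\<lambda>x. linked (f x) (g x))" if "computable f" "computable g" for f g
 proof -
  have "decidable (\<lambda>x. linked (pfst x) (psnd x))"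
   unfolding linked_def by (intro decidable_ex_less chain computable_intros)
  from decidable_compose[OF this computable_pair[OF that]] show ?thesis by simp
 qed
 have best: "computable (\<lambda>x. best x)" unfolding best_def
 proof (intro computable_diff computable_id computable_LEAST)
  show "decidable (\<lambda>p. psnd p <= pfst p \<or> linked (psnd p) (psnd p - pfst p))"
   by (intro decidable_disj decidable_le linked computable_intros)
 qed auto
 have route: "computable (\<lambda>x. route x)" unfolding route_def
 proof (rule computable_LEAST)
  show "decidable (\<lambda>p. ~ linked (psnd p) (best (psnd p)) \<or> chain (psnd p) (best (psnd p)) (pfst p))"
   by (intro decidable_disj decidable_not linked chain computable_compose[OF best] computable_intros)
  show "\<exists>c. ~ linked s (best s) \<or> chain s (best s) c" for s unfolding linked_def by blast
 qed
 have "computable (\<lambda>q. appr (place (pfst q + psnd q) (route (pfst q + psnd q)) (pfst q)))"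
  by (rule appr, rule place) (intro computable_compose[OF route] computable_intros)+
 then show ?thesis by (simp only: wnum_def[abs_def])
qed

text \<open>K is connected, so any two of its points are joined by small steps. \<open>G\<close>
  replaces each point by a late index whose word is near it; taken from a finite net, these indices
  are bounded by I and available as soon as \<open>slow s\<close> reaches I.\<close>

lemma linked_eventually: "\<exists>S. \<forall>s\<ge>S. linked s M"
proof -
 \<comment> \<open>Words of consecutive indices lie within 2 + 1 + 2 multiples of \<epsilon>, and
   \<open>dist_near\<close> asks for (1/4)^M.\<close>
 define \<epsilon> :: real where "\<epsilon> = (1 / 4) ^ M / 5"
 have \<epsilon>: "0 < \<epsilon>" by (simp add: \<epsilon>_def)
 obtain N0 where N0: "\<And>n. N0 <= n ==> \<exists>\<kappa>\<in>K. dst (pmw (appr n)) \<kappa> < \<epsilon>" by (rule appr_near[OF \<epsilon>]) (rule that, assumption+)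
 define N1 where "N1 = max N0 M"
 obtain N where N: "finite N" "N \<subseteq> K" "\<And>\<kappa>. \<kappa> \<in> K ==> \<exists>\<nu>\<in>N. dst \<kappa> \<nu> < \<epsilon>"
  by (rule finite_net[OF B K(1,2) \<epsilon>]) (rule that, assumption+)
 have "\<exists>n\<ge>N1. dst (pmw (appr n)) \<nu> < \<epsilon>" if "\<nu> \<in> K" for \<nu> by (rule appr_dense[OF that \<epsilon>])
 then obtain g where g: "\<And>\<nu>. \<nu> \<in> K ==> N1 <= g \<nu> & dst (pmw (appr (g \<nu>))) \<nu> < \<epsilon>" by metis
 obtain net where net: "\<And>\<kappa>. \<kappa> \<in> K ==> net \<kappa> \<in> N & dst \<kappa> (net \<kappa>) < \<epsilon>" using N(3) by metis
 obtain I where I: "\<And>\<nu>. \<nu> \<in> N ==> g \<nu> <= I"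
  using finite_imageI[OF N(1), of g] unfolding finite_nat_set_iff_bounded_le by auto
 define G where "G \<kappa> = g (net \<kappa>)" for \<kappa>
 have inv: "\<kappa> \<in> inv_measures B" if "\<kappa> \<in> K" for \<kappa> using that K(1) by auto
 have G: "N1 <= G \<kappa>" "G \<kappa> <= I" "dst (pmw (appr (G \<kappa>))) \<kappa> < 2 * \<epsilon>" if k: "\<kappa> \<in> K" for \<kappa>
 proof -
  have n: "net \<kappa> \<in> K" "dst \<kappa> (net \<kappa>) < \<epsilon>" using net[OF k] N(2) by auto
  show "N1 <= G \<kappa>" "G \<kappa> <= I" using g[OF n(1)] I net[OF k] by (auto simp: G_def)
  have "dst (pmw (appr (G \<kappa>))) \<kappa> <= dst (pmw (appr (G \<kappa>))) (net \<kappa>) + dst (net \<kappa>) \<kappa>"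
   by (rule dist_triangle_M[OF B pmw_inv inv[OF n(1)] inv[OF k]])
  also have "\<dots> < 2 * \<epsilon>" using n(2) g[OF n(1)] by (simp add: G_def dist_sym[OF B, of "net \<kappa>"])
  finally show "dst (pmw (appr (G \<kappa>))) \<kappa> < 2 * \<epsilon>" .
 qed
 have close: "near M (appr a) (appr c)"
  if "\<kappa> \<in> K" "\<nu> \<in> K" "dst (pmw (appr a)) \<kappa> < 2 * \<epsilon>" "dst \<kappa> \<nu> < \<epsilon>" "dst (pmw (appr c)) \<nu> < 2 * \<epsilon>" for a c \<kappa> \<nu>
 proof (rule dist_near)
  have "dst (pmw (appr a)) (pmw (appr c)) <= dst (pmw (appr a)) \<nu> + dst \<nu> (pmw (appr c))"
   by (rule dist_triangle_M[OF B pmw_inv inv[OF that(2)] pmw_inv])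
  moreover have "dst (pmw (appr a)) \<nu> <= dst (pmw (appr a)) \<kappa> + dst \<kappa> \<nu>"
   by (rule dist_triangle_M[OF B pmw_inv inv[OF that(1)] inv[OF that(2)]])
  ultimately have "dst (pmw (appr a)) (pmw (appr c)) <= 5 * \<epsilon>"
   using that(3-5) dist_sym[OF B, of \<nu> "pmw (appr c)"] by linarith
  then show "dst (pmw (appr a)) (pmw (appr c)) <= (1 / 4) ^ M" by (simp add: \<epsilon>_def)
 qed
 have self: "dst \<kappa> \<kappa> < \<epsilon>" if "\<kappa> \<in> K" for \<kappa>
 proof -
  obtain n where "(1 / 2) ^ n < \<epsilon>" using real_arch_pow_inv[of \<epsilon> "1 / 2"] \<epsilon> by auto
  then show ?thesis using dist_le[OF B inv[OF that] inv[OF that], of 0 n] by simp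
 qed
 define m where "m = max N1 I"
 have "linked s M" if s: "(m + 1)\<^sup>2 + 1 <= s" for s
 proof -
  define R where "R = {(a, c). N1 <= a & a <= slow s & N1 <= c & c <= slow s & near M (appr a) (appr c)}"
  have sm: "m <= slow (s - 1)" "m <= slow s" by (rule slow_ge, use s in linarith)+
  have mono: "slow (s - 1) <= slow s"
  proof (rule slow_le)
   show "s - 1 < (slow s + 2)\<^sup>2" using slow[of s] by linarith
  qed
  have link: "(a, c) \<in> R\<^sup>*" if a: "N1 <= a" "a <= slow s" and c: "N1 <= c" "c <= slow s" for a c
  proof -
   obtain \<kappa> where \<kappa>: "\<kappa> \<in> K" "dst (pmw (appr a)) \<kappa> < \<epsilon>" using N0[of a] a by (auto simp: N1_def)
   obtain \<nu> where \<nu>: "\<nu> \<in> K" "dst (pmw (appr c)) \<nu> < \<epsilon>" using N0[of c] c by (auto simp: N1_def)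
   have Gs: "G \<eta> <= slow s" if "\<eta> \<in> K" for \<eta> using G(2)[OF that] sm(2) by (simp add: m_def)
   have "(a, G \<kappa>) \<in> R"
    using close[OF \<kappa>(1) \<kappa>(1) _ self[OF \<kappa>(1)] G(3)[OF \<kappa>(1)], of a] \<kappa>(2) \<epsilon> a G(1)[OF \<kappa>(1)] Gs[OF \<kappa>(1)]
    by (simp add: R_def)
   moreover have "(G \<kappa>, G \<nu>) \<in> R\<^sup>*"
   proof (rule rtrancl_image[of _ _ _ G])
    show "(\<kappa>, \<nu>) \<in> {(\<mu>, \<nu>). \<mu> \<in> K & \<nu> \<in> K & dst \<mu> \<nu> < \<epsilon>}\<^sup>*"
     by (rule chain_connected[OF B K(1,2,3) \<epsilon> \<kappa>(1) \<nu>(1)])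
    show "(G x, G y) \<in> R" if "(x, y) \<in> {(\<mu>, \<nu>). \<mu> \<in> K & \<nu> \<in> K & dst \<mu> \<nu> < \<epsilon>}" for x y
    proof -
     have xy: "x \<in> K" "y \<in> K" "dst x y < \<epsilon>" using that by auto
     then show ?thesis using close[OF xy(1,2) G(3)[OF xy(1)] xy(3) G(3)[OF xy(2)]] G(1) Gs by (simp add: R_def)
    qed
   qed
   moreover have "(G \<nu>, c) \<in> R"
    using close[OF \<nu>(1) \<nu>(1) G(3)[OF \<nu>(1)] self[OF \<nu>(1)], of c] \<nu>(2) \<epsilon> c G(1)[OF \<nu>(1)] Gs[OF \<nu>(1)]
    by (simp add: R_def)
   ultimately show ?thesis by (meson converse_rtrancl_into_rtrancl rtrancl_into_rtrancl)
  qed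
  have sub: "R \<subseteq> {..slow s} \<times> {..slow s}" by (auto simp: R_def)
  have fin: "finite R" by (rule finite_subset[OF sub]) simp
  have "card R <= card ({..slow s} \<times> {..slow s})" by (rule card_mono[OF _ sub]) simp
  also have "\<dots> = (slow s + 1)\<^sup>2" by (simp add: power2_eq_square)
  also have "\<dots> <= s" using s by (intro slow_square) simp
  finally have card: "card R <= s" .
  have "(slow (s - 1), slow s) \<in> R\<^sup>*" using sm mono by (intro link) (auto simp: m_def)
  \<comment> \<open>A path in the finite relation R can be shortened to at most
    \<open>card R\<close> steps, hence to at most s.\<close>
  then obtain n where "n <= card R" and n': "(slow (s - 1), slow s) \<in> R ^^ n"
   unfolding rtrancl_finite_eq_relpow[OF fin] by (elim UN_E) (rule that, simp_all)
  then have n: "n <= s" using card by linarith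
  from n' obtain f where f: "f 0 = slow (s - 1)" "f n = slow s" "\<forall>i<n. (f i, f (Suc i)) \<in> R"
   unfolding relpow_fun_conv by (elim exE conjE) (rule that)
  have fr: "N1 <= f i & f i <= slow s" if "i <= n" for i
  proof (cases "i = n")
   case True
   then show ?thesis using f(2) sm by (auto simp: m_def)
  next
   case False
   then have "(f i, f (Suc i)) \<in> R" using f(3) that by simp
   then show ?thesis by (simp add: R_def)
  qed
  have "f (min j n) < s + 1" for j using fr[of "min j n"] slow_self_le[of s] by simp
  \<comment> \<open>A path with fewer than s steps is prolonged by resting at its end.\<close>
  then obtain c where c: "c < (s + 1) ^ (s + 1)" "\<forall>j<s + 1. (c div (s + 1) ^ j) mod (s + 1) = f (min j n)"
   using base_digits[of "s + 1" "\<lambda>j. f (min j n)" "s + 1"] by blast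
  have pl: "place s c j = f (min j n)" if "j < s + 1" for j using c(2) that unfolding place_def by blast
  have "chain s M c"
   unfolding chain_def
  proof (intro conjI allI impI)
   show "place s c 0 = slow (s - 1)" "place s c s = slow s" using pl[of 0] pl[of s] f n by (auto simp: min_def)
   show "M <= place s c j" if "j < s + 1" for j
    using pl[OF that] fr[of "min j n"] by (simp add: N1_def)
   show "near M (appr (place s c j)) (appr (place s c (j + 1)))" if "j < s" for j
   proof (cases "j < n")
    case True
    then have "(f j, f (Suc j)) \<in> R" using f(3) by simp
    then show ?thesis using pl[of j] pl[of "j + 1"] that True by (simp add: R_def min_def)
   next
    case False
    then show ?thesis using pl[of j] pl[of "j + 1"] that by (simp add: min_def)
   qed
  qed
  then show ?thesis unfolding linked_def using c(1) by blast
 qed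
 then show ?thesis by blast
qed

lemma stage_eventually:
 assumes "\<And>s. S <= s ==> P s"
 shows "\<forall>\<^sub>F q in sequentially. P (pfst q + psnd q)"
proof -
 have "{q. pfst q + psnd q < S} \<subseteq> (\<lambda>(a, c). pair a c) ` ({..<S} \<times> {..<S})"
 proof
  fix q assume "q \<in> {q. pfst q + psnd q < S}"
  then show "q \<in> (\<lambda>(a, c). pair a c) ` ({..<S} \<times> {..<S})"
   by (intro image_eqI[of _ _ "(pfst q, psnd q)"]) auto
 qed
 then have "finite {q. pfst q + psnd q < S}" by (rule finite_subset) simp
 then obtain Q where Q: "\<forall>q\<in>{q. pfst q + psnd q < S}. q < Q" unfolding finite_nat_set_iff_bounded by (elim exE)
 have "S <= pfst q + psnd q" if "Q <= q" for q by (rule ccontr) (use Q[rule_format, of q] that in auto)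
 then show ?thesis unfolding eventually_sequentially by (intro exI[of _ Q] allI impI assms)
qed

lemma route_eventually: "\<exists>S. \<forall>s\<ge>S. \<exists>M'\<ge>M. chain s M' (route s)"
proof -
 obtain S where S0: "\<forall>s\<ge>S. linked s (Suc M)" using linked_eventually[of "Suc M"] by (elim exE)
 note S = S0[rule_format]
 have "\<exists>M'\<ge>M. chain s M' (route s)" if s: "max S (Suc M) <= s" for s
 proof -
  define q where "q = (LEAST q. s <= q \<or> linked s (s - q))"
  have "q <= s - Suc M" unfolding q_def by (rule Least_le) (use s S[of s] in simp)
  then have q: "q < s" "M <= s - q" using s by auto
  moreover have "s <= q \<or> linked s (s - q)" unfolding q_def by (rule LeastI[of _ s]) simp
  ultimately have l: "linked s (best s)" "M <= best s" by (auto simp: best_def q_def)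
  have "\<exists>c. chain s (best s) c" using l(1) unfolding linked_def by blast
  then have "\<exists>c. ~ linked s (best s) \<or> chain s (best s) c" by blast
  then have "~ linked s (best s) \<or> chain s (best s) (route s)" unfolding route_def by (rule LeastI_ex)
  then show ?thesis using l by blast
 qed
 then show ?thesis by blast
qed

lemma wnum_step: "(\<lambda>q. dst (pmw (wnum q)) (pmw (wnum (Suc q)))) \<longlonglongrightarrow> 0"
proof (rule LIMSEQ_I)
 fix r :: real assume "0 < r"
 then obtain M where M: "(1 / 2) ^ M < r / 3" using real_arch_pow_inv[of "r / 3" "1 / 2"] by auto
 obtain S where S0: "\<forall>s\<ge>S. \<exists>M'\<ge>M. chain s M' (route s)" using route_eventually[of M] by (elim exE)
 note S = S0[rule_format]
 define P where "P s \<longleftrightarrow> (\<exists>M'\<ge>M. chain s M' (route s)) & (\<exists>M'\<ge>M. chain (Suc s) M' (route (Suc s)))" for s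
 have "\<forall>\<^sub>F q in sequentially. P (pfst q + psnd q)"
  by (rule stage_eventually[of S]) (simp add: P_def S)
 moreover have "norm (dst (pmw (wnum q)) (pmw (wnum (Suc q))) - 0) < r" if P: "P (pfst q + psnd q)" for q
 proof -
  have "\<exists>M'\<ge>M. near M' (wnum q) (wnum (Suc q))"
  proof (cases "psnd q")
   case 0
   have "Suc q = Suc (pair (pfst q) (psnd q))" by simp
   also have "\<dots> = pair 0 (Suc (pfst q))" unfolding 0 by (rule pair_Suc)
   finally have "Suc q = pair 0 (Suc (pfst q))" .
   then have "wnum (Suc q) = wnum q" using P 0 by (auto simp: P_def chain_def wnum_def)
   then show ?thesis by (intro exI[of _ M]) simp
  next
   case (Suc c)
   have "Suc q = Suc (pair (pfst q) (psnd q))" by simp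
   also have "\<dots> = pair (Suc (pfst q)) c" unfolding Suc by (rule pair_Suc)
   finally have "Suc q = pair (Suc (pfst q)) c" .
   then have "wnum (Suc q) = appr (place (pfst q + psnd q) (route (pfst q + psnd q)) (pfst q + 1))"
    using Suc by (simp add: wnum_def)
   moreover obtain M' where "M <= M'" "chain (pfst q + psnd q) M' (route (pfst q + psnd q))"
    using P unfolding P_def by (elim exE conjE)
   moreover have "pfst q < pfst q + psnd q" using Suc by simp
   ultimately show ?thesis unfolding chain_def wnum_def[of q] by (intro exI[of _ M']) simp
  qed
  then obtain M' where M': "M <= M'" "near M' (wnum q) (wnum (Suc q))" by blast
  have "dst (pmw (wnum q)) (pmw (wnum (Suc q))) <= 3 * (1 / 2) ^ M'" by (rule near_dist[OF M'(2)])
  also have "\<dots> <= 3 * (1 / 2) ^ M" using power_decreasing[OF M'(1), of "1 / 2 :: real"] by simp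
  also have "\<dots> < r" using M by simp
  finally show ?thesis using dist_nonneg[OF B pmw_inv pmw_inv] by simp
 qed
 ultimately have "\<forall>\<^sub>F q in sequentially. norm (dst (pmw (wnum q)) (pmw (wnum (Suc q))) - 0) < r"
  by (auto elim: eventually_mono)
 then show "\<exists>N. \<forall>q\<ge>N. norm (dst (pmw (wnum q)) (pmw (wnum (Suc q))) - 0) < r"
  by (simp only: eventually_sequentially)
qed

lemma wnum_near:
 assumes "0 < \<epsilon>"
 shows "\<forall>\<^sub>F q in sequentially. \<exists>\<kappa>\<in>K. dst (pmw (wnum q)) \<kappa> < \<epsilon>"
proof -
 obtain N where N: "\<And>n. N <= n ==> \<exists>\<kappa>\<in>K. dst (pmw (appr n)) \<kappa> < \<epsilon>" by (rule appr_near[OF assms]) (rule that, assumption+)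
 obtain S where S0: "\<forall>s\<ge>S. \<exists>M'\<ge>N. chain s M' (route s)" using route_eventually[of N] by (elim exE)
 note S = S0[rule_format]
 have "\<forall>\<^sub>F q in sequentially. \<exists>M'\<ge>N. chain (pfst q + psnd q) M' (route (pfst q + psnd q))"
  by (rule stage_eventually[where P = "\<lambda>s. \<exists>M'\<ge>N. chain s M' (route s)", OF S])
 then show ?thesis
 proof (rule eventually_mono)
  fix q assume "\<exists>M'\<ge>N. chain (pfst q + psnd q) M' (route (pfst q + psnd q))"
  then obtain M' where M': "N <= M'" "chain (pfst q + psnd q) M' (route (pfst q + psnd q))" by (elim exE conjE)
  then have "M' <= place (pfst q + psnd q) (route (pfst q + psnd q)) (pfst q)" unfolding chain_def by simp
  with M'(1) have "N <= place (pfst q + psnd q) (route (pfst q + psnd q)) (pfst q)" by (rule le_trans)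
  then show "\<exists>\<kappa>\<in>K. dst (pmw (wnum q)) \<kappa> < \<epsilon>" unfolding wnum_def by (rule N)
 qed
qed

text \<open>Stage (m + 1)^2 ends at index m, so every late index of \<open>appr\<close> is visited,
  and density passes from \<open>appr\<close> to the path.\<close>

lemma wnum_dense:
 assumes "\<kappa> \<in> K" "0 < \<epsilon>"
 shows "\<exists>\<^sub>F q in sequentially. dst (pmw (wnum q)) \<kappa> < \<epsilon>"
 unfolding frequently_sequentially
proof
 fix N
 obtain S where S0: "\<forall>s\<ge>S. \<exists>M'\<ge>0. chain s M' (route s)" using route_eventually[of 0] by (elim exE)
 note S = S0[rule_format]
 obtain m where m: "max N S <= m" "dst (pmw (appr m)) \<kappa> < \<epsilon>" using appr_dense[OF assms, of "max N S"] by (elim exE conjE)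
 define s where "s = (m + 1)\<^sup>2"
 have "m <= s" by (simp add: s_def power2_eq_square)
 then have "\<exists>M'\<ge>0. chain s M' (route s)" using m by (intro S) simp
 then have "wnum (pair s 0) = appr m" by (auto simp: chain_def wnum_def s_def slow_at[simplified])
 moreover have "N <= pair s 0" using pfst_le[of "pair s 0"] m \<open>m <= s\<close> by simp
 ultimately show "\<exists>q\<ge>N. dst (pmw (wnum q)) \<kappa> < \<epsilon>" using m(2) by (intro exI[of _ "pair s 0"]) simp
qed

end

section \<open>Self-reference\<close>

lemma put_trips_seqi: "(\<And>f i. f \<in> set fs ==> put_trips (f i) = {}) ==> put_trips (seqi i fs) = {}"
 by (induction fs arbitrary: i) (auto simp: clear_def)

lemma put_trips_compile: "put_trips (compile p xs out b) = {}"
proof (induction p arbitrary: xs out b)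
 case (Comp f gs)
 then show ?case by (auto simp: Let_def intro!: put_trips_seqi)
qed (simp_all add: clear_def copy_def)

lemma put_trips_dispatch: "put_trips (dispatch x t cs) \<subseteq> (\<Union>c\<in>set cs. put_trips c)"
 by (induction cs arbitrary: x t) (auto simp: clear_def)

lemma put_trips_main_prog: "put_trips (main_prog R ts) \<subseteq> set ts"
 using put_trips_dispatch[of 4 7 "Inc 5 # map (\<lambda>t. Seq (Put 3 t) (Inc 3)) ts"]
 by (auto simp: main_prog_def loop_body_def put_trips_compile clear_def)

text \<open>\<open>idx m\<close> is the number of the word shown after m instructions. From \<tau> 0
  on it grows by steps of at most one and tends to infinity, so closeness of consecutive words
  survives this slowing down.\<close>

lemma (in random_automaton) limit_measures_eq:
 fixes w :: "nat => nat list"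
 assumes M: "M \<in> inv_measures A" and B: "B ~= {}" and K: "K \<subseteq> inv_measures B" "compactin (weak_star B) K"
  and w: "\<And>n. w n \<in> lists B" "\<And>n. w n ~= []"
  and step: "(\<lambda>n. dist_M B (periodic_measure (w n)) (periodic_measure (w (Suc n)))) \<longlonglongrightarrow> 0"
  and near: "\<And>\<epsilon>. 0 < \<epsilon> ==> \<forall>\<^sub>F n in sequentially. \<exists>\<kappa>\<in>K. dist_M B (periodic_measure (w n)) \<kappa> < \<epsilon>"
  and dense: "\<And>\<kappa> \<epsilon>. \<kappa> \<in> K ==> 0 < \<epsilon> ==> \<exists>\<^sub>F n in sequentially. dist_M B (periodic_measure (w n)) \<kappa> < \<epsilon>"
  and \<tau>: "strict_mono \<tau>" "\<And>n m. \<tau> n <= m ==> m < \<tau> (Suc n) ==> spells m (w n)"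
 shows "limit_measures A F M = K"
proof -
 define idx where "idx m = (LEAST n. m < \<tau> (Suc n))" for m
 have ex: "m < \<tau> (Suc m)" for m using strict_mono_imp_increasing[OF \<tau>(1), of "Suc m"] by simp
 have lt: "m < \<tau> (Suc (idx m))" for m unfolding idx_def by (rule LeastI[of _ m]) (rule ex)
 have le: "\<tau> (idx m) <= m" if "\<tau> 0 <= m" for m
 proof (cases "idx m")
  case (Suc n)
  then have "~ m < \<tau> (Suc n)" unfolding idx_def using not_less_Least[of n "\<lambda>n. m < \<tau> (Suc n)"] by simp
  then show ?thesis using Suc by simp
 qed (use that in simp)
 have idxI: "idx m = n" if "\<tau> n <= m" "m < \<tau> (Suc n)" for m n
 proof -
  have "\<tau> 0 <= m" using that(1) strict_mono_less_eq[OF \<tau>(1), of 0 n] by simp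
  then have "\<tau> (idx m) < \<tau> (Suc n)" "\<tau> n < \<tau> (Suc (idx m))" using le[of m] lt[of m] that by linarith+
  then have "idx m < Suc n" "n < Suc (idx m)" using strict_mono_less[OF \<tau>(1)] by blast+
  then show ?thesis by simp
 qed
 have idx_Suc: "idx (Suc m) = idx m \<or> idx (Suc m) = Suc (idx m)" if m: "\<tau> 0 <= m" for m
 proof (cases "Suc m < \<tau> (Suc (idx m))")
  case True
  then show ?thesis using le[OF m] by (intro disjI1 idxI) auto
 next
  case False
  then have "Suc m = \<tau> (Suc (idx m))" using lt[of m] by simp
  then show ?thesis using strict_monoD[OF \<tau>(1), of "Suc (idx m)"] by (intro disjI2 idxI) auto
 qed
 have idx_ge: "n <= idx m" if "\<tau> n <= m" for n m
 proof -
  have "\<tau> n < \<tau> (Suc (idx m))" using that lt[of m] by linarith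
  then have "n < Suc (idx m)" using strict_mono_less[OF \<tau>(1)] by blast
  then show ?thesis by simp
 qed
 have top: "filterlim idx at_top sequentially"
  unfolding filterlim_at_top eventually_sequentially using idx_ge by blast
 define W where "W m = w (idx m)" for m
 have W: "W m \<in> lists B" "W m ~= []" for m using w by (simp_all add: W_def)
 have sp: "spells m (W m)" if "\<tau> 0 <= m" for m
  unfolding W_def by (rule \<tau>(2)[OF le[OF that] lt])
 have pinv: "periodic_measure (w n) \<in> inv_measures B" for n by (rule periodic_measure_inv[OF w])
 have conv: "(\<lambda>t. measure ((push_forward A F ^^ t) M) (cyl u) - measure (periodic_measure (W (level t))) (cyl u)) \<longlonglongrightarrow> 0" for u
 proof -
  define \<Delta> where "\<Delta> n = \<bar>measure (periodic_measure (w n)) (cyl u) - measure (periodic_measure (w (Suc n))) (cyl u)\<bar>" for n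
  have "\<Delta> \<longlonglongrightarrow> 0"
  proof (cases "u \<in> lists B")
   case True
   have lim: "(\<lambda>n. 2 ^ length u * dist_M B (periodic_measure (w n)) (periodic_measure (w (Suc n)))) \<longlonglongrightarrow> 0"
    by (rule tendsto_mult_right_zero[OF step])
   have bnd: "norm (\<Delta> n) <= 2 ^ length u * dist_M B (periodic_measure (w n)) (periodic_measure (w (Suc n)))" for n
    unfolding \<Delta>_def real_norm_def abs_idempotent by (rule dist_ge[OF fin(1) B pinv pinv True])
   show ?thesis by (rule Lim_null_comparison[OF _ lim], rule always_eventually, rule allI, rule bnd)
  next
   case False
   then have "\<Delta> = (\<lambda>_. 0)" by (intro ext) (simp add: \<Delta>_def inv_null[OF pinv])
   then show ?thesis by simp
  qed
  then have "(\<lambda>m. \<Delta> (idx m)) \<longlonglongrightarrow> 0" by (rule filterlim_compose[OF _ top])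
  moreover have "\<forall>\<^sub>F m in sequentially. norm (measure (periodic_measure (W m)) (cyl u) - measure (periodic_measure (W (Suc m))) (cyl u)) <= \<Delta> (idx m)"
   unfolding eventually_sequentially
  proof (intro exI[of _ "\<tau> 0"] allI impI)
   fix m assume "\<tau> 0 <= m"
   from idx_Suc[OF this] show "norm (measure (periodic_measure (W m)) (cyl u) - measure (periodic_measure (W (Suc m))) (cyl u)) <= \<Delta> (idx m)"
    by (auto simp: W_def \<Delta>_def)
  qed
  ultimately have "(\<lambda>m. measure (periodic_measure (W m)) (cyl u) - measure (periodic_measure (W (Suc m))) (cyl u)) \<longlonglongrightarrow> 0"
   by (rule Lim_null_comparison[rotated])
  from tends_to_words[OF sp this]
  show ?thesis
   using push_forward_iterate(2)[OF M measurable_F F_configs] F_translate[of 1] shift_pow[of 1] by simp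
 qed
 have "{\<mu> \<in> inv_measures A. \<forall>U. openin (weak_star A) U & \<mu> \<in> U --> (\<exists>\<^sub>F t in sequentially. (push_forward A F ^^ t) M \<in> U)} = K"
 proof (rule limit_set_eq[OF fin(1) B K finite_A B_A _ W conv])
  show "(push_forward A F ^^ t) M \<in> inv_measures A" for t
   using push_forward_iterate(1)[OF M measurable_F F_configs] F_translate[of 1] shift_pow[of 1] by simp
  show "\<forall>\<^sub>F m in sequentially. \<exists>\<kappa>\<in>K. dist_M B (periodic_measure (W m)) \<kappa> < \<epsilon>" if "0 < \<epsilon>" for \<epsilon>
   unfolding W_def using near[OF that] top by (rule eventually_compose_filterlim)
  show "\<exists>\<^sub>F m in sequentially. dist_M B (periodic_measure (W m)) \<kappa> < \<epsilon>" if k: "\<kappa> \<in> K" "0 < \<epsilon>" for \<kappa> \<epsilon>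
   unfolding frequently_sequentially
  proof
   fix N
   obtain n where n: "N <= n" "dist_M B (periodic_measure (w n)) \<kappa> < \<epsilon>"
    using dense[OF k, unfolded frequently_sequentially, rule_format, of N] by (elim exE conjE)
   have "idx (\<tau> n) = n" using strict_monoD[OF \<tau>(1), of n "Suc n"] by (intro idxI) auto
   moreover have "n <= \<tau> n" by (rule strict_mono_imp_increasing[OF \<tau>(1)])
   ultimately show "\<exists>m\<ge>N. dist_M B (periodic_measure (W m)) \<kappa> < \<epsilon>"
    using n by (intro exI[of _ "\<tau> n"]) (simp add: W_def)
  qed
 qed
 then show ?thesis by (simp add: limit_measures_def)
qed

lemma (in letters) admissible_words:
 assumes "K \<in> admissible_sets B"
 obtains w where "computable w" "(\<lambda>q. dst (pmw (w q)) (pmw (w (Suc q)))) \<longlonglongrightarrow> 0"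
  "\<And>\<epsilon>. 0 < \<epsilon> ==> \<forall>\<^sub>F q in sequentially. \<exists>\<kappa>\<in>K. dst (pmw (w q)) \<kappa> < \<epsilon>"
  "\<And>\<kappa> \<epsilon>. \<kappa> \<in> K ==> 0 < \<epsilon> ==> \<exists>\<^sub>F q in sequentially. dst (pmw (w q)) \<kappa> < \<epsilon>"
proof -
 have K: "K \<subseteq> inv_measures B" "compactin (weak_star B) K" "connectedin (weak_star B) K" "K ~= {}" "Pi2_computable B K"
  using assms by (simp_all add: admissible_sets_def)
 from K(5,1) obtain E where E: "decidable (\<lambda>x. E (pfst x) (pfst (psnd x)) (pfst (psnd (psnd x))) (psnd (psnd (psnd x))))"
  "\<And>i u. (\<exists>\<kappa>\<in>K. dst (pmw u) \<kappa> <= (1 / 2) ^ i) \<longleftrightarrow> (\<forall>i'. \<exists>j. E i u i' j)" by (rule Pi2_events) (rule that, assumption+)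
 interpret target B K E by (unfold_locales; fact K E)
 show ?thesis by (rule that[OF computable_wnum wnum_step wnum_near wnum_dense])
qed

lemma admissible_nonempty:
 assumes "K \<in> admissible_sets B"
 shows "B ~= {}"
proof
 assume "B = {}"
 then have "configs B = {}" by (simp add: configs_def)
 moreover obtain \<kappa> where "\<kappa> \<in> inv_measures B" using assms unfolding admissible_sets_def by auto
 ultimately have "prob_space \<kappa>" "AE x in \<kappa>. False" unfolding inv_measures_def by auto
 then show False using prob_space.AE_False by blast
qed

context alphabet begin

text \<open>Pigeonhole: a letter is non-inert for at most one colour, so the 64 masses sum to at
  most 1.\<close>

lemma colour:
 assumes "M \<in> inv_measures A"
 obtains k where "k < 64" "measure M {x. cel k (x 0) ~= In} <= 1 / 64"
proof -
 interpret stationary M by (rule inv_stationary[OF assms])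
 let ?E = "\<lambda>k. {x :: config. cel k (x 0) ~= In}"
 have ev: "?E k \<in> events" for k using site_borel[of 0 "{a. cel k a ~= In}"] by (simp add: sets_M)
 have "disjoint_family_on ?E {..<64}"
  by (auto simp: disjoint_family_on_def cel_def split: if_splits)
 then have "(\<Sum>k<64. prob (?E k)) = prob (\<Union>k<64. ?E k)"
  by (intro finite_measure_finite_Union[symmetric]) (use ev in auto)
 also have "\<dots> <= 1" by (rule prob_le_1)
 finally have s: "(\<Sum>k<64. prob (?E k)) <= 1" .
 have "\<exists>k<64. prob (?E k) <= 1 / 64"
 proof (rule ccontr)
  assume "~ ?thesis"
  then have "(\<Sum>k<64 :: nat. 1 / 64) < (\<Sum>k<64. prob (?E k))" by (intro sum_strict_mono) (auto simp: not_le lessThan_empty_iff)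
  then show False using s by simp
 qed
 with that show ?thesis by blast
qed

text \<open>Full support enters here: the letter of a waiting wall gets positive mass.\<close>

lemma random_automatonI:
 assumes M: "M \<in> mixing_full_measures A" and k: "k < 64" "measure M {x. cel k (x 0) ~= In} <= 1 / 64"
  and n0: "2 <= n0" "psi M n0 <= 1 / 2" and e: "2 <= e"
 shows "random_automaton B C d T k n0 e M"
proof -
 have inv: "M \<in> inv_measures A" using M by (simp add: mixing_full_measures_def)
 interpret stationary M by (rule inv_stationary[OF inv])
 interpret automaton B C d T k n0 e by unfold_locales (use k n0 e in auto)
 have "fst d \<in> B" using TB[OF dT] by simp
 note l = lett[OF this k(1), of Ww]
 have W: "Ww \<in> cells C B T" by (simp add: cells_def)
 have "0 < measure M (cyl [lett k (fst d) Ww])"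
  using M l(1)[OF W] unfolding mixing_full_measures_def full_support_def by auto
 also have "\<dots> <= prob {x. cel k (x 0) = Ww}"
  using site_borel[of 0 "{a. cel k a = Ww}"] l(3)[OF W]
  by (intro finite_measure_mono) (auto simp: cyl_def sets_M)
 finally have w: "0 < prob {x. cel k (x 0) = Ww}" .
 have ae: "AE x in M. x \<in> configs A" using inv by (simp add: inv_measures_def)
 show ?thesis by unfold_locales (fact assms w ae)+
qed

end

section \<open>Coding of packets by numbers\<close>

context letters begin

definition trips :: "trip list" where
 "trips = map (\<lambda>i. (sorted_list_of_set B ! (i mod b), sorted_list_of_set B ! ((i div b) mod b), b * b <= i)) [0..<2 * (b * b)]"

text \<open>One more than the index in \<open>trips\<close> of the packet to be written, and 0 after
  the end, as \<open>main_program\<close> expects. Positions count from the end of the word because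
  \<open>spells\<close> wants it reversed.\<close>

definition emission :: "nat => nat => nat" where
 "emission v j = (if j < Suc (pfst v) then Suc (digit v (pfst v - 2 * j mod Suc (pfst v)) +
   b * digit v (pfst v - (2 * j + 1) mod Suc (pfst v)) + b * b * of_bool (j = pfst v)) else 0)"

lemma computable_emission:
 assumes "computable f" "computable g"
 shows "computable (\<lambda>x. emission (f x) (g x))"
by (auto simp: emission_def computable_intros computable_digit assms)

lemma trips_emission:
 assumes j: "j < Suc (pfst v)"
 shows "0 < emission v j" "emission v j <= length trips"
  "trips ! (emission v j - 1) = (rev (word v) ! (2 * j mod length (word v)), rev (word v) ! ((2 * j + 1) mod length (word v)),
    Suc j = length (word v))"
proof -
 define x where "x = digit v (pfst v - 2 * j mod Suc (pfst v))"
 define y where "y = digit v (pfst v - (2 * j + 1) mod Suc (pfst v))"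
 define f :: nat where "f = of_bool (j = pfst v)"
 have xy: "x < b" "y < b" by (simp_all add: x_def y_def digit_less)
 define i where "i = x + b * y + b * b * f"
 have em: "emission v j = Suc i" using j by (simp add: emission_def i_def x_def y_def f_def)
 have "b * Suc y <= b * b" using xy(2) by (intro mult_le_mono2) simp
 then have low: "x + b * y < b * b" using xy(1) by simp
 have i: "i < 2 * (b * b)" using low by (simp add: i_def f_def)
 then show "0 < emission v j" "emission v j <= length trips" by (simp_all add: em trips_def)
 have eq: "i = x + b * (y + b * f)" by (simp add: i_def algebra_simps)
 have m: "i mod b = x" "i div b = y + b * f" using xy(1) by (simp_all add: eq)
 have m2: "(i div b) mod b = y" using xy(2) by (simp add: m(2))
 have m3: "b * b <= i \<longleftrightarrow> j = pfst v"
 using low i_def f_def by auto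
 have rv: "rev (word v) ! (a mod Suc (pfst v)) = sorted_list_of_set B ! digit v (pfst v - a mod Suc (pfst v))" for a
 by (auto simp: rev_nth word_nth)
 show "trips ! (emission v j - 1) = (rev (word v) ! (2 * j mod length (word v)), rev (word v) ! ((2 * j + 1) mod length (word v)),
    Suc j = length (word v))"
  unfolding word(3) rv using i m(1) m2 m3 by (simp add: em trips_def x_def y_def)
qed

lemma trips_letters: "t \<in> set trips ==> fst t \<in> B & fst (snd t) \<in> B"
proof -
 have "sorted_list_of_set B ! (i mod b) \<in> B" for i
  using nth_mem[of "i mod b" "sorted_list_of_set B"] b_pos B by simp
 then show "t \<in> set trips ==> fst t \<in> B & fst (snd t) \<in> B" by (auto simp: trips_def)
qed

end

text \<open>e lists n0, the alphabet, the four other positions and the table. Only the leftmost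
  position - e n0 is missing, and it is computed from e itself; the code of a negative integer - a
  is 2 a - 1.\<close>

definition self_code :: "nat => nat" where
 "self_code e = pair (pfst (psnd e)) (pair (Suc (pair (2 * (e * pfst e) - 1) (pfst (psnd (psnd e))))) (psnd (psnd (psnd e))))"

lemma computable_self_code: "computable (\<lambda>e. self_code e)"
 unfolding self_code_def by (intro computable_intros)

text \<open>There is no circle: neither the alphabet nor the table depends on e, as the table is
  indexed by patterns and not by positions.\<close>

lemma (in alphabet) self_code:
 assumes n0: "2 <= n0"
 obtains e where "2 <= e" "ca_code A (nbh n0 e) (local_rule k) = self_code e"
proof -
 define e where "e = pair n0 (pair (list_encode (sorted_list_of_set A)) (pair
  (list_encode (map int_encode [- int n0, - 1, 0, int n0])) (list_encode (map (local_rule k) (List.n_lists 5 (sorted_list_of_set A))))))"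
 have e: "2 <= e" using n0 pfst_le[of e] by (simp add: e_def)
 have "0 < e * n0" using e n0 by simp
 then obtain y where y: "e * n0 = Suc y" using gr0_implies_Suc by blast
 have "int_encode (- int (Suc y)) = 2 * Suc y - 1"
  by (simp add: int_encode_def sum_encode_def)
 then have i: "int_encode (- int (e * n0)) = 2 * (e * n0) - 1" unfolding y .
 have f: "pfst e = n0" "pfst (psnd e) = list_encode (sorted_list_of_set A)"
  "pfst (psnd (psnd e)) = list_encode (map int_encode [- int n0, - 1, 0, int n0])"
  "psnd (psnd (psnd e)) = list_encode (map (local_rule k) (List.n_lists 5 (sorted_list_of_set A)))"
  by (simp_all add: e_def)
 have "ca_code A (nbh n0 e) (local_rule k) = self_code e"
  unfolding ca_code_def sorted_nbh[OF n0 e] self_code_def f nbl_def pair_def list.map(2) list_encode.simps(2) i by (rule refl)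
 with e show ?thesis by (rule that)
qed

lemma compose_answer:
 assumes "computable c" "computable (\<lambda>x. G (pfst x) (pfst (psnd x)) (psnd (psnd x)))"
 obtains R where "\<And>n j e a. evaluates p [c e] a ==> evaluates R [n, j, e] (G n j a)"
proof -
 obtain q where q: "\<And>x. evaluates q [x] (c x)" using assms(1) unfolding computable_def by auto
 obtain g where g: "\<And>x. evaluates g [x] (G (pfst x) (pfst (psnd x)) (psnd (psnd x)))"
  using assms(2) unfolding computable_def by auto
 obtain r where r: "\<And>x y. evaluates r [x, y] (pair x y)" using computable2_pair unfolding computable2_def by auto
 have "evaluates (Comp g [Comp r [Proj 0, Comp r [Proj 1, Comp p [Comp q [Proj 2]]]]]) [n, j, e] (G n j a)"
  if a: "evaluates p [c e] a" for n j e a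
 proof -
  have "evaluates (Comp p [Comp q [Proj 2]]) [n, j, e] a"
   by (rule evaluates_Comp1[OF evaluates_Comp1[OF evaluates_Proj2 q] a])
  then have "evaluates (Comp r [Proj 1, Comp p [Comp q [Proj 2]]]) [n, j, e] (pair j a)"
   by (rule evaluates_Comp2[OF evaluates_Proj1 _ r])
  then have "evaluates (Comp r [Proj 0, Comp r [Proj 1, Comp p [Comp q [Proj 2]]]]) [n, j, e] (pair n (pair j a))"
   by (rule evaluates_Comp2[OF evaluates_Proj0 _ r])
  then show ?thesis using g[of "pair n (pair j a)"] by (intro evaluates_Comp1) simp_all
 qed
 then show ?thesis by (rule that)
qed

theorem corollary7:
  fixes B :: "nat set"
    and P :: "config measure set set"
    and \<mu> :: "nat set \<Rightarrow> config measure"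
  assumes "finite B"
    and "P \<subseteq> admissible_sets B"
    and "\<exists>K\<in>admissible_sets B. K \<in> P"
    and "\<exists>K\<in>admissible_sets B. K \<notin> P"
    and "\<And>A. finite A \<Longrightarrow> B \<subseteq> A \<Longrightarrow> \<mu> A \<in> mixing_full_measures A"
  shows "\<not> (\<exists>p. \<forall>A F N f.
            finite A \<and> B \<subseteq> A \<and> cellular_automaton A F \<and> given_by_local_rule A F N f \<longrightarrow>
            evaluates p [ca_code A N f] (if limit_measures A F (\<mu> A) \<in> P then 1 else 0))"
proof
 assume "\<exists>p. \<forall>A F N f. finite A & B \<subseteq> A & cellular_automaton A F & given_by_local_rule A F N f -->
      evaluates p [ca_code A N f] (if limit_measures A F (\<mu> A) \<in> P then 1 else 0)"
 then obtain p where p: "\<forall>A F N f. finite A & B \<subseteq> A & cellular_automaton A F & given_by_local_rule A F N f -->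
      evaluates p [ca_code A N f] (if limit_measures A F (\<mu> A) \<in> P then 1 else 0)" by (elim exE)
 obtain K1 K2 where K1: "K1 \<in> admissible_sets B" "K1 \<in> P" and K2: "K2 \<in> admissible_sets B" "K2 \<notin> P"
  using assms(3,4) by blast
 interpret letters B using assms(1) admissible_nonempty[OF K1(1)] by unfold_locales
 obtain w1 where w1: "computable w1" "(\<lambda>q. dst (pmw (w1 q)) (pmw (w1 (Suc q)))) \<longlonglongrightarrow> 0"
  "\<And>\<epsilon>. 0 < \<epsilon> ==> \<forall>\<^sub>F q in sequentially. \<exists>\<kappa>\<in>K1. dst (pmw (w1 q)) \<kappa> < \<epsilon>"
  "\<And>\<kappa> \<epsilon>. \<kappa> \<in> K1 ==> 0 < \<epsilon> ==> \<exists>\<^sub>F q in sequentially. dst (pmw (w1 q)) \<kappa> < \<epsilon>"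
  by (rule admissible_words[OF K1(1)]) (rule that, assumption+)
 obtain w2 where w2: "computable w2" "(\<lambda>q. dst (pmw (w2 q)) (pmw (w2 (Suc q)))) \<longlonglongrightarrow> 0"
  "\<And>\<epsilon>. 0 < \<epsilon> ==> \<forall>\<^sub>F q in sequentially. \<exists>\<kappa>\<in>K2. dst (pmw (w2 q)) \<kappa> < \<epsilon>"
  "\<And>\<kappa> \<epsilon>. \<kappa> \<in> K2 ==> 0 < \<epsilon> ==> \<exists>\<^sub>F q in sequentially. dst (pmw (w2 q)) \<kappa> < \<epsilon>"
  by (rule admissible_words[OF K2(1)]) (rule that, assumption+)
 \<comment> \<open>The program puts the code computed from its input to the alleged procedure and
   emits the words of K1 after answer 0, those of K2 otherwise.\<close>
 have "computable (\<lambda>x. emission (if psnd (psnd x) = 0 then w1 (pfst x) else w2 (pfst x)) (pfst (psnd x)))"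
  by (intro computable_emission computable_If decidable_eq computable_compose[OF w1(1)] computable_compose[OF w2(1)] computable_intros)
 then obtain R where R: "\<And>n j e a. evaluates p [self_code e] a ==>
   evaluates R [n, j, e] (emission (if a = 0 then w1 n else w2 n) j)"
  by (rule compose_answer[OF computable_self_code, of "\<lambda>n j a. emission (if a = 0 then w1 n else w2 n) j"]) (rule that, assumption)
 define C where "C = main_prog R trips"
 define d :: trip where "d = (sorted_list_of_set B ! 0, sorted_list_of_set B ! 0, True)"
 define T where "T = insert d (set trips)"
 have b0: "sorted_list_of_set B ! 0 \<in> B" using nth_mem[of 0 "sorted_list_of_set B"] b_pos B by simp
 interpret alphabet B C d T
 proof
  show "finite B" "finite T" "d \<in> T" using B by (simp_all add: T_def)
  show "put_trips C \<subseteq> T" using put_trips_main_prog[of R trips] by (auto simp: C_def T_def)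
  show "fst t \<in> B & fst (snd t) \<in> B" if "t \<in> T" for t
   using that b0 trips_letters[of t] by (auto simp: T_def d_def)
  show "\<exists>c1 c2. C = Seq c1 c2" "snd (snd d)" by (simp_all add: C_def main_prog_def d_def)
 qed
 \<comment> \<open>The program and with it the alphabet are fixed by now. Colour, mixing distance
   and e are chosen afterwards and depend on the measure; the program learns of them through e,
   which contains n0 and the table.\<close>
 define M where "M = \<mu> A"
 have M: "M \<in> mixing_full_measures A" unfolding M_def by (rule assms(5)[OF finite_A B_A])
 then have inv: "M \<in> inv_measures A" and "psi M \<longlonglongrightarrow> 0" by (simp_all add: mixing_full_measures_def psi_mixing_def)
 obtain k where k: "k < 64" "measure M {x. cel k (x 0) ~= In} <= 1 / 64" by (rule colour[OF inv])
 have "\<forall>\<^sub>F n in sequentially. psi M n < 1 / 2" by (rule order_tendstoD(2)[OF \<open>psi M \<longlonglongrightarrow> 0\<close>]) (simp add: one_ereal_def divide_ereal_def)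
 then obtain n0 where n0: "2 <= n0" "psi M n0 <= 1 / 2"
  unfolding eventually_sequentially by (metis less_imp_le max.cobounded1 max.cobounded2)
 obtain e where code: "2 <= e" "ca_code A (nbh n0 e) (local_rule k) = self_code e" by (rule self_code[OF n0(1)])
 interpret random_automaton B C d T k n0 e M by (rule random_automatonI[OF M k n0 code(1)])
 define a :: nat where "a = (if limit_measures A F M \<in> P then 1 else 0)"
 have a: "evaluates p [self_code e] a"
  using p[rule_format, OF conjI[OF finite_A conjI[OF B_A conjI[OF cellular_automaton_F local_rule_F]]]]
  by (simp only: code(2) a_def M_def)
 define w where "w n = (if a = 0 then w1 n else w2 n)" for n
 define K where "K = (if a = 0 then K1 else K2)"
 have K: "K \<subseteq> inv_measures B" "compactin (weak_star B) K" using K1 K2 by (auto simp: K_def admissible_sets_def)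
 interpret prog: main_program R trips e d "\<lambda>n. emission (w n)" "\<lambda>n. Suc (pfst (w n))"
 proof
  show "evaluates R [n, j, e] (emission (w n) j)" for n j using R[OF a] by (simp add: w_def)
  show "0 < emission (w n) j & emission (w n) j <= length trips" if "j < Suc (pfst (w n))" for n j
   using trips_emission(1,2)[OF that] by simp
  show "emission (w n) (Suc (pfst (w n))) = 0" for n by (simp add: emission_def)
 qed
 obtain \<tau> where \<tau>: "strict_mono \<tau>"
  "\<And>n N j. \<tau> n <= N ==> N < \<tau> (Suc n) ==> j < Suc (pfst (w n)) ==> actv (prog.conf N) j = prog.symb n j"
  by (rule prog.main_loop) (rule that, assumption+)
 have sp: "spells m (word (w n))" if m: "\<tau> n <= m" "m < \<tau> (Suc n)" for n m
  unfolding spells_def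
 proof (intro conjI allI impI)
  fix j assume "j < length (word (w n))"
  then have j: "j < Suc (pfst (w n))" by simp
  have "acv m j = actv (prog.conf m) j" unfolding acv_def conf_def prog.conf_def unfolding C_def by (rule refl)
  then show "acv m j = (rev (word (w n)) ! (2 * j mod length (word (w n))),
    rev (word (w n)) ! ((2 * j + 1) mod length (word (w n))), Suc j = length (word (w n)))"
   unfolding \<tau>(2)[OF m j] prog.symb_def trips_emission(3)[OF j] .
 qed simp
 have "limit_measures A F M = K"
 proof (rule limit_measures_eq[OF inv B(2) K word(1,2) _ _ _ \<tau>(1) sp])
  show "(\<lambda>n. dst (pmw (w n)) (pmw (w (Suc n)))) \<longlonglongrightarrow> 0" using w1(2) w2(2) by (cases "a = 0") (simp_all add: w_def)
  show "\<forall>\<^sub>F n in sequentially. \<exists>\<kappa>\<in>K. dst (pmw (w n)) \<kappa> < \<epsilon>" if "0 < \<epsilon>" for \<epsilon>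
   using w1(3)[OF that] w2(3)[OF that] by (cases "a = 0") (simp_all add: w_def K_def)
  show "\<exists>\<^sub>F n in sequentially. dst (pmw (w n)) \<kappa> < \<epsilon>" if "\<kappa> \<in> K" "0 < \<epsilon>" for \<kappa> \<epsilon>
   using w1(4) w2(4) that by (cases "a = 0") (simp_all add: w_def K_def)
 qed
 \<comment> \<open>The limit set is K1, which has the property, if the answer is 0, and K2, which
   lacks it, if the answer is 1.\<close>
 then show False using K1(2) K2(2) by (simp add: a_def K_def split: if_splits)
qed

end
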